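(* Let $T>0$. Let $p>2$, $\alpha>2$, $\beta>2$, $\lambda>0$, $\lambda_0>0$, $\lambda_1>0$ and $\widetilde{\lambda}_0,\widetilde{\lambda}_1\in\mathbb{R}$ with $|\widetilde{\lambda}_0+\widetilde{\lambda}_1|<2\sqrt{\lambda_0\lambda_1}$, and let $\widetilde{h}_0,\widetilde{h}_1\in H^1(0,T)$. Suppose that $(u_0,u_1)\in H^2\times H^1$ satisfies the compatibility conditions $$u_{0x}(0)=-|u_0(0)|^{\alpha-2}u_0(0)+\lambda_0u_1(0)+\widetilde{h}_1(0)u_0(1)+\widetilde{\lambda}_1u_1(1),$$ $$-u_{0x}(1)=-|u_0(1)|^{\beta-2}u_0(1)+\lambda_1u_1(1)+\widetilde{h}_0(0)u_0(0)+\widetilde{\lambda}_0u_1(0).$$ Then, for $T_*\in(0,T]$ small enough, the problem $$u_{tt}-u_{xx}+u+\lambda u_t=|u|^{p-2}u,\quad 0<x<1,\ 0<t<T_*,$$ $$u_x(0,t)=-|u(0,t)|^{\alpha-2}u(0,t)+\lambda_0u_t(0,t)+\widetilde{h}_1(t)u(1,t)+\widetilde{\lambda}_1u_t(1,t),$$ $$-u_x(1,t)=-|u(1,t)|^{\beta-2}u(1,t)+\lambda_1u_t(1,t)+\widetilde{h}_0(t)u(0,t)+\widetilde{\lambda}_0u_t(0,t),$$ $$u(x,0)=u_0(x),\quad u_t(x,0)=u_1(x),$$ has a unique local solution $u$ with $$u\in L^\infty(0,T_*;H^2),\quad u_t\in L^\infty(0,T_*;H^1),\quad u_{tt}\in L^\infty(0,T_*;L^2),\quad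 u(0,\cdot),\,u(1,\cdot)\in H^2(0,T_* ).$$
   Context: $\Omega=(0,1)$; $L^2=L^2(\Omega)$ and $H^m=W^{m,2}(\Omega)$ are the usual real-valued Lebesgue and Sobolev spaces on $(0,1)$. $L^\infty(0,T_*;X)$ is the usual Bochner space. The equation is understood a.e. in $(0,1)\times(0,T_* )$ and the boundary conditions for a.e. $t\in(0,T_* )$. *)

theory Defs
  imports "HOL-Analysis.Analysis"
begin

text \<open>
  Elements of Lebesgue and Sobolev spaces are represented by functions; all notions below are
  invariant under changes on null sets.

  Weak derivatives on an open set \<open>S\<close>. A smooth function is given together with its iterated
  partial derivatives: \<open>D bs\<close>, for a list \<open>bs\<close> of basis vectors, is the derivative of \<open>D []\<close> in the
  directions \<open>bs\<close>. As each \<open>D bs\<close> is (Frechet) differentiable, this says that \<open>D []\<close> is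
  infinitely differentiable.
\<close>

definition smooth_partials :: "('a::euclidean_space list \<Rightarrow> 'a \<Rightarrow> real) \<Rightarrow> bool" where
  "smooth_partials D \<longleftrightarrow>
     (\<forall>bs\<in>lists Basis. \<forall>z. (D bs has_derivative (\<lambda>h. \<Sum>b\<in>Basis. (h \<bullet> b) * D (b # bs) z)) (at z))"

definition locally_integrable :: "'a::euclidean_space set \<Rightarrow> ('a \<Rightarrow> real) \<Rightarrow> bool" where
  "locally_integrable S f \<longleftrightarrow> (\<forall>K. compact K \<and> K \<subseteq> S \<longrightarrow> f absolutely_integrable_on K)"

definition has_weak_deriv ::
  "'a::euclidean_space set \<Rightarrow> 'a list \<Rightarrow> ('a \<Rightarrow> real) \<Rightarrow> ('a \<Rightarrow> real) \<Rightarrow> bool" where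
  "has_weak_deriv S bs f g \<longleftrightarrow>
     locally_integrable S f \<and> locally_integrable S g \<and>
     (\<forall>D. smooth_partials D \<and> (\<exists>K. compact K \<and> K \<subseteq> S \<and> (\<forall>z. z \<notin> K \<longrightarrow> D [] z = 0)) \<longrightarrow>
        (LINT z|lebesgue_on S. f z * D bs z) =
          (-1) ^ length bs * (LINT z|lebesgue_on S. g z * D [] z))"

definition L2 :: "real set \<Rightarrow> (real \<Rightarrow> real) set" where
  "L2 S = {f \<in> borel_measurable (lebesgue_on S). integrable (lebesgue_on S) (\<lambda>x. (f x)\<^sup>2)}"

definition L2_norm :: "real set \<Rightarrow> (real \<Rightarrow> real) \<Rightarrow> real" where
  "L2_norm S f = sqrt (LINT x|lebesgue_on S. (f x)\<^sup>2)"

text \<open>The \<open>k\<close>-th weak derivative on an open subset of the line (unique up to null sets).\<close>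

definition weak_deriv :: "real set \<Rightarrow> nat \<Rightarrow> (real \<Rightarrow> real) \<Rightarrow> real \<Rightarrow> real" where
  "weak_deriv S k f = (SOME g. has_weak_deriv S (replicate k 1) f g)"

definition Sobolev :: "nat \<Rightarrow> real set \<Rightarrow> (real \<Rightarrow> real) set" where
  "Sobolev m S = {f \<in> L2 S. \<forall>k\<in>{1..m}. \<exists>g\<in>L2 S. has_weak_deriv S (replicate k 1) f g}"

definition Sobolev_norm :: "nat \<Rightarrow> real set \<Rightarrow> (real \<Rightarrow> real) \<Rightarrow> real" where
  "Sobolev_norm m S f = sqrt (\<Sum>k\<le>m. (L2_norm S (weak_deriv S k f))\<^sup>2)"

text \<open>
  The value at a point \<open>x\<close> of the closure of \<open>S\<close> of the representative of \<open>f\<close> that is continuous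
  up to the boundary; for an interval it exists for every \<open>f\<close> in a Sobolev space of order
  at least one.
\<close>

definition cont_value :: "real set \<Rightarrow> (real \<Rightarrow> real) \<Rightarrow> real \<Rightarrow> real" where
  "cont_value S f x =
     (THE y. \<exists>g. continuous_on (closure S) g \<and> (AE s in lebesgue_on S. f s = g s) \<and> g x = y)"

text \<open>
  The Bochner space of strongly measurable, essentially bounded functions on \<open>I\<close> with values in
  a space \<open>X\<close> of functions with (semi)norm \<open>N\<close>. Strong measurability: almost everywhere limit,
  with respect to \<open>N\<close>, of \<open>X\<close>-valued simple functions.
\<close>

definition Linf_Bochner ::
  "real set \<Rightarrow> (real \<Rightarrow> real) set \<Rightarrow> ((real \<Rightarrow> real) \<Rightarrow> real) \<Rightarrow> (real \<Rightarrow> real \<Rightarrow> real) set" where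
  "Linf_Bochner I X N = {u.
     (AE t in lebesgue_on I. u t \<in> X) \<and>
     (\<exists>s. (\<forall>n. simple_function (lebesgue_on I) (s n) \<and> (\<forall>t\<in>I. s n t \<in> X)) \<and>
          (AE t in lebesgue_on I. (\<lambda>n::nat. N (\<lambda>x. s n t x - u t x)) \<longlonglongrightarrow> 0)) \<and>
     (\<exists>C. AE t in lebesgue_on I. N (u t) \<le> C)}"

abbreviation \<Omega> :: "real set" where "\<Omega> \<equiv> {0<..<1}"

text \<open>
  \<open>w\<close> is the value at time \<open>0\<close> of the representative of \<open>u\<close> that is continuous from \<open>[0,T]\<close>
  into \<open>L\<^sup>2(0,1)\<close>.
\<close>

definition has_initial_value :: "real \<Rightarrow> (real \<Rightarrow> real \<Rightarrow> real) \<Rightarrow> (real \<Rightarrow> real) \<Rightarrow> bool" where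
  "has_initial_value T u w \<longleftrightarrow>
     (\<exists>U. (\<forall>t\<in>{0..T}. U t \<in> L2 \<Omega> \<and>
             ((\<lambda>s. L2_norm \<Omega> (\<lambda>x. U s x - U t x)) \<longlongrightarrow> 0) (at t within {0..T})) \<and>
          (AE t in lebesgue_on {0<..<T}. AE x in lebesgue_on \<Omega>. u t x = U t x) \<and>
          (AE x in lebesgue_on \<Omega>. U 0 x = w x))"

text \<open>
  Solutions on \<open>(0,T)\<close>. The unknown is written with time first, so that \<open>u t\<close> is a function
  on \<open>(0,1)\<close>, and the space-time domain is \<open>(0,T) \<times> (0,1)\<close> with basis directions \<open>(1,0)\<close> for time
  and \<open>(0,1)\<close> for space.
\<close>

definition is_solution ::
  "real \<Rightarrow> real \<Rightarrow> real \<Rightarrow> real \<Rightarrow> real \<Rightarrow> real \<Rightarrow> real \<Rightarrow> real \<Rightarrow> (real \<Rightarrow> real) \<Rightarrow> (real \<Rightarrow> real) \<Rightarrow>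
   (real \<Rightarrow> real) \<Rightarrow> (real \<Rightarrow> real) \<Rightarrow> real \<Rightarrow> (real \<Rightarrow> real \<Rightarrow> real) \<Rightarrow> bool" where
  "is_solution p \<alpha> \<beta> lam lam0 lam1 tlam0 tlam1 h0 h1 u0 u1 T u \<longleftrightarrow>
     (\<exists>ut utt uxx.
        has_weak_deriv ({0<..<T} \<times> \<Omega>) [(1,0)] (\<lambda>(t,x). u t x) (\<lambda>(t,x). ut t x) \<and>
        has_weak_deriv ({0<..<T} \<times> \<Omega>) [(1,0),(1,0)] (\<lambda>(t,x). u t x) (\<lambda>(t,x). utt t x) \<and>
        has_weak_deriv ({0<..<T} \<times> \<Omega>) [(0,1),(0,1)] (\<lambda>(t,x). u t x) (\<lambda>(t,x). uxx t x) \<and>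
        u \<in> Linf_Bochner {0<..<T} (Sobolev 2 \<Omega>) (Sobolev_norm 2 \<Omega>) \<and>
        ut \<in> Linf_Bochner {0<..<T} (Sobolev 1 \<Omega>) (Sobolev_norm 1 \<Omega>) \<and>
        utt \<in> Linf_Bochner {0<..<T} (L2 \<Omega>) (L2_norm \<Omega>) \<and>
        (\<lambda>t. cont_value \<Omega> (u t) 0) \<in> Sobolev 2 {0<..<T} \<and>
        (\<lambda>t. cont_value \<Omega> (u t) 1) \<in> Sobolev 2 {0<..<T} \<and>
        (AE (t,x) in lebesgue_on ({0<..<T} \<times> \<Omega>).
           utt t x - uxx t x + u t x + lam * ut t x = \<bar>u t x\<bar> powr (p - 2) * u t x) \<and>
        (AE t in lebesgue_on {0<..<T}.
           cont_value \<Omega> (weak_deriv \<Omega> 1 (u t)) 0 =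
             - (\<bar>cont_value \<Omega> (u t) 0\<bar> powr (\<alpha> - 2) * cont_value \<Omega> (u t) 0)
             + lam0 * cont_value \<Omega> (ut t) 0
             + h1 t * cont_value \<Omega> (u t) 1 + tlam1 * cont_value \<Omega> (ut t) 1) \<and>
        (AE t in lebesgue_on {0<..<T}.
           - cont_value \<Omega> (weak_deriv \<Omega> 1 (u t)) 1 =
             - (\<bar>cont_value \<Omega> (u t) 1\<bar> powr (\<beta> - 2) * cont_value \<Omega> (u t) 1)
             + lam1 * cont_value \<Omega> (ut t) 1
             + h0 t * cont_value \<Omega> (u t) 0 + tlam0 * cont_value \<Omega> (ut t) 0) \<and>
        has_initial_value T u u0 \<and>
        has_initial_value T ut u1)"

end

theory Submission
 imports Defs
begin

text \<open>
 Every solution has a representative for which \<open>u\<^sub>t\<close> and \<open>u\<^sub>x\<close> are continuous: the slices \<open>u t\<close>, \<open>u\<^sub>t t\<close>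
 are uniformly Hoelder continuous in \<open>x\<close>, and their local averages are Lipschitz in \<open>t\<close>. The Riemann invariants
 \<open>u\<^sub>t + u\<^sub>x\<close>, \<open>u\<^sub>t - u\<^sub>x\<close> satisfy integral equations along the characteristics. At an end point one of them is
 incoming, and the boundary conditions become a linear system for \<open>(u\<^sub>t(0,t), u\<^sub>t(1,t))\<close> with determinant
 \<open>(1 + lam0) (1 + lam1) - tlam0 tlam1 > 0\<close>; Gronwall's argument on short time steps gives uniqueness.

 For existence, \<open>u = exp (- lam t / 2) w\<close> removes the damping. The boundary conditions determine a continuation of the
 initial Riemann invariants beyond \<open>[0,1]\<close> in terms of \<open>w\<close>, so that d'Alembert's formula turns the problem into a fixed
 point equation for \<open>w\<close>, which is a contraction for small times. By the compatibility conditions the continued invariants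
 are in \<open>H\<^sup>1\<close>, which makes the fixed point as regular as claimed; its second derivatives are translates of
 \<open>L\<^sup>2\<close> functions plus continuous functions.
\<close>

text \<open>Uniqueness is claimed among all weak solutions, and these are tested only against smooth
  functions of compact support, so the integral equations must be extracted from the weak
  formulation. Test functions \<open>d t * e (x + \<sigma> * t)\<close> do this: letting the support
  of \<open>e\<close> shrink concentrates them on one line, with \<open>\<sigma> = 0\<close> for
  \<open>u\<close> itself and \<open>\<sigma> = 1\<close>, \<open>\<sigma> = -1\<close> for the two
  invariants. The damping is removed only for existence: the source then contains \<open>w\<close>
  but none of its derivatives, so that the contraction can use the supremum norm of merely
  continuous functions, at the price of boundary terms depending on time. The continuation beyond
  \<open>[0, 1]\<close> encodes the reflections at both ends and spares a distinction of cases in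
  d'Alembert's formula, but \<open>w\<close> has to live on \<open>[-T, 1 + T]\<close>. The
  determinant is positive because
  \<open>4 * tlam0 * tlam1 <= (tlam0 + tlam1)^2 < 4 * lam0 * lam1\<close>. Times are at most 1, so
  that a characteristic traced back to time 0 is reflected at most once. Strong measurability is
  obtained from continuity in time, as translates of a fixed square integrable function move
  continuously in L^2.\<close>

abbreviation cont :: "('a::topological_space => 'b::topological_space) => bool" where
 "cont f \<equiv> continuous_on UNIV f"

abbreviation lint :: "('a::euclidean_space => real) => bool" where
 "lint f \<equiv> integrable lborel f"

abbreviation BM :: "('a::topological_space => real) set" where
 "BM \<equiv> borel_measurable borel"

lemmas LINT_cong = Bochner_Integration.integral_cong

section \<open>Test functions\<close>

text \<open>Smoothness as data, in the style of \<open>smooth_partials\<close>: \<open>d k\<close>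
  is the k-th derivative of \<open>d 0\<close>. Carrying all derivatives along turns statements
  about smooth functions into statements about indices.\<close>

definition smooth_seq :: "(nat => real => real) => bool" where
 "smooth_seq d \<longleftrightarrow> (ALL k x. (d k has_real_derivative d (Suc k) x) (at x))"

lemma smooth_seqD: "smooth_seq d ==> (d k has_real_derivative d (Suc k) x) (at x)"
 unfolding smooth_seq_def by blast

lemma smooth_seq_continuous: "smooth_seq d ==> continuous_on A (d k)"
 by (meson DERIV_isCont continuous_at_imp_continuous_on smooth_seqD)

lemma smooth_seq_borel: "smooth_seq d ==> d k \<in> BM"
 by (simp add: borel_measurable_continuous_onI smooth_seq_continuous)

text \<open>Dependent choice reduces smoothness to a single derivative: a class closed under
  differentiation provides the whole sequence.\<close>

lemma smooth_seq_of_class: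
 assumes "f \<in> F" and "!!g. g \<in> F ==> \<exists>g'\<in>F. ALL x. (g has_real_derivative g' x) (at x)"
 obtains d where "smooth_seq d" "d 0 = f"
proof -
 have "EX d. \<forall>n::nat. (d n \<in> F & (n = 0 --> d n = f)) & (ALL x. (d n has_real_derivative d (Suc n) x) (at x))"
  using assms by (intro dependent_nat_choice) auto
 then show ?thesis
  using that unfolding smooth_seq_def by blast
qed

lemma smooth_seq_support:
 assumes d: "smooth_seq d" and 0: "!!x. x ~: {a..b} ==> d 0 x = 0" and x: "x ~: {a..b}"
 shows "d k x = 0"
 using x
proof (induction k arbitrary: x)
 case 0
 then show ?case using assms(2) by blast
next
 case (Suc k)
 \<comment> \<open>Off the closed interval the function vanishes in a neighbourhood, so its
   derivative there is that of zero.\<close>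
 have "open (- {a..b})" by auto
 then have "((%_. 0) has_real_derivative d (Suc k) x) (at x)"
  using has_field_derivative_transform_within_open[OF smooth_seqD[OF d], where S="- {a..b}" and g="%_. 0"]
   Suc by auto
 then show ?case
  using DERIV_const DERIV_unique by blast
qed

lemma smooth_seq_bounded:
 assumes d: "smooth_seq d" and 0: "!!x. x ~: {a..b} ==> d 0 x = 0"
 obtains B where "B > 0" "!!x. \<bar>d k x\<bar> <= B"
proof -
 have "bounded (d k ` {a..b})"
  using smooth_seq_continuous[OF d] by (intro compact_imp_bounded compact_continuous_image) auto
 then obtain B where B: "B > 0" "!!x. x \<in> {a..b} ==> \<bar>d k x\<bar> <= B"
  by (auto simp: bounded_pos)
 show ?thesis
  by (rule that[of B]) (use B smooth_seq_support[OF d 0] in \<open>auto, smt (verit, best) atLeastAtMost_iff\<close>)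
qed

text \<open>The classical \<open>exp (- c / y)\<close> for positive \<open>y\<close>, continued by
  zero, together with the negative powers of \<open>y\<close> that differentiation produces; up to
  linear combinations the family in \<open>n\<close> is thereby closed under derivatives. The
  parameter \<open>c\<close> is later sent to zero to approach indicators.\<close>

definition flat_fun :: "real => nat => real => real" where
 "flat_fun c n y = (if y > 0 then inverse y ^ n * exp (- (c / y)) else 0)"

text \<open>The exponential beats the power by one order: \<open>exp z >= (z / N) ^ N\<close> with
  \<open>N = n + 1\<close> leaves a factor \<open>y\<close>. The linear bound is what
  differentiability at the origin needs.\<close>

lemma flat_fun_le:
 assumes "c > 0"
 obtains K where "!!y. \<bar>flat_fun c n y\<bar> <= K * \<bar>y\<bar>"
proof -
 define N where "N = Suc n"
 have "\<bar>flat_fun c n y\<bar> <= (real N / c) ^ N * \<bar>y\<bar>" for y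
 proof (cases "y > 0")
  case True
  have "(c / y / N) ^ N <= (1 + c / y / N) ^ N"
   using assms True by (intro power_mono) auto
  also have "... <= exp (c / y)"
   using assms True by (intro exp_ge_one_plus_x_over_n_power_n) (auto simp: N_def add_nonneg_pos intro: order_trans[of _ 0])
  finally have *: "(c / y / N) ^ N <= exp (c / y)" .
  have "(c / y / N) ^ N > 0"
   using assms True by (simp add: N_def)
  then have "exp (- (c / y)) <= inverse ((c / y / N) ^ N)"
   unfolding exp_minus using * by (rule le_imp_inverse_le[rotated])
  also have "... = (real N / c) ^ N * y ^ N"
  proof -
   have "inverse (c / y / N) = real N / c * y" by simp
   then show ?thesis by (simp only: power_inverse[symmetric] power_mult_distrib)
  qed
  finally have "inverse y ^ n * exp (- (c / y)) <= inverse y ^ n * ((real N / c) ^ N * y ^ N)"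
   using True by (intro mult_left_mono) auto
  also have "... = (real N / c) ^ N * y"
   using True by (simp add: N_def power_inverse)
  finally show ?thesis using True by (simp add: flat_fun_def)
 next
  case False
  then show ?thesis using assms by (simp add: flat_fun_def mult_nonneg_nonpos)
 qed
 then show ?thesis using that by blast
qed

lemma flat_fun_Suc: "flat_fun c n y / y = flat_fun c (Suc n) y"
 by (auto simp: flat_fun_def field_simps)

lemma DERIV_flat_fun:
 assumes c: "c > 0"
 shows "(flat_fun c n has_real_derivative c * flat_fun c (n + 2) y - n * flat_fun c (n + 1) y) (at y)"
proof -
 consider "y > 0" | "y < 0" | "y = 0" by linarith
 then show ?thesis
 proof cases
  case 1
  have *: "((%y. inverse y ^ n * exp (- (c / y))) has_real_derivative
    c * flat_fun c (n + 2) y - n * flat_fun c (n + 1) y) (at y)"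
   using 1
   by (auto intro!: derivative_eq_intros simp: flat_fun_def power2_eq_square divide_inverse)
     (cases n; simp add: algebra_simps)
  show ?thesis
   by (rule has_field_derivative_transform_within_open[OF *, of "{0<..}"]) (use 1 in \<open>auto simp: flat_fun_def\<close>)
 next
  case 2
  have *: "((%y. 0) has_real_derivative 0) (at y)" by simp
  have "(flat_fun c n has_real_derivative 0) (at y)"
   by (rule has_field_derivative_transform_within_open[OF *, of "{..<0}"]) (use 2 in \<open>auto simp: flat_fun_def\<close>)
  then show ?thesis using 2 by (simp add: flat_fun_def)
 next
  case 3
  \<comment> \<open>At the origin the difference quotient of \<open>flat_fun c n\<close> is
    \<open>flat_fun c (Suc n)\<close>, which tends to zero by the linear bound.\<close>
  obtain K where K: "!!y. \<bar>flat_fun c (Suc n) y\<bar> <= K * \<bar>y\<bar>"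
   using flat_fun_le[OF c] by blast
  have "((%h. flat_fun c (Suc n) h) \<longlongrightarrow> 0) (at 0)"
  proof (rule Lim_null_comparison)
   show "\<forall>\<^sub>F h in at 0. norm (flat_fun c (Suc n) h) <= K * \<bar>h\<bar>"
    using K by auto
   show "((%h. K * \<bar>h\<bar>) \<longlongrightarrow> 0) (at 0)"
    by (auto intro!: tendsto_eq_intros)
  qed
  moreover have "flat_fun c m 0 = 0" for m
   by (simp add: flat_fun_def)
  ultimately show ?thesis
   using 3 by (simp add: DERIV_def flat_fun_Suc)
 qed
qed

text \<open>Left unnormalised: with values in \<open>[0, 1]\<close> it converges to the indicator of
  the open interval as \<open>c\<close> tends to 0. Averages carry the integral of the bump as a
  factor instead.\<close>

definition bump :: "real => real => real => real => real" where
 "bump c a b x = flat_fun c 0 (x - a) * flat_fun c 0 (b - x)"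

text \<open>The span of the products of two flat functions, one at each end; by the product rule and
  \<open>DERIV_flat_fun\<close> it is closed under differentiation, as
  \<open>smooth_seq_of_class\<close> requires.\<close>

inductive_set bump_class :: "real => real => real => (real => real) set" for c a b where
 base: "(%x. flat_fun c m (x - a) * flat_fun c n (b - x)) \<in> bump_class c a b"
| add: "f \<in> bump_class c a b ==> g \<in> bump_class c a b ==> (%x. f x + g x) \<in> bump_class c a b"
| scale: "f \<in> bump_class c a b ==> (%x. r * f x) \<in> bump_class c a b"

lemma bump_class_deriv:
 assumes c: "c > 0" and "f \<in> bump_class c a b"
 shows "\<exists>f'\<in>bump_class c a b. ALL x. (f has_real_derivative f' x) (at x)"
 using assms(2)
proof induction
 case (base m n)
 let ?A = "%m n x. flat_fun c m (x - a) * flat_fun c n (b - x)"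
 let ?f' = "%x. (c * ?A (m + 2) n x + (- real m) * ?A (m + 1) n x) +
  ((- c) * ?A m (n + 2) x + real n * ?A m (n + 1) x)"
 have 1: "?f' \<in> bump_class c a b"
  by (intro bump_class.intros)
 have 2: "ALL x. (?A m n has_real_derivative ?f' x) (at x)"
 proof
  fix x
  have A: "((%x. flat_fun c m (x - a)) has_real_derivative
    (c * flat_fun c (m + 2) (x - a) - m * flat_fun c (m + 1) (x - a)) * 1) (at x)"
   by (rule DERIV_chain'[OF _ DERIV_flat_fun[OF c]]) (auto intro!: derivative_eq_intros)
  have B: "((%x. flat_fun c n (b - x)) has_real_derivative
    (c * flat_fun c (n + 2) (b - x) - n * flat_fun c (n + 1) (b - x)) * (-1)) (at x)"
   by (rule DERIV_chain'[OF _ DERIV_flat_fun[OF c]]) (auto intro!: derivative_eq_intros)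
  show "(?A m n has_real_derivative ?f' x) (at x)"
   by (rule DERIV_cong[OF DERIV_mult[OF A B]]) (simp add: algebra_simps)
 qed
 show ?case by (rule bexI[where x="?f'"], rule 2, rule 1)
next
 case (add f g)
 then obtain f' g' where "f' \<in> bump_class c a b" "ALL x. (f has_real_derivative f' x) (at x)"
  "g' \<in> bump_class c a b" "ALL x. (g has_real_derivative g' x) (at x)" by blast
 then show ?case
  by (intro bexI[of _ "%x. f' x + g' x"]) (auto intro!: DERIV_add bump_class.add)
next
 case (scale f r)
 then obtain f' where "f' \<in> bump_class c a b" "ALL x. (f has_real_derivative f' x) (at x)" by blast
 then show ?case
  by (intro bexI[of _ "%x. r * f' x"]) (auto intro!: DERIV_cmult bump_class.scale)
qed

lemma bump_smooth_seq:
 assumes "c > 0"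
 obtains d where "smooth_seq d" "d 0 = bump c a b"
proof (rule smooth_seq_of_class[of "bump c a b" "bump_class c a b"])
 show "bump c a b \<in> bump_class c a b"
  using bump_class.base[of c 0 a 0 b] by (simp add: bump_def[abs_def])
qed (use bump_class_deriv[OF assms] that in auto)

lemma bump_outside: "x ~: {a<..<b} ==> bump c a b x = 0"
 by (auto simp: bump_def flat_fun_def)

lemma bump_pos: "x \<in> {a<..<b} ==> bump c a b x > 0"
 by (auto simp: bump_def flat_fun_def)

lemma bump_nonneg: "bump c a b x >= 0"
 by (auto simp: bump_def flat_fun_def)

lemma bump_le_1: "c > 0 ==> bump c a b x <= 1"
 by (auto simp: bump_def flat_fun_def mult_le_one)

lemma bump_continuous: "c > 0 ==> continuous_on A (bump c a b)"
 by (metis bump_smooth_seq smooth_seq_continuous)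

lemma bump_borel [measurable]: "bump c a b \<in> BM"
 unfolding bump_def[abs_def] flat_fun_def by measurable

lemma bump_tendsto_indicator:
 "(%n. bump (1 / real (Suc n)) a b x) \<longlonglongrightarrow> indicator {a<..<b} x"
proof (cases "x \<in> {a<..<b}")
 case True
 have "(%n. exp (- (1 / real (Suc n) / (x - a))) * exp (- (1 / real (Suc n) / (b - x)))) \<longlonglongrightarrow>
   exp (- (0 / (x - a))) * exp (- (0 / (b - x)))"
  by (intro tendsto_intros LIMSEQ_inverse_real_of_nat[unfolded inverse_eq_divide]) (use True in auto)
 then show ?thesis
  using True by (simp add: bump_def flat_fun_def)
next
 case False
 then show ?thesis by (auto simp: bump_def flat_fun_def)
qed

text \<open>Iterated partial derivatives of \<open>d (p \<bullet> z) * e (q \<bullet> z)\<close> by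
  the Leibniz rule; \<open>i\<close> and \<open>j\<close> count the derivatives that have fallen on
  each factor. The choice \<open>p = (1, 0)\<close>, \<open>q = (\<sigma>, 1)\<close> gives test
  functions that follow the lines \<open>x = \<xi> - \<sigma> * t\<close>.\<close>

fun lin_partials ::
 "'a::euclidean_space => 'a => (nat => real => real) => (nat => real => real) => 'a list => nat => nat => 'a => real"
where
 "lin_partials p q d e [] i j z = d i (p \<bullet> z) * e j (q \<bullet> z)"
| "lin_partials p q d e (b # bs) i j z =
   (p \<bullet> b) * lin_partials p q d e bs (Suc i) j z + (q \<bullet> b) * lin_partials p q d e bs i (Suc j) z"

lemma lin_partials_deriv:
 assumes "smooth_seq d" "smooth_seq e"
 shows "(lin_partials p q d e bs i j has_derivative
   (%h. \<Sum>b\<in>Basis. (h \<bullet> b) * lin_partials p q d e (b # bs) i j z)) (at z)"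
proof (induction bs arbitrary: i j)
 case Nil
 have "((%z. d i (p \<bullet> z)) has_derivative (%h. d (Suc i) (p \<bullet> z) * (p \<bullet> h))) (at z)"
  using has_derivative_compose[OF has_derivative_inner_right[OF has_derivative_ident]
    smooth_seqD[OF assms(1), unfolded has_field_derivative_def]] .
 moreover have "((%z. e j (q \<bullet> z)) has_derivative (%h. e (Suc j) (q \<bullet> z) * (q \<bullet> h))) (at z)"
  using has_derivative_compose[OF has_derivative_inner_right[OF has_derivative_ident]
    smooth_seqD[OF assms(2), unfolded has_field_derivative_def]] .
 ultimately have *: "((%z. d i (p \<bullet> z) * e j (q \<bullet> z)) has_derivative
   (%h. d i (p \<bullet> z) * (e (Suc j) (q \<bullet> z) * (q \<bullet> h)) + d (Suc i) (p \<bullet> z) * (p \<bullet> h) * e j (q \<bullet> z))) (at z)"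
  by (auto intro!: has_derivative_mult)
 have "d i (p \<bullet> z) * (e (Suc j) (q \<bullet> z) * (q \<bullet> h)) + d (Suc i) (p \<bullet> z) * (p \<bullet> h) * e j (q \<bullet> z) =
   (\<Sum>b\<in>Basis. (h \<bullet> b) * lin_partials p q d e [b] i j z)" for h
 proof -
  have 1: "p \<bullet> h = (\<Sum>b\<in>Basis. (h \<bullet> b) * (p \<bullet> b))" "q \<bullet> h = (\<Sum>b\<in>Basis. (h \<bullet> b) * (q \<bullet> b))"
   by (subst euclidean_inner, simp add: mult.commute)+
  show ?thesis
   unfolding 1 by (simp add: sum_distrib_left sum_distrib_right sum.distrib[symmetric] distrib_left mult_ac add.commute)
 qed
 moreover have "lin_partials p q d e [] i j = (%z. d i (p \<bullet> z) * e j (q \<bullet> z))"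
  by (simp add: fun_eq_iff)
 ultimately show ?case
  using * by simp
next
 case (Cons b bs)
 have *: "(lin_partials p q d e (b # bs) i j has_derivative
   (%h. (p \<bullet> b) * (\<Sum>c\<in>Basis. (h \<bullet> c) * lin_partials p q d e (c # bs) (Suc i) j z) +
    (q \<bullet> b) * (\<Sum>c\<in>Basis. (h \<bullet> c) * lin_partials p q d e (c # bs) i (Suc j) z))) (at z)"
 proof -
  have "lin_partials p q d e (b # bs) i j = (%z. (p \<bullet> b) * lin_partials p q d e bs (Suc i) j z +
    (q \<bullet> b) * lin_partials p q d e bs i (Suc j) z)"
   by (simp add: fun_eq_iff)
  then show ?thesis
   by (simp only:) (intro has_derivative_add has_derivative_mult_right Cons.IH)
 qed
 show ?case
  by (rule has_derivative_eq_rhs[OF *])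
   (simp add: fun_eq_iff sum_distrib_left sum.distrib[symmetric] distrib_left mult_ac add_ac)
qed

lemma smooth_partials_lin:
 assumes "smooth_seq d" "smooth_seq e"
 shows "smooth_partials (%bs. lin_partials p q d e bs 0 0)"
 unfolding smooth_partials_def using lin_partials_deriv[OF assms] by blast

lemma smooth_partials_seq:
 assumes "smooth_seq d"
 shows "smooth_partials (%bs. d (length (bs :: real list)))"
 unfolding smooth_partials_def
 using smooth_seqD[OF assms] unfolding has_field_derivative_def by (simp add: mult_commute_abs)

lemma smooth_partials_seqD:
 assumes "smooth_partials D"
 shows "smooth_seq (%k. D (replicate k (1::real)))"
 unfolding smooth_seq_def
proof (intro allI)
 fix k x
 have "replicate k (1::real) \<in> lists Basis" by (induction k) auto
 then have "(D (replicate k 1) has_derivative (%h. \<Sum>b\<in>Basis. (h \<bullet> b) * D (b # replicate k 1) x)) (at x)"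
  using assms unfolding smooth_partials_def by blast
 then show "(D (replicate k 1) has_real_derivative D (replicate (Suc k) 1) x) (at x)"
  unfolding has_field_derivative_def by (simp add: mult_commute_abs)
qed

section \<open>Lebesgue integration\<close>

lemma LINT_lebesgue_on:
 fixes f :: "'a::euclidean_space => real"
 assumes "S \<in> sets borel" "f \<in> BM"
 shows "(LINT z|lebesgue_on S. f z) = (LINT z|lborel. indicator S z * f z)"
 using assms by (simp add: integral_restrict_space integral_completion)

lemma integrable_lebesgue_on:
 fixes f :: "'a::euclidean_space => real"
 assumes "S \<in> sets borel" "f \<in> BM"
 shows "integrable (lebesgue_on S) f \<longleftrightarrow> lint (%z. indicator S z * f z)"
 using assms by (simp add: integrable_restrict_space integrable_completion)

lemma AE_lebesgue_on:
 assumes "S \<in> sets (borel :: 'a::euclidean_space measure)"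
 shows "(AE z in lebesgue_on S. P z) \<longleftrightarrow> (AE z in lborel. z \<in> S --> P z)"
 using assms by (simp add: AE_restrict_space_iff AE_completion_iff)

lemmas AE_lebesgue_on_Ioo = AE_lebesgue_on[OF borel_open[OF open_greaterThanLessThan]]

text \<open>Membership in the function spaces is a matter of Lebesgue measurability, while Fubini
  and substitution are applied on \<open>lborel\<close>. Arguments of that kind begin by passing to
  a Borel function, here also made zero outside \<open>S\<close>.\<close>

lemma borel_representative:
 fixes f :: "'a::euclidean_space => real"
 assumes S: "S \<in> sets borel" and f: "f \<in> borel_measurable (lebesgue_on S)"
 obtains f' where "f' \<in> BM" "AE z in lebesgue_on S. f z = f' z" "!!z. z ~: S ==> f' z = 0"
proof -
 have "(%z. if z \<in> S then f z else 0) \<in> borel_measurable lebesgue"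
  using borel_measurable_if_I[OF f] S by simp
 then obtain h where h: "h \<in> borel_measurable lborel" "AE z in lborel. (if z \<in> S then f z else 0) = h z"
  using completion_ex_borel_measurable_real by blast
 show ?thesis
 proof (rule that[of "%z. indicator S z * h z"])
  show "(%z. indicator S z * h z) \<in> BM"
   using h S by (intro borel_measurable_times) (auto intro!: borel_measurable_indicator)
  show "AE z in lebesgue_on S. f z = indicator S z * h z"
   unfolding AE_lebesgue_on[OF S] using h(2) by eventually_elim auto
 qed simp
qed

lemma measurable_lebesgue_on_cong_AE:
 fixes f :: "'a::euclidean_space => real"
 assumes S: "S \<in> sets borel" and f: "f \<in> borel_measurable (lebesgue_on S)"
  and eq: "AE z in lebesgue_on S. f z = g z"
 shows "g \<in> borel_measurable (lebesgue_on S)"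
proof -
 have "AE z in lebesgue. (if z \<in> S then f z else 0) = (if z \<in> S then g z else 0)"
  using eq S by (auto simp: AE_restrict_space_iff elim!: eventually_mono)
 moreover have "(%z. if z \<in> S then f z else 0) \<in> borel_measurable lebesgue"
  using borel_measurable_if_I[OF f] S by simp
 ultimately have "(%z. if z \<in> S then g z else 0) \<in> borel_measurable lebesgue"
  by (rule borel_measurable_AE[rotated])
 then show ?thesis
  using S by (simp add: borel_measurable_if)
qed

lemma LINT_lebesgue_on_cong_AE:
 fixes f :: "'a::euclidean_space => real"
 assumes S: "S \<in> sets borel" and f: "f \<in> borel_measurable (lebesgue_on S)"
  and eq: "AE z in lebesgue_on S. f z = g z"
 shows "(LINT z|lebesgue_on S. f z) = (LINT z|lebesgue_on S. g z)"
 using measurable_lebesgue_on_cong_AE[OF assms] f eq by (intro integral_cong_AE) auto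

lemma absolutely_integrable_on_borel:
 fixes f :: "'a::euclidean_space => real"
 assumes "S \<in> sets borel" "f \<in> BM"
 shows "f absolutely_integrable_on S \<longleftrightarrow> lint (%z. indicator S z * f z)"
 using assms unfolding set_integrable_def by (simp add: integrable_completion)

lemma absolutely_integrable_on_cong_AE:
 fixes f :: "'a::euclidean_space => real"
 assumes S: "S \<in> sets borel" and f: "f absolutely_integrable_on S"
  and eq: "AE z in lebesgue_on S. f z = g z"
 shows "g absolutely_integrable_on S"
proof -
 have f': "integrable (lebesgue_on S) f"
  using f S by (simp add: integrable_restrict_space set_integrable_def)
 have "integrable (lebesgue_on S) g"
  using f' measurable_lebesgue_on_cong_AE[OF S _ eq] eq
  by (subst integrable_cong_AE[of _ _ f]) auto
 then show ?thesis
  using S by (simp add: integrable_restrict_space set_integrable_def)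
qed

lemma AE_lebesgue_on_subset:
 assumes "S \<in> sets (borel :: 'a::euclidean_space measure)" "T \<in> sets borel" "T \<subseteq> S"
  "AE z in lebesgue_on S. P z"
 shows "AE z in lebesgue_on T. P z"
 using assms(3,4) unfolding AE_lebesgue_on[OF assms(1)] AE_lebesgue_on[OF assms(2)]
 by (auto elim!: eventually_mono)

lemma locally_integrable_cong_AE:
 fixes S :: "'a::euclidean_space set"
 assumes S: "S \<in> sets borel" and f: "locally_integrable S f" and eq: "AE z in lebesgue_on S. f z = g z"
 shows "locally_integrable S g"
 using f unfolding locally_integrable_def
 by (meson absolutely_integrable_on_cong_AE AE_lebesgue_on_subset[OF S _ _ eq] borel_compact)

text \<open>Exhaustion by compact sets: on each of them \<open>f\<close> is integrable and hence
  measurable, and the restrictions converge pointwise.\<close>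

lemma locally_integrable_measurable:
 fixes S :: "'a::euclidean_space set"
 assumes S: "open S" and f: "locally_integrable S f"
 shows "f \<in> borel_measurable (lebesgue_on S)"
proof -
 obtain C where C: "!!n::nat. compact (C n)" "!!n. C n \<subseteq> S" "!!n. C n \<subseteq> C (Suc n)" "\<Union>(range C) = S"
  "!!K. compact K ==> K \<subseteq> S ==> EX N. ALL n>=N. K \<subseteq> C n"
 proof (rule open_Union_compact_subsets[OF S])
  fix C :: "nat => 'a set"
  assume *: "!!n. compact (C n)" "!!n. C n \<subseteq> S" "!!n. C n \<subseteq> interior (C (Suc n))" "\<Union> (range C) = S"
   "!!K. compact K ==> K \<subseteq> S ==> EX N. ALL n>=N. K \<subseteq> C n"
  then show thesis
   by (intro that[of C]) (meson interior_subset order_trans)+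
 qed
 have 1: "(%z. indicator (C n) z * f z) \<in> borel_measurable lebesgue" for n
 proof -
  have "f absolutely_integrable_on C n"
   using f C(1,2) unfolding locally_integrable_def by blast
  then show ?thesis
   unfolding set_integrable_def by (auto dest: borel_measurable_integrable)
 qed
 have 2: "(%n. indicator (C n) z * f z) \<longlonglongrightarrow> indicator S z * f z" for z
 proof (cases "z \<in> S")
  case True
  then obtain N where "ALL n>=N. {z} \<subseteq> C n" using C(5)[of "{z}"] by auto
  then have "\<forall>\<^sub>F n in sequentially. indicator (C n) z * f z = indicator S z * f z"
   using True by (auto simp: eventually_sequentially intro!: exI[of _ N])
  then show ?thesis by (rule tendsto_eventually)
 next
  case False
  then have "z ~: C n" for n using C(2) by auto
  then show ?thesis using False by simp
 qed
 have "(%z. indicator S z * f z) \<in> borel_measurable lebesgue"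
  using borel_measurable_LIMSEQ_real[OF 2 1] by simp
 then show ?thesis
  using S by (simp add: borel_measurable_restrict_space_iff)
qed

section \<open>Criteria for integrability and for vanishing almost everywhere\<close>

lemma borel_indicator_mult_continuous:
 fixes f :: "'a::euclidean_space => real"
 assumes "S \<in> sets borel" "continuous_on S f"
 shows "(%x. indicator S x * f x) \<in> BM"
 using borel_measurable_continuous_on_indicator[OF assms] by simp

lemma integrable_indicator_continuous:
 fixes f :: "real => real"
 assumes "continuous_on {a..b} f"
 shows "lint (%x. indicator {a..b} x * f x)"
 using borel_integrable_atLeastAtMost'[OF assms] unfolding set_integrable_def by simp

lemma integrable_mult_bounded:
 fixes f g :: "'a => real"
 assumes "integrable M f" "g \<in> borel_measurable M" "!!x. \<bar>g x\<bar> <= C"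
 shows "integrable M (%x. f x * g x)"
proof (rule Bochner_Integration.integrable_bound[of M "%x. C * \<bar>f x\<bar>"])
 show "AE x in M. norm (f x * g x) <= norm (C * \<bar>f x\<bar>)"
 proof (rule AE_I2)
  fix x
  have "0 <= C" using assms(3)[of x] by linarith
  then show "norm (f x * g x) <= norm (C * \<bar>f x\<bar>)"
   using mult_left_mono[OF assms(3)[of x] abs_ge_zero[of "f x"]] by (simp add: abs_mult mult.commute)
 qed
qed (use assms in \<open>auto intro: borel_measurable_integrable\<close>)

lemma integrable_indicator_subset:
 fixes f :: "'a => real"
 assumes "integrable M (%x. indicator T x * f x)" "S \<in> sets M" "S \<subseteq> T"
 shows "integrable M (%x. indicator S x * f x)"
proof -
 have "(%x. indicator S x * f x) = (%x. indicator S x * (indicator T x * f x))"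
  using assms(3) by (auto simp: fun_eq_iff indicator_def)
 then show ?thesis
  using integrable_real_mult_indicator[OF assms(2,1)] by (simp add: mult.commute)
qed

text \<open>Dynkin's argument: open intervals are stable under intersection and generate the Borel
  sets, and the sets over which \<open>f\<close> has integral zero are closed under complements and
  countable disjoint unions.\<close>

lemma AE_zero_of_interval_integrals:
 fixes f :: "real => real"
 assumes f: "lint f"
  and 0: "!!a b. (LINT x|lborel. indicator {a<..<b} x * f x) = 0"
 shows "AE x in lborel. f x = 0"
proof (rule sigma_finite_measure.density_zero[OF lborel.sigma_finite_measure_axioms f])
 have sets_eq: "sigma_sets UNIV (range (%(a, b). {a<..<b})) = sets (borel :: real measure)"
 proof -
  have *: "(%(a, b). {a<..<b}) = (%(a, b::real). box a b)"
   by (auto simp: fun_eq_iff box_real)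
  show ?thesis
   unfolding * borel_eq_box[where 'a=real] by (rule sets_measure_of[symmetric]) simp
 qed
 fix A :: "real set" assume "A \<in> sets lborel"
 then have A: "A \<in> sigma_sets UNIV (range (%(a, b). {a<..<b}))"
  by (simp add: sets_eq)
 have int: "lint (%x. indicator S x * f x)" if "S \<in> sets borel" for S
  using integrable_real_mult_indicator[OF _ f, of S] that by (simp add: mult.commute)
 \<comment> \<open>Complements require the integral over the whole line to vanish; it is the limit
   of the integrals over \<open>(-n, n)\<close>.\<close>
 have all: "(LINT x|lborel. f x) = 0"
 proof -
  have "(%n::nat. LINT x|lborel. indicator {- real n<..<real n} x * f x) \<longlonglongrightarrow> (LINT x|lborel. f x)"
  proof (rule integral_dominated_convergence[where w="%x. \<bar>f x\<bar>"])
   show "AE x in lborel. (%n::nat. indicator {- real n<..<real n} x * f x) \<longlonglongrightarrow> f x"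
   proof (rule AE_I2)
    fix x
    obtain N::nat where "\<bar>x\<bar> < real N" using reals_Archimedean2 by blast
    then have "\<forall>\<^sub>F n in sequentially. indicator {- real n<..<real n} x * f x = f x"
     by (intro eventually_sequentiallyI[of N]) (auto simp: indicator_def)
    then show "(%n::nat. indicator {- real n<..<real n} x * f x) \<longlonglongrightarrow> f x"
     by (rule tendsto_eventually)
   qed
  qed (use f in \<open>auto simp: indicator_def abs_mult intro!: borel_measurable_times borel_measurable_indicator\<close>)
  then show ?thesis using LIMSEQ_unique[OF _ tendsto_const[of 0]] by (simp add: 0)
 qed
 have I: "Int_stable (range (%(a, b). {a<..<b::real}))"
  by (auto simp: Int_stable_def Int_greaterThanLessThan image_iff)
 have P: "range (%(a, b). {a<..<b::real}) \<subseteq> Pow UNIV"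
  by simp
 have "(LINT x|lborel. indicator A x * f x) = 0"
  using I P A
 proof (induction rule: sigma_sets_induct_disjoint)
  case (basic A)
  then show ?case using 0 by auto
 next
  case empty
  then show ?case by simp
 next
  case (compl A)
  then have A: "A \<in> sets borel"
   by (simp add: sets_eq)
  have "(LINT x|lborel. indicator (UNIV - A) x * f x) = (LINT x|lborel. f x - indicator A x * f x)"
   by (intro LINT_cong) (auto simp: indicator_def)
  also have "... = 0"
   using all compl f int[OF A] by simp
  finally show ?case .
 next
  case (union A)
  then have A: "A i \<in> sets borel" for i
   by (simp add: sets_eq)
  have "set_lebesgue_integral lborel (\<Union>(range A)) f = (\<Sum>i. set_lebesgue_integral lborel (A i) f)"
   using union(1) A int[of "\<Union>(range A)"]
   by (intro lebesgue_integral_countable_add) (auto simp: disjoint_family_on_def set_integrable_def)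
  then show ?case
   using union(3) by (simp add: set_lebesgue_integral_def)
 qed
 then show "set_lebesgue_integral lborel A f = 0"
  by (simp add: set_lebesgue_integral_def)
qed

text \<open>Dominated convergence from bumps to indicators of open intervals reduces the claim to
  \<open>AE_zero_of_interval_integrals\<close>.\<close>

lemma AE_zero_of_bump_integrals:
 fixes g :: "real => real"
 assumes g[measurable]: "g \<in> BM"
  and int: "!!\<alpha> \<beta>. a < \<alpha> ==> \<alpha> < \<beta> ==> \<beta> < b ==> lint (%x. indicator {\<alpha>..\<beta>} x * g x)"
  and 0: "!!\<alpha> \<beta> n. a < \<alpha> ==> \<alpha> < \<beta> ==> \<beta> < b ==>
   (LINT x|lborel. g x * bump (1 / real (Suc n)) \<alpha> \<beta> x) = 0"
 shows "AE x in lborel. x \<in> {a<..<b} --> g x = 0"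
proof -
 have open_zero: "(LINT x|lborel. indicator {\<alpha><..<\<beta>} x * g x) = 0"
  if *: "a < \<alpha>" "\<alpha> < \<beta>" "\<beta> < b" for \<alpha> \<beta>
 proof -
  have "(%n. LINT x|lborel. g x * bump (1 / real (Suc n)) \<alpha> \<beta> x) \<longlonglongrightarrow>
    (LINT x|lborel. g x * indicator {\<alpha><..<\<beta>} x)"
  proof (rule integral_dominated_convergence[where w="%x. indicator {\<alpha>..\<beta>} x * \<bar>g x\<bar>"])
   show "lint (%x. indicator {\<alpha>..\<beta>} x * \<bar>g x\<bar>)"
    using integrable_abs[OF int[OF *]] by (simp add: abs_mult)
   show "AE x in lborel. (%n. g x * bump (1 / real (Suc n)) \<alpha> \<beta> x) \<longlonglongrightarrow> g x * indicator {\<alpha><..<\<beta>} x"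
    by (intro AE_I2 tendsto_mult_left bump_tendsto_indicator)
   show "AE x in lborel. norm (g x * bump (1 / real (Suc n)) \<alpha> \<beta> x) <= indicator {\<alpha>..\<beta>} x * \<bar>g x\<bar>" for n
   proof (rule AE_I2)
    fix x
    show "norm (g x * bump (1 / real (Suc n)) \<alpha> \<beta> x) <= indicator {\<alpha>..\<beta>} x * \<bar>g x\<bar>"
     using bump_nonneg[of "1 / real (Suc n)" \<alpha> \<beta> x] bump_le_1[of "1 / real (Suc n)" \<alpha> \<beta> x]
      bump_outside[of x \<alpha> \<beta> "1 / real (Suc n)"]
     by (cases "x \<in> {\<alpha>..\<beta>}") (auto simp: abs_mult mult_left_le)
   qed
  qed auto
  then have "0 = (LINT x|lborel. g x * indicator {\<alpha><..<\<beta>} x)"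
   unfolding 0[OF *] LIMSEQ_const_iff .
  then show ?thesis
   by (simp add: mult.commute)
 qed
 \<comment> \<open>Integrability of \<open>g\<close> is known only away from \<open>a\<close> and
   \<open>b\<close>, so the conclusion is reached on countably many inner intervals that exhaust
   \<open>(a, b)\<close>.\<close>
 have "AE x in lborel. \<forall>n::nat. indicator {a + 1 / Suc n<..<b - 1 / Suc n} x * g x = 0"
  unfolding AE_all_countable
 proof
  fix n :: nat
  define A B where "A = a + 1 / Suc n" and "B = b - 1 / Suc n"
  have AB: "a < A" "B < b" by (auto simp: A_def B_def)
  show "AE x in lborel. indicator {a + 1 / Suc n<..<b - 1 / Suc n} x * g x = 0"
  proof (cases "A < B")
   case True
   have "AE x in lborel. indicator {A<..<B} x * g x = 0"
   proof (rule AE_zero_of_interval_integrals)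
    show "lint (%x. indicator {A<..<B} x * g x)"
     by (rule integrable_indicator_subset[OF int[OF AB(1) True AB(2)]]) auto
    fix u v
    have "(LINT x|lborel. indicator {u<..<v} x * (indicator {A<..<B} x * g x)) =
     (LINT x|lborel. indicator {max u A<..<min v B} x * g x)"
     by (intro LINT_cong) (auto simp: indicator_def)
    also have "... = 0"
     using open_zero[of "max u A" "min v B"] AB by (cases "max u A < min v B") auto
    finally show "(LINT x|lborel. indicator {u<..<v} x * (indicator {A<..<B} x * g x)) = 0" .
   qed
   then show ?thesis by (simp add: A_def B_def)
  next
   case False
   then show ?thesis by (auto simp: A_def B_def indicator_def)
  qed
 qed
 then show ?thesis
 proof eventually_elim
  case (elim x)
  show ?case
  proof
   assume x: "x \<in> {a<..<b}"
   then have "0 < min (x - a) (b - x)" by auto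
   then obtain n where "inverse (real (Suc n)) < min (x - a) (b - x)"
    using reals_Archimedean by blast
   then have "x \<in> {a + 1 / Suc n<..<b - 1 / Suc n}"
    by (auto simp: inverse_eq_divide)
   then show "g x = 0" using elim[rule_format, of n] by simp
  qed
 qed
qed

section \<open>Functions with square integrable derivative\<close>

lemma integrable_product_lborel:
 fixes f g :: "real => real"
 assumes f: "lint f" and g: "lint g"
 shows "integrable (lborel \<Otimes>\<^sub>M lborel) (%(x, y). f x * g y)"
proof -
 have [measurable]: "f \<in> BM" "g \<in> BM"
  using f g by auto
 have "lint (%x. (LINT y|lborel. norm (f x * g y)))"
  using f by (simp add: abs_mult)
 then show ?thesis
  using g by (intro lborel_pair.Fubini_integrable) auto
qed

text \<open>For \<open>x < a\<close> the indicator is empty and the value is zero, so only arguments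
  to the right of \<open>a\<close> carry information.\<close>

definition prim_from :: "real => (real => real) => real => real" where
 "prim_from a g x = (LINT s|lborel. indicator {a..x} s * g s)"

lemma prim_from_self [simp]: "prim_from a g a = 0"
proof -
 have "AE s in lborel. indicator {a..a} s * g s = 0"
  using AE_lborel_singleton[of a] by eventually_elim auto
 then show ?thesis
  unfolding prim_from_def by (rule integral_eq_zero_AE)
qed

lemma prim_from_diff:
 assumes g: "lint (%x. indicator {a..b} x * g x)" and xy: "a <= x" "x <= y" "y <= b"
 shows "prim_from a g y - prim_from a g x = (LINT s|lborel. indicator {x..y} s * g s)"
proof -
 have int: "lint (%x. indicator S x * g x)" if "S \<in> sets borel" "S \<subseteq> {a..b}" for S
  using integrable_indicator_subset[OF g] that by auto
 have "prim_from a g y = (LINT s|lborel. indicator {a..x} s * g s + indicator {x<..y} s * g s)"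
  unfolding prim_from_def using xy
  by (intro LINT_cong) (auto simp: indicator_def)
 also have "... = prim_from a g x + (LINT s|lborel. indicator {x<..y} s * g s)"
  unfolding prim_from_def using xy by (intro Bochner_Integration.integral_add int) auto
 also have "(LINT s|lborel. indicator {x<..y} s * g s) = (LINT s|lborel. indicator {x..y} s * g s)"
 proof (rule integral_cong_AE)
  show "AE s in lborel. indicator {x<..y} s * g s = indicator {x..y} s * g s"
   using AE_lborel_singleton[of x] by eventually_elim (auto simp: indicator_def)
 next
  have "{x<..y} \<subseteq> {a..b}" "{x..y} \<subseteq> {a..b}" using xy by auto
  then show "(%s. indicator {x<..y} s * g s) \<in> borel_measurable lborel"
   "(%s. indicator {x..y} s * g s) \<in> borel_measurable lborel"
   using int[of "{x<..y}"] int[of "{x..y}"] by (auto dest: borel_measurable_integrable)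
 qed
 finally show ?thesis by simp
qed

text \<open>Dominated convergence: the indicators converge at every \<open>s\<close> except possibly
  at \<open>x\<close>, a null set.\<close>

lemma indefinite_integral_tendsto:
 assumes g: "lint g"
 shows "cont (%x. LINT s|lborel. indicator {..x} s * g (s::real) :: real)"
proof -
 have [measurable]: "g \<in> BM" using g by auto
 have "isCont (%x. LINT s|lborel. indicator {..x} s * g s) x" for x
  unfolding isCont_def
 proof (rule tendsto_at_iff_sequentially[THEN iffD2], intro allI impI)
  fix X :: "nat => real" assume X: "ALL i. X i \<in> UNIV - {x}" "X \<longlonglongrightarrow> x"
  show "((%x. LINT s|lborel. indicator {..x} s * g s) \<circ> X) \<longlonglongrightarrow> (LINT s|lborel. indicator {..x} s * g s)"
   unfolding comp_def
  proof (rule integral_dominated_convergence[where w="%s. \<bar>g s\<bar>"])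
   show "AE s in lborel. (%i. indicator {..X i} s * g s) \<longlonglongrightarrow> indicator {..x} s * g s"
    using AE_lborel_singleton[of x]
   proof eventually_elim
    case (elim s)
    have "\<forall>\<^sub>F i in sequentially. indicator {..X i} s * g s = indicator {..x} s * g s"
    proof (cases "s < x")
     case True
     show ?thesis using order_tendstoD(1)[OF X(2) True] by eventually_elim (use True in auto)
    next
     case False
     then have "x < s" using elim by auto
     show ?thesis using order_tendstoD(2)[OF X(2) \<open>x < s\<close>] by eventually_elim (use \<open>x < s\<close> in auto)
    qed
    then show ?case by (rule tendsto_eventually)
   qed
  qed (use g in \<open>auto simp: abs_mult indicator_def\<close>)
 qed
 then show ?thesis by (simp add: continuous_at_imp_continuous_on)
qed

lemma prim_from_continuous:
 assumes g: "lint (%x. indicator {a..b} x * g x)"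
 shows "continuous_on {a..b} (prim_from a g)"
proof -
 have "prim_from a g x = (LINT s|lborel. indicator {..x} s * (indicator {a..b} s * g s))" if "x \<in> {a..b}" for x
  unfolding prim_from_def using that by (intro LINT_cong) (auto simp: indicator_def)
 then show ?thesis
  using indefinite_integral_tendsto[OF g]
  by (metis (no_types, lifting) continuous_on_cong continuous_on_subset subset_UNIV)
qed

lemma prim_from_borel:
 assumes "g \<in> BM"
 shows "prim_from a g \<in> BM"
proof -
 have [measurable]: "g \<in> BM" by fact
 \<comment> \<open>Written with a conditional, the integrand is visibly measurable in both variables
   jointly.\<close>
 have "(%x. LINT s|lborel. (if a <= s & s <= x then g s else 0)) \<in> BM"
  by measurable
 moreover have "(%x. LINT s|lborel. (if a <= s & s <= x then g s else 0)) = prim_from a g"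
  unfolding prim_from_def fun_eq_iff by (intro allI LINT_cong) auto
 ultimately show ?thesis by simp
qed

text \<open>Splitting the square \<open>[a,x] \<times> [a,x]\<close> along its diagonal.\<close>

lemma prim_from_mult:
 assumes f[measurable]: "f \<in> BM" and g[measurable]: "g \<in> BM"
  and fi: "lint (%x. indicator {a..b} x * f x)"
  and gi: "lint (%x. indicator {a..b} x * g x)"
  and x: "x \<in> {a..b}"
 shows "prim_from a f x * prim_from a g x =
  (LINT s|lborel. indicator {a..x} s * (f s * prim_from a g s + prim_from a f s * g s))"
proof -
 have [measurable]: "prim_from a f \<in> BM" "prim_from a g \<in> BM"
  by (rule prim_from_borel[OF f], rule prim_from_borel[OF g])
 let ?f = "%s. indicator {a..x} s * f s" and ?g = "%s. indicator {a..x} s * g s"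
 have fx: "lint ?f" and gx: "lint ?g"
  using x by (auto intro: integrable_indicator_subset[OF fi] integrable_indicator_subset[OF gi])
 have I: "integrable (lborel \<Otimes>\<^sub>M lborel) (%(s, r). ?f s * ?g r)"
  by (rule integrable_product_lborel[OF fx gx])
 have I1: "integrable (lborel \<Otimes>\<^sub>M lborel) (%(s, r). ?f s * ?g r * of_bool (r <= s))"
  by (rule Bochner_Integration.integrable_bound[OF I]) (auto simp: abs_mult)
 have I2: "integrable (lborel \<Otimes>\<^sub>M lborel) (%(s, r). ?f s * ?g r * of_bool (s < r))"
  by (rule Bochner_Integration.integrable_bound[OF I]) (auto simp: abs_mult)
 have 1: "(LINT s|lborel. LINT r|lborel. ?f s * ?g r * of_bool (r <= s)) =
   (LINT s|lborel. ?f s * prim_from a g s)"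
 proof (rule LINT_cong[OF refl])
  fix s
  show "(LINT r|lborel. ?f s * ?g r * of_bool (r <= s)) = ?f s * prim_from a g s"
  proof (cases "s \<in> {a..x}")
   case True
   have "(LINT r|lborel. ?f s * ?g r * of_bool (r <= s)) = (LINT r|lborel. f s * (indicator {a..s} r * g r))"
    using True by (intro LINT_cong) (auto simp: indicator_def)
   then show ?thesis using True by (simp add: prim_from_def)
  qed simp
 qed
 \<comment> \<open>Exchanging the order of integration brings out \<open>prim_from a f r\<close> on
   the second triangle; its strict inequality differs from the closed interval only in the point
   \<open>r\<close>.\<close>
 have 2: "(LINT s|lborel. LINT r|lborel. ?f s * ?g r * of_bool (s < r)) =
   (LINT r|lborel. prim_from a f r * ?g r)"
 proof -
  have "(LINT s|lborel. LINT r|lborel. ?f s * ?g r * of_bool (s < r)) =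
   (LINT r|lborel. LINT s|lborel. ?f s * ?g r * of_bool (s < r))"
   using lborel_pair.Fubini_integral[OF I2] by simp
  also have "... = (LINT r|lborel. prim_from a f r * ?g r)"
  proof (rule LINT_cong[OF refl])
   fix r
   show "(LINT s|lborel. ?f s * ?g r * of_bool (s < r)) = prim_from a f r * ?g r"
   proof (cases "r \<in> {a..x}")
    case True
    have "(LINT s|lborel. ?f s * ?g r * of_bool (s < r)) = (LINT s|lborel. (indicator {a..r} s * f s) * g r)"
    proof (rule integral_cong_AE)
     show "AE s in lborel. ?f s * ?g r * of_bool (s < r) = (indicator {a..r} s * f s) * g r"
      using AE_lborel_singleton[of r] by eventually_elim (use True in \<open>auto simp: indicator_def\<close>)
    qed measurable
    then show ?thesis using True by (simp add: prim_from_def)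
   qed simp
  qed
  finally show ?thesis .
 qed
 \<comment> \<open>The primitives are known to be bounded only on \<open>{a..b}\<close>, so they are
   multiplied by the indicator before the criterion for bounded factors is applied.\<close>
 have Pint: "lint (%s. ?f s * prim_from a g s)" "lint (%r. prim_from a f r * ?g r)"
 proof -
  have b: "EX C. ALL s. \<bar>indicator {a..b} s * prim_from a h s\<bar> <= C"
   if "lint (%x. indicator {a..b} x * h x)" for h
  proof -
   have "bounded (prim_from a h ` {a..b})"
    by (intro compact_imp_bounded compact_continuous_image prim_from_continuous that) auto
   then obtain C where "C > 0" "\<forall>s\<in>{a..b}. \<bar>prim_from a h s\<bar> <= C"
    by (auto simp: bounded_pos)
   then show ?thesis by (intro exI[of _ C]) (auto simp: indicator_def)
  qed
  obtain C where "!!s. \<bar>indicator {a..b} s * prim_from a g s\<bar> <= C" using b[OF gi] by blast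
  then have "lint (%s. ?f s * (indicator {a..b} s * prim_from a g s))"
   by (intro integrable_mult_bounded[OF fx]) auto
  also have "(%s. ?f s * (indicator {a..b} s * prim_from a g s)) = (%s. ?f s * prim_from a g s)"
   using x by (auto simp: fun_eq_iff indicator_def)
  finally show "lint (%s. ?f s * prim_from a g s)" .
  obtain C where "!!s. \<bar>indicator {a..b} s * prim_from a f s\<bar> <= C" using b[OF fi] by blast
  then have "lint (%s. ?g s * (indicator {a..b} s * prim_from a f s))"
   by (intro integrable_mult_bounded[OF gx]) auto
  also have "(%s. ?g s * (indicator {a..b} s * prim_from a f s)) = (%s. prim_from a f s * ?g s)"
   using x by (auto simp: fun_eq_iff indicator_def)
  finally show "lint (%r. prim_from a f r * ?g r)" .
 qed
 have "prim_from a f x * prim_from a g x = (LINT s|lborel. LINT r|lborel. ?f s * ?g r)"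
  by (simp add: prim_from_def)
 also have "... = (LINT z|(lborel \<Otimes>\<^sub>M lborel). (%(s, r). ?f s * ?g r) z)"
  using lborel_pair.integral_fst'[OF I] by simp
 also have "... = (LINT z|(lborel \<Otimes>\<^sub>M lborel). (%(s, r). ?f s * ?g r * of_bool (r <= s)) z +
   (%(s, r). ?f s * ?g r * of_bool (s < r)) z)"
  by (intro LINT_cong) auto
 also have "... = (LINT z|(lborel \<Otimes>\<^sub>M lborel). (%(s, r). ?f s * ?g r * of_bool (r <= s)) z) +
   (LINT z|(lborel \<Otimes>\<^sub>M lborel). (%(s, r). ?f s * ?g r * of_bool (s < r)) z)"
  using I1 I2 by (rule Bochner_Integration.integral_add)
 also have "... = (LINT s|lborel. ?f s * prim_from a g s) + (LINT r|lborel. prim_from a f r * ?g r)"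
  using lborel_pair.integral_fst'[OF I1] lborel_pair.integral_fst'[OF I2] 1 2 by simp
 also have "... = (LINT s|lborel. ?f s * prim_from a g s + prim_from a f s * ?g s)"
  using Pint by simp
 also have "... = (LINT s|lborel. indicator {a..x} s * (f s * prim_from a g s + prim_from a f s * g s))"
  by (intro LINT_cong) (auto simp: algebra_simps)
 finally show ?thesis .
qed

text \<open>\<open>F\<close> is absolutely continuous on \<open>[a,b]\<close> with square integrable derivative \<open>g\<close>.\<close>

definition ac_deriv :: "real => real => (real => real) => (real => real) => bool" where
 "ac_deriv a b F g \<longleftrightarrow> g \<in> BM &
   lint (%x. indicator {a..b} x * (g x)^2) &
   (\<forall>x\<in>{a..b}. F x = F a + prim_from a g x)"

lemma ac_derivD:
 assumes "ac_deriv a b F g"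
 shows "g \<in> BM" "lint (%x. indicator {a..b} x * (g x)^2)"
  "x \<in> {a..b} ==> F x = F a + prim_from a g x"
 using assms unfolding ac_deriv_def by blast+

lemma integrable_indicator_Icc [simp]: "lint (indicator {a..b::real} :: real => real)"
 by (intro integrable_real_indicator) (auto simp: emeasure_lborel_Icc_eq)

lemma integrable_of_square_integrable:
 fixes g :: "real => real"
 assumes g[measurable]: "g \<in> BM" and "lint (%x. indicator {a..b} x * (g x)^2)"
 shows "lint (%x. indicator {a..b} x * g x)"
proof (rule Bochner_Integration.integrable_bound)
 show "lint (%x. indicator {a..b} x + indicator {a..b} x * (g x)^2)"
  using assms by simp
 show "AE x in lborel. norm (indicator {a..b} x * g x) <= norm (indicator {a..b} x + indicator {a..b} x * (g x)^2)"
 proof (rule AE_I2)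
  fix x
  have "\<bar>g x\<bar> <= 1 + (g x)^2"
   using sum_squares_bound[of 1 "\<bar>g x\<bar>"] by (simp add: power2_eq_square)
  then show "norm (indicator {a..b} x * g x) <= norm (indicator {a..b} x + indicator {a..b} x * (g x)^2)"
   by (auto simp: indicator_def)
 qed
qed simp

lemma ac_deriv_integrable:
 assumes "ac_deriv a b F g"
 shows "lint (%x. indicator {a..b} x * g x)"
 by (rule integrable_of_square_integrable[OF ac_derivD(1,2)[OF assms]])

lemma ac_deriv_continuous:
 assumes "ac_deriv a b F g"
 shows "continuous_on {a..b} F"
proof -
 have "continuous_on {a..b} (%x. F a + prim_from a g x)"
  by (intro continuous_on_add continuous_on_const prim_from_continuous ac_deriv_integrable[OF assms])
 then show ?thesis
  by (rule continuous_on_eq) (rule ac_derivD(3)[OF assms, symmetric])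
qed

lemma ac_deriv_diff:
 assumes "ac_deriv a b F g" "a <= x" "x <= y" "y <= b"
 shows "F y - F x = (LINT s|lborel. indicator {x..y} s * g s)"
proof -
 have "F x = F a + prim_from a g x" "F y = F a + prim_from a g y"
  using assms(2-) by (auto intro!: ac_derivD(3)[OF assms(1)])
 then show ?thesis
  using prim_from_diff[OF ac_deriv_integrable[OF assms(1)] assms(2-)] by linarith
qed

text \<open>Cauchy-Schwarz through Young's inequality
  \<open>\<bar>g\<bar> <= 1 / (2 * \<epsilon>) + \<epsilon> / 2 * g^2\<close>, integrated between
  the two points; \<open>\<epsilon> = sqrt (y - x) / C\<close> balances the two terms. The constant
  depends only on the norm of the derivative, hence is uniform in time for the slices of a
  solution.\<close>

lemma ac_deriv_hoelder:
 assumes F: "ac_deriv a b F g" and x: "x \<in> {a..b}" and y: "y \<in> {a..b}"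
  and C: "C > 0" "(LINT s|lborel. indicator {a..b} s * (g s)^2) <= C^2"
 shows "\<bar>F x - F y\<bar> <= C * sqrt \<bar>x - y\<bar>"
proof -
 have [measurable]: "g \<in> BM" using F by (rule ac_derivD)
 have *: "\<bar>F y - F x\<bar> <= C * sqrt (y - x)" if xy: "a <= x" "x < y" "y <= b" for x y
 proof -
  define \<epsilon> where "\<epsilon> = sqrt (y - x) / C"
  have \<epsilon>: "\<epsilon> > 0" using xy C by (simp add: \<epsilon>_def)
  have ix: "lint (%x. indicator {a..b} x * (g x)^2)" using F by (rule ac_derivD)
  have ixy: "lint (%s. indicator {x..y} s * (g s)^2)"
   by (rule integrable_indicator_subset[OF ix]) (use xy in auto)
  have "\<bar>F y - F x\<bar> = \<bar>LINT s|lborel. indicator {x..y} s * g s\<bar>"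
   using ac_deriv_diff[OF F, of x y] xy by simp
  also have "... <= (LINT s|lborel. \<bar>indicator {x..y} s * g s\<bar>)"
   by (rule integral_abs_bound)
  also have "... <= (LINT s|lborel. 1 / (2 * \<epsilon>) * indicator {x..y} s + \<epsilon> / 2 * (indicator {x..y} s * (g s)^2))"
  proof (rule integral_mono)
   show "lint (%s. \<bar>indicator {x..y} s * g s\<bar>)"
    using integrable_indicator_subset[OF ac_deriv_integrable[OF F], of "{x..y}"] xy by auto
   show "lint (%s. 1 / (2 * \<epsilon>) * indicator {x..y} s + \<epsilon> / 2 * (indicator {x..y} s * (g s)^2))"
    using ixy by simp
   fix s
   have "0 <= (1 - \<epsilon> * \<bar>g s\<bar>)^2" by simp
   then have "\<bar>g s\<bar> <= 1 / (2 * \<epsilon>) + \<epsilon> / 2 * (g s)^2"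
    using \<epsilon> by (simp add: field_simps power2_eq_square)
   then show "\<bar>indicator {x..y} s * g s\<bar> <=
     1 / (2 * \<epsilon>) * indicator {x..y} s + \<epsilon> / 2 * (indicator {x..y} s * (g s)^2)"
    by (auto simp: indicator_def)
  qed
  also have "... = (y - x) / (2 * \<epsilon>) + \<epsilon> / 2 * (LINT s|lborel. indicator {x..y} s * (g s)^2)"
   using ixy xy by simp
  also have "... <= (y - x) / (2 * \<epsilon>) + \<epsilon> / 2 * C^2"
  proof -
   have "(LINT s|lborel. indicator {x..y} s * (g s)^2) <= (LINT s|lborel. indicator {a..b} s * (g s)^2)"
    using xy by (intro integral_mono ixy ix) (auto simp: indicator_def)
   then show ?thesis
    using C \<epsilon> by (intro add_left_mono mult_left_mono) auto
  qed
  also have "... = C * sqrt (y - x)"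
  proof -
   define r where "r = sqrt (y - x)"
   have "r > 0" "y - x = r * r" using xy by (simp_all add: r_def)
   then show ?thesis
    using C(1) unfolding \<epsilon>_def by (simp add: r_def[symmetric] field_simps power2_eq_square)
  qed
  finally show ?thesis .
 qed
 show ?thesis
 proof (cases x y rule: linorder_cases)
  case less
  then show ?thesis using *[of x y] x y by (simp add: abs_minus_commute)
 next
  case greater
  then show ?thesis using *[of y x] x y by simp
 qed simp
qed

section \<open>Calculus of \<open>ac_deriv\<close>: algebra, substitution, gluing\<close>

lemma ac_deriv_cong:
 assumes "ac_deriv a b F g" "!!x. x \<in> {a..b} ==> F x = G x"
 shows "ac_deriv a b G g"
 unfolding ac_deriv_def
proof (intro conjI ballI)
 fix x assume x: "x \<in> {a..b}"
 then show "G x = G a + prim_from a g x"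
  using ac_derivD(3)[OF assms(1) x] assms(2)[OF x] assms(2)[of a] by simp
qed (use ac_derivD[OF assms(1)] in blast)+

lemma ac_deriv_subset:
 assumes F: "ac_deriv a b F g" and "a <= c" "d <= b"
 shows "ac_deriv c d F g"
 unfolding ac_deriv_def
proof (intro conjI ballI)
 show "g \<in> BM" by (rule ac_derivD(1)[OF F])
 show "lint (%x. indicator {c..d} x * (g x)^2)"
  by (rule integrable_indicator_subset[OF ac_derivD(2)[OF F]]) (use assms in auto)
 fix x assume "x \<in> {c..d}"
 then show "F x = F c + prim_from c g x"
  using ac_deriv_diff[OF F, of c x] assms by (simp add: prim_from_def)
qed

lemma integrable_square_add:
 fixes f g :: "real => real"
 assumes [measurable]: "f \<in> BM" "g \<in> BM"
  and i: "lint (%x. indicator S x * (f x)^2)" "lint (%x. indicator S x * (g x)^2)"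
  and S[measurable]: "S \<in> sets borel"
 shows "lint (%x. indicator S x * (f x + g x)^2)"
proof (rule Bochner_Integration.integrable_bound)
 show "lint (%x. 2 * (indicator S x * (f x)^2) + 2 * (indicator S x * (g x)^2))"
  using i by simp
 show "AE x in lborel. norm (indicator S x * (f x + g x)^2) <=
   norm (2 * (indicator S x * (f x)^2) + 2 * (indicator S x * (g x)^2))"
 proof (rule AE_I2)
  fix x
  have "(f x + g x)^2 <= 2 * (f x)^2 + 2 * (g x)^2"
   using sum_squares_ge_zero[of "f x - g x" 0] by (simp add: power2_eq_square algebra_simps)
  then show "norm (indicator S x * (f x + g x)^2) <=
   norm (2 * (indicator S x * (f x)^2) + 2 * (indicator S x * (g x)^2))"
   by (auto simp: indicator_def)
 qed
qed measurable

lemma integrable_square_mult_bounded: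
 fixes f g :: "real => real"
 assumes [measurable]: "f \<in> BM" "g \<in> BM"
  and i: "lint (%x. indicator S x * (f x)^2)" and g: "!!x. \<bar>g x\<bar> <= C"
 shows "lint (%x. indicator S x * (f x * g x)^2)"
proof -
 have "(g x)^2 <= C^2" for x
  using g[of x] by (simp add: abs_le_square_iff[symmetric])
 then have "lint (%x. (indicator S x * (f x)^2) * (g x)^2)"
  by (intro integrable_mult_bounded[OF i, where C="C^2"]) auto
 then show ?thesis by (simp add: power_mult_distrib mult.assoc)
qed

lemma continuous_on_Icc_bounded:
 fixes f :: "real => real"
 assumes "continuous_on {a..b} f"
 obtains C where "C > 0" "!!x. x \<in> {a..b} ==> \<bar>f x\<bar> <= C"
proof -
 have "bounded (f ` {a..b})"
  using assms by (intro compact_imp_bounded compact_continuous_image) auto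
 then show ?thesis using that by (auto simp: bounded_pos)
qed

lemma integrable_square_continuous:
 fixes f :: "real => real"
 assumes "continuous_on {a..b} f"
 shows "lint (%x. indicator {a..b} x * (f x)^2)"
 by (intro integrable_indicator_continuous continuous_intros assms)

lemma ac_deriv_add:
 assumes F: "ac_deriv a b F f" and G: "ac_deriv a b G g"
 shows "ac_deriv a b (%x. F x + G x) (%x. f x + g x)"
 unfolding ac_deriv_def
proof (intro conjI ballI)
 note [measurable] = ac_derivD(1)[OF F] ac_derivD(1)[OF G]
 show "(%x. f x + g x) \<in> BM" by measurable
 show "lint (%x. indicator {a..b} x * (f x + g x)^2)"
  by (rule integrable_square_add) (use ac_derivD[OF F] ac_derivD[OF G] in auto)
 fix x assume x: "x \<in> {a..b}"
 have "prim_from a (%x. f x + g x) x = prim_from a f x + prim_from a g x"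
 proof -
  have "lint (%s. indicator {a..x} s * f s)" "lint (%s. indicator {a..x} s * g s)"
   using x by (auto intro: integrable_indicator_subset[OF ac_deriv_integrable[OF F]]
    integrable_indicator_subset[OF ac_deriv_integrable[OF G]])
  then show ?thesis unfolding prim_from_def by (simp add: distrib_left)
 qed
 then show "F x + G x = F a + G a + prim_from a (%x. f x + g x) x"
  using ac_derivD(3)[OF F x] ac_derivD(3)[OF G x] by linarith
qed

lemma ac_deriv_cmult:
 assumes F: "ac_deriv a b F f"
 shows "ac_deriv a b (%x. c * F x) (%x. c * f x)"
 unfolding ac_deriv_def
proof (intro conjI ballI)
 note [measurable] = ac_derivD(1)[OF F]
 show "(%x. c * f x) \<in> BM" by measurable
 show "lint (%x. indicator {a..b} x * (c * f x)^2)"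
  using integrable_mult_right[OF ac_derivD(2)[OF F], of "c^2"] by (simp add: power_mult_distrib mult_ac)
 fix x assume x: "x \<in> {a..b}"
 have "prim_from a (%x. c * f x) x = c * prim_from a f x"
 proof -
  have "prim_from a (%x. c * f x) x = (LINT s|lborel. c * (indicator {a..x} s * f s))"
   unfolding prim_from_def by (simp add: mult_ac)
  also have "... = c * prim_from a f x" unfolding prim_from_def by simp
  finally show ?thesis .
 qed
 moreover have "F x = F a + prim_from a f x" by (rule ac_derivD(3)[OF F x])
 ultimately show "c * F x = c * F a + prim_from a (%x. c * f x) x"
  by (simp only: distrib_left)
qed

lemma ac_deriv_diff_fun:
 assumes F: "ac_deriv a b F f" and G: "ac_deriv a b G g"
 shows "ac_deriv a b (%x. F x - G x) (%x. f x - g x)"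
 using ac_deriv_add[OF F ac_deriv_cmult[OF G, of "-1"]] by simp

text \<open>The indicator keeps the derivative Borel on the whole line, although \<open>f\<close> is
  controlled only on the interval.\<close>

lemma ac_deriv_C1:
 assumes "!!x. x \<in> {a..b} ==> (F has_real_derivative f x) (at x within {a..b})" and f: "continuous_on {a..b} f"
 shows "ac_deriv a b F (%x. indicator {a..b} x * f x)"
 unfolding ac_deriv_def
proof (intro conjI ballI)
 show "(%x. indicator {a..b} x * f x) \<in> BM"
  by (rule borel_indicator_mult_continuous[OF _ f]) simp
 have "lint (%x. indicator {a..b} x * (f x)^2)"
  by (rule integrable_square_continuous[OF f])
 also have "(%x. indicator {a..b} x * (f x)^2) = (%x. indicator {a..b} x * (indicator {a..b} x * f x)^2)"
  by (auto simp: fun_eq_iff indicator_def)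
 finally show "lint (%x. indicator {a..b} x * (indicator {a..b} x * f x)^2)" .
 fix x assume x: "x \<in> {a..b}"
 have "(LINT s|lborel. indicator {a..x} s *\<^sub>R f s) = F x - F a"
 proof (rule integral_FTC_Icc)
  show "a <= x" using x by simp
  show "continuous_on {a..x} f" using f by (rule continuous_on_subset) (use x in auto)
  fix y assume "a <= y" "y <= x"
  then show "(F has_vector_derivative f y) (at y within {a..x})"
   using assms(1)[of y] x unfolding has_real_derivative_iff_has_vector_derivative
   by (auto intro: has_vector_derivative_within_subset)
 qed
 moreover have "(LINT s|lborel. indicator {a..x} s *\<^sub>R f s) = prim_from a (%x. indicator {a..b} x * f x) x"
  unfolding prim_from_def using x by (intro LINT_cong) (auto simp: indicator_def)
 ultimately show "F x = F a + prim_from a (%x. indicator {a..b} x * f x) x"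
  by simp
qed

lemma ac_deriv_const: "ac_deriv a b (%x. c) (%x. 0)"
 unfolding ac_deriv_def prim_from_def by simp

lemma prim_from_cong_AE:
 assumes "AE s in lborel. s \<in> {a..x} --> f s = g s" and [measurable]: "f \<in> BM" "g \<in> BM"
 shows "prim_from a f x = prim_from a g x"
 unfolding prim_from_def
proof (rule integral_cong_AE)
 show "AE s in lborel. indicator {a..x} s * f s = indicator {a..x} s * g s"
  using assms(1) by eventually_elim (auto simp: indicator_def)
qed measurable

text \<open>With both factors written as initial value plus primitive, \<open>prim_from_mult\<close>
  handles the product of the primitives, and the remaining terms are linear.\<close>

lemma ac_deriv_parts_aux:
 assumes F: "ac_deriv a b F f" and G: "ac_deriv a b G g" and x: "x \<in> {a..b}"
 shows "F x * G x = F a * G a + (LINT s|lborel. indicator {a..x} s * (f s * G s + F s * g s))"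
proof -
 have fg[measurable]: "f \<in> BM" "g \<in> BM"
  by (rule ac_derivD(1)[OF F], rule ac_derivD(1)[OF G])
 have Fx: "F y = F a + prim_from a f y" and Gx: "G y = G a + prim_from a g y" if "y \<in> {a..b}" for y
  by (rule ac_derivD(3)[OF F that], rule ac_derivD(3)[OF G that])
 let ?P = "prim_from a f" and ?Q = "prim_from a g"
 have if_: "lint (%s. indicator {a..x} s * f s)" and ig: "lint (%s. indicator {a..x} s * g s)"
  using x by (auto intro: integrable_indicator_subset[OF ac_deriv_integrable[OF F]]
    integrable_indicator_subset[OF ac_deriv_integrable[OF G]])
 have [measurable]: "?P \<in> BM" "?Q \<in> BM"
  by (rule prim_from_borel[OF fg(1)], rule prim_from_borel[OF fg(2)])
 have bdd: "EX C. ALL s. \<bar>indicator {a..x} s * prim_from a h s\<bar> <= C" if hi: "lint (%s. indicator {a..x} s * h s)" for h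
 proof -
  obtain C where "C > 0" "!!s. s \<in> {a..x} ==> \<bar>prim_from a h s\<bar> <= C"
   using continuous_on_Icc_bounded[OF prim_from_continuous[OF hi]] by blast
  then show ?thesis by (intro exI[of _ C]) (auto simp: indicator_def)
 qed
 have iPQ: "lint (%s. indicator {a..x} s * (f s * ?Q s + ?P s * g s))"
 proof -
  obtain C D where "!!s. \<bar>indicator {a..x} s * ?P s\<bar> <= C" "!!s. \<bar>indicator {a..x} s * ?Q s\<bar> <= D"
   using bdd[OF if_] bdd[OF ig] by blast
  then have "lint (%s. (indicator {a..x} s * f s) * (indicator {a..x} s * ?Q s) +
    (indicator {a..x} s * g s) * (indicator {a..x} s * ?P s))"
   by (intro Bochner_Integration.integrable_add integrable_mult_bounded[OF if_] integrable_mult_bounded[OF ig]) auto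
  also have "(%s. (indicator {a..x} s * f s) * (indicator {a..x} s * ?Q s) +
    (indicator {a..x} s * g s) * (indicator {a..x} s * ?P s)) = (%s. indicator {a..x} s * (f s * ?Q s + ?P s * g s))"
   by (auto simp: fun_eq_iff indicator_def)
  finally show ?thesis .
 qed
 have "(LINT s|lborel. indicator {a..x} s * (f s * G s + F s * g s)) =
  (LINT s|lborel. indicator {a..x} s * (f s * ?Q s + ?P s * g s) +
    (G a * (indicator {a..x} s * f s) + F a * (indicator {a..x} s * g s)))"
 proof (rule LINT_cong[OF refl])
  fix s
  show "indicator {a..x} s * (f s * G s + F s * g s) =
   indicator {a..x} s * (f s * ?Q s + ?P s * g s) + (G a * (indicator {a..x} s * f s) + F a * (indicator {a..x} s * g s))"
  proof (cases "s \<in> {a..x}")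
   case True
   then have "s \<in> {a..b}" using x by auto
   then show ?thesis using Fx[of s] Gx[of s] True by (simp add: algebra_simps)
  qed simp
 qed
 also have "... = ?P x * ?Q x + (G a * ?P x + F a * ?Q x)"
  using prim_from_mult[OF fg ac_deriv_integrable[OF F] ac_deriv_integrable[OF G] x] iPQ if_ ig
  by (simp add: prim_from_def)
 finally have "(LINT s|lborel. indicator {a..x} s * (f s * G s + F s * g s)) = ?P x * ?Q x + (G a * ?P x + F a * ?Q x)" .
 moreover have "F x * G x = (F a + ?P x) * (G a + ?Q x)"
  using Fx[OF x] Gx[OF x] by simp
 ultimately show ?thesis by (simp add: algebra_simps)
qed

lemma ac_deriv_parts:
 assumes "ac_deriv a b F f" "ac_deriv a b G g" "a <= b"
 shows "(LINT s|lborel. indicator {a..b} s * (f s * G s + F s * g s)) = F b * G b - F a * G a"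
 using ac_deriv_parts_aux[OF assms(1,2), of b] assms(3) by simp

lemma ac_deriv_mult:
 assumes F: "ac_deriv a b F f" and G: "ac_deriv a b G g"
 shows "ac_deriv a b (%x. F x * G x) (%x. indicator {a..b} x * (f x * G x + F x * g x))"
 unfolding ac_deriv_def
proof (intro conjI ballI)
 note [measurable] = ac_derivD(1)[OF F] ac_derivD(1)[OF G]
 have [measurable]: "(%x. indicator {a..b} x * F x) \<in> BM" "(%x. indicator {a..b} x * G x) \<in> BM"
  by (intro borel_indicator_mult_continuous ac_deriv_continuous[OF F] ac_deriv_continuous[OF G]; simp)+
 have eq: "indicator {a..b} x * (f x * G x + F x * g x) =
   f x * (indicator {a..b} x * G x) + g x * (indicator {a..b} x * F x)" for x
  by (simp add: algebra_simps)
 show "(%x. indicator {a..b} x * (f x * G x + F x * g x)) \<in> BM"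
  unfolding eq by measurable
 obtain C where C: "C > 0" "!!x. x \<in> {a..b} ==> \<bar>F x\<bar> <= C"
  using continuous_on_Icc_bounded[OF ac_deriv_continuous[OF F]] by blast
 obtain D where D: "D > 0" "!!x. x \<in> {a..b} ==> \<bar>G x\<bar> <= D"
  using continuous_on_Icc_bounded[OF ac_deriv_continuous[OF G]] by blast
 show "lint (%x. indicator {a..b} x * (indicator {a..b} x * (f x * G x + F x * g x))^2)"
  unfolding eq
 proof (rule integrable_square_add)
  have "\<bar>indicator {a..b} x * F x\<bar> <= C" for x using C by (auto simp: indicator_def)
  then show "lint (%x. indicator {a..b} x * (g x * (indicator {a..b} x * F x))^2)"
   by (intro integrable_square_mult_bounded[where C=C] ac_derivD(2)[OF G]) auto
  have "\<bar>indicator {a..b} x * G x\<bar> <= D" for x using D by (auto simp: indicator_def)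
  then show "lint (%x. indicator {a..b} x * (f x * (indicator {a..b} x * G x))^2)"
   by (intro integrable_square_mult_bounded[where C=D] ac_derivD(2)[OF F]) auto
 qed auto
 fix x assume x: "x \<in> {a..b}"
 have "prim_from a (%x. indicator {a..b} x * (f x * G x + F x * g x)) x =
   (LINT s|lborel. indicator {a..x} s * (f s * G s + F s * g s))"
  unfolding prim_from_def using x by (intro LINT_cong) (auto simp: indicator_def)
 then show "F x * G x = F a * G a + prim_from a (%x. indicator {a..b} x * (f x * G x + F x * g x)) x"
  using ac_deriv_parts_aux[OF F G x] by simp
qed

text \<open>Restricted to unit speed in either direction, which covers characteristics and
  reflections and preserves Lebesgue measure.\<close>

lemma ac_deriv_affine:
 assumes F: "ac_deriv a b F f" and \<sigma>: "\<sigma> = 1 \<or> \<sigma> = -1"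
  and sub: "!!x. x \<in> {a'..b'} ==> c + \<sigma> * x \<in> {a..b}"
 shows "ac_deriv a' b' (%x. F (c + \<sigma> * x)) (%x. \<sigma> * f (c + \<sigma> * x))"
 unfolding ac_deriv_def
proof (intro conjI ballI)
 note [measurable] = ac_derivD(1)[OF F]
 show "(%x. \<sigma> * f (c + \<sigma> * x)) \<in> BM" by measurable
 have s2: "\<sigma>^2 = 1" "\<bar>\<sigma>\<bar> = 1" "\<sigma> ~= 0" using \<sigma> by auto
 have I: "lint (%x. indicator {a..b} (c + \<sigma> * x) * (f (c + \<sigma> * x))^2)"
  using lborel_integrable_real_affine[OF ac_derivD(2)[OF F] s2(3)] .
 have "lint (%x. indicator {a'..b'} x * (indicator {a..b} (c + \<sigma> * x) * (f (c + \<sigma> * x))^2))"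
  using integrable_mult_indicator[OF _ I, of "{a'..b'}"] by simp
 also have "(%x. indicator {a'..b'} x * (indicator {a..b} (c + \<sigma> * x) * (f (c + \<sigma> * x))^2)) =
   (%x. indicator {a'..b'} x * (\<sigma> * f (c + \<sigma> * x))^2)"
  using sub by (auto simp: fun_eq_iff indicator_def power_mult_distrib s2)
 finally show "lint (%x. indicator {a'..b'} x * (\<sigma> * f (c + \<sigma> * x))^2)" .
 fix x assume x: "x \<in> {a'..b'}"
 then have ax: "a' \<in> {a'..b'}" "a' <= x" by auto
 have "prim_from a' (%x. \<sigma> * f (c + \<sigma> * x)) x = F (c + \<sigma> * x) - F (c + \<sigma> * a')"
  using \<sigma>
 proof
  assume s: "\<sigma> = 1"
  have "F (c + x) - F (c + a') = (LINT s|lborel. indicator {c + a'..c + x} s * f s)"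
   using sub[OF x] sub[OF ax(1)] x s by (intro ac_deriv_diff[OF F]) auto
  also have "... = (LINT s|lborel. indicator {c + a'..c + x} (c + 1 * s) * f (c + 1 * s))"
   using lborel_integral_real_affine[of 1 "%s. indicator {c + a'..c + x} s * f s" c] by simp
  also have "... = prim_from a' (%x. \<sigma> * f (c + \<sigma> * x)) x"
   unfolding prim_from_def s by (intro LINT_cong) (auto simp: indicator_def)
  finally show ?thesis using s by simp
 next
  assume s: "\<sigma> = -1"
  have "F (c - a') - F (c - x) = (LINT s|lborel. indicator {c - x..c - a'} s * f s)"
   using sub[OF x] sub[OF ax(1)] x s by (intro ac_deriv_diff[OF F]) auto
  also have "... = (LINT s|lborel. indicator {c - x..c - a'} (c + (-1) * s) * f (c + (-1) * s))"
   using lborel_integral_real_affine[of "-1" "%s. indicator {c - x..c - a'} s * f s" c] by simp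
  also have "... = (LINT s|lborel. - (indicator {a'..x} s * (\<sigma> * f (c + \<sigma> * s))))"
   unfolding s by (intro LINT_cong) (auto simp: indicator_def)
  also have "... = - prim_from a' (%x. \<sigma> * f (c + \<sigma> * x)) x"
   unfolding prim_from_def by simp
  finally show ?thesis using s by simp
 qed
 then show "F (c + \<sigma> * x) = F (c + \<sigma> * a') + prim_from a' (%x. \<sigma> * f (c + \<sigma> * x)) x"
  by simp
qed

text \<open>Both hypotheses speak of the same function, so the pieces meet at \<open>c\<close>
  without a separate matching condition; the two derivatives may disagree at \<open>c\<close>, a
  null set.\<close>

lemma ac_deriv_glue:
 assumes F: "ac_deriv a c F f" and G: "ac_deriv c b F g" and "a <= c" "c <= b"
 shows "ac_deriv a b F (%x. if x <= c then f x else g x)"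
 unfolding ac_deriv_def
proof (intro conjI ballI)
 let ?h = "%x. if x <= c then f x else g x"
 note [measurable] = ac_derivD(1)[OF F] ac_derivD(1)[OF G]
 show "?h \<in> BM" by measurable
 have ia: "lint (%x. indicator {a..c} x * (f x)^2)"
  and ib: "lint (%x. indicator {c..b} x * (g x)^2)"
  by (rule ac_derivD(2)[OF F], rule ac_derivD(2)[OF G])
 show i2: "lint (%x. indicator {a..b} x * (?h x)^2)"
 proof (rule Bochner_Integration.integrable_bound[OF Bochner_Integration.integrable_add[OF ia ib]])
  show "AE x in lborel. norm (indicator {a..b} x * (?h x)^2) <=
    norm (indicator {a..c} x * (f x)^2 + indicator {c..b} x * (g x)^2)"
   using assms(3,4) by (intro AE_I2) (auto simp: indicator_def)
 qed measurable
 have ih: "lint (%x. indicator {a..b} x * ?h x)"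
  by (rule integrable_of_square_integrable[OF _ i2]) measurable
 have 1: "F x = F a + prim_from a ?h x" if "x \<in> {a..c}" for x
 proof -
  have "prim_from a ?h x = prim_from a f x"
   unfolding prim_from_def using that by (intro LINT_cong) (auto simp: indicator_def)
  then show ?thesis using ac_derivD(3)[OF F that] by simp
 qed
 fix x assume x: "x \<in> {a..b}"
 show "F x = F a + prim_from a ?h x"
 proof (cases "x <= c")
  case True
  then show ?thesis using x by (intro 1) auto
 next
  case False
  then have xc: "x \<in> {c..b}" using x by auto
  have "prim_from a ?h x - prim_from a ?h c = (LINT s|lborel. indicator {c..x} s * ?h s)"
   using prim_from_diff[OF ih, of c x] assms xc by auto
  also have "... = prim_from c ?h x" by (simp add: prim_from_def)
  also have "... = prim_from c g x"
  proof (rule prim_from_cong_AE)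
   show "AE s in lborel. s \<in> {c..x} --> ?h s = g s"
    using AE_lborel_singleton[of c] by eventually_elim auto
  qed measurable
  finally have "prim_from a ?h x - prim_from a ?h c = prim_from c g x" .
  moreover have "F x = F c + prim_from c g x" by (rule ac_derivD(3)[OF G xc])
  moreover have "F c = F a + prim_from a ?h c" using 1[of c] assms by auto
  ultimately show ?thesis by linarith
 qed
qed

section \<open>Weak derivatives and Sobolev spaces on intervals\<close>

lemma smooth_partials_continuous:
 assumes "smooth_partials D" "bs \<in> lists Basis"
 shows "continuous_on A (D bs)"
 using assms unfolding smooth_partials_def
 by (meson has_derivative_continuous continuous_at_imp_continuous_on)

lemma has_weak_derivD:
 assumes "has_weak_deriv S bs f g" "smooth_partials D" "compact K" "K \<subseteq> S" "!!z. z ~: K ==> D [] z = 0"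
 shows "(LINT z|lebesgue_on S. f z * D bs z) = (-1) ^ length bs * (LINT z|lebesgue_on S. g z * D [] z)"
 using assms unfolding has_weak_deriv_def by blast

lemma has_weak_deriv_cong_AE:
 assumes S: "open S" and bs: "bs \<in> lists Basis" and w: "has_weak_deriv S bs f g"
  and f: "AE z in lebesgue_on S. f z = f' z" and g: "AE z in lebesgue_on S. g z = g' z"
 shows "has_weak_deriv S bs f' g'"
 unfolding has_weak_deriv_def
proof (intro conjI allI impI)
 have Sb: "S \<in> sets borel" using S by simp
 have lf: "locally_integrable S f" and lg: "locally_integrable S g"
  using w unfolding has_weak_deriv_def by auto
 show "locally_integrable S f'" "locally_integrable S g'"
  using locally_integrable_cong_AE[OF Sb lf f] locally_integrable_cong_AE[OF Sb lg g] by auto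
 fix D assume D: "smooth_partials D & (EX K. compact K & K \<subseteq> S & (ALL z. z ~: K --> D [] z = 0))"
 have m: "D cs \<in> borel_measurable (lebesgue_on S)" if "cs \<in> lists Basis" for cs
  using smooth_partials_continuous[of D cs] D that S
  by (intro continuous_imp_measurable_on_sets_lebesgue) auto
 have "(LINT z|lebesgue_on S. f z * D bs z) = (LINT z|lebesgue_on S. f' z * D bs z)"
  by (rule LINT_lebesgue_on_cong_AE[OF Sb])
   (use f m[OF bs] locally_integrable_measurable[OF S lf] in \<open>auto elim!: eventually_mono\<close>)
 moreover have "(LINT z|lebesgue_on S. g z * D [] z) = (LINT z|lebesgue_on S. g' z * D [] z)"
  by (rule LINT_lebesgue_on_cong_AE[OF Sb])
   (use g m[of "[]"] locally_integrable_measurable[OF S lg] in \<open>auto elim!: eventually_mono\<close>)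
 moreover have "(LINT z|lebesgue_on S. f z * D bs z) = (-1) ^ length bs * (LINT z|lebesgue_on S. g z * D [] z)"
  using w D unfolding has_weak_deriv_def by blast
 ultimately show "(LINT z|lebesgue_on S. f' z * D bs z) = (-1) ^ length bs * (LINT z|lebesgue_on S. g' z * D [] z)"
  by simp
qed

lemma LINT_Ioo_eq_Icc:
 assumes [measurable]: "(f :: real => real) \<in> BM"
 shows "(LINT x|lborel. indicator {a<..<b} x * f x) = (LINT x|lborel. indicator {a..b} x * f x)"
proof (rule integral_cong_AE)
 show "AE x in lborel. indicator {a<..<b} x * f x = indicator {a..b} x * f x"
  using AE_lborel_singleton[of a] AE_lborel_singleton[of b] by eventually_elim (auto simp: indicator_def)
qed measurable

text \<open>Integration by parts: a test function supported in the open interval leaves no boundary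
  terms. The function is first cut off by an indicator to make it Borel, and restored at the end by
  equality almost everywhere.\<close>

lemma has_weak_deriv_of_ac:
 assumes F: "ac_deriv a b F g" and ab: "a < b"
 shows "has_weak_deriv {a<..<b} [1] F g"
proof -
 note [measurable] = ac_derivD(1)[OF F]
 define F' where "F' x = indicator {a..b} x * F x" for x
 have F'm[measurable]: "F' \<in> BM"
  unfolding F'_def[abs_def] by (rule borel_indicator_mult_continuous[OF _ ac_deriv_continuous[OF F]]) simp
 have "has_weak_deriv {a<..<b} [1] F' g"
  unfolding has_weak_deriv_def
 proof (intro conjI allI impI)
  show "locally_integrable {a<..<b} F'"
   unfolding locally_integrable_def
  proof (intro allI impI)
   fix K :: "real set" assume K: "compact K & K \<subseteq> {a<..<b}"
   have "lint (%x. indicator {a..b} x * F' x)"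
    using integrable_indicator_continuous[OF ac_deriv_continuous[OF F]]
    by (simp add: F'_def indicator_inter_arith[symmetric] mult.assoc[symmetric])
   then have "lint (%x. indicator K x * F' x)"
    by (rule integrable_indicator_subset) (use K borel_compact in auto)
   then show "F' absolutely_integrable_on K"
    using K by (simp add: absolutely_integrable_on_borel borel_compact)
  qed
  show "locally_integrable {a<..<b} g"
   unfolding locally_integrable_def
  proof (intro allI impI)
   fix K :: "real set" assume K: "compact K & K \<subseteq> {a<..<b}"
   have "lint (%x. indicator K x * g x)"
    by (rule integrable_indicator_subset[OF ac_deriv_integrable[OF F]]) (use K borel_compact in auto)
   then show "g absolutely_integrable_on K"
    using K by (simp add: absolutely_integrable_on_borel borel_compact)
  qed
  fix D :: "real list => real => real"
  assume "smooth_partials D & (EX K. compact K & K \<subseteq> {a<..<b} & (ALL z. z ~: K --> D [] z = 0))"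
  then obtain K where D: "smooth_partials D" and K: "compact K" "K \<subseteq> {a<..<b}" "!!z. z ~: K ==> D [] z = 0"
   by blast
  have ss: "smooth_seq (%k. D (replicate k 1))" by (rule smooth_partials_seqD[OF D])
  have d1: "(D [] has_real_derivative D [1] x) (at x)" for x
   using smooth_seqD[OF ss, of 0 x] by simp
  have c: "continuous_on A (D [])" "continuous_on A (D [1])" for A
   using smooth_seq_continuous[OF ss, of A 0] smooth_seq_continuous[OF ss, of A 1] by auto
  have [measurable]: "D [] \<in> BM" "D [1] \<in> BM"
   using c by (auto intro: borel_measurable_continuous_onI)
  have G: "ac_deriv a b (D []) (%x. indicator {a..b} x * D [1] x)"
   by (rule ac_deriv_C1) (use d1 c in \<open>auto intro: has_field_derivative_at_within\<close>)
  have ends: "D [] a = 0" "D [] b = 0" using K by force+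
  obtain C where C: "C > 0" "!!x. x \<in> {a..b} ==> \<bar>D [] x\<bar> <= C"
   using continuous_on_Icc_bounded[OF c(1)] by blast
  have Cb: "\<bar>indicator {a..b} s * D [] s\<bar> <= C" for s
   using C(1) C(2)[of s] by (cases "s \<in> {a..b}") auto
  have i1: "lint (%s. indicator {a..b} s * (g s * D [] s))"
  proof -
   have "lint (%s. (indicator {a..b} s * g s) * (indicator {a..b} s * D [] s))"
    by (rule integrable_mult_bounded[OF ac_deriv_integrable[OF F] _ Cb]) measurable
   then show ?thesis
    by (rule Bochner_Integration.integrable_cong[THEN iffD1, rotated 2]) (auto simp: indicator_def)
  qed
  have i2: "lint (%s. indicator {a..b} s * (F s * D [1] s))"
   by (intro integrable_indicator_continuous continuous_intros ac_deriv_continuous[OF F] c)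
  have "(LINT s|lborel. indicator {a..b} s * (F s * D [1] s)) + (LINT s|lborel. indicator {a..b} s * (g s * D [] s)) =
    (LINT s|lborel. indicator {a..b} s * (F s * D [1] s) + indicator {a..b} s * (g s * D [] s))"
   using i1 i2 by simp
  also have "... = (LINT s|lborel. indicator {a..b} s * (g s * D [] s + F s * (indicator {a..b} s * D [1] s)))"
   by (intro LINT_cong) (auto simp: indicator_def)
  also have "... = 0"
   using ac_deriv_parts[OF F G] ab ends by simp
  finally have *: "(LINT s|lborel. indicator {a..b} s * (F s * D [1] s)) = - (LINT s|lborel. indicator {a..b} s * (g s * D [] s))"
   by linarith
  have "(LINT z|lebesgue_on {a<..<b}. F' z * D [1] z) = (LINT s|lborel. indicator {a..b} s * (F' s * D [1] s))"
   by (subst LINT_lebesgue_on) (auto simp: LINT_Ioo_eq_Icc)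
  also have "... = (LINT s|lborel. indicator {a..b} s * (F s * D [1] s))"
   by (intro LINT_cong) (auto simp: F'_def indicator_def)
  also have "... = - (LINT z|lebesgue_on {a<..<b}. g z * D [] z)"
   unfolding * by (subst LINT_lebesgue_on) (auto simp: LINT_Ioo_eq_Icc)
  finally show "(LINT z|lebesgue_on {a<..<b}. F' z * D [1] z) = (-1) ^ length [1::real] * (LINT z|lebesgue_on {a<..<b}. g z * D [] z)"
   by simp
 qed
 then show ?thesis
  by (rule has_weak_deriv_cong_AE[rotated 2]) (auto simp: F'_def AE_lebesgue_on)
qed

text \<open>Appending \<open>cs\<close> on the right differentiates along \<open>cs\<close> first,
  so every derivative of a smooth function comes with its own derivatives.\<close>

lemma smooth_partials_shift:
 assumes "smooth_partials D" "cs \<in> lists Basis"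
 shows "smooth_partials (%bs. D (bs @ cs))"
 unfolding smooth_partials_def
proof (intro ballI allI)
 fix bs z assume "bs \<in> lists (Basis :: 'a set)"
 then have "bs @ cs \<in> lists Basis" using assms(2) by simp
 then show "(D (bs @ cs) has_derivative (%h. \<Sum>b\<in>Basis. (h \<bullet> b) * D ((b # bs) @ cs) z)) (at z)"
  using assms(1) unfolding smooth_partials_def by simp
qed

lemma smooth_partials_deriv_support:
 fixes D :: "'a::euclidean_space list => 'a => real"
 assumes D: "smooth_partials D" and K: "compact K" "!!z. z ~: K ==> D [] z = 0" and z: "z ~: K" and b: "b \<in> Basis"
 shows "D [b] z = 0"
proof -
 have d: "(D [] has_derivative (%h. \<Sum>b\<in>Basis. (h \<bullet> b) * D [b] z)) (at z)"
  using D unfolding smooth_partials_def by fastforce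
 have "((%_. 0) has_derivative (%h. \<Sum>b\<in>Basis. (h \<bullet> b) * D [b] z)) (at z)"
  by (rule has_derivative_transform_within_open[OF d, where s="- K"]) (use K z compact_imp_closed in \<open>auto simp: open_Compl\<close>)
 from has_derivative_unique[OF this has_derivative_const]
 have "(\<Sum>b'\<in>Basis. (b \<bullet> b') * D [b'] z) = 0" by (rule fun_cong)
 moreover have "(\<Sum>b'\<in>Basis. (b \<bullet> b') * D [b'] z) = (\<Sum>b'\<in>Basis. if b' = b then D [b] z else 0)"
  by (rule sum.cong) (use b in \<open>auto simp: inner_Basis\<close>)
 ultimately show ?thesis using b by simp
qed

text \<open>The derivative of a test function in direction \<open>b\<close> serves as test function
  for the first identity, the function itself for the second; the two signs cancel.\<close>

lemma has_weak_deriv_twice: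
 fixes S :: "'a::euclidean_space set"
 assumes fg: "has_weak_deriv S [b] f g" and gk: "has_weak_deriv S [b] g k" and b: "b \<in> Basis"
 shows "has_weak_deriv S [b, b] f k"
 unfolding has_weak_deriv_def
proof (intro conjI allI impI)
 show "locally_integrable S f" "locally_integrable S k"
  using assms unfolding has_weak_deriv_def by auto
 fix D :: "'a list => 'a => real"
 assume "smooth_partials D & (EX K. compact K & K \<subseteq> S & (ALL z. z ~: K --> D [] z = 0))"
 then obtain K where D: "smooth_partials D" and K: "compact K" "K \<subseteq> S" "!!z. z ~: K ==> D [] z = 0"
  by blast
 have D': "smooth_partials (%bs. D (bs @ [b]))"
  by (rule smooth_partials_shift[OF D]) (use b in simp)
 have D1: "D ([] @ [b]) z = 0" if "z ~: K" for z
  using smooth_partials_deriv_support[OF D K(1,3) that b] by simp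
 have "(LINT z|lebesgue_on S. f z * D [b, b] z) = - (LINT z|lebesgue_on S. g z * D [b] z)"
  using has_weak_derivD[OF fg D' K(1,2) D1] by simp
 moreover have "(LINT z|lebesgue_on S. g z * D [b] z) = - (LINT z|lebesgue_on S. k z * D [] z)"
  using has_weak_derivD[OF gk D K] by simp
 ultimately show "(LINT z|lebesgue_on S. f z * D [b, b] z) = (-1) ^ length [b, b] * (LINT z|lebesgue_on S. k z * D [] z)"
  by simp
qed

text \<open>Both hypotheses evaluate the integral of \<open>f\<close> against the second derivative
  of one test function; comparing the results gives the identity for \<open>g\<close>.\<close>

lemma has_weak_deriv_second:
 fixes S :: "real set"
 assumes "has_weak_deriv S [1] f g" "has_weak_deriv S [1, 1] f k"
 shows "has_weak_deriv S [1] g k"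
 unfolding has_weak_deriv_def
proof (intro conjI allI impI)
 show "locally_integrable S g" "locally_integrable S k"
  using assms unfolding has_weak_deriv_def by auto
 fix D :: "real list => real => real"
 assume "smooth_partials D & (EX K. compact K & K \<subseteq> S & (ALL z. z ~: K --> D [] z = 0))"
 then obtain K where D: "smooth_partials D" and K: "compact K" "K \<subseteq> S" "!!z. z ~: K ==> D [] z = 0"
  by blast
 have D': "smooth_partials (%bs. D (bs @ [1]))"
  by (rule smooth_partials_shift[OF D]) simp
 have D1: "D ([] @ [1]) z = 0" if "z ~: K" for z
  using smooth_partials_deriv_support[OF D K(1,3) that] by simp
 have "(LINT z|lebesgue_on S. f z * D [1, 1] z) = - (LINT z|lebesgue_on S. g z * D [1] z)"
  using has_weak_derivD[OF assms(1) D' K(1,2) D1] by simp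
 moreover have "(LINT z|lebesgue_on S. f z * D [1, 1] z) = (LINT z|lebesgue_on S. k z * D [] z)"
  using has_weak_derivD[OF assms(2) D K] by simp
 ultimately show "(LINT z|lebesgue_on S. g z * D [1] z) = (-1) ^ length [1::real] * (LINT z|lebesgue_on S. k z * D [] z)"
  by simp
qed

lemma bump_indicator:
 assumes "{\<alpha><..<\<beta>} \<subseteq> S"
 shows "indicator S x * bump c \<alpha> \<beta> x = bump c \<alpha> \<beta> x"
proof (cases "x \<in> S")
 case False
 then have "x ~: {\<alpha><..<\<beta>}" using assms by blast
 then show ?thesis by (simp add: bump_outside)
qed simp

text \<open>Makes the choice operator in \<open>weak_deriv\<close> harmless. Two weak derivatives
  have the same integral against every bump, and Borel representatives bring the claim to
  \<open>AE_zero_of_bump_integrals\<close>.\<close>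

lemma has_weak_deriv_unique:
 fixes a b :: real
 assumes g: "has_weak_deriv {a<..<b} (replicate k 1) f g" and h: "has_weak_deriv {a<..<b} (replicate k 1) f h"
 shows "AE x in lebesgue_on {a<..<b}. g x = h x"
proof -
 let ?S = "{a<..<b}"
 have lg: "locally_integrable ?S g" and lh: "locally_integrable ?S h"
  using g h unfolding has_weak_deriv_def by auto
 have ob: "open ?S" "?S \<in> sets borel" by auto
 obtain g' where g'[measurable]: "g' \<in> BM" and gg: "AE z in lebesgue_on ?S. g z = g' z"
  by (rule borel_representative[OF ob(2) locally_integrable_measurable[OF ob(1) lg]])
 obtain h' where h'[measurable]: "h' \<in> BM" and hh: "AE z in lebesgue_on ?S. h z = h' z"
  by (rule borel_representative[OF ob(2) locally_integrable_measurable[OF ob(1) lh]])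
 have lists: "replicate k (1::real) \<in> lists Basis" by (induction k) auto
 have g2: "has_weak_deriv ?S (replicate k 1) f g'" and h2: "has_weak_deriv ?S (replicate k 1) f h'"
  using has_weak_deriv_cong_AE[OF _ lists g _ gg] has_weak_deriv_cong_AE[OF _ lists h _ hh] by auto
 have int: "lint (%x. indicator {\<alpha>..\<beta>} x * k x)"
  if "k = g' \<or> k = h'" "a < \<alpha>" "\<beta> < b" for \<alpha> \<beta> k
 proof -
  have "locally_integrable ?S k"
   using that(1) g2 h2 unfolding has_weak_deriv_def by blast
  moreover have "{\<alpha>..\<beta>} \<subseteq> ?S" using that by auto
  ultimately have "k absolutely_integrable_on {\<alpha>..\<beta>}"
   unfolding locally_integrable_def by blast
  moreover have "k \<in> BM" using that by auto
  ultimately show ?thesis by (simp add: absolutely_integrable_on_borel)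
 qed
 have "AE x in lborel. x \<in> {a<..<b} --> g' x - h' x = 0"
 proof (rule AE_zero_of_bump_integrals)
  fix \<alpha> \<beta> and n :: nat assume *: "a < \<alpha>" "\<alpha> < \<beta>" "\<beta> < b"
  show "lint (%x. indicator {\<alpha>..\<beta>} x * (g' x - h' x))"
   using int[of g' \<alpha> \<beta>] int[of h' \<alpha> \<beta>] * by (simp add: right_diff_distrib)
  let ?b = "bump (1 / real (Suc n)) \<alpha> \<beta>"
  obtain d where d: "smooth_seq d" "d 0 = ?b"
   using bump_smooth_seq[of "1 / real (Suc n)" \<alpha> \<beta>] by auto
  define D where "D bs = d (length (bs :: real list))" for bs
  have D: "smooth_partials D" "EX K. compact K & K \<subseteq> ?S & (ALL z. z ~: K --> D [] z = 0)"
   using smooth_partials_seq[OF d(1)] * bump_outside[of _ \<alpha> \<beta>] d(2)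
   by (auto simp: D_def[abs_def] intro!: exI[of _ "{\<alpha>..\<beta>}"])
  have conv: "(LINT z|lebesgue_on ?S. k z * D [] z) = (LINT z|lborel. k z * ?b z)"
   if "k \<in> BM" for k
  proof -
   have "(LINT z|lebesgue_on ?S. k z * D [] z) = (LINT z|lborel. indicator ?S z * (k z * D [] z))"
    by (rule LINT_lebesgue_on) (use that in \<open>auto simp: D_def d\<close>)
   also have "... = (LINT z|lborel. k z * ?b z)"
   proof (intro LINT_cong refl)
    fix z
    have "indicator ?S z * ?b z = ?b z" using * by (intro bump_indicator) auto
    then show "indicator ?S z * (k z * D [] z) = k z * ?b z"
     by (simp add: D_def d mult.left_commute)
   qed
   finally show ?thesis .
  qed
  have ib: "lint (%x. k x * ?b x)" if "k = g' \<or> k = h'" for k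
  proof -
   have "lint (%x. (indicator {\<alpha>..\<beta>} x * k x) * ?b x)"
    using bump_nonneg[of "1 / real (Suc n)" \<alpha> \<beta>] bump_le_1[of "1 / real (Suc n)" \<alpha> \<beta>]
    by (intro integrable_mult_bounded[OF int[OF that *(1,3)], where C=1]) auto
   also have "(%x. (indicator {\<alpha>..\<beta>} x * k x) * ?b x) = (%x. k x * (indicator {\<alpha>..\<beta>} x * ?b x))"
    by (simp add: mult_ac)
   also have "... = (%x. k x * ?b x)"
    by (subst bump_indicator) auto
   finally show ?thesis .
  qed
  have "(-1) ^ k * (LINT z|lebesgue_on ?S. g' z * D [] z) = (-1) ^ k * (LINT z|lebesgue_on ?S. h' z * D [] z)"
  proof -
   obtain K where K: "compact K" "K \<subseteq> ?S" "!!z. z ~: K ==> D [] z = 0" using D(2) by blast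
   show ?thesis
    using has_weak_derivD[OF g2 D(1) K] has_weak_derivD[OF h2 D(1) K] by simp
  qed
  then have "(LINT z|lborel. g' z * ?b z) = (LINT z|lborel. h' z * ?b z)"
   using conv by simp
  then show "(LINT x|lborel. (g' x - h' x) * ?b x) = 0"
   using ib[of g'] ib[of h'] by (simp add: left_diff_distrib)
 qed measurable
 then have "AE x in lebesgue_on ?S. g' x = h' x"
  by (subst AE_lebesgue_on) (auto elim!: eventually_mono)
 then show ?thesis using gg hh by eventually_elim simp
qed

lemma weak_deriv_AE_eq:
 fixes a b :: real
 assumes "has_weak_deriv {a<..<b} (replicate k 1) f g"
 shows "AE x in lebesgue_on {a<..<b}. weak_deriv {a<..<b} k f x = g x"
 using has_weak_deriv_unique[OF someI[of "has_weak_deriv {a<..<b} (replicate k 1) f", OF assms] assms]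
 unfolding weak_deriv_def .

text \<open>The lemma of du Bois-Reymond. Subtracting the primitive of \<open>g\<close> leaves
  \<open>n\<close>, which is orthogonal to derivatives of test functions, that is, to test functions
  of integral zero. Every bump becomes one of these after subtraction of a multiple of a fixed
  reference bump, whence \<open>n\<close> is constant.\<close>

lemma dubois_reymond:
 fixes m g :: "real => real"
 assumes ab: "a < b" and m[measurable]: "m \<in> BM" and g[measurable]: "g \<in> BM"
  and mi: "lint (%x. indicator {a..b} x * m x)" and gi: "lint (%x. indicator {a..b} x * g x)"
  and weak: "!!d \<alpha> \<beta>. a < \<alpha> ==> \<alpha> < \<beta> ==> \<beta> < b ==> smooth_seq d ==> (!!x. x ~: {\<alpha>..\<beta>} ==> d 0 x = 0) ==>
   (LINT x|lborel. m x * d 1 x) = - (LINT x|lborel. g x * d 0 x)"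
 obtains c where "AE x in lborel. x \<in> {a<..<b} --> m x = c + prim_from a g x"
proof -
 \<comment> \<open>The middle third is an arbitrary place for the reference bump
   \<open>bump 1 u v\<close>.\<close>
 define u v where "u = a + (b - a) / 3" and "v = b - (b - a) / 3"
 have uv: "a < u" "u < v" "v < b" using ab by (auto simp: u_def v_def field_simps)
 obtain e where e: "smooth_seq e" "e 0 = bump 1 u v" using bump_smooth_seq[of 1 u v] by auto
 let ?\<theta> = "bump 1 u v" and ?G = "prim_from a g"
 have [measurable]: "?G \<in> BM" by (rule prim_from_borel[OF g])
 define n where "n x = m x - ?G x" for x
 have [measurable]: "n \<in> BM" unfolding n_def by measurable
 have ni: "lint (%x. indicator {a..b} x * n x)"
  using mi integrable_indicator_continuous[OF prim_from_continuous[OF gi]] by (simp add: n_def right_diff_distrib)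
 have bi: "lint (bump c \<alpha> \<beta>)" if "c > 0" for c \<alpha> \<beta>
 proof -
  have "lint (%x. indicator {\<alpha>..\<beta>} x * bump c \<alpha> \<beta> x)"
   by (rule integrable_indicator_continuous[OF bump_continuous[OF that]])
  also have "(%x. indicator {\<alpha>..\<beta>} x * bump c \<alpha> \<beta> x) = bump c \<alpha> \<beta>"
   by (subst bump_indicator) auto
  finally show ?thesis .
 qed
 define I where "I = (LINT x|lborel. ?\<theta> x)"
 have I: "I > 0"
 proof -
  have "I ~= 0"
  proof
   assume "I = 0"
   then have "AE x in lborel. ?\<theta> x = 0"
    unfolding I_def using bi[of 1 u v] bump_nonneg by (subst (asm) integral_nonneg_eq_0_iff_AE) auto
   then have "AE x in lborel. x ~: {u<..<v}"
    by eventually_elim (use bump_pos[of _ u v 1] in force)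
   then have "{u<..<v} \<in> null_sets lborel"
    by (subst (asm) AE_iff_null_sets[symmetric]) auto
   then show False using uv by (auto simp: null_sets_def)
  qed
  moreover have "I >= 0" unfolding I_def by (intro Bochner_Integration.integral_nonneg bump_nonneg)
  ultimately show ?thesis by simp
 qed
 \<comment> \<open>The only possible constant: the average of \<open>n\<close> against the reference
   bump.\<close>
 define c where "c = (LINT x|lborel. n x * ?\<theta> x) / I"
 have nb: "lint (%x. n x * bump \<gamma> \<alpha> \<beta> x)" if "\<gamma> > 0" "a < \<alpha>" "\<beta> < b" for \<gamma> \<alpha> \<beta>
 proof -
  have "lint (%x. (indicator {a..b} x * n x) * bump \<gamma> \<alpha> \<beta> x)"
   using bump_nonneg[of \<gamma> \<alpha> \<beta>] bump_le_1[of \<gamma> \<alpha> \<beta>] that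
   by (intro integrable_mult_bounded[OF ni, where C=1]) auto
  also have "(%x. (indicator {a..b} x * n x) * bump \<gamma> \<alpha> \<beta> x) = (%x. n x * (indicator {a..b} x * bump \<gamma> \<alpha> \<beta> x))"
   by (simp add: mult_ac)
  also have "... = (%x. n x * bump \<gamma> \<alpha> \<beta> x)"
   using that by (subst bump_indicator) auto
  finally show ?thesis .
 qed
 have "AE x in lborel. x \<in> {a<..<b} --> n x - c = 0"
 proof (rule AE_zero_of_bump_integrals)
  fix \<alpha> \<beta> and N :: nat assume *: "a < \<alpha>" "\<alpha> < \<beta>" "\<beta> < b"
  define \<gamma> where "\<gamma> = 1 / real (Suc N)"
  have \<gamma>: "\<gamma> > 0" by (simp add: \<gamma>_def)
  let ?\<chi> = "bump \<gamma> \<alpha> \<beta>"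
  show "lint (%x. indicator {\<alpha>..\<beta>} x * (n x - c))"
   using integrable_indicator_subset[OF ni, of "{\<alpha>..\<beta>}"] * by (auto simp: right_diff_distrib)
  obtain d where d: "smooth_seq d" "d 0 = ?\<chi>" using bump_smooth_seq[OF \<gamma>] by auto
  \<comment> \<open>This \<open>r\<close> makes the integral of \<open>h\<close> zero, so that the
    primitive \<open>\<phi>\<close> of \<open>h\<close> vanishes again to the right of both supports
    and is an admissible test function.\<close>
  define r where "r = (LINT x|lborel. ?\<chi> x) / I"
  define h where "h x = ?\<chi> x - r * ?\<theta> x" for x
  have hc: "continuous_on A h" for A
   unfolding h_def using bump_continuous[OF \<gamma>] bump_continuous[of 1] by (intro continuous_intros) auto
  obtain P where P: "!!x. (P has_real_derivative h x) (at x)"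
  proof -
   have "EX F. \<forall>x::real. -\<infinity> < ereal x --> ereal x < \<infinity> --> (F has_vector_derivative h x) (at x)"
    using hc[of UNIV] by (intro einterval_antiderivative) (auto simp: continuous_on_eq_continuous_at)
   then show ?thesis using that by (auto simp: has_real_derivative_iff_has_vector_derivative)
  qed
  define \<phi> where "\<phi> x = P x - P a" for x
  have \<phi>': "(\<phi> has_real_derivative h x) (at x)" for x
   unfolding \<phi>_def using P by (auto intro!: derivative_eq_intros)
  define A B where "A = min u \<alpha>" and "B = max v \<beta>"
  have AB: "a < A" "A < B" "B < b" using * uv by (auto simp: A_def B_def)
  have hz: "h x = 0" if "x <= A \<or> x >= B" for x
   using that bump_outside[of x u v] bump_outside[of x \<alpha> \<beta>] by (auto simp: h_def A_def B_def)
  have hint: "(LINT x|lborel. h x) = 0"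
   unfolding h_def using bi[OF \<gamma>] bi[of 1] I by (simp add: r_def I_def[symmetric])
  have \<phi>int: "\<phi> y - \<phi> x = (LINT s|lborel. h s * indicator {x..y} s)" if "x <= y" for x y
   by (rule integral_FTC_Icc_real[symmetric]) (use that \<phi>' hc[of UNIV] in \<open>auto simp: continuous_on_eq_continuous_at\<close>)
  have \<phi>a: "\<phi> a = 0" by (simp add: \<phi>_def)
  have \<phi>z: "\<phi> x = 0" if "x ~: {A..B}" for x
  proof (cases "x < A")
   case True
   have "\<phi> (max x a) - \<phi> (min x a) = (LINT s|lborel. 0 * (s::real))"
    unfolding \<phi>int[OF order_trans[OF min.cobounded1 max.cobounded1]]
   proof (intro LINT_cong refl)
    fix s show "h s * indicator {min x a..max x a} s = 0 * s"
    proof (cases "s \<in> {min x a..max x a}")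
     case True
     then have "s <= max x a" by simp
     then have "s <= A" using \<open>x < A\<close> AB by linarith
     then show ?thesis by (simp add: hz)
    qed simp
   qed
   then show ?thesis using \<phi>a by (auto simp: max_def min_def split: if_splits)
  next
   case False
   then have xB: "x > B" using that by auto
   have "\<phi> x - \<phi> a = (LINT s|lborel. h s * indicator {a..x} s)"
    using \<phi>int[of a x] xB AB by auto
   also have "... = (LINT s|lborel. h s)"
   proof (intro LINT_cong refl)
    fix s show "h s * indicator {a..x} s = h s"
     using hz[of s] xB AB by (cases "s \<in> {a..x}") auto
   qed
   finally show ?thesis using hint \<phi>a by simp
  qed
  \<comment> \<open>The sequence of derivatives of \<open>\<phi>\<close> starts with the primitive;
    from index 1 on it is the combination of the sequences of the two bumps.\<close>
  define D where "D k = (if k = 0 then \<phi> else (%x. d (k - 1) x - r * e (k - 1) x))" for k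
  have Dss: "smooth_seq D"
   unfolding smooth_seq_def
  proof (intro allI)
   fix k x
   show "(D k has_real_derivative D (Suc k) x) (at x)"
   proof (cases k)
    case 0
    then show ?thesis using \<phi>'[of x] by (simp add: D_def d e h_def)
   next
    case (Suc j)
    then show ?thesis
     using smooth_seqD[OF d(1), of j x] smooth_seqD[OF e(1), of j x]
     by (auto simp: D_def intro!: derivative_eq_intros)
   qed
  qed
  have D0: "D 0 = \<phi>" and D1: "D 1 = h" by (auto simp: D_def d e h_def fun_eq_iff)
  have w: "(LINT x|lborel. m x * h x) = - (LINT x|lborel. g x * \<phi> x)"
   using weak[OF AB Dss] \<phi>z unfolding D0 D1 by blast
  have [measurable]: "h \<in> BM" "\<phi> \<in> BM"
   using smooth_seq_borel[OF Dss, of 0] smooth_seq_borel[OF Dss, of 1] by (simp_all only: D0 D1)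
  have hb: "\<bar>h x\<bar> <= 1 + \<bar>r\<bar>" for x
  proof -
   have "\<bar>h x\<bar> <= \<bar>?\<chi> x\<bar> + \<bar>r\<bar> * \<bar>?\<theta> x\<bar>" unfolding h_def by (metis abs_mult abs_triangle_ineq4)
   also have "... <= 1 + \<bar>r\<bar> * 1"
    using bump_nonneg[of \<gamma> \<alpha> \<beta> x] bump_le_1[OF \<gamma>, of \<alpha> \<beta> x] bump_nonneg[of 1 u v x] bump_le_1[of 1 u v x]
    by (intro add_mono mult_left_mono) auto
   finally show ?thesis by simp
  qed
  have hind: "indicator {a..b} x * h x = h x" for x
   using hz[of x] AB by (cases "x \<in> {a..b}") auto
  have ih: "lint (%x. k x * h x)" if "lint (%x. indicator {a..b} x * k x)" for k
  proof -
   have "lint (%x. (indicator {a..b} x * k x) * h x)"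
    by (rule integrable_mult_bounded[OF that _ hb]) measurable
   also have "(%x. (indicator {a..b} x * k x) * h x) = (%x. k x * h x)"
    using hind by (simp add: fun_eq_iff mult.assoc mult.left_commute[of _ "k _"])
   finally show ?thesis .
  qed
  \<comment> \<open>Integration by parts for the primitive of \<open>g\<close>, obtained from
    \<open>prim_from_mult\<close> at \<open>b\<close>, where the primitive of \<open>h\<close> is
    zero.\<close>
  have Gh: "(LINT x|lborel. ?G x * h x) = - (LINT x|lborel. g x * \<phi> x)"
  proof -
   obtain C where C: "C > 0" "!!x. x \<in> {a..b} ==> \<bar>\<phi> x\<bar> <= C"
    using continuous_on_Icc_bounded[OF smooth_seq_continuous[OF Dss, of _ 0]] unfolding D0 by blast
   have cb: "\<bar>\<phi> x\<bar> <= C" for x using C(2)[of x] \<phi>z[of x] C(1) AB by (cases "x \<in> {a..b}") auto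
   have ig: "lint (%x. (indicator {a..b} x * g x) * \<phi> x)"
    by (rule integrable_mult_bounded[OF gi _ cb]) measurable
   have igeq: "(%x. (indicator {a..b} x * g x) * \<phi> x) = (%x. g x * \<phi> x)"
   proof
    fix x show "(indicator {a..b} x * g x) * \<phi> x = g x * \<phi> x"
     using \<phi>z[of x] AB by (cases "x \<in> {a..b}") auto
   qed
   have hp: "prim_from a h x = \<phi> x" if "x \<in> {a..b}" for x
    using \<phi>int[of a x] that \<phi>a by (simp add: prim_from_def mult.commute)
   have "prim_from a g b * prim_from a h b =
     (LINT s|lborel. indicator {a..b} s * (g s * prim_from a h s + ?G s * h s))"
    using ab integrable_indicator_continuous[OF hc]
    by (intro prim_from_mult[OF _ _ gi]) auto
   also have "... = (LINT s|lborel. g s * \<phi> s + ?G s * h s)"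
   proof (intro LINT_cong refl)
    fix s show "indicator {a..b} s * (g s * prim_from a h s + ?G s * h s) = g s * \<phi> s + ?G s * h s"
     using hp[of s] hz[of s] \<phi>z[of s] AB by (cases "s \<in> {a..b}") auto
   qed
   also have "... = (LINT s|lborel. g s * \<phi> s) + (LINT s|lborel. ?G s * h s)"
    using ig ih[OF integrable_indicator_continuous[OF prim_from_continuous[OF gi]]]
    unfolding igeq by (rule Bochner_Integration.integral_add)
   finally show ?thesis using hp[of b] \<phi>z[of b] AB ab by simp
  qed
  have "0 = (LINT x|lborel. m x * h x) - (LINT x|lborel. ?G x * h x)" using w Gh by simp
  also have "... = (LINT x|lborel. n x * h x)"
   unfolding n_def left_diff_distrib
   by (rule Bochner_Integration.integral_diff[symmetric, OF ih[OF mi] ih[OF integrable_indicator_continuous[OF prim_from_continuous[OF gi]]]])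
  also have "... = (LINT x|lborel. n x * ?\<chi> x - r * (n x * ?\<theta> x))"
   by (intro LINT_cong) (auto simp: h_def algebra_simps)
  also have "... = (LINT x|lborel. n x * ?\<chi> x) - r * (LINT x|lborel. n x * ?\<theta> x)"
   using nb[OF \<gamma> *(1,3)] nb[of 1 u v] uv by simp
  also have "... = (LINT x|lborel. n x * ?\<chi> x) - c * (LINT x|lborel. ?\<chi> x)"
   using I by (simp add: r_def c_def)
  also have "... = (LINT x|lborel. (n x - c) * ?\<chi> x)"
   using nb[OF \<gamma> *(1,3)] bi[OF \<gamma>, of \<alpha> \<beta>] by (simp add: left_diff_distrib)
  finally show "(LINT x|lborel. (n x - c) * bump (1 / real (Suc N)) \<alpha> \<beta> x) = 0"
   by (simp add: \<gamma>_def)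
 qed measurable
 then show ?thesis
  by (intro that[of c]) (auto simp: n_def elim!: eventually_mono)
qed

section \<open>Representatives of square integrable functions and of Sobolev functions\<close>

lemma L2_representative:
 assumes f: "f \<in> L2 {a<..<b}"
 obtains f' where "f' \<in> BM" "AE x in lebesgue_on {a<..<b}. f x = f' x"
  "lint (%x. indicator {a..b} x * (f' x)^2)"
proof -
 have S: "{a<..<b} \<in> sets borel" by simp
 have fm: "f \<in> borel_measurable (lebesgue_on {a<..<b})"
  and fi: "integrable (lebesgue_on {a<..<b}) (%x. (f x)^2)"
  using f unfolding L2_def by auto
 obtain f' where f'[measurable]: "f' \<in> BM" and ff: "AE x in lebesgue_on {a<..<b}. f x = f' x"
  and f0: "!!x. x ~: {a<..<b} ==> f' x = 0"
  by (rule borel_representative[OF S fm]) blast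
 have "integrable (lebesgue_on {a<..<b}) (%x. (f' x)^2)"
  using fi ff measurable_lebesgue_on_cong_AE[OF S fm ff]
  by (subst integrable_cong_AE[of _ _ "%x. (f x)^2"]) (use fm in \<open>auto elim!: eventually_mono\<close>)
 then have "lint (%x. indicator {a<..<b} x * (f' x)^2)"
  by (subst (asm) integrable_lebesgue_on) auto
 also have "(%x. indicator {a<..<b} x * (f' x)^2) = (%x. indicator {a..b} x * (f' x)^2)"
 proof
  fix x show "indicator {a<..<b} x * (f' x)^2 = indicator {a..b} x * (f' x)^2"
   using f0[of x] by (cases "x \<in> {a<..<b}") auto
 qed
 finally show ?thesis using that f' ff by blast
qed

lemma L2I:
 assumes "f' \<in> BM" "AE x in lebesgue_on {a<..<b}. f x = f' x"
  "lint (%x. indicator {a..b} x * (f' x)^2)"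
 shows "f \<in> L2 {a<..<b}"
proof -
 have S: "{a<..<b} \<in> sets borel" by simp
 note [measurable] = assms(1)
 have f'm: "f' \<in> borel_measurable (lebesgue_on {a<..<b})"
  using assms(1) by (simp add: measurable_completion measurable_restrict_space1)
 have fm: "f \<in> borel_measurable (lebesgue_on {a<..<b})"
  by (rule measurable_lebesgue_on_cong_AE[OF S f'm]) (use assms(2) in \<open>auto elim!: eventually_mono\<close>)
 have "lint (%x. indicator {a<..<b} x * (f' x)^2)"
  by (rule integrable_indicator_subset[OF assms(3)]) auto
 then have "integrable (lebesgue_on {a<..<b}) (%x. (f' x)^2)"
  by (subst integrable_lebesgue_on) auto
 then have "integrable (lebesgue_on {a<..<b}) (%x. (f x)^2)"
  using fm f'm assms(2)
  by (subst integrable_cong_AE[of _ _ "%x. (f' x)^2"]) (auto elim!: eventually_mono)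
 then show ?thesis using fm unfolding L2_def by simp
qed

lemma L2_norm_sq:
 assumes f'[measurable]: "f' \<in> BM" and "AE x in lebesgue_on {a<..<b}. f x = f' x"
 shows "(L2_norm {a<..<b} f)^2 = (LINT x|lborel. indicator {a..b} x * (f' x)^2)"
proof -
 have S: "{a<..<b} \<in> sets borel" by simp
 have f'm: "f' \<in> borel_measurable (lebesgue_on {a<..<b})"
  using assms(1) by (simp add: measurable_completion measurable_restrict_space1)
 have "(LINT x|lebesgue_on {a<..<b}. (f' x)^2) = (LINT x|lebesgue_on {a<..<b}. (f x)^2)"
  by (rule LINT_lebesgue_on_cong_AE[OF S]) (use f'm assms(2) in \<open>auto elim!: eventually_mono\<close>)
 moreover have "(LINT x|lebesgue_on {a<..<b}. (f' x)^2) = (LINT x|lborel. indicator {a..b} x * (f' x)^2)"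
  by (subst LINT_lebesgue_on) (auto simp: LINT_Ioo_eq_Icc)
 moreover have "(LINT x|lborel. indicator {a..b} x * (f' x)^2) >= 0"
  by (intro Bochner_Integration.integral_nonneg) auto
 ultimately show ?thesis unfolding L2_norm_def by simp
qed

text \<open>The embedding of H^1 into continuous functions in one dimension: the weak identity is
  the hypothesis of \<open>dubois_reymond\<close>, and square integrability on a bounded interval
  gives integrability.\<close>

lemma weak_rep:
 assumes ab: "a < b" and f: "f \<in> L2 {a<..<b}" and g: "g \<in> L2 {a<..<b}" and w: "has_weak_deriv {a<..<b} [1] f g"
 obtains F g' where "ac_deriv a b F g'" "AE x in lebesgue_on {a<..<b}. f x = F x"
  "AE x in lebesgue_on {a<..<b}. g x = g' x"
proof -
 let ?S = "{a<..<b}"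
 obtain f' where f'[measurable]: "f' \<in> BM" and ff: "AE x in lebesgue_on ?S. f x = f' x"
  and fi: "lint (%x. indicator {a..b} x * (f' x)^2)"
  using L2_representative[OF f] .
 obtain g' where g'[measurable]: "g' \<in> BM" and gg: "AE x in lebesgue_on ?S. g x = g' x"
  and gi: "lint (%x. indicator {a..b} x * (g' x)^2)"
  using L2_representative[OF g] .
 have w': "has_weak_deriv ?S [1] f' g'"
  by (rule has_weak_deriv_cong_AE[OF _ _ w ff gg]) auto
 obtain c where c: "AE x in lborel. x \<in> {a<..<b} --> f' x = c + prim_from a g' x"
 proof (rule dubois_reymond[OF ab f' g' integrable_of_square_integrable[OF f' fi] integrable_of_square_integrable[OF g' gi]])
  fix d \<alpha> \<beta>
  assume *: "a < \<alpha>" "\<alpha> < \<beta>" "\<beta> < b" and d: "smooth_seq d" and d0: "!!x. x ~: {\<alpha>..\<beta>} ==> d 0 x = 0"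
  define D where "D bs = d (length (bs :: real list))" for bs
  have D: "smooth_partials D" using smooth_partials_seq[OF d] by (simp add: D_def[abs_def])
  have conv: "(LINT z|lebesgue_on ?S. k z * d j z) = (LINT z|lborel. k z * d j z)"
   if [measurable]: "k \<in> BM" for k j
  proof -
   have [measurable]: "d j \<in> BM" by (rule smooth_seq_borel[OF d])
   have "(LINT z|lebesgue_on ?S. k z * d j z) = (LINT z|lborel. indicator ?S z * (k z * d j z))"
    by (rule LINT_lebesgue_on) auto
   also have "... = (LINT z|lborel. k z * d j z)"
   proof (intro LINT_cong refl)
    fix z
    have "d j z = 0" if "z ~: {\<alpha>..\<beta>}"
     using smooth_seq_support[OF d _ that] d0 by blast
    then show "indicator ?S z * (k z * d j z) = k z * d j z"
     using * by (cases "z \<in> ?S") auto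
   qed
   finally show ?thesis .
  qed
  have "(LINT z|lebesgue_on ?S. f' z * D [1] z) = (-1) ^ length [1::real] * (LINT z|lebesgue_on ?S. g' z * D [] z)"
   by (rule has_weak_derivD[OF w' D, of "{\<alpha>..\<beta>}"]) (use * d0 in \<open>auto simp: D_def\<close>)
  then show "(LINT x|lborel. f' x * d 1 x) = - (LINT x|lborel. g' x * d 0 x)"
   by (simp add: D_def conv)
 qed blast
 show ?thesis
 proof (rule that[of "%x. c + prim_from a g' x" g'])
  show "ac_deriv a b (%x. c + prim_from a g' x) g'"
   using gi unfolding ac_deriv_def by simp
  have "AE x in lebesgue_on ?S. f' x = c + prim_from a g' x"
   using c by (simp add: AE_lebesgue_on)
  then show "AE x in lebesgue_on ?S. f x = c + prim_from a g' x"
   using ff by eventually_elim simp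
 qed (rule gg)
qed

lemma has_weak_deriv_Nil: "locally_integrable S f ==> has_weak_deriv S [] f f"
 unfolding has_weak_deriv_def by simp

lemma Sobolev1_rep:
 assumes "a < b" "f \<in> Sobolev 1 {a<..<b}"
 obtains F g where "ac_deriv a b F g" "AE x in lebesgue_on {a<..<b}. f x = F x"
proof -
 obtain g where "g \<in> L2 {a<..<b}" "has_weak_deriv {a<..<b} [1] f g" "f \<in> L2 {a<..<b}"
  using assms(2) unfolding Sobolev_def by auto
 then show ?thesis using weak_rep[OF assms(1)] that by metis
qed

text \<open>The derivative of the first representative is known only up to null sets; exchanging it
  for the absolutely continuous representative of the weak derivative makes \<open>F\<close>
  continuously differentiable up to the end points.\<close>

lemma Sobolev2_rep:
 assumes ab: "a < b" and "f \<in> Sobolev 2 {a<..<b}"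
 obtains F G g where "ac_deriv a b F G" "ac_deriv a b G g" "AE x in lebesgue_on {a<..<b}. f x = F x"
proof -
 let ?S = "{a<..<b}"
 have f: "f \<in> L2 ?S" and *: "!!k. k \<in> {1..2} ==> \<exists>g\<in>L2 ?S. has_weak_deriv ?S (replicate k 1) f g"
  using assms(2) unfolding Sobolev_def by auto
 obtain g where g: "g \<in> L2 ?S" "has_weak_deriv ?S [1] f g" using *[of 1] by auto
 obtain k where k: "k \<in> L2 ?S" "has_weak_deriv ?S [1, 1] f k" using *[of 2] by (auto simp: numeral_2_eq_2)
 obtain F g' where F: "ac_deriv a b F g'" "AE x in lebesgue_on ?S. f x = F x" "AE x in lebesgue_on ?S. g x = g' x"
  using weak_rep[OF ab f g] by blast
 obtain G k' where G: "ac_deriv a b G k'" "AE x in lebesgue_on ?S. g x = G x"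
  using weak_rep[OF ab g(1) k(1) has_weak_deriv_second[OF g(2) k(2)]] by blast
 define G' where "G' x = indicator {a..b} x * G x" for x
 have G'm[measurable]: "G' \<in> BM"
  unfolding G'_def[abs_def] by (rule borel_indicator_mult_continuous[OF _ ac_deriv_continuous[OF G(1)]]) simp
 have G': "ac_deriv a b G' k'"
  by (rule ac_deriv_cong[OF G(1)]) (simp add: G'_def)
 have [measurable]: "g' \<in> BM" by (rule ac_derivD(1)[OF F(1)])
 have gG: "AE x in lborel. x \<in> {a<..<b} --> g' x = G' x"
 proof -
  have "AE x in lebesgue_on ?S. g' x = G x" using F(3) G(2) by eventually_elim simp
  then show ?thesis by (auto simp: AE_lebesgue_on G'_def elim!: eventually_mono)
 qed
 then have gG': "AE x in lborel. x \<in> {a..b} --> g' x = G' x"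
  using AE_lborel_singleton[of a] AE_lborel_singleton[of b] by eventually_elim auto
 have "ac_deriv a b F G'"
  unfolding ac_deriv_def
 proof (intro conjI ballI)
  show "lint (%x. indicator {a..b} x * (G' x)^2)"
   by (rule integrable_square_continuous[OF ac_deriv_continuous[OF G']])
  fix x assume x: "x \<in> {a..b}"
  have "prim_from a g' x = prim_from a G' x"
   by (rule prim_from_cong_AE) (use gG' x in \<open>auto elim!: eventually_mono\<close>)
  then show "F x = F a + prim_from a G' x"
   using ac_derivD(3)[OF F(1) x] by simp
 qed (rule G'm)
 then show ?thesis using that G' F(2) by blast
qed

lemma ac_deriv_borel_rep:
 assumes "ac_deriv a b F g"
 shows "(%x. indicator {a..b} x * F x) \<in> BM"
  "AE x in lebesgue_on {a<..<b}. F x = indicator {a..b} x * F x"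
  "lint (%x. indicator {a..b} x * (indicator {a..b} x * F x)^2)"
proof -
 show "(%x. indicator {a..b} x * F x) \<in> BM"
  by (rule borel_indicator_mult_continuous[OF _ ac_deriv_continuous[OF assms]]) simp
 show "AE x in lebesgue_on {a<..<b}. F x = indicator {a..b} x * F x"
  by (subst AE_lebesgue_on) auto
 have "(%x. indicator {a..b} x * (indicator {a..b} x * F x)^2) = (%x. indicator {a..b} x * (F x)^2)"
  by (auto simp: fun_eq_iff indicator_def)
 then show "lint (%x. indicator {a..b} x * (indicator {a..b} x * F x)^2)"
  using integrable_square_continuous[OF ac_deriv_continuous[OF assms]] by simp
qed

lemma L2_of_ac:
 assumes F: "ac_deriv a b F g"
 shows "F \<in> L2 {a<..<b}" "g \<in> L2 {a<..<b}"
proof -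
 show "F \<in> L2 {a<..<b}" by (rule L2I[OF ac_deriv_borel_rep[OF F]])
 show "g \<in> L2 {a<..<b}"
  by (rule L2I[OF ac_derivD(1)[OF F] _ ac_derivD(2)[OF F]]) simp
qed

lemma Sobolev1I:
 assumes "a < b" and F: "ac_deriv a b F g"
 shows "F \<in> Sobolev 1 {a<..<b}"
 using L2_of_ac[OF F] has_weak_deriv_of_ac[OF F assms(1)] unfolding Sobolev_def by auto

lemma Sobolev2I:
 assumes ab: "a < b" and F: "ac_deriv a b F G" and G: "ac_deriv a b G g"
 shows "F \<in> Sobolev 2 {a<..<b}"
proof -
 have 1: "has_weak_deriv {a<..<b} [1] F G" by (rule has_weak_deriv_of_ac[OF F ab])
 have 2: "has_weak_deriv {a<..<b} [1, 1] F g"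
  by (rule has_weak_deriv_twice[OF 1 has_weak_deriv_of_ac[OF G ab]]) simp
 have "\<exists>h\<in>L2 {a<..<b}. has_weak_deriv {a<..<b} (replicate k 1) F h" if "k \<in> {1..2}" for k
 proof -
  have "k = 1 \<or> k = 2" using that by auto
  then show ?thesis
   using 1 2 L2_of_ac[OF F] L2_of_ac[OF G] by (auto simp: numeral_2_eq_2)
 qed
 then show ?thesis using L2_of_ac[OF F] unfolding Sobolev_def by auto
qed

lemma weak_deriv_0_AE:
 fixes a b :: real
 assumes "locally_integrable {a<..<b} f"
 shows "AE x in lebesgue_on {a<..<b}. weak_deriv {a<..<b} 0 f x = f x"
 using weak_deriv_AE_eq[of a b 0 f f] has_weak_deriv_Nil[OF assms] by simp

text \<open>The norm is defined through chosen weak derivatives, including one of order zero;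
  uniqueness almost everywhere expresses it by the representative.\<close>

lemma Sobolev_norm_1_sq:
 assumes ab: "a < b" and F: "ac_deriv a b F g" and f: "AE x in lebesgue_on {a<..<b}. f x = F x"
 shows "(Sobolev_norm 1 {a<..<b} f)^2 =
  (LINT x|lborel. indicator {a..b} x * (F x)^2) + (LINT x|lborel. indicator {a..b} x * (g x)^2)"
  (is "?L = ?I F + ?I g")
proof -
 let ?S = "{a<..<b}"
 have f': "AE x in lebesgue_on ?S. F x = f x" using f by eventually_elim simp
 have w: "has_weak_deriv ?S [1] f g"
  by (rule has_weak_deriv_cong_AE[OF _ _ has_weak_deriv_of_ac[OF F ab] f']) auto
 have "(L2_norm ?S (weak_deriv ?S 0 f))^2 = (LINT x|lborel. indicator {a..b} x * (indicator {a..b} x * F x)^2)"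
 proof (rule L2_norm_sq[OF ac_deriv_borel_rep(1)[OF F]])
  have "locally_integrable ?S f" using w unfolding has_weak_deriv_def by simp
  from weak_deriv_0_AE[OF this] f
  show "AE x in lebesgue_on ?S. weak_deriv ?S 0 f x = indicator {a..b} x * F x"
   using ac_deriv_borel_rep(2)[OF F] by eventually_elim simp
 qed
 also have "... = ?I F"
  by (intro LINT_cong) (auto simp: indicator_def)
 finally have 0: "(L2_norm ?S (weak_deriv ?S 0 f))^2 = ?I F" .
 have 1: "(L2_norm ?S (weak_deriv ?S 1 f))^2 = ?I g"
  by (rule L2_norm_sq[OF ac_derivD(1)[OF F]]) (use weak_deriv_AE_eq[of a b 1 f g] w in simp)
 have "?L = (L2_norm ?S (weak_deriv ?S 0 f))^2 + (L2_norm ?S (weak_deriv ?S 1 f))^2"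
  unfolding Sobolev_norm_def by (simp add: sum_nonneg)
 then show ?thesis using 0 1 by simp
qed

lemma Sobolev_norm_2_sq:
 assumes ab: "a < b" and F: "ac_deriv a b F G" and G: "ac_deriv a b G g" and f: "AE x in lebesgue_on {a<..<b}. f x = F x"
 shows "(Sobolev_norm 2 {a<..<b} f)^2 =
  (LINT x|lborel. indicator {a..b} x * (F x)^2) + (LINT x|lborel. indicator {a..b} x * (G x)^2) +
  (LINT x|lborel. indicator {a..b} x * (g x)^2)"
proof -
 let ?S = "{a<..<b}"
 have f': "AE x in lebesgue_on ?S. F x = f x" using f by eventually_elim simp
 have w: "has_weak_deriv ?S [1, 1] f g"
  by (rule has_weak_deriv_cong_AE[OF _ _ has_weak_deriv_twice[OF has_weak_deriv_of_ac[OF F ab] has_weak_deriv_of_ac[OF G ab]] f']) auto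
 have 2: "(L2_norm ?S (weak_deriv ?S 2 f))^2 = (LINT x|lborel. indicator {a..b} x * (g x)^2)"
  by (rule L2_norm_sq[OF ac_derivD(1)[OF G]]) (use weak_deriv_AE_eq[of a b 2 f g] w in \<open>simp add: numeral_2_eq_2\<close>)
 have "(Sobolev_norm 2 ?S f)^2 = (Sobolev_norm 1 ?S f)^2 + (L2_norm ?S (weak_deriv ?S 2 f))^2"
  unfolding Sobolev_norm_def by (simp add: sum_nonneg numeral_2_eq_2)
 then show ?thesis using 2 Sobolev_norm_1_sq[OF ab F f] by simp
qed

text \<open>A non-empty open set is not null, so the two functions agree on the open interval and,
  by closedness, at the end points too. Used to turn identities for almost every time into
  identities for every time, time 0 included.\<close>

lemma continuous_AE_eq:
 fixes g h :: "real => real"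
 assumes ab: "a < b" and g: "continuous_on {a..b} g" and h: "continuous_on {a..b} h"
  and eq: "AE s in lborel. s \<in> {a<..<b} --> g s = h s" and x: "x \<in> {a..b}"
 shows "g x = h x"
proof -
 have "\<not> (\<exists>y\<in>{a<..<b}. g y ~= h y)"
 proof
  assume "\<exists>y\<in>{a<..<b}. g y ~= h y"
  then obtain y where y: "y \<in> {a<..<b}" "g y ~= h y" by blast
  let ?U = "{a<..<b} \<inter> (%s. g s - h s) -` (- {0})"
  have U: "open ?U"
   by (rule continuous_open_preimage)
    (auto intro!: continuous_intros continuous_on_subset[OF g] continuous_on_subset[OF h] simp: open_Compl)
  have "AE s in lborel. s ~: ?U"
   using eq by eventually_elim auto
  then have "?U \<in> null_sets lborel"
   using U by (subst AE_iff_null_sets) auto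
  then have "negligible ?U"
   unfolding negligible_iff_null_sets by (rule null_sets_completionI)
  moreover have "?U ~= {}" using y by auto
  ultimately show False using open_not_negligible[OF U] by blast
 qed
 then have eq': "g s - h s = 0" if "s \<in> {a<..<b}" for s using that by auto
 have "closed {s \<in> {a..b}. g s - h s = 0}"
  by (rule continuous_closed_preimage_constant) (auto intro!: continuous_intros g h)
 moreover have "{a<..<b} \<subseteq> {s \<in> {a..b}. g s - h s = 0}" using eq' by auto
 ultimately have "closure {a<..<b} \<subseteq> {s \<in> {a..b}. g s - h s = 0}" by (rule closure_minimal[rotated])
 then show ?thesis using x ab by auto
qed

text \<open>Evaluates the definite description: any second continuous representative agrees by
  \<open>continuous_AE_eq\<close>.\<close>

lemma cont_value_eq:
 assumes ab: "a < b" and F: "continuous_on {a..b} F" and f: "AE x in lebesgue_on {a<..<b}. f x = F x" and x: "x \<in> {a..b}"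
 shows "cont_value {a<..<b} f x = F x"
 unfolding cont_value_def
proof (rule the_equality)
 have cl: "closure {a<..<b} = {a..b}" using ab by simp
 show "EX g. continuous_on (closure {a<..<b}) g & (AE s in lebesgue_on {a<..<b}. f s = g s) & g x = F x"
  using F f cl by auto
 fix y assume "EX g. continuous_on (closure {a<..<b}) g & (AE s in lebesgue_on {a<..<b}. f s = g s) & g x = y"
 then obtain g where g: "continuous_on {a..b} g" "AE s in lebesgue_on {a<..<b}. f s = g s" "g x = y"
  using cl by auto
 have "AE s in lebesgue_on {a<..<b}. g s = F s" using g(2) f by eventually_elim simp
 then have "g x = F x"
  by (intro continuous_AE_eq[OF ab g(1) F _ x]) (simp add: AE_lebesgue_on)
 then show "y = F x" using g(3) by simp
qed

section \<open>Integration along characteristics\<close>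

lemma open_null_empty:
 fixes U :: "real set"
 assumes U: "open U" and "AE s in lborel. s ~: U"
 shows "U = {}"
proof -
 have "U \<in> null_sets lborel"
  using assms by (subst AE_iff_null_sets) auto
 then have "negligible U"
  unfolding negligible_iff_null_sets by (rule null_sets_completionI)
 then show ?thesis using open_not_negligible[OF U] by blast
qed

lemma AE_imp_dense:
 assumes ab: "a < b" and N: "AE t in lborel. t \<in> {a<..<b} --> t \<in> N"
 shows "{a..b} \<subseteq> closure (N :: real set)"
proof -
 have "{a<..<b} - closure N = {}"
 proof (rule open_null_empty)
  show "AE s in lborel. s ~: {a<..<b} - closure N"
   using N by eventually_elim (use closure_subset in auto)
 qed auto
 then have "{a<..<b} \<subseteq> closure N" by blast
 then have "closure {a<..<b} \<subseteq> closure N" by (rule closure_minimal) simp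
 then show ?thesis using ab by simp
qed

text \<open>Projection onto an interval. Composition with it extends functions continuously from an
  interval to the whole line, so that continuity can be stated on \<open>UNIV\<close>.\<close>

definition clamp_to :: "real => real => real => real" where
 "clamp_to a b x = max a (min b x)"

lemma clamp_to_in: "a <= b ==> clamp_to a b x \<in> {a..b}"
 by (auto simp: clamp_to_def)

lemma clamp_to_id: "x \<in> {a..b} ==> clamp_to a b x = x"
 by (auto simp: clamp_to_def)

lemma clamp_to_continuous [continuous_intros]:
 "continuous_on A f ==> continuous_on A (%x. clamp_to a b (f x))"
 unfolding clamp_to_def by (intro continuous_intros)

lemma bump_integrable: "c > 0 ==> lint (bump c \<alpha> \<beta>)"
proof -
 assume c: "c > 0"
 have "lint (%x. indicator {\<alpha>..\<beta>} x * bump c \<alpha> \<beta> x)"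
  by (rule integrable_indicator_continuous[OF bump_continuous[OF c]])
 then show ?thesis by (subst (asm) bump_indicator) auto
qed

lemma bump_integral_pos:
 assumes "\<alpha> < \<beta>" "c > 0"
 shows "(LINT x|lborel. bump c \<alpha> \<beta> x) > 0"
proof -
 have "(LINT x|lborel. bump c \<alpha> \<beta> x) ~= 0"
 proof
  assume "(LINT x|lborel. bump c \<alpha> \<beta> x) = 0"
  then have "AE x in lborel. bump c \<alpha> \<beta> x = 0"
   using bump_integrable[OF assms(2)] bump_nonneg by (subst (asm) integral_nonneg_eq_0_iff_AE) auto
  then have "AE x in lborel. x ~: {\<alpha><..<\<beta>}"
   by eventually_elim (use bump_pos[of _ \<alpha> \<beta> c] in force)
  then have "{\<alpha><..<\<beta>} = {}" by (rule open_null_empty[rotated]) simp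
  then show False using assms by simp
 qed
 moreover have "(LINT x|lborel. bump c \<alpha> \<beta> x) >= 0" by (intro Bochner_Integration.integral_nonneg bump_nonneg)
 ultimately show ?thesis by simp
qed

lemma integrable_bump_mult:
 assumes "continuous_on {\<alpha>..\<beta>} h" "c > 0"
 shows "lint (%x. h x * bump c \<alpha> \<beta> x)"
proof -
 have "lint (%x. indicator {\<alpha>..\<beta>} x * (h x * bump c \<alpha> \<beta> x))"
  by (intro integrable_indicator_continuous continuous_intros assms bump_continuous)
 also have "(%x. indicator {\<alpha>..\<beta>} x * (h x * bump c \<alpha> \<beta> x)) = (%x. h x * (indicator {\<alpha>..\<beta>} x * bump c \<alpha> \<beta> x))"
  by (simp add: mult_ac)
 also have "... = (%x. h x * bump c \<alpha> \<beta> x)" by (subst bump_indicator) auto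
 finally show ?thesis .
qed

lemma bump_average:
 assumes h: "continuous_on {\<alpha>..\<beta>} h" and c: "c > 0"
  and close: "!!y. y \<in> {\<alpha><..<\<beta>} ==> \<bar>h y - h0\<bar> <= \<epsilon>"
 shows "\<bar>(LINT x|lborel. h x * bump c \<alpha> \<beta> x) - h0 * (LINT x|lborel. bump c \<alpha> \<beta> x)\<bar> <=
  \<epsilon> * (LINT x|lborel. bump c \<alpha> \<beta> x)"
proof -
 have "(LINT x|lborel. h x * bump c \<alpha> \<beta> x) - h0 * (LINT x|lborel. bump c \<alpha> \<beta> x) =
   (LINT x|lborel. (h x - h0) * bump c \<alpha> \<beta> x)"
  using integrable_bump_mult[OF h c] bump_integrable[OF c] by (simp add: left_diff_distrib)
 also have "\<bar>...\<bar> <= (LINT x|lborel. \<bar>(h x - h0) * bump c \<alpha> \<beta> x\<bar>)"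
  by (rule integral_abs_bound)
 also have "... <= (LINT x|lborel. \<epsilon> * bump c \<alpha> \<beta> x)"
 proof (rule integral_mono)
  show "lint (%x. \<bar>(h x - h0) * bump c \<alpha> \<beta> x\<bar>)"
   using integrable_bump_mult[OF h c] bump_integrable[OF c] by (simp add: left_diff_distrib)
  fix x
  show "\<bar>(h x - h0) * bump c \<alpha> \<beta> x\<bar> <= \<epsilon> * bump c \<alpha> \<beta> x"
   using close[of x] bump_nonneg[of c \<alpha> \<beta> x] bump_outside[of x \<alpha> \<beta> c]
   by (cases "x \<in> {\<alpha><..<\<beta>}") (auto simp: abs_mult intro: mult_right_mono)
 qed (use bump_integrable[OF c] in simp)
 finally show ?thesis by simp
qed

text \<open>
 Equicontinuity in \<open>x\<close> turns uniform continuity in \<open>t\<close> of countably many local averages into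
 joint uniform continuity.
\<close>

lemma continuous_extension_of_slices:
 fixes Z :: "real => real => real"
 assumes T: "T > 0" and N: "{0..T} \<subseteq> closure N" and C: "C > 0"
  and hoelder: "!!t x y. t \<in> N ==> x \<in> {0..1} ==> y \<in> {0..1} ==> \<bar>Z t x - Z t y\<bar> <= C * sqrt \<bar>x - y\<bar>"
  and moments: "!!\<gamma> \<delta> \<epsilon>. \<gamma> \<in> \<rat> ==> \<delta> \<in> \<rat> ==> 0 < \<gamma> ==> \<gamma> < \<delta> ==> \<delta> < 1 ==> \<epsilon> > 0 ==>
   \<exists>\<eta>>0. \<forall>t\<in>N. \<forall>s\<in>N. \<bar>t - s\<bar> < \<eta> --> \<bar>LINT x|lborel. (Z t x - Z s x) * bump 1 \<gamma> \<delta> x\<bar> <= \<epsilon>"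
 obtains Z' where "cont (%(t, x). Z' t x)" "!!t x. t \<in> N \<inter> {0..T} ==> x \<in> {0..1} ==> Z' t x = Z t x"
proof -
 have cont: "continuous_on {0..1} (Z t)" if "t \<in> N" for t
  unfolding continuous_on_iff
 proof (intro ballI allI impI)
  fix x e :: real assume x: "x \<in> {0..1}" and e: "e > 0"
  have "dist (Z t y) (Z t x) < e" if y: "y \<in> {0..1}" "dist y x < (e / C)^2" for y
  proof -
   have "\<bar>Z t y - Z t x\<bar> <= C * sqrt \<bar>y - x\<bar>" using hoelder[OF \<open>t \<in> N\<close> y(1) x] .
   also have "... < C * (e / C)"
   proof (intro mult_strict_left_mono C)
    have "sqrt \<bar>y - x\<bar> < sqrt ((e / C)^2)"
     using y by (intro real_sqrt_less_mono) (simp add: dist_real_def)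
    then show "sqrt \<bar>y - x\<bar> < e / C" using e C by simp
   qed
   finally show ?thesis using C by (simp add: dist_real_def)
  qed
  then show "\<exists>d>0. \<forall>y\<in>{0..1}. dist y x < d --> dist (Z t y) (Z t x) < e"
   using e C by (intro exI[of _ "(e / C)^2"]) auto
 qed
 have time: "\<exists>\<eta>>0. \<forall>t\<in>N. \<forall>s\<in>N. \<bar>t - s\<bar> < \<eta> --> (\<forall>x\<in>{0..1}. \<bar>Z t x - Z s x\<bar> <= \<epsilon>)" if \<epsilon>: "\<epsilon> > 0" for \<epsilon>
 proof -
  \<comment> \<open>The unit interval is cut into \<open>n\<close> cells so short that, by the
    Hoelder bound, \<open>Z t - Z s\<close> varies by at most \<open>\<epsilon> / 2\<close> on
    each.\<close>
  have e4: "\<epsilon> / (4 * C) > 0" using \<epsilon> C by simp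
  obtain n where n: "n > 0" "sqrt (1 / real n) <= \<epsilon> / (4 * C)"
  proof -
   obtain n where "inverse (real (Suc n)) < (\<epsilon> / (4 * C))^2"
    using reals_Archimedean[OF zero_less_power[OF e4]] by blast
   then have "sqrt (1 / real (Suc n)) <= sqrt ((\<epsilon> / (4 * C))^2)"
    by (intro real_sqrt_le_mono) (simp add: inverse_eq_divide)
   then have "sqrt (1 / real (Suc n)) <= \<epsilon> / (4 * C)" using e4 by simp
   then show ?thesis using that[of "Suc n"] by blast
  qed
  \<comment> \<open>The middle half of each cell: it stays away from 0 and 1, and its end points are
    rational, as the hypothesis on the moments demands.\<close>
  define \<gamma> \<delta> where "\<gamma> i = (real i + 1/4) / real n" and "\<delta> i = (real i + 3/4) / real n" for i
  define I where "I i = (LINT x|lborel. bump 1 (\<gamma> i) (\<delta> i) x)" for i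
  have \<gamma>\<delta>: "\<gamma> i \<in> \<rat>" "\<delta> i \<in> \<rat>" "0 < \<gamma> i" "\<gamma> i < \<delta> i" "\<delta> i < 1" if "i < n" for i
  proof -
   have "real i + 3/4 < real n" using that by linarith
   then show "\<delta> i < 1" using n by (simp add: \<delta>_def)
   show "\<gamma> i < \<delta> i" using n by (simp add: \<gamma>_def \<delta>_def divide_strict_right_mono)
   show "\<gamma> i > 0" using n by (simp add: \<gamma>_def add_nonneg_pos)
   show "\<gamma> i \<in> \<rat>" "\<delta> i \<in> \<rat>" by (simp_all add: \<gamma>_def \<delta>_def)
  qed
  have I: "I i > 0" if "i < n" for i unfolding I_def using \<gamma>\<delta>[OF that] by (intro bump_integral_pos) auto
  have "\<forall>i\<in>{..<n}. \<exists>\<eta>>0. \<forall>t\<in>N. \<forall>s\<in>N. \<bar>t - s\<bar> < \<eta> -->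
    \<bar>LINT x|lborel. (Z t x - Z s x) * bump 1 (\<gamma> i) (\<delta> i) x\<bar> <= \<epsilon> / 2 * I i"
   using \<gamma>\<delta> I \<epsilon> by (intro ballI moments) auto
  then have "\<exists>\<eta>. \<forall>i\<in>{..<n}. \<eta> i > 0 & (\<forall>t\<in>N. \<forall>s\<in>N. \<bar>t - s\<bar> < \<eta> i -->
    \<bar>LINT x|lborel. (Z t x - Z s x) * bump 1 (\<gamma> i) (\<delta> i) x\<bar> <= \<epsilon> / 2 * I i)"
   by (rule bchoice)
  then obtain \<eta> where "\<forall>i\<in>{..<n}. \<eta> i > 0 & (\<forall>t\<in>N. \<forall>s\<in>N. \<bar>t - s\<bar> < \<eta> i -->
    \<bar>LINT x|lborel. (Z t x - Z s x) * bump 1 (\<gamma> i) (\<delta> i) x\<bar> <= \<epsilon> / 2 * I i)" ..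
  then have \<eta>: "!!i. i < n ==> \<eta> i > 0" "!!i t s. i < n ==> t \<in> N ==> s \<in> N ==> \<bar>t - s\<bar> < \<eta> i ==>
    \<bar>LINT x|lborel. (Z t x - Z s x) * bump 1 (\<gamma> i) (\<delta> i) x\<bar> <= \<epsilon> / 2 * I i"
   by blast+
  define \<eta>0 where "\<eta>0 = Min (\<eta> ` {..<n})"
  have \<eta>0: "\<eta>0 > 0" "!!i. i < n ==> \<eta>0 <= \<eta> i"
   using \<eta>(1) n unfolding \<eta>0_def by (auto simp: Min_gr_iff lessThan_empty_iff)
  have "\<bar>Z t x - Z s x\<bar> <= \<epsilon>" if ts: "t \<in> N" "s \<in> N" "\<bar>t - s\<bar> < \<eta>0" and x: "x \<in> {0..1}" for t s x
  proof -
   \<comment> \<open>The minimum puts \<open>x = 1\<close>, where the floor equals \<open>n\<close>,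
     into the last cell.\<close>
   define i where "i = min (nat \<lfloor>real n * x\<rfloor>) (n - 1)"
   have "i <= n - 1" by (simp add: i_def)
   then have i: "i < n" using n by linarith
   have ix: "real i <= real n * x" "real n * x <= real i + 1"
   proof -
    have fl: "real (nat \<lfloor>real n * x\<rfloor>) <= real n * x" "real n * x < real (nat \<lfloor>real n * x\<rfloor>) + 1"
     using x by (auto simp: of_nat_nat)
    have "real n * x <= real n" using x by (simp add: mult_left_le)
    then show "real i <= real n * x" "real n * x <= real i + 1"
     using fl n by (auto simp: i_def min_def of_nat_diff)
   qed
   have near: "\<bar>x - y\<bar> <= 1 / real n" if "y \<in> {\<gamma> i<..<\<delta> i}" for y
   proof -
    have "real i + 1/4 < real n * y" "real n * y < real i + 3/4"
     using that n by (auto simp: \<gamma>_def \<delta>_def field_simps)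
    then have "real n * \<bar>x - y\<bar> <= 1"
     using ix n by (auto simp: abs_if algebra_simps)
    then show ?thesis using n by (simp add: field_simps)
   qed
   have "\<bar>(Z t y - Z s y) - (Z t x - Z s x)\<bar> <= \<epsilon> / 2" if y: "y \<in> {\<gamma> i<..<\<delta> i}" for y
   proof -
    have y01: "y \<in> {0..1}" using y \<gamma>\<delta>[OF i] by auto
    have s: "sqrt \<bar>y - x\<bar> <= \<epsilon> / (4 * C)"
     by (rule order_trans[OF real_sqrt_le_mono n(2)]) (use near[OF y] in \<open>simp add: abs_minus_commute\<close>)
    have "\<bar>(Z t y - Z s y) - (Z t x - Z s x)\<bar> <= \<bar>Z t y - Z t x\<bar> + \<bar>Z s y - Z s x\<bar>" by linarith
    also have "... <= C * (\<epsilon> / (4 * C)) + C * (\<epsilon> / (4 * C))"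
     using hoelder[OF ts(1) y01 x] hoelder[OF ts(2) y01 x] mult_left_mono[OF s, of C] C by linarith
    finally show ?thesis using C by simp
   qed
   then have "\<bar>(LINT y|lborel. (Z t y - Z s y) * bump 1 (\<gamma> i) (\<delta> i) y) - (Z t x - Z s x) * I i\<bar> <= \<epsilon> / 2 * I i"
    unfolding I_def using \<gamma>\<delta>[OF i]
    by (intro bump_average continuous_intros continuous_on_subset[OF cont] ts) auto
   moreover have "\<bar>LINT y|lborel. (Z t y - Z s y) * bump 1 (\<gamma> i) (\<delta> i) y\<bar> <= \<epsilon> / 2 * I i"
    using \<eta>(2)[OF i ts(1,2)] ts(3) \<eta>0(2)[OF i] by auto
   ultimately have "\<bar>(Z t x - Z s x) * I i\<bar> <= \<epsilon> * I i" by linarith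
   then show ?thesis using I[OF i] by (simp add: abs_mult)
  qed
  then show ?thesis using \<eta>0(1) by blast
 qed
 have "uniformly_continuous_on (N \<times> {0..1}) (%(t, x). Z t x)"
  unfolding uniformly_continuous_on_def
 proof (intro allI impI)
  fix e :: real assume e: "e > 0"
  then obtain \<eta> where \<eta>: "\<eta> > 0" "!!t s x. t \<in> N ==> s \<in> N ==> \<bar>t - s\<bar> < \<eta> ==> x \<in> {0..1} ==> \<bar>Z t x - Z s x\<bar> <= e / 4"
   using time[of "e / 4"] by auto
  define d where "d = min \<eta> ((e / (2 * C))^2)"
  have d: "d > 0" using \<eta> e C by (simp add: d_def)
  have "dist (Z s y) (Z t x) < e" if "t \<in> N" "x \<in> {0..1}" "s \<in> N" "y \<in> {0..1}" "dist (s, y) (t, x) < d" for t x s y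
  proof -
   have *: "\<bar>s - t\<bar> < d" "\<bar>y - x\<bar> < d"
    using that(5) dist_fst_le[of "(s, y)" "(t, x)"] dist_snd_le[of "(s, y)" "(t, x)"] by (auto simp: dist_real_def)
   have "sqrt \<bar>y - x\<bar> < sqrt ((e / (2 * C))^2)"
    using *(2) by (intro real_sqrt_less_mono) (simp add: d_def)
   then have "C * sqrt \<bar>y - x\<bar> < C * (e / (2 * C))" using e C by (intro mult_strict_left_mono) auto
   then have "\<bar>Z s y - Z s x\<bar> < e / 2" using hoelder[OF that(3,4,2)] C by simp
   moreover have "\<bar>Z s x - Z t x\<bar> <= e / 4" using *(1) that by (intro \<eta>(2)) (auto simp: d_def)
   ultimately show ?thesis using e unfolding dist_real_def prod.case by linarith
  qed
  then show "\<exists>d>0. \<forall>x\<in>N \<times> {0..1}. \<forall>x'\<in>N \<times> {0..1}. dist x' x < d -->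
    dist (case x' of (t, x) => Z t x) (case x of (t, x) => Z t x) < e"
   using d by (intro exI[of _ d]) auto
 qed
 \<comment> \<open>Uniform continuity extends the slices from the dense set of times to the closed
   rectangle; clamping both variables then extends them to the plane.\<close>
 then obtain g where g: "uniformly_continuous_on (closure (N \<times> {0..1})) g"
  "!!z. z \<in> N \<times> {0..1} ==> (case z of (t, x) => Z t x) = g z"
  by (rule uniformly_continuous_on_extension_on_closure) blast
 have cl: "{0..T} \<times> {0..1} \<subseteq> closure (N \<times> {0..1::real})"
  using N by (auto simp: closure_Times)
 show ?thesis
 proof (rule that[of "%t x. g (clamp_to 0 T t, clamp_to 0 1 x)"])
  have "cont (%z. g (clamp_to 0 T (fst z), clamp_to 0 1 (snd z)))"
   by (rule continuous_on_compose2[OF uniformly_continuous_imp_continuous[OF g(1)]])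
    (use cl clamp_to_in[of 0 T] clamp_to_in[of 0 1] T in \<open>auto intro!: continuous_intros\<close>)
  then show "cont (%(t, x). g (clamp_to 0 T t, clamp_to 0 1 x))"
   by (simp add: case_prod_unfold)
  fix t x assume "t \<in> N \<inter> {0..T}" "x \<in> {0..1::real}"
  then show "g (clamp_to 0 T t, clamp_to 0 1 x) = Z t x"
   using g(2)[of "(t, x)"] by (simp add: clamp_to_id)
 qed
qed

lemma borel_measurable_pair:
 assumes "f \<in> borel_measurable (borel :: (real \<times> real) measure)"
 shows "f \<in> borel_measurable (lborel \<Otimes>\<^sub>M lborel)"
 using assms by (simp add: lborel_prod)

text \<open>A weak derivative in time passes to moments: by Fubini \<open>m\<close> has the weak
  derivative \<open>n\<close>, which is bounded by \<open>M\<close>. Hence \<open>m\<close>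
  coincides with a Lipschitz function on a set \<open>E\<close> of full measure, which depends on
  \<open>\<psi>\<close>.\<close>

lemma moment_lipschitz:
 fixes f g :: "real \<times> real => real"
 assumes T: "T > 0" and f: "f \<in> BM" and g: "g \<in> BM"
  and \<psi>: "cont \<psi>" "!!x. x ~: {\<gamma>..\<delta>} ==> \<psi> x = 0"
  and fi: "!!\<alpha> \<beta>. 0 < \<alpha> ==> \<beta> < T ==> lint (%z. indicator ({\<alpha>..\<beta>} \<times> {\<gamma>..\<delta>}) z * f z)"
  and gi: "!!\<alpha> \<beta>. 0 < \<alpha> ==> \<beta> < T ==> lint (%z. indicator ({\<alpha>..\<beta>} \<times> {\<gamma>..\<delta>}) z * g z)"
  and weak: "!!d \<alpha> \<beta>. 0 < \<alpha> ==> \<alpha> < \<beta> ==> \<beta> < T ==> smooth_seq d ==> (!!x. x ~: {\<alpha>..\<beta>} ==> d 0 x = 0) ==>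
   (LINT z|lborel. f z * (d 1 (fst z) * \<psi> (snd z))) = - (LINT z|lborel. g z * (d 0 (fst z) * \<psi> (snd z)))"
  and bf: "AE t in lborel. t \<in> {0<..<T} --> \<bar>LINT x|lborel. f (t, x) * \<psi> x\<bar> <= M"
  and bg: "AE t in lborel. t \<in> {0<..<T} --> \<bar>LINT x|lborel. g (t, x) * \<psi> x\<bar> <= M"
 obtains E where "AE t in lborel. t \<in> {0<..<T} --> t \<in> E"
  "!!s t. s \<in> E ==> t \<in> E ==> \<bar>(LINT x|lborel. f (t, x) * \<psi> x) - (LINT x|lborel. f (s, x) * \<psi> x)\<bar> <= M * \<bar>t - s\<bar>"
proof -
 define m n where "m t = (LINT x|lborel. f (t, x) * \<psi> x)" and "n t = (LINT x|lborel. g (t, x) * \<psi> x)" for t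
 note [measurable] = borel_measurable_pair[OF f] borel_measurable_pair[OF g]
 have \<psi>m[measurable]: "\<psi> \<in> BM" using \<psi>(1) by (rule borel_measurable_continuous_onI)
 have m[measurable]: "m \<in> BM" and n[measurable]: "n \<in> BM"
  unfolding m_def n_def by measurable
 have int: "lint (%t. indicator {0..T} t * k t)"
  if [measurable]: "k \<in> BM" and "AE t in lborel. t \<in> {0<..<T} --> \<bar>k t\<bar> <= M" for k :: "real => real"
 proof (rule Bochner_Integration.integrable_bound[of _ "%t. M * indicator {0..T} t"])
  show "AE t in lborel. norm (indicator {0..T} t * k t) <= norm (M * indicator {0..T} t :: real)"
   using that(2) AE_lborel_singleton[of 0] AE_lborel_singleton[of T]
   by eventually_elim (auto simp: indicator_def)
 qed auto
 have int_m: "lint (%t. indicator {0..T} t * m t)" and int_n: "lint (%t. indicator {0..T} t * n t)"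
  using bf bg by (auto intro!: int simp: m_def n_def)
 obtain B where B: "B > 0" "!!x. \<bar>\<psi> x\<bar> <= B"
 proof -
  obtain B where "B > 0" "!!x. x \<in> {\<gamma>..\<delta>} ==> \<bar>\<psi> x\<bar> <= B"
   using continuous_on_Icc_bounded[OF continuous_on_subset[OF \<psi>(1) subset_UNIV]] by blast
  then show ?thesis using that[of B] \<psi>(2) by (metis abs_zero less_eq_real_def)
 qed
 \<comment> \<open>Integrability is given only on boxes compactly inside the time interval, so the
   integrand is cut to the support of the test function before Fubini is applied.\<close>
 have fub: "(LINT z|lborel. h z * (d j (fst z) * \<psi> (snd z))) = (LINT t|lborel. (LINT x|lborel. h (t, x) * \<psi> x) * d j t)"
  if hm: "h \<in> BM" and
   hi: "!!\<alpha> \<beta>. 0 < \<alpha> ==> \<beta> < T ==> lint (%z. indicator ({\<alpha>..\<beta>} \<times> {\<gamma>..\<delta>}) z * h z)"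
   and \<alpha>\<beta>: "0 < \<alpha>" "\<beta> < T" and d: "smooth_seq d" and d0: "!!x. x ~: {\<alpha>..\<beta>} ==> d 0 x = 0" for h d \<alpha> \<beta> j
 proof -
  note [measurable] = borel_measurable_pair[OF hm] smooth_seq_borel[OF d, of j]
  obtain A where A: "A > 0" "!!x. \<bar>d j x\<bar> <= A" using smooth_seq_bounded[OF d d0] by blast
  have dj: "d j x = 0" if "x ~: {\<alpha>..\<beta>}" for x using smooth_seq_support[OF d _ that] d0 by blast
  have "lint (%z. (indicator ({\<alpha>..\<beta>} \<times> {\<gamma>..\<delta>}) z * h z) * (d j (fst z) * \<psi> (snd z)))"
  proof (rule integrable_mult_bounded[OF hi[OF \<alpha>\<beta>]])
   show "\<bar>d j (fst z) * \<psi> (snd z)\<bar> <= A * B" for z :: "real \<times> real"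
    unfolding abs_mult using A B by (intro mult_mono) auto
   have "(%z. d j (fst z) * \<psi> (snd z)) \<in> borel_measurable (lborel \<Otimes>\<^sub>M lborel)" by measurable
   then show "(%z. d j (fst z) * \<psi> (snd z)) \<in> borel_measurable lborel" by (simp add: lborel_prod)
  qed
  also have "(%z. (indicator ({\<alpha>..\<beta>} \<times> {\<gamma>..\<delta>}) z * h z) * (d j (fst z) * \<psi> (snd z))) = (%z. h z * (d j (fst z) * \<psi> (snd z)))"
   using dj \<psi>(2) by (force simp: fun_eq_iff indicator_def)
  finally have I: "integrable (lborel \<Otimes>\<^sub>M lborel) (%z. h z * (d j (fst z) * \<psi> (snd z)))"
   by (simp add: lborel_prod)
  have "(LINT z|lborel. h z * (d j (fst z) * \<psi> (snd z))) = (LINT t|lborel. LINT x|lborel. h (t, x) * (d j t * \<psi> x))"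
   using lborel_pair.integral_fst'[OF I] by (simp add: lborel_prod)
  also have "... = (LINT t|lborel. (LINT x|lborel. h (t, x) * \<psi> x) * d j t)"
  proof (intro LINT_cong refl)
   fix t
   have "(LINT x|lborel. h (t, x) * (d j t * \<psi> x)) = (LINT x|lborel. (h (t, x) * \<psi> x) * d j t)"
    by (simp add: mult_ac)
   also have "... = (LINT x|lborel. h (t, x) * \<psi> x) * d j t" by simp
   finally show "(LINT x|lborel. h (t, x) * (d j t * \<psi> x)) = (LINT x|lborel. h (t, x) * \<psi> x) * d j t" .
  qed
  finally show ?thesis .
 qed
 obtain c where c: "AE t in lborel. t \<in> {0<..<T} --> m t = c + prim_from 0 n t"
 proof (rule dubois_reymond[OF T m n int_m int_n])
  fix d \<alpha> \<beta> assume *: "0 < \<alpha>" "\<alpha> < \<beta>" "\<beta> < T" "smooth_seq d" "!!x. x ~: {\<alpha>..\<beta>} ==> d 0 x = 0"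
  show "(LINT x|lborel. m x * d 1 x) = - (LINT x|lborel. n x * d 0 x)"
   using weak[OF *] fub[OF f fi *(1,3,4,5), of 1] fub[OF g gi *(1,3,4,5), of 0] by (simp add: m_def n_def)
 qed blast
 define E where "E = {t \<in> {0<..<T}. m t = c + prim_from 0 n t}"
 have le: "\<bar>m t - m s\<bar> <= M * \<bar>t - s\<bar>" if st: "s \<in> E" "t \<in> E" "s <= t" for s t
 proof -
  have "m t - m s = prim_from 0 n t - prim_from 0 n s" using st by (simp add: E_def)
  also have "... = (LINT r|lborel. indicator {s..t} r * n r)"
   by (rule prim_from_diff[OF int_n]) (use st in \<open>auto simp: E_def\<close>)
  finally have "\<bar>m t - m s\<bar> <= (LINT r|lborel. \<bar>indicator {s..t} r * n r\<bar>)" by simp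
  also have "... <= (LINT r|lborel. M * indicator {s..t} r)"
  proof (rule integral_mono_AE)
   show "lint (%r. \<bar>indicator {s..t} r * n r\<bar>)"
    using integrable_indicator_subset[OF int_n, of "{s..t}"] st by (auto simp: E_def)
   show "AE r in lborel. \<bar>indicator {s..t} r * n r\<bar> <= M * indicator {s..t} r"
    using bg by eventually_elim (use st in \<open>auto simp: E_def n_def indicator_def\<close>)
  qed simp
  also have "... = M * \<bar>t - s\<bar>" using st by simp
  finally show ?thesis .
 qed
 show ?thesis
 proof (rule that[of E])
  show "AE t in lborel. t \<in> {0<..<T} --> t \<in> E"
   using c by eventually_elim (auto simp: E_def)
  fix s t assume "s \<in> E" "t \<in> E"
  then show "\<bar>(LINT x|lborel. f (t, x) * \<psi> x) - (LINT x|lborel. f (s, x) * \<psi> x)\<bar> <= M * \<bar>t - s\<bar>"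
   using le[of s t] le[of t s] unfolding m_def by (cases "s <= t") (auto simp: abs_minus_commute)
 qed
qed

text \<open>The rescaled integral also covers negative \<open>y\<close>.\<close>

definition prim :: "(real => real) => real => real" where
 "prim g y = y * integral {0..1} (%\<theta>. g (y * \<theta>))"

section \<open>Calculus of \<open>prim\<close>\<close>

lemma prim_0 [simp]: "prim g 0 = 0"
 by (simp add: prim_def)

lemma continuous_antiderivative:
 fixes g :: "real => real"
 assumes "cont g"
 obtains G where "!!x. (G has_real_derivative g x) (at x)"
proof -
 have "EX F. \<forall>x::real. -\<infinity> < ereal x --> ereal x < \<infinity> --> (F has_vector_derivative g x) (at x)"
  using assms by (intro einterval_antiderivative) (auto simp: continuous_on_eq_continuous_at)
 then show ?thesis using that by (auto simp: has_real_derivative_iff_has_vector_derivative)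
qed

lemma prim_eq_antiderivative:
 assumes G: "!!x. (G has_real_derivative g x) (at x)"
 shows "prim g y = G y - G 0"
proof -
 have "((%\<theta>. g (y * \<theta>) * y) has_integral G (y * 1) - G (y * 0)) {0..1}"
 proof (rule fundamental_theorem_of_calculus)
  fix \<theta> :: real
  have "((%\<theta>. G (y * \<theta>)) has_real_derivative g (y * \<theta>) * y) (at \<theta> within {0..1})"
   by (rule DERIV_chain2[OF G]) (auto intro!: derivative_eq_intros)
  then show "((%\<theta>. G (y * \<theta>)) has_vector_derivative g (y * \<theta>) * y) (at \<theta> within {0..1})"
   by (simp add: has_real_derivative_iff_has_vector_derivative)
 qed simp
 then have "integral {0..1} (%\<theta>. g (y * \<theta>) * y) = G y - G 0"
  by (rule integral_unique[THEN trans]) simp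
 then show ?thesis by (simp add: prim_def mult.commute)
qed

lemma DERIV_prim:
 assumes "cont g"
 shows "(prim g has_real_derivative g y) (at y)"
proof -
 obtain G where G: "!!x. (G has_real_derivative g x) (at x)" using continuous_antiderivative[OF assms] by blast
 have "prim g = (%y. G y - G 0)" by (simp add: fun_eq_iff prim_eq_antiderivative[OF G])
 then show ?thesis using G by (auto intro!: derivative_eq_intros)
qed

lemma prim_LINT:
 assumes g: "cont g" and "0 <= y"
 shows "prim g y = (LINT s|lborel. indicator {0..y} s * g s)"
 using integral_FTC_Icc_real[OF assms(2) DERIV_prim[OF g]] g
 by (simp add: mult.commute continuous_on_eq_continuous_at)

lemma prim_shift_LINT:
 assumes g: "cont g" and "s <= t"
 shows "prim (%u. g (s + u)) (t - s) = (LINT \<tau>|lborel. indicator {s..t} \<tau> * g \<tau>)"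
proof -
 have c: "cont (%u. g (s + u))"
  by (intro continuous_on_compose2[OF g] continuous_intros) auto
 have "(LINT \<tau>|lborel. indicator {s..t} \<tau> * g \<tau>) = (LINT u|lborel. indicator {s..t} (s + 1 * u) * g (s + 1 * u))"
  using lborel_integral_real_affine[of 1 "%\<tau>. indicator {s..t} \<tau> * g \<tau>" s] by simp
 also have "... = (LINT u|lborel. indicator {0..t - s} u * g (s + u))"
  by (intro LINT_cong) (auto simp: indicator_def)
 finally show ?thesis using prim_LINT[OF c] assms(2) by simp
qed

text \<open>The fixed interval of integration in \<open>prim\<close> lets one theorem on parameter
  integrals give continuity in the parameter and in the limit of integration at once.\<close>

lemma prim_continuous_on:
 fixes g :: "'a::topological_space => real => real"
 assumes g: "cont (%(z, s). g z s)" and y: "continuous_on A y"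
 shows "continuous_on A (%z. prim (g z) (y z))"
proof -
 have "continuous_on (A \<times> cbox 0 1) (%(z, \<theta>). g z (y z * \<theta>))"
 proof -
  have "continuous_on (A \<times> cbox 0 1) (%w. (%(z, s). g z s) (fst w, y (fst w) * snd w))"
   by (intro continuous_on_compose2[OF g] continuous_intros continuous_on_compose2[OF y]) auto
  then show ?thesis by (simp add: case_prod_unfold)
 qed
 then have "continuous_on A (%z. integral (cbox 0 1) (%\<theta>. g z (y z * \<theta>)))"
  by (rule integral_continuous_on_param)
 then show ?thesis unfolding prim_def by (intro continuous_intros y) simp
qed

lemma prim_bound:
 assumes g: "cont g" and "!!s. \<bar>s\<bar> <= \<bar>y\<bar> ==> \<bar>g s\<bar> <= M"
 shows "\<bar>prim g y\<bar> <= M * \<bar>y\<bar>"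
proof -
 have "norm (integral {0..1} (%\<theta>. g (y * \<theta>))) <= M * (1 - 0)"
 proof (rule integral_bound)
  show "continuous_on {0..1} (%\<theta>. g (y * \<theta>))"
   by (intro continuous_on_compose2[OF g] continuous_intros) auto
  fix \<theta> :: real assume "\<theta> \<in> {0..1}"
  then show "norm (g (y * \<theta>)) <= M"
   using assms(2)[of "y * \<theta>"] by (simp add: abs_mult mult_left_le)
 qed simp
 then have "\<bar>y\<bar> * \<bar>integral {0..1} (%\<theta>. g (y * \<theta>))\<bar> <= \<bar>y\<bar> * M"
  by (intro mult_left_mono) auto
 then show ?thesis by (simp add: prim_def abs_mult mult.commute)
qed

lemma prim_diff:
 assumes "cont g" "cont h"
 shows "prim (%s. g s - h s) y = prim g y - prim h y"
proof -
 obtain G where G: "!!x. (G has_real_derivative g x) (at x)" using continuous_antiderivative[OF assms(1)] by blast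
 obtain H where H: "!!x. (H has_real_derivative h x) (at x)" using continuous_antiderivative[OF assms(2)] by blast
 have "((%x. G x - H x) has_real_derivative g x - h x) (at x)" for x
  by (intro DERIV_diff G H)
 then show ?thesis
  using prim_eq_antiderivative[OF G] prim_eq_antiderivative[OF H] prim_eq_antiderivative[of "%x. G x - H x"] by simp
qed

section \<open>Integral identities on segments\<close>

lemma continuous_on_pair:
 assumes "cont (%(t, x). f t x)" "continuous_on A g" "continuous_on A h"
 shows "continuous_on A (%z. f (g z) (h z))"
proof -
 have "continuous_on A (%z. (%(t, x). f t x) (g z, h z))"
  by (rule continuous_on_compose2[OF assms(1)]) (auto intro!: continuous_intros assms)
 then show ?thesis by simp
qed

lemma integrable_compact_support:
 fixes f :: "real \<times> real => real"
 assumes f: "cont f" and K: "compact K" and 0: "!!z. z ~: K ==> f z = 0"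
 shows "lint f"
proof -
 have "lint (%z. indicator K z *\<^sub>R f z)"
  by (rule borel_integrable_compact[OF K continuous_on_subset[OF f]]) simp
 also have "(%z. indicator K z *\<^sub>R f z) = f"
 proof
  fix z show "indicator K z *\<^sub>R f z = f z" using 0[of z] by (cases "z \<in> K") auto
 qed
 finally show ?thesis .
qed

text \<open>The weak identity sees only averages over strips of parallel lines. After the shear
  \<open>\<eta> = x + \<sigma> * t\<close> it says that the continuous function \<open>K\<close> has
  average zero against bumps around \<open>\<xi>\<close>. Shrinking them gives
  \<open>K \<xi> = 0\<close>, the weak identity on a single line, and \<open>dubois_reymond\<close>
  integrates it.\<close>

lemma line_identity_interior:
 fixes f g :: "real => real => real"
 assumes f: "cont (%(t, x). f t x)" and g: "cont (%(t, x). g t x)"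
  and weak: "!!d e \<alpha> \<beta> \<gamma> \<delta>. smooth_seq d ==> smooth_seq e ==> (!!t. t ~: {\<alpha>..\<beta>} ==> d 0 t = 0) ==>
    (!!y. y ~: {\<gamma>..\<delta>} ==> e 0 y = 0) ==> 0 < \<alpha> ==> \<alpha> < \<beta> ==> \<beta> < T ==> \<gamma> < \<delta> ==>
    (!!t y. t \<in> {\<alpha>..\<beta>} ==> y \<in> {\<gamma>..\<delta>} ==> y - \<sigma> * t \<in> {0<..<1}) ==>
    (LINT z|lborel. f (fst z) (snd z) * (d 1 (fst z) * e 0 (snd z + \<sigma> * fst z))) =
    - (LINT z|lborel. g (fst z) (snd z) * (d 0 (fst z) * e 0 (snd z + \<sigma> * fst z)))"
  and st: "0 < s" "s < t" "t < T"
  and ends: "\<xi> - \<sigma> * s \<in> {0<..<1}" "\<xi> - \<sigma> * t \<in> {0<..<1}"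
 shows "f t (\<xi> - \<sigma> * t) - f s (\<xi> - \<sigma> * s) = prim (%u. g (s + u) (\<xi> - \<sigma> * (s + u))) (t - s)"
proof -
 \<comment> \<open>Half of the smallest distance of the end points of the segment to 0 and 1; by
   convexity every parallel segment shifted by at most \<open>\<rho>\<close> stays inside.\<close>
 define \<rho> where "\<rho> = min (min (\<xi> - \<sigma> * s) (\<xi> - \<sigma> * t)) (min (1 - (\<xi> - \<sigma> * s)) (1 - (\<xi> - \<sigma> * t))) / 2"
 have \<rho>: "\<rho> > 0" using ends by (simp add: \<rho>_def)
 have inside: "\<eta> - \<sigma> * \<tau> \<in> {0<..<1}" if "\<tau> \<in> {s..t}" "\<bar>\<eta> - \<xi>\<bar> <= \<rho>" for \<tau> \<eta>
 proof -
  have "2 * \<rho> <= \<xi> - \<sigma> * s" "2 * \<rho> <= \<xi> - \<sigma> * t" "2 * \<rho> <= 1 - (\<xi> - \<sigma> * s)" "2 * \<rho> <= 1 - (\<xi> - \<sigma> * t)"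
   by (simp_all add: \<rho>_def)
  moreover have "(\<sigma> * s <= \<sigma> * \<tau> & \<sigma> * \<tau> <= \<sigma> * t) \<or> (\<sigma> * t <= \<sigma> * \<tau> & \<sigma> * \<tau> <= \<sigma> * s)"
   using that(1) by (cases "\<sigma> >= 0") (auto simp: mult_left_mono mult_left_mono_neg)
  ultimately show ?thesis
   unfolding greaterThanLessThan_iff using that(2) \<rho> by (intro conjI; linarith)
 qed
 let ?m = "%\<tau>. f \<tau> (\<xi> - \<sigma> * \<tau>)" and ?n = "%\<tau>. g \<tau> (\<xi> - \<sigma> * \<tau>)"
 have cm: "continuous_on A ?m" and cn: "continuous_on A ?n" for A
  by (intro continuous_on_pair[OF f] continuous_on_pair[OF g] continuous_intros)+
 obtain c where c: "AE \<tau> in lborel. \<tau> \<in> {s<..<t} --> ?m \<tau> = c + prim_from s ?n \<tau>"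
 proof (rule dubois_reymond[OF st(2), of ?m ?n])
  show "?m \<in> BM" "?n \<in> BM"
   using cm[of UNIV] cn[of UNIV] by (auto intro: borel_measurable_continuous_onI)
  show "lint (%x. indicator {s..t} x * ?m x)" "lint (%x. indicator {s..t} x * ?n x)"
   by (intro integrable_indicator_continuous cm cn)+
  fix d \<alpha> \<beta> assume \<alpha>\<beta>: "s < \<alpha>" "\<alpha> < \<beta>" "\<beta> < t" and d: "smooth_seq d" and d0: "!!x. x ~: {\<alpha>..\<beta>} ==> d 0 x = 0"
  have dz: "d j x = 0" if "x ~: {\<alpha>..\<beta>}" for j x
   using smooth_seq_support[OF d _ that] d0 by blast
  have dc: "continuous_on A (d j)" for A j by (rule smooth_seq_continuous[OF d])
  \<comment> \<open>The defect of the weak identity on the line belonging to \<open>\<eta>\<close>,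
    for the fixed test function \<open>d\<close> in time.\<close>
  define K where "K \<eta> = integral {\<alpha>..\<beta>} (%\<tau>. f \<tau> (\<eta> - \<sigma> * \<tau>) * d 1 \<tau> + g \<tau> (\<eta> - \<sigma> * \<tau>) * d 0 \<tau>)" for \<eta>
  have Kc: "cont K"
  proof -
   have "continuous_on (UNIV \<times> cbox \<alpha> \<beta>) (%(\<eta>, \<tau>). f \<tau> (\<eta> - \<sigma> * \<tau>) * d 1 \<tau> + g \<tau> (\<eta> - \<sigma> * \<tau>) * d 0 \<tau>)"
    unfolding case_prod_unfold
    by (intro continuous_intros continuous_on_pair[OF f] continuous_on_pair[OF g] continuous_on_compose2[OF dc[of UNIV]]) auto
   from integral_continuous_on_param[OF this] show ?thesis unfolding K_def[abs_def] by simp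
  qed
  have KL: "K \<eta> = (LINT \<tau>|lborel. f \<tau> (\<eta> - \<sigma> * \<tau>) * d 1 \<tau> + g \<tau> (\<eta> - \<sigma> * \<tau>) * d 0 \<tau>)" for \<eta>
  proof -
   let ?h = "%\<tau>. f \<tau> (\<eta> - \<sigma> * \<tau>) * d 1 \<tau> + g \<tau> (\<eta> - \<sigma> * \<tau>) * d 0 \<tau>"
   have "set_integrable lborel {\<alpha>..\<beta>} ?h"
    by (intro borel_integrable_atLeastAtMost' continuous_intros continuous_on_pair[OF f] continuous_on_pair[OF g] dc)
   then have "K \<eta> = (LINT \<tau>|lborel. indicator {\<alpha>..\<beta>} \<tau> * ?h \<tau>)"
    unfolding K_def by (simp add: set_borel_integral_eq_integral(2)[symmetric] set_lebesgue_integral_def)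
   also have "... = (LINT \<tau>|lborel. ?h \<tau>)"
   proof (intro LINT_cong refl)
    fix \<tau> show "indicator {\<alpha>..\<beta>} \<tau> * ?h \<tau> = ?h \<tau>" using dz[of \<tau>] by (cases "\<tau> \<in> {\<alpha>..\<beta>}") auto
   qed
   finally show ?thesis .
  qed
  have Kzero: "(LINT \<eta>|lborel. K \<eta> * bump 1 (\<xi> - r) (\<xi> + r) \<eta>) = 0" if r: "0 < r" "r <= \<rho>" for r
  proof -
   obtain e where e: "smooth_seq e" "e 0 = bump 1 (\<xi> - r) (\<xi> + r)" using bump_smooth_seq[of 1 "\<xi> - r" "\<xi> + r"] by auto
   let ?b = "bump 1 (\<xi> - r) (\<xi> + r)"
   have bc: "continuous_on A ?b" for A by (rule bump_continuous) simp
   have bz: "?b y = 0" if "y ~: {\<xi> - r..\<xi> + r}" for y using that by (intro bump_outside) auto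
   \<comment> \<open>Fubini, the translation \<open>\<eta> = x + \<sigma> * \<tau>\<close> on each
     time slice, and Fubini again, so that the integral over time becomes the inner one.\<close>
   have key: "(LINT z|lborel. h (fst z) (snd z) * (d j (fst z) * ?b (snd z + \<sigma> * fst z))) =
     (LINT \<eta>|lborel. LINT \<tau>|lborel. h \<tau> (\<eta> - \<sigma> * \<tau>) * d j \<tau> * ?b \<eta>)"
    "integrable (lborel \<Otimes>\<^sub>M lborel) (%(\<tau>, \<eta>). h \<tau> (\<eta> - \<sigma> * \<tau>) * d j \<tau> * ?b \<eta>)"
    if h: "cont (%(t, x). h t x)" for h :: "real => real => real" and j
   proof -
    have "lint (%(\<tau>, \<eta>). h \<tau> (\<eta> - \<sigma> * \<tau>) * d j \<tau> * ?b \<eta>)"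
    proof (rule integrable_compact_support)
     show "cont (%(\<tau>, \<eta>). h \<tau> (\<eta> - \<sigma> * \<tau>) * d j \<tau> * ?b \<eta>)"
      unfolding case_prod_unfold
      by (intro continuous_intros continuous_on_pair[OF h] continuous_on_compose2[OF dc[of UNIV]] continuous_on_compose2[OF bc[of UNIV]]) auto
     show "compact ({\<alpha>..\<beta>} \<times> {\<xi> - r..\<xi> + r})" by (intro compact_Times) auto
     show "(case z of (\<tau>, \<eta>) => h \<tau> (\<eta> - \<sigma> * \<tau>) * d j \<tau> * ?b \<eta>) = 0" if "z ~: {\<alpha>..\<beta>} \<times> {\<xi> - r..\<xi> + r}" for z
      using that dz[of "fst z" j] bz[of "snd z"] by (cases z) force
    qed
    then show I: "integrable (lborel \<Otimes>\<^sub>M lborel) (%(\<tau>, \<eta>). h \<tau> (\<eta> - \<sigma> * \<tau>) * d j \<tau> * ?b \<eta>)"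
     by (simp add: lborel_prod)
    have "lint (%z. h (fst z) (snd z) * (d j (fst z) * ?b (snd z + \<sigma> * fst z)))"
    proof (rule integrable_compact_support)
     show "cont (%z. h (fst z) (snd z) * (d j (fst z) * ?b (snd z + \<sigma> * fst z)))"
      by (intro continuous_intros continuous_on_pair[OF h] continuous_on_compose2[OF dc[of UNIV]] continuous_on_compose2[OF bc[of UNIV]]) auto
     have "compact ((%z. (fst z, snd z - \<sigma> * fst z)) ` ({\<alpha>..\<beta>} \<times> {\<xi> - r..\<xi> + r}))"
      by (intro compact_continuous_image compact_Times continuous_intros) auto
     then show "compact ((%z. (fst z, snd z - \<sigma> * fst z)) ` ({\<alpha>..\<beta>} \<times> {\<xi> - r..\<xi> + r}))" .
     fix z assume z: "z ~: (%z. (fst z, snd z - \<sigma> * fst z)) ` ({\<alpha>..\<beta>} \<times> {\<xi> - r..\<xi> + r})"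
     have "fst z ~: {\<alpha>..\<beta>} \<or> snd z + \<sigma> * fst z ~: {\<xi> - r..\<xi> + r}"
     proof (rule ccontr)
      assume "\<not> ?thesis"
      then have "z = (%z. (fst z, snd z - \<sigma> * fst z)) (fst z, snd z + \<sigma> * fst z)"
       "(fst z, snd z + \<sigma> * fst z) \<in> {\<alpha>..\<beta>} \<times> {\<xi> - r..\<xi> + r}" by auto
      with z show False by blast
     qed
     then show "h (fst z) (snd z) * (d j (fst z) * ?b (snd z + \<sigma> * fst z)) = 0"
      using dz[of "fst z" j] bz[of "snd z + \<sigma> * fst z"] by auto
    qed
    then have I': "integrable (lborel \<Otimes>\<^sub>M lborel) (%z. h (fst z) (snd z) * (d j (fst z) * ?b (snd z + \<sigma> * fst z)))"
     by (simp add: lborel_prod)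
    have "(LINT z|lborel. h (fst z) (snd z) * (d j (fst z) * ?b (snd z + \<sigma> * fst z))) =
      (LINT \<tau>|lborel. LINT x|lborel. h \<tau> x * (d j \<tau> * ?b (x + \<sigma> * \<tau>)))"
     using lborel_pair.integral_fst'[OF I'] by (simp add: lborel_prod)
    also have "... = (LINT \<tau>|lborel. LINT \<eta>|lborel. h \<tau> (\<eta> - \<sigma> * \<tau>) * d j \<tau> * ?b \<eta>)"
    proof (rule LINT_cong[OF refl])
     fix \<tau>
     show "(LINT x|lborel. h \<tau> x * (d j \<tau> * ?b (x + \<sigma> * \<tau>))) = (LINT \<eta>|lborel. h \<tau> (\<eta> - \<sigma> * \<tau>) * d j \<tau> * ?b \<eta>)"
      using lborel_integral_real_affine[of 1 "%x. h \<tau> x * (d j \<tau> * ?b (x + \<sigma> * \<tau>))" "- \<sigma> * \<tau>"]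
      by (simp add: algebra_simps)
    qed
    also have "... = (LINT \<eta>|lborel. LINT \<tau>|lborel. h \<tau> (\<eta> - \<sigma> * \<tau>) * d j \<tau> * ?b \<eta>)"
     using lborel_pair.Fubini_integral[OF I] by simp
    finally show "(LINT z|lborel. h (fst z) (snd z) * (d j (fst z) * ?b (snd z + \<sigma> * fst z))) =
     (LINT \<eta>|lborel. LINT \<tau>|lborel. h \<tau> (\<eta> - \<sigma> * \<tau>) * d j \<tau> * ?b \<eta>)" .
   qed
   have "(LINT z|lborel. f (fst z) (snd z) * (d 1 (fst z) * e 0 (snd z + \<sigma> * fst z))) =
    - (LINT z|lborel. g (fst z) (snd z) * (d 0 (fst z) * e 0 (snd z + \<sigma> * fst z)))"
   proof (rule weak[OF d e(1), where \<alpha>=\<alpha> and \<beta>=\<beta> and \<gamma>="\<xi> - r" and \<delta>="\<xi> + r"])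
    show "y - \<sigma> * \<tau> \<in> {0<..<1}" if "\<tau> \<in> {\<alpha>..\<beta>}" "y \<in> {\<xi> - r..\<xi> + r}" for \<tau> y
     using that \<alpha>\<beta> r by (intro inside) auto
   qed (use d0 bz e \<alpha>\<beta> st r in auto)
   then have sum0: "(LINT \<eta>|lborel. LINT \<tau>|lborel. f \<tau> (\<eta> - \<sigma> * \<tau>) * d 1 \<tau> * ?b \<eta>) +
     (LINT \<eta>|lborel. LINT \<tau>|lborel. g \<tau> (\<eta> - \<sigma> * \<tau>) * d 0 \<tau> * ?b \<eta>) = 0"
    unfolding e(2) key(1)[OF f] key(1)[OF g] by simp
   have i1: "lint (%\<eta>. LINT \<tau>|lborel. h \<tau> (\<eta> - \<sigma> * \<tau>) * d j \<tau> * ?b \<eta>)"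
    if "cont (%(t, x). h t x)" for h :: "real => real => real" and j
    using lborel_pair.integrable_snd[OF key(2)[OF that]] by simp
   have i2: "lint (%\<tau>. h \<tau> (\<eta> - \<sigma> * \<tau>) * d j \<tau>)"
    if h: "cont (%(t, x). h t x)" for h :: "real => real => real" and j \<eta>
   proof -
    have "lint (%\<tau>. indicator {\<alpha>..\<beta>} \<tau> * (h \<tau> (\<eta> - \<sigma> * \<tau>) * d j \<tau>))"
     by (intro integrable_indicator_continuous continuous_intros continuous_on_pair[OF h] dc)
    also have "(%\<tau>. indicator {\<alpha>..\<beta>} \<tau> * (h \<tau> (\<eta> - \<sigma> * \<tau>) * d j \<tau>)) = (%\<tau>. h \<tau> (\<eta> - \<sigma> * \<tau>) * d j \<tau>)"
    proof
     fix \<tau> show "indicator {\<alpha>..\<beta>} \<tau> * (h \<tau> (\<eta> - \<sigma> * \<tau>) * d j \<tau>) = h \<tau> (\<eta> - \<sigma> * \<tau>) * d j \<tau>"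
      using dz[of \<tau> j] by (cases "\<tau> \<in> {\<alpha>..\<beta>}") auto
    qed
    finally show ?thesis .
   qed
   have "(LINT \<eta>|lborel. K \<eta> * ?b \<eta>) = (LINT \<eta>|lborel. (LINT \<tau>|lborel. f \<tau> (\<eta> - \<sigma> * \<tau>) * d 1 \<tau> * ?b \<eta>) +
     (LINT \<tau>|lborel. g \<tau> (\<eta> - \<sigma> * \<tau>) * d 0 \<tau> * ?b \<eta>))"
    unfolding KL using i2[OF f] i2[OF g]
    by (intro LINT_cong refl) (simp add: distrib_right)
   also have "... = 0"
    using sum0 i1[OF f] i1[OF g] by simp
   finally show ?thesis .
  qed
  \<comment> \<open>Otherwise the averages of \<open>K\<close> over a small neighbourhood would lie
    within half of the modulus of \<open>K \<xi>\<close> from it and could not vanish.\<close>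
  have "K \<xi> = 0"
  proof (rule ccontr)
   assume "K \<xi> ~= 0"
   define \<epsilon> where "\<epsilon> = \<bar>K \<xi>\<bar> / 2"
   have \<epsilon>: "\<epsilon> > 0" using \<open>K \<xi> ~= 0\<close> by (simp add: \<epsilon>_def)
   obtain r0 where r0: "r0 > 0" "!!\<eta>. dist \<eta> \<xi> < r0 ==> dist (K \<eta>) (K \<xi>) < \<epsilon>"
    using Kc \<epsilon> unfolding continuous_on_iff by (metis UNIV_I)
   define r where "r = min r0 \<rho>"
   have r: "0 < r" "r <= \<rho>" "r <= r0" using r0 \<rho> by (auto simp: r_def)
   let ?I = "LINT \<eta>|lborel. bump 1 (\<xi> - r) (\<xi> + r) \<eta>"
   have "\<bar>(LINT \<eta>|lborel. K \<eta> * bump 1 (\<xi> - r) (\<xi> + r) \<eta>) - K \<xi> * ?I\<bar> <= \<epsilon> * ?I"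
   proof (rule bump_average)
    fix y assume "y \<in> {\<xi> - r<..<\<xi> + r}"
    then have "dist y \<xi> < r0" using r by (auto simp: dist_real_def)
    then show "\<bar>K y - K \<xi>\<bar> <= \<epsilon>" using r0(2)[of y] by (simp add: dist_real_def)
   qed (use continuous_on_subset[OF Kc] in auto)
   moreover have "?I > 0" using r by (intro bump_integral_pos) auto
   ultimately have "\<bar>K \<xi>\<bar> <= \<epsilon>" using Kzero[OF r(1,2)] by (simp add: abs_mult)
   then show False using \<epsilon> by (simp add: \<epsilon>_def)
  qed
  moreover have "K \<xi> = (LINT \<tau>|lborel. ?m \<tau> * d 1 \<tau>) + (LINT \<tau>|lborel. ?n \<tau> * d 0 \<tau>)"
  proof -
   have "lint (%\<tau>. h \<tau> * d j \<tau>)" if h: "continuous_on {\<alpha>..\<beta>} h" for h j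
   proof -
    have "lint (%\<tau>. indicator {\<alpha>..\<beta>} \<tau> * (h \<tau> * d j \<tau>))"
     by (intro integrable_indicator_continuous continuous_intros h dc)
    also have "(%\<tau>. indicator {\<alpha>..\<beta>} \<tau> * (h \<tau> * d j \<tau>)) = (%\<tau>. h \<tau> * d j \<tau>)"
    proof
     fix \<tau> show "indicator {\<alpha>..\<beta>} \<tau> * (h \<tau> * d j \<tau>) = h \<tau> * d j \<tau>"
      using dz[of \<tau> j] by (cases "\<tau> \<in> {\<alpha>..\<beta>}") auto
    qed
    finally show ?thesis .
   qed
   then show ?thesis unfolding KL using cm cn by simp
  qed
  ultimately show "(LINT x|lborel. ?m x * d 1 x) = - (LINT x|lborel. ?n x * d 0 x)" by simp
 qed blast
 have int_n: "lint (%x. indicator {s..t} x * ?n x)" by (intro integrable_indicator_continuous cn)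
 have eq: "?m \<tau> = c + prim_from s ?n \<tau>" if "\<tau> \<in> {s..t}" for \<tau>
  by (rule continuous_AE_eq[OF st(2) cm _ c that])
   (intro continuous_on_add continuous_on_const prim_from_continuous int_n)
 have "?m t - ?m s = prim_from s ?n t"
  using eq[of t] eq[of s] st by simp
 then show ?thesis
  using prim_shift_LINT[OF cn, of s t] st by (simp add: prim_from_def)
qed

text \<open>Up to the boundary, by contracting the segment towards the centre of the rectangle.\<close>

lemma line_identity:
 fixes f g :: "real => real => real"
 assumes f: "cont (%(t, x). f t x)" and g: "cont (%(t, x). g t x)"
  and weak: "!!d e \<alpha> \<beta> \<gamma> \<delta>. smooth_seq d ==> smooth_seq e ==> (!!t. t ~: {\<alpha>..\<beta>} ==> d 0 t = 0) ==>
    (!!y. y ~: {\<gamma>..\<delta>} ==> e 0 y = 0) ==> 0 < \<alpha> ==> \<alpha> < \<beta> ==> \<beta> < T ==> \<gamma> < \<delta> ==>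
    (!!t y. t \<in> {\<alpha>..\<beta>} ==> y \<in> {\<gamma>..\<delta>} ==> y - \<sigma> * t \<in> {0<..<1}) ==>
    (LINT z|lborel. f (fst z) (snd z) * (d 1 (fst z) * e 0 (snd z + \<sigma> * fst z))) =
    - (LINT z|lborel. g (fst z) (snd z) * (d 0 (fst z) * e 0 (snd z + \<sigma> * fst z)))"
  and st: "0 <= s" "s <= t" "t <= T" "T > 0"
  and ends: "\<xi> - \<sigma> * s \<in> {0..1}" "\<xi> - \<sigma> * t \<in> {0..1}"
 shows "f t (\<xi> - \<sigma> * t) - f s (\<xi> - \<sigma> * s) = prim (%u. g (s + u) (\<xi> - \<sigma> * (s + u))) (t - s)"
proof (cases "s = t")
 case False
 \<comment> \<open>Convex combinations with the centre \<open>(T / 2, 1 / 2)\<close>;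
   \<open>\<xi>'\<close> moves so that the contracted end points stay on one line of the same
   slope.\<close>
 define s' t' \<xi>' where "s' \<theta> = (1 - \<theta>) * s + \<theta> * (T / 2)" and "t' \<theta> = (1 - \<theta>) * t + \<theta> * (T / 2)"
  and "\<xi>' \<theta> = (1 - \<theta>) * \<xi> + \<theta> * (1 / 2 + \<sigma> * (T / 2))" for \<theta> :: real
 have c[continuous_intros]: "continuous_on A s'" "continuous_on A t'" "continuous_on A \<xi>'" for A
  unfolding s'_def t'_def \<xi>'_def by (intro continuous_intros)+
 \<comment> \<open>The defect of the identity on the contracted segment: zero for
   \<open>0 < \<theta> < 1\<close> by the interior case, and continuous at
   \<open>\<theta> = 0\<close>.\<close>
 define \<Phi> where "\<Phi> \<theta> = f (t' \<theta>) (\<xi>' \<theta> - \<sigma> * t' \<theta>) - f (s' \<theta>) (\<xi>' \<theta> - \<sigma> * s' \<theta>) -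
   prim (%u. g (s' \<theta> + u) (\<xi>' \<theta> - \<sigma> * (s' \<theta> + u))) (t' \<theta> - s' \<theta>)" for \<theta>
 have "cont \<Phi>"
 proof -
  have "cont (%(\<theta>, u). g (s' \<theta> + u) (\<xi>' \<theta> - \<sigma> * (s' \<theta> + u)))"
   unfolding case_prod_unfold
   by (intro continuous_on_pair[OF g] continuous_intros continuous_on_compose2[OF c(1)[of UNIV]] continuous_on_compose2[OF c(3)[of UNIV]]) auto
  then show ?thesis unfolding \<Phi>_def
   by (intro continuous_on_diff continuous_on_pair[OF f] prim_continuous_on continuous_intros) auto
 qed
 then have lim: "(\<Phi> \<longlongrightarrow> \<Phi> 0) (at_right 0)"
  by (auto simp: continuous_on_eq_continuous_at isCont_def intro: tendsto_within_subset)
 have "\<Phi> \<theta> = 0" if \<theta>: "0 < \<theta>" "\<theta> < 1" for \<theta>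
 proof -
  have pos: "0 < s' \<theta>" "s' \<theta> < t' \<theta>" "t' \<theta> < T"
  proof -
   show "0 < s' \<theta>" using \<theta> st by (simp add: s'_def add_nonneg_pos)
   show "s' \<theta> < t' \<theta>" using \<theta> st False by (simp add: s'_def t'_def)
   have "(1 - \<theta>) * t <= (1 - \<theta>) * T" using \<theta> st by (intro mult_left_mono) auto
   moreover have "\<theta> * (T / 2) < \<theta> * T" using \<theta> st by simp
   ultimately have "t' \<theta> < (1 - \<theta>) * T + \<theta> * T" unfolding t'_def by linarith
   then show "t' \<theta> < T" by (simp add: algebra_simps)
  qed
  have mid: "(1 - \<theta>) * x + \<theta> * (1 / 2) \<in> {0<..<1}" if x: "x \<in> {0..1}" for x
  proof -
   have "0 <= (1 - \<theta>) * x" "(1 - \<theta>) * x <= 1 - \<theta>" using x \<theta> by (auto simp: mult_left_le)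
   then show ?thesis unfolding greaterThanLessThan_iff using \<theta> by (intro conjI; linarith)
  qed
  have "\<xi>' \<theta> - \<sigma> * s' \<theta> = (1 - \<theta>) * (\<xi> - \<sigma> * s) + \<theta> * (1 / 2)" "\<xi>' \<theta> - \<sigma> * t' \<theta> = (1 - \<theta>) * (\<xi> - \<sigma> * t) + \<theta> * (1 / 2)"
   by (simp_all add: \<xi>'_def s'_def t'_def algebra_simps)
  then have "f (t' \<theta>) (\<xi>' \<theta> - \<sigma> * t' \<theta>) - f (s' \<theta>) (\<xi>' \<theta> - \<sigma> * s' \<theta>) =
    prim (%u. g (s' \<theta> + u) (\<xi>' \<theta> - \<sigma> * (s' \<theta> + u))) (t' \<theta> - s' \<theta>)"
  proof -
   note interior = line_identity_interior[where f=f and g=g and \<sigma>=\<sigma> and T=T, OF f g]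
   show ?thesis if "\<xi>' \<theta> - \<sigma> * s' \<theta> = (1 - \<theta>) * (\<xi> - \<sigma> * s) + \<theta> * (1 / 2)"
    "\<xi>' \<theta> - \<sigma> * t' \<theta> = (1 - \<theta>) * (\<xi> - \<sigma> * t) + \<theta> * (1 / 2)"
   proof (rule interior, goal_cases)
    case (1 d e \<alpha> \<beta> \<gamma> \<delta>)
    show ?case by (rule weak[OF 1])
   qed (use that mid[OF ends(1)] mid[OF ends(2)] pos in \<open>simp_all only:\<close>)
  qed
  then show ?thesis by (simp add: \<Phi>_def)
 qed
 then have "\<forall>\<^sub>F \<theta> in at_right 0. \<Phi> \<theta> = 0"
  by (auto simp: eventually_at_right_field intro!: exI[of _ 1])
 then have "(\<Phi> \<longlongrightarrow> 0) (at_right 0)" by (rule tendsto_eventually)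
 then have "\<Phi> 0 = 0" using lim tendsto_unique trivial_limit_at_right_real by blast
 then show ?thesis by (simp add: \<Phi>_def s'_def t'_def \<xi>'_def)
qed simp

section \<open>Traces and characteristics of a solution\<close>

lemma ac_deriv_DERIV:
 assumes ab: "a < b" and F: "ac_deriv a b F G" and G: "continuous_on {a..b} G" and x: "x \<in> {a..b}"
 shows "(F has_real_derivative G x) (at x within {a..b})"
proof -
 have eq: "F y = F a + integral {a..y} G" if y: "y \<in> {a..b}" for y
 proof -
  have "set_integrable lborel {a..y} G"
   by (intro borel_integrable_atLeastAtMost' continuous_on_subset[OF G]) (use y in auto)
  then have "prim_from a G y = integral {a..y} G"
   unfolding prim_from_def by (simp add: set_borel_integral_eq_integral(2)[symmetric] set_lebesgue_integral_def)
  then show ?thesis using ac_derivD(3)[OF F y] by simp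
 qed
 have D: "((%y. F a + integral {a..y} G) has_real_derivative 0 + G x) (at x within {a..b})"
  by (intro DERIV_add DERIV_const integral_has_real_derivative G x)
 have "(F has_real_derivative 0 + G x) (at x within {a..b})"
  by (rule has_field_derivative_transform_within[OF D zero_less_one x]) (rule eq[symmetric])
 then show ?thesis by simp
qed

text \<open>From \<open>\<bar>f\<bar> <= 1 + f^2\<close>; the bound is crude, but its uniformity
  over the time slices is what matters.\<close>

lemma moment_bound:
 fixes f \<psi> :: "real => real"
 assumes f[measurable]: "f \<in> BM" and fi: "lint (%x. indicator {0..1} x * (f x)^2)"
  and le: "(LINT x|lborel. indicator {0..1} x * (f x)^2) <= C^2"
  and \<psi>: "\<psi> \<in> BM" "!!x. 0 <= \<psi> x" "!!x. \<psi> x <= 1" "!!x. x ~: {0..1} ==> \<psi> x = (0::real)"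
 shows "\<bar>LINT x|lborel. f x * \<psi> x\<bar> <= 1 + C^2"
proof -
 have i: "lint (%x. indicator {0..1} x * f x)" by (rule integrable_of_square_integrable[OF f fi])
 have "\<bar>\<psi> x\<bar> <= 1" for x using \<psi>(2,3)[of x] by simp
 then have "lint (%x. (indicator {0..1} x * f x) * \<psi> x)"
  using \<psi>(1) by (intro integrable_mult_bounded[OF i, where C=1]) auto
 also have eq: "(%x. (indicator {0..1} x * f x) * \<psi> x) = (%x. f x * \<psi> x)"
 proof
  fix x show "(indicator {0..1} x * f x) * \<psi> x = f x * \<psi> x" using \<psi>(4)[of x] by (cases "x \<in> {0..1}") auto
 qed
 finally have i': "lint (%x. f x * \<psi> x)" .
 have "\<bar>LINT x|lborel. f x * \<psi> x\<bar> <= (LINT x|lborel. \<bar>f x * \<psi> x\<bar>)" by (rule integral_abs_bound)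
 also have "... <= (LINT x|lborel. indicator {0..1} x + indicator {0..1} x * (f x)^2)"
 proof (rule integral_mono)
  fix x
  have "\<bar>f x\<bar> <= 1 + (f x)^2"
   using sum_squares_bound[of 1 "\<bar>f x\<bar>"] by (simp add: power2_eq_square)
  moreover have "\<bar>f x * \<psi> x\<bar> <= \<bar>f x\<bar>"
   using \<psi>(2,3)[of x] by (simp add: abs_mult mult_left_le)
  ultimately show "\<bar>f x * \<psi> x\<bar> <= indicator {0..1} x + indicator {0..1} x * (f x)^2"
   using \<psi>(4)[of x] by (cases "x \<in> {0..1}") auto
 qed (use i' fi in auto)
 also have "... = 1 + (LINT x|lborel. indicator {0..1} x * (f x)^2)"
  using fi by simp
 finally show ?thesis using le by linarith
qed

section \<open>Test functions adapted to a direction\<close>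

definition test_prod :: "(nat => real => real) => (nat => real => real) => real => nat => nat => real \<times> real => real" where
 "test_prod d e \<sigma> i j z = d i (fst z) * e j (snd z + \<sigma> * fst z)"

lemma lin_partials_test_prod:
 "lin_partials (1, 0) (\<sigma>, 1) d e [] i j = test_prod d e \<sigma> i j"
 "lin_partials (1, 0) (\<sigma>, 1) d e [(1, 0)] i j = (%z. test_prod d e \<sigma> (Suc i) j z + \<sigma> * test_prod d e \<sigma> i (Suc j) z)"
 "lin_partials (1, 0) (\<sigma>, 1) d e [(1, 0), (1, 0)] i j = (%z. test_prod d e \<sigma> (Suc (Suc i)) j z +
   2 * \<sigma> * test_prod d e \<sigma> (Suc i) (Suc j) z + \<sigma>^2 * test_prod d e \<sigma> i (Suc (Suc j)) z)"
 "lin_partials (1, 0) (\<sigma>, 1) d e [(0, 1), (0, 1)] i j = test_prod d e \<sigma> i (Suc (Suc j))"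
 by (auto simp: fun_eq_iff test_prod_def inner_prod_def algebra_simps power2_eq_square)

lemma test_prod_continuous:
 assumes "smooth_seq d" "smooth_seq e"
 shows "continuous_on A (test_prod d e \<sigma> i j)"
 unfolding test_prod_def[abs_def]
 by (intro continuous_intros continuous_on_compose2[OF smooth_seq_continuous[OF assms(1), of UNIV]]
   continuous_on_compose2[OF smooth_seq_continuous[OF assms(2), of UNIV]]) auto

definition sheared_box :: "real => real => real => real => real => (real \<times> real) set" where
 "sheared_box \<sigma> \<alpha> \<beta> \<gamma> \<delta> = {z. fst z \<in> {\<alpha>..\<beta>} & snd z + \<sigma> * fst z \<in> {\<gamma>..\<delta>}}"

lemma compact_sheared_box: "compact (sheared_box \<sigma> \<alpha> \<beta> \<gamma> \<delta>)"
proof -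
 have "sheared_box \<sigma> \<alpha> \<beta> \<gamma> \<delta> = (%z. (fst z, snd z - \<sigma> * fst z)) ` ({\<alpha>..\<beta>} \<times> {\<gamma>..\<delta>})"
 proof (intro equalityI subsetI)
  fix z assume "z \<in> sheared_box \<sigma> \<alpha> \<beta> \<gamma> \<delta>"
  then show "z \<in> (%z. (fst z, snd z - \<sigma> * fst z)) ` ({\<alpha>..\<beta>} \<times> {\<gamma>..\<delta>})"
   by (intro image_eqI[of _ _ "(fst z, snd z + \<sigma> * fst z)"]) (auto simp: sheared_box_def)
 qed (auto simp: sheared_box_def)
 moreover have "compact ..."
  by (intro compact_continuous_image compact_Times continuous_intros) auto
 ultimately show ?thesis by simp
qed

lemma test_prod_support:
 assumes "smooth_seq d" "smooth_seq e" "!!t. t ~: {\<alpha>..\<beta>} ==> d 0 t = 0" "!!y. y ~: {\<gamma>..\<delta>} ==> e 0 y = 0"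
  and z: "z ~: sheared_box \<sigma> \<alpha> \<beta> \<gamma> \<delta>"
 shows "test_prod d e \<sigma> i j z = 0"
proof -
 have "d i t = 0" if "t ~: {\<alpha>..\<beta>}" for t using smooth_seq_support[OF assms(1) _ that] assms(3) by blast
 moreover have "e j y = 0" if "y ~: {\<gamma>..\<delta>}" for y using smooth_seq_support[OF assms(2) _ that] assms(4) by blast
 ultimately show ?thesis using z by (auto simp: sheared_box_def test_prod_def)
qed

lemma integrable_test_prod:
 fixes f :: "real \<times> real => real"
 assumes d: "smooth_seq d" and e: "smooth_seq e" and d0: "!!t. t ~: {\<alpha>..\<beta>} ==> d 0 t = 0" and e0: "!!y. y ~: {\<gamma>..\<delta>} ==> e 0 y = 0"
  and f: "lint (%z. indicator (sheared_box \<sigma> \<alpha> \<beta> \<gamma> \<delta>) z * f z)"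
 shows "lint (%z. f z * test_prod d e \<sigma> i j z)"
proof -
 let ?K = "sheared_box \<sigma> \<alpha> \<beta> \<gamma> \<delta>"
 have c: "continuous_on A (test_prod d e \<sigma> i j)" for A by (rule test_prod_continuous[OF d e])
 have tz: "test_prod d e \<sigma> i j z = 0" if "z ~: ?K" for z using test_prod_support[OF d e d0 e0 that] by blast
 have "bounded (test_prod d e \<sigma> i j ` ?K)"
  by (intro compact_imp_bounded compact_continuous_image c compact_sheared_box)
 then obtain B where B: "B > 0" "!!z. z \<in> ?K ==> \<bar>test_prod d e \<sigma> i j z\<bar> <= B"
  by (auto simp: bounded_pos)
 have b: "\<bar>test_prod d e \<sigma> i j z\<bar> <= B" for z using B tz[of z] by (cases "z \<in> ?K") auto
 have "lint (%z. (indicator ?K z * f z) * test_prod d e \<sigma> i j z)"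
  by (rule integrable_mult_bounded[OF f _ b]) (use borel_measurable_continuous_onI[OF c] in simp)
 also have "(%z. (indicator ?K z * f z) * test_prod d e \<sigma> i j z) = (%z. f z * test_prod d e \<sigma> i j z)"
 proof
  fix z show "(indicator ?K z * f z) * test_prod d e \<sigma> i j z = f z * test_prod d e \<sigma> i j z"
   using tz[of z] by (cases "z \<in> ?K") auto
 qed
 finally show ?thesis .
qed

lemma locally_integrable_lborel:
 assumes S: "open S" and f: "locally_integrable S f" and ff: "AE z in lebesgue_on S. f z = f' z"
  and f': "f' \<in> BM" and K: "compact K" "K \<subseteq> S"
 shows "lint (%z. indicator K z * f' z :: real)"
proof -
 have "locally_integrable S f'" by (rule locally_integrable_cong_AE[OF _ f ff]) (use S in simp)
 then have "f' absolutely_integrable_on K" using K unfolding locally_integrable_def by blast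
 then show ?thesis using f' K by (simp add: absolutely_integrable_on_borel borel_compact)
qed

text \<open>Brings the weak formulation into working form: Borel representatives replace the
  functions, and since the test function vanishes outside the sheared box, integrals over
  \<open>S\<close> become integrals over the plane.\<close>

lemma weak_test_prod:
 fixes S :: "(real \<times> real) set"
 assumes S: "open S" and w: "has_weak_deriv S bs f g" and bs: "bs \<in> lists Basis"
  and ff: "AE z in lebesgue_on S. f z = f' z" and gg: "AE z in lebesgue_on S. g z = g' z"
  and f': "f' \<in> BM" and g': "g' \<in> BM"
  and d: "smooth_seq d" and e: "smooth_seq e" and d0: "!!t. t ~: {\<alpha>..\<beta>} ==> d 0 t = 0" and e0: "!!y. y ~: {\<gamma>..\<delta>} ==> e 0 y = 0"
  and K: "sheared_box \<sigma> \<alpha> \<beta> \<gamma> \<delta> \<subseteq> S"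
 shows "(LINT z|lborel. f' z * lin_partials (1, 0) (\<sigma>, 1) d e bs 0 0 z) =
  (-1) ^ length bs * (LINT z|lborel. g' z * test_prod d e \<sigma> 0 0 z)"
proof -
 let ?D = "%bs. lin_partials (1, 0) (\<sigma>, 1) d e bs 0 0" and ?K = "sheared_box \<sigma> \<alpha> \<beta> \<gamma> \<delta>"
 have D: "smooth_partials ?D" by (rule smooth_partials_lin[OF d e])
 have Dz: "lin_partials (1, 0) (\<sigma>, 1) d e cs i j z = 0" if "z ~: ?K" for cs i j z
 proof (induction cs arbitrary: i j)
  case Nil
  then show ?case using test_prod_support[OF d e d0 e0 that] unfolding lin_partials_test_prod(1) by blast
 qed simp
 have conv: "(LINT z|lebesgue_on S. h z * ?D cs z) = (LINT z|lborel. h' z * ?D cs z)"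
  if h: "locally_integrable S h" "AE z in lebesgue_on S. h z = h' z" "h' \<in> BM" and cs: "cs \<in> lists Basis" for h h' cs
 proof -
  have Dm: "?D cs \<in> BM"
   using smooth_partials_continuous[OF D cs, of UNIV] by (rule borel_measurable_continuous_onI)
  then have Dm': "?D cs \<in> borel_measurable (lebesgue_on S)"
   by (simp add: measurable_completion measurable_restrict_space1)
  have "(LINT z|lebesgue_on S. h z * ?D cs z) = (LINT z|lebesgue_on S. h' z * ?D cs z)"
   by (rule LINT_lebesgue_on_cong_AE)
    (use S h(2) Dm' locally_integrable_measurable[OF S h(1)] in \<open>auto elim!: eventually_mono\<close>)
  also have "... = (LINT z|lborel. indicator S z * (h' z * ?D cs z))"
   using S h(3) Dm by (intro LINT_lebesgue_on) auto
  also have "... = (LINT z|lborel. h' z * ?D cs z)"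
  proof (rule LINT_cong[OF refl])
   fix z show "indicator S z * (h' z * ?D cs z) = h' z * ?D cs z"
    using Dz[of z cs 0 0] K by (cases "z \<in> S") auto
  qed
  finally show ?thesis .
 qed
 have "(LINT z|lebesgue_on S. f z * ?D bs z) = (-1) ^ length bs * (LINT z|lebesgue_on S. g z * ?D [] z)"
  by (rule has_weak_derivD[OF w D compact_sheared_box K]) (rule Dz)
 moreover have "locally_integrable S f" "locally_integrable S g" using w unfolding has_weak_deriv_def by auto
 ultimately show ?thesis
  using conv[OF _ ff f' bs] conv[OF _ gg g', of "[]"] by (simp add: lin_partials_test_prod(1))
qed

section \<open>Time slices of functions on the rectangle\<close>

lemma AE_slices:
 assumes "AE z in lborel. P (z :: real \<times> real)"
 shows "AE t in lborel. AE x in lborel. P (t, x)"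
 by (rule lborel_pair.AE_pair) (unfold lborel_prod, rule assms)

lemma AE_of_slices:
 assumes "{z. P z} \<in> sets (borel :: (real \<times> real) measure)" and "AE t in lborel. AE x in lborel. P (t, x)"
 shows "AE z in lborel. P z"
proof -
 have "AE z in lborel \<Otimes>\<^sub>M lborel. P z"
 proof (rule lborel_pair.AE_pair_measure)
  show "{z \<in> space (lborel \<Otimes>\<^sub>M lborel). P z} \<in> sets (lborel \<Otimes>\<^sub>M lborel)"
   unfolding lborel_prod using assms(1) by simp
 qed (rule assms(2))
 then show ?thesis unfolding lborel_prod .
qed

lemma slice_borel:
 assumes "f \<in> borel_measurable (borel :: (real \<times> real) measure)"
 shows "(%x. f (t, x)) \<in> BM"
 using borel_measurable_pair[OF assms] by measurable

lemma Linf_BochnerD: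
 assumes "u \<in> Linf_Bochner I X N"
 obtains C where "AE t in lebesgue_on I. u t \<in> X" "AE t in lebesgue_on I. N (u t) <= C"
 using assms unfolding Linf_Bochner_def by blast

text \<open>One triple per time slice, so that a single choice provides all representatives; the
  derivatives \<open>g\<close> and \<open>k\<close>, of which only the norms matter, remain
  quantified.\<close>

definition good_slice :: "real => (real => real) => (real => real) => (real => real) \<times> (real => real) \<times> (real => real) => bool" where
 "good_slice C v w = (%(F, G, W).
   (EX g k. ac_deriv 0 1 F G & ac_deriv 0 1 G g & ac_deriv 0 1 W k &
    (AE x in lebesgue_on \<Omega>. v x = F x) & (AE x in lebesgue_on \<Omega>. w x = W x) &
    (LINT x|lborel. indicator {0..1} x * (F x)^2) <= C^2 & (LINT x|lborel. indicator {0..1} x * (G x)^2) <= C^2 &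
    (LINT x|lborel. indicator {0..1} x * (g x)^2) <= C^2 & (LINT x|lborel. indicator {0..1} x * (W x)^2) <= C^2 &
    (LINT x|lborel. indicator {0..1} x * (k x)^2) <= C^2))"

lemma LINT_indicator_square_nonneg: "(LINT x|lborel. indicator S x * (F x)^2) >= (0::real)"
 by (intro Bochner_Integration.integral_nonneg) auto

lemma good_slice_exists:
 assumes v: "v \<in> Sobolev 2 \<Omega>" "Sobolev_norm 2 \<Omega> v <= C" and w: "w \<in> Sobolev 1 \<Omega>" "Sobolev_norm 1 \<Omega> w <= C"
 shows "EX r. good_slice C v w r"
proof -
 obtain F G g where F: "ac_deriv 0 1 F G" "ac_deriv 0 1 G g" "AE x in lebesgue_on \<Omega>. v x = F x"
  using Sobolev2_rep[OF zero_less_one v(1)] by blast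
 obtain W k where W: "ac_deriv 0 1 W k" "AE x in lebesgue_on \<Omega>. w x = W x"
  using Sobolev1_rep[OF zero_less_one w(1)] by blast
 have "0 <= Sobolev_norm 2 \<Omega> v" "0 <= Sobolev_norm 1 \<Omega> w"
  unfolding Sobolev_norm_def by (auto intro!: sum_nonneg)
 then have "(Sobolev_norm 2 \<Omega> v)^2 <= C^2" "(Sobolev_norm 1 \<Omega> w)^2 <= C^2"
  using v(2) w(2) by (auto intro!: power_mono)
 then have "good_slice C v w (F, G, W)"
  unfolding good_slice_def Sobolev_norm_2_sq[OF zero_less_one F] Sobolev_norm_1_sq[OF zero_less_one W]
  using F W LINT_indicator_square_nonneg[of "{0..1}" F] LINT_indicator_square_nonneg[of "{0..1}" G]
   LINT_indicator_square_nonneg[of "{0..1}" g] LINT_indicator_square_nonneg[of "{0..1}" W]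
   LINT_indicator_square_nonneg[of "{0..1}" k]
  unfolding prod.case by (intro exI[of _ g] exI[of _ k]) linarith
 then show ?thesis by blast
qed

lemma sheared_box_0: "sheared_box 0 \<alpha> \<beta> \<gamma> \<delta> = {\<alpha>..\<beta>} \<times> {\<gamma>..\<delta>}"
 by (auto simp: sheared_box_def)

lemma slice_LINT_cong:
 fixes f :: "real => real"
 assumes [measurable]: "f \<in> BM" and "continuous_on {0..1} F"
  and eq: "AE x in lborel. x \<in> \<Omega> --> f x = F x" and \<psi>[measurable]: "\<psi> \<in> BM"
  and \<psi>0: "!!x. x ~: \<Omega> ==> \<psi> x = (0::real)"
 shows "(LINT x|lborel. f x * \<psi> x) = (LINT x|lborel. F x * \<psi> x)"
proof -
 have [measurable]: "(%x. indicator {0..1} x * F x) \<in> BM"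
  by (rule borel_indicator_mult_continuous[OF _ assms(2)]) simp
 have "(LINT x|lborel. f x * \<psi> x) = (LINT x|lborel. (indicator {0..1} x * F x) * \<psi> x)"
 proof (rule integral_cong_AE)
  show "AE x in lborel. f x * \<psi> x = (indicator {0..1} x * F x) * \<psi> x"
   using eq
  proof eventually_elim
   case (elim x)
   then show ?case using \<psi>0[of x] by (cases "x \<in> \<Omega>") auto
  qed
 qed measurable
 also have "... = (LINT x|lborel. F x * \<psi> x)"
 proof (rule LINT_cong[OF refl])
  fix x show "(indicator {0..1} x * F x) * \<psi> x = F x * \<psi> x"
   using \<psi>0[of x] by (cases "x \<in> {0..1}") auto
 qed
 finally show ?thesis .
qed

lemma ac_parts_test:
 assumes F: "ac_deriv 0 1 F G" and e: "smooth_seq e" and e0: "!!y. y ~: \<Omega> ==> e 0 y = 0" and Gc: "continuous_on {0..1} G"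
 shows "(LINT x|lborel. F x * e 1 x) = - (LINT x|lborel. G x * e 0 x)"
proof -
 have e0': "e 0 y = 0" if "y ~: {0..1}" for y using that by (intro e0) auto
 have z: "e j y = 0" if "y ~: {0..1}" for j y using smooth_seq_support[OF e _ that] e0' by blast
 have ec: "continuous_on A (e j)" for A j by (rule smooth_seq_continuous[OF e])
 have E: "ac_deriv 0 1 (e 0) (%x. indicator {0..1} x * e 1 x)"
  by (rule ac_deriv_C1) (use smooth_seqD[OF e, of 0] ec in \<open>auto intro: has_field_derivative_at_within\<close>)
 have ind: "(LINT x|lborel. h x * e j x) = (LINT x|lborel. indicator {0..1} x * (h x * e j x))" for h j
 proof (rule LINT_cong[OF refl])
  fix x show "h x * e j x = indicator {0..1} x * (h x * e j x)"
   using z[of x j] by (cases "x \<in> {0..1}") auto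
 qed
 have "(LINT s|lborel. indicator {0..1} s * (G s * e 0 s + F s * (indicator {0..1} s * e 1 s))) = 0"
  using ac_deriv_parts[OF F E] e0[of 0] e0[of 1] by simp
 also have "(LINT s|lborel. indicator {0..1} s * (G s * e 0 s + F s * (indicator {0..1} s * e 1 s))) =
   (LINT s|lborel. indicator {0..1} s * (G s * e 0 s) + indicator {0..1} s * (F s * e 1 s))"
  by (rule LINT_cong[OF refl]) (auto simp: indicator_def)
 also have "... = (LINT s|lborel. indicator {0..1} s * (G s * e 0 s)) + (LINT s|lborel. indicator {0..1} s * (F s * e 1 s))"
  by (intro Bochner_Integration.integral_add integrable_indicator_continuous continuous_intros Gc ec ac_deriv_continuous[OF F])
 finally show ?thesis unfolding ind by simp
qed

text \<open>Hoelder bounds in space come from the uniform Sobolev norms. In time, the moments of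
  \<open>v\<close> are Lipschitz because of \<open>vt\<close>, and those of \<open>vt\<close>
  because of \<open>vtt\<close>. The space derivative has no such identity; integration by parts in
  space leads its moments back to \<open>v\<close>.\<close>

lemma solution_slices:
 fixes v vt vtt :: "real => real => real"
 assumes T: "T > 0"
  and w1: "has_weak_deriv ({0<..<T} \<times> \<Omega>) [(1,0)] (%(t,x). v t x) (%(t,x). vt t x)"
  and w2: "has_weak_deriv ({0<..<T} \<times> \<Omega>) [(1,0),(1,0)] (%(t,x). v t x) (%(t,x). vtt t x)"
  and v: "v \<in> Linf_Bochner {0<..<T} (Sobolev 2 \<Omega>) (Sobolev_norm 2 \<Omega>)"
  and vt: "vt \<in> Linf_Bochner {0<..<T} (Sobolev 1 \<Omega>) (Sobolev_norm 1 \<Omega>)"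
  and vtt: "vtt \<in> Linf_Bochner {0<..<T} (L2 \<Omega>) (L2_norm \<Omega>)"
 obtains V W X N where
  "cont (%(t, x). V t x)" "cont (%(t, x). W t x)" "cont (%(t, x). X t x)"
  "AE t in lborel. t \<in> {0<..<T} --> t \<in> N" "N \<subseteq> {0<..<T}"
  "!!t. t \<in> N ==> AE x in lebesgue_on \<Omega>. v t x = V t x"
  "!!t. t \<in> N ==> AE x in lebesgue_on \<Omega>. vt t x = W t x"
  "!!t x. t \<in> N ==> x \<in> {0..1} ==> (V t has_real_derivative X t x) (at x within {0..1})"
  "!!t. t \<in> N ==> AE x in lebesgue_on \<Omega>. weak_deriv \<Omega> 1 (v t) x = X t x"
  "AE z in lebesgue_on ({0<..<T} \<times> \<Omega>). v (fst z) (snd z) = V (fst z) (snd z)"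
  "AE z in lebesgue_on ({0<..<T} \<times> \<Omega>). vt (fst z) (snd z) = W (fst z) (snd z)"
proof -
 let ?R = "{0<..<T} \<times> \<Omega>"
 have R: "open ?R" "?R \<in> sets borel" by (auto intro!: open_Times borel_open)
 obtain C1 where C1: "AE t in lebesgue_on {0<..<T}. v t \<in> Sobolev 2 \<Omega>" "AE t in lebesgue_on {0<..<T}. Sobolev_norm 2 \<Omega> (v t) <= C1"
  using Linf_BochnerD[OF v] .
 obtain C2 where C2: "AE t in lebesgue_on {0<..<T}. vt t \<in> Sobolev 1 \<Omega>" "AE t in lebesgue_on {0<..<T}. Sobolev_norm 1 \<Omega> (vt t) <= C2"
  using Linf_BochnerD[OF vt] .
 obtain C3 where C3: "AE t in lebesgue_on {0<..<T}. vtt t \<in> L2 \<Omega>" "AE t in lebesgue_on {0<..<T}. L2_norm \<Omega> (vtt t) <= C3"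
  using Linf_BochnerD[OF vtt] .
 define C where "C = max 1 (max C1 (max C2 C3))"
 have C: "C > 0" "C1 <= C" "C2 <= C" "C3 <= C" by (auto simp: C_def)
 have locs: "locally_integrable ?R (%(t,x). v t x)" "locally_integrable ?R (%(t,x). vt t x)" "locally_integrable ?R (%(t,x). vtt t x)"
  using w1 w2 unfolding has_weak_deriv_def by auto
 obtain vB where vB: "vB \<in> BM" "AE z in lebesgue_on ?R. (%(t,x). v t x) z = vB z"
  by (rule borel_representative[OF R(2) locally_integrable_measurable[OF R(1) locs(1)]]) blast
 obtain wB where wB: "wB \<in> BM" "AE z in lebesgue_on ?R. (%(t,x). vt t x) z = wB z"
  by (rule borel_representative[OF R(2) locally_integrable_measurable[OF R(1) locs(2)]]) blast
 obtain aB where aB: "aB \<in> BM" "AE z in lebesgue_on ?R. (%(t,x). vtt t x) z = aB z"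
  by (rule borel_representative[OF R(2) locally_integrable_measurable[OF R(1) locs(3)]]) blast
 have slice: "AE t in lborel. t \<in> {0<..<T} --> (AE x in lborel. x \<in> \<Omega> --> q t x = qB (t, x))"
  if "AE z in lebesgue_on ?R. (%(t,x). q t x) z = qB z" for q :: "real => real => real" and qB
 proof -
  have "AE z in lborel. z \<in> ?R --> (%(t,x). q t x) z = qB z"
   using that by (simp add: AE_lebesgue_on[OF R(2)])
  from AE_slices[OF this] show ?thesis
   by eventually_elim (auto elim!: eventually_mono)
 qed
 have sl: "AE t in lborel. t \<in> {0<..<T} --> (AE x in lborel. x \<in> \<Omega> --> v t x = vB (t, x))"
  "AE t in lborel. t \<in> {0<..<T} --> (AE x in lborel. x \<in> \<Omega> --> vt t x = wB (t, x))"
  "AE t in lborel. t \<in> {0<..<T} --> (AE x in lborel. x \<in> \<Omega> --> vtt t x = aB (t, x))"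
  by (rule slice[OF vB(2)], rule slice[OF wB(2)], rule slice[OF aB(2)])
 have normal: "AE t in lborel. t \<in> {0<..<T} --> (EX r. good_slice C (v t) (vt t) r) & vtt t \<in> L2 \<Omega> & L2_norm \<Omega> (vtt t) <= C"
  using C1[unfolded AE_lebesgue_on_Ioo]
   C2[unfolded AE_lebesgue_on_Ioo]
   C3[unfolded AE_lebesgue_on_Ioo]
 proof eventually_elim
  case (elim t)
  show ?case
   using elim C good_slice_exists[of "v t" C "vt t"] by auto
 qed
 \<comment> \<open>The times at which all slicewise properties hold at once, a set of full measure
   in the time interval.\<close>
 define N0 where "N0 = {t \<in> {0<..<T}. (EX r. good_slice C (v t) (vt t) r) & vtt t \<in> L2 \<Omega> & L2_norm \<Omega> (vtt t) <= C &
   (AE x in lborel. x \<in> \<Omega> --> v t x = vB (t, x)) & (AE x in lborel. x \<in> \<Omega> --> vt t x = wB (t, x)) &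
   (AE x in lborel. x \<in> \<Omega> --> vtt t x = aB (t, x))}"
 have N0: "AE t in lborel. t \<in> {0<..<T} --> t \<in> N0"
  using sl normal by eventually_elim (auto simp: N0_def)
 have "\<forall>t\<in>N0. EX r. good_slice C (v t) (vt t) r" unfolding N0_def by blast
 from bchoice[OF this] obtain r where "\<forall>t\<in>N0. good_slice C (v t) (vt t) (r t)" ..
 define V0 X0 W0 where "V0 t = fst (r t)" and "X0 t = fst (snd (r t))" and "W0 t = snd (snd (r t))" for t
 have good: "good_slice C (v t) (vt t) (V0 t, X0 t, W0 t)" if "t \<in> N0" for t
  using \<open>\<forall>t\<in>N0. good_slice C (v t) (vt t) (r t)\<close> that by (simp add: V0_def X0_def W0_def)
 have V0: "ac_deriv 0 1 (V0 t) (X0 t)" "AE x in lebesgue_on \<Omega>. v t x = V0 t x" "AE x in lebesgue_on \<Omega>. vt t x = W0 t x"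
  "(LINT x|lborel. indicator {0..1} x * (V0 t x)^2) <= C^2" "(LINT x|lborel. indicator {0..1} x * (X0 t x)^2) <= C^2"
  "(LINT x|lborel. indicator {0..1} x * (W0 t x)^2) <= C^2" if "t \<in> N0" for t
  using good[OF that] unfolding good_slice_def by auto
 have X0: "EX g. ac_deriv 0 1 (X0 t) g & (LINT x|lborel. indicator {0..1} x * (g x)^2) <= C^2" if "t \<in> N0" for t
  using good[OF that] unfolding good_slice_def by auto
 have W0: "EX k. ac_deriv 0 1 (W0 t) k & (LINT x|lborel. indicator {0..1} x * (k x)^2) <= C^2" if "t \<in> N0" for t
  using good[OF that] unfolding good_slice_def by auto
 have cX: "continuous_on {0..1} (X0 t)" and cW: "continuous_on {0..1} (W0 t)" and cV: "continuous_on {0..1} (V0 t)" if "t \<in> N0" for t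
  using X0[OF that] W0[OF that] ac_deriv_continuous V0(1)[OF that] by blast+
 have hV: "\<bar>V0 t x - V0 t y\<bar> <= C * sqrt \<bar>x - y\<bar>" and hX: "\<bar>X0 t x - X0 t y\<bar> <= C * sqrt \<bar>x - y\<bar>"
  and hW: "\<bar>W0 t x - W0 t y\<bar> <= C * sqrt \<bar>x - y\<bar>" if t: "t \<in> N0" and xy: "x \<in> {0..1}" "y \<in> {0..1}" for t x y
  using ac_deriv_hoelder[OF V0(1)[OF t] xy C(1) V0(5)[OF t]] X0[OF t] W0[OF t] ac_deriv_hoelder[OF _ xy C(1)] by blast+
 have sq: "lint (%x. indicator {0..1} x * (f x)^2) & (LINT x|lborel. indicator {0..1} x * (f x)^2) <= C^2"
  if f[measurable]: "f \<in> BM" and h: "h \<in> L2 \<Omega>" "L2_norm \<Omega> h <= C" and eq: "AE x in lborel. x \<in> \<Omega> --> h x = f x" for f h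
 proof -
  have eq': "AE x in lebesgue_on \<Omega>. h x = f x" using eq by (simp add: AE_lebesgue_on)
  obtain h' where h': "h' \<in> BM" "AE x in lebesgue_on \<Omega>. h x = h' x"
   "lint (%x. indicator {0..1} x * (h' x)^2)"
   using L2_representative[OF h(1)] .
  note [measurable] = h'(1)
  have "AE x in lebesgue_on \<Omega>. h' x = f x" using eq' h'(2) by eventually_elim simp
  then have "AE x in lborel. x \<in> \<Omega> --> h' x = f x" by (simp add: AE_lebesgue_on)
  then have "AE x in lborel. indicator {0..1} x * (h' x)^2 = indicator {0..1} x * (f x)^2"
   using AE_lborel_singleton[of 0] AE_lborel_singleton[of 1]
   by eventually_elim (auto simp: indicator_def)
  then have "lint (%x. indicator {0..1} x * (f x)^2)"
   using h'(3) by (subst integrable_cong_AE[of _ _ "%x. indicator {0..1} x * (h' x)^2"]) (auto elim!: eventually_mono)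
  moreover have "(L2_norm \<Omega> h)^2 = (LINT x|lborel. indicator {0..1} x * (f x)^2)"
   by (rule L2_norm_sq[OF f eq'])
  moreover have "(L2_norm \<Omega> h)^2 <= C^2"
   using h(2) by (intro power_mono) (auto simp: L2_norm_def)
  ultimately show ?thesis by simp
 qed
 have sqc: "lint (%x. indicator {0..1} x * (f x)^2) & (LINT x|lborel. indicator {0..1} x * (f x)^2) <= C^2"
  if f: "f \<in> BM" and h: "continuous_on {0..1} H" "(LINT x|lborel. indicator {0..1} x * (H x)^2) <= C^2"
   and eq: "AE x in lborel. x \<in> \<Omega> --> h x = f x" "AE x in lebesgue_on \<Omega>. h x = H x" for f h H
 proof -
  have hB: "(%x. indicator {0..1} x * H x) \<in> BM"
   by (rule borel_indicator_mult_continuous[OF _ h(1)]) simp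
  have i: "indicator {0..1} x * (indicator {0..1} x * H x)^2 = indicator {0..1} x * (H x)^2" for x :: real
   by (auto simp: indicator_def)
  have e: "AE x in lebesgue_on \<Omega>. h x = indicator {0..1} x * H x"
  proof -
   have "AE x in lborel. x \<in> \<Omega> --> h x = H x" using eq(2) by (simp add: AE_lebesgue_on)
   then show ?thesis by (subst AE_lebesgue_on) (auto elim!: eventually_mono)
  qed
  have "h \<in> L2 \<Omega>"
   by (rule L2I[OF hB e]) (simp add: i integrable_square_continuous[OF h(1)])
  moreover have "(L2_norm \<Omega> h)^2 <= C^2" using L2_norm_sq[OF hB e] h(2) by (simp add: i)
  then have "L2_norm \<Omega> h <= C" using C(1) by (simp add: power2_le_iff_abs_le)
  ultimately show ?thesis by (intro sq[OF f _ _ eq(1)])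
 qed
 define M where "M = 1 + C^2"
 have bumpsupp: "bump 1 \<gamma> \<delta> x = 0" if "0 < \<gamma>" "\<delta> < 1" "x ~: \<Omega>" for \<gamma> \<delta> x
  using that by (intro bump_outside) auto
 have mb: "AE t in lborel. t \<in> {0<..<T} --> \<bar>LINT x|lborel. q (t, x) * bump 1 \<gamma> \<delta> x\<bar> <= M"
  if q: "q = vB \<or> q = wB \<or> q = aB" and \<gamma>\<delta>: "0 < \<gamma>" "\<delta> < 1" for q \<gamma> \<delta>
  using N0
 proof eventually_elim
  case (elim t)
  show ?case
  proof
   assume "t \<in> {0<..<T}"
   then have t: "t \<in> N0" using elim by simp
   have m: "(%x. q (t, x)) \<in> BM" using q vB(1) wB(1) aB(1) by (auto intro: slice_borel)
   have "lint (%x. indicator {0..1} x * (q (t, x))^2) & (LINT x|lborel. indicator {0..1} x * (q (t, x))^2) <= C^2"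
    using q
   proof (elim disjE)
    assume "q = vB" then show ?thesis using t by (intro sqc[OF m cV[OF t] V0(4)[OF t] _ V0(2)[OF t]]) (auto simp: N0_def)
   next
    assume "q = wB" then show ?thesis using t by (intro sqc[OF m cW[OF t] V0(6)[OF t] _ V0(3)[OF t]]) (auto simp: N0_def)
   next
    assume "q = aB" then show ?thesis using t by (intro sq[OF m, of "vtt t"]) (auto simp: N0_def)
   qed
   then show "\<bar>LINT x|lborel. q (t, x) * bump 1 \<gamma> \<delta> x\<bar> <= M"
    unfolding M_def using bumpsupp[OF \<gamma>\<delta>]
    by (intro moment_bound[OF m]) (auto intro: bump_nonneg bump_le_1)
  qed
 qed
 have loc_int: "lint (%z. indicator ({\<alpha>..\<beta>} \<times> {\<gamma>..\<delta>}) z * q z)"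
  if q: "q = vB \<or> q = wB \<or> q = aB" and "0 < \<alpha>" "\<beta> < T" "0 < \<gamma>" "\<delta> < 1" for q \<alpha> \<beta> \<gamma> \<delta>
 proof -
  have K: "compact ({\<alpha>..\<beta>} \<times> {\<gamma>..\<delta>})" "{\<alpha>..\<beta>} \<times> {\<gamma>..\<delta>} \<subseteq> ?R"
   using that by (auto intro!: compact_Times)
  show ?thesis
   using q locally_integrable_lborel[OF R(1) locs(1) vB(2,1) K] locally_integrable_lborel[OF R(1) locs(2) wB(2,1) K]
    locally_integrable_lborel[OF R(1) locs(3) aB(2,1) K] by blast
 qed
 \<comment> \<open>The identity between \<open>vt\<close> and \<open>vtt\<close> compares two weak
   derivatives of \<open>v\<close>: the first is tested with \<open>d'\<close>, the derivative of
   \<open>d\<close>, and the second with \<open>d\<close> itself.\<close>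
 have weak1: "(LINT z|lborel. vB z * (d 1 (fst z) * e 0 (snd z))) = - (LINT z|lborel. wB z * (d 0 (fst z) * e 0 (snd z)))"
  and weak2: "(LINT z|lborel. wB z * (d 1 (fst z) * e 0 (snd z))) = - (LINT z|lborel. aB z * (d 0 (fst z) * e 0 (snd z)))"
  if d: "smooth_seq d" and e: "smooth_seq e" and d0: "!!t. t ~: {\<alpha>..\<beta>} ==> d 0 t = 0" and e0: "!!y. y ~: {\<gamma>..\<delta>} ==> e 0 y = 0"
   and ab: "0 < \<alpha>" "\<beta> < T" "0 < \<gamma>" "\<delta> < 1" for d e \<alpha> \<beta> \<gamma> \<delta>
 proof -
  have K: "sheared_box 0 \<alpha> \<beta> \<gamma> \<delta> \<subseteq> ?R" using ab by (auto simp: sheared_box_0)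
  define d' where "d' k = d (Suc k)" for k
  have d': "smooth_seq d'" using d by (simp add: smooth_seq_def d'_def)
  have d'0: "d' 0 t = 0" if "t ~: {\<alpha>..\<beta>}" for t
   unfolding d'_def using smooth_seq_support[OF d _ that] d0 by blast
  have lists: "[(1,0)] \<in> lists (Basis :: (real \<times> real) set)" "[(1,0),(1,0)] \<in> lists (Basis :: (real \<times> real) set)"
   by (auto simp: Basis_prod_def)
  have A: "(LINT z|lborel. vB z * lin_partials (1, 0) (0, 1) d e [(1,0)] 0 0 z) =
    (-1) ^ length [(1,0)::real \<times> real] * (LINT z|lborel. wB z * test_prod d e 0 0 0 z)"
   by (rule weak_test_prod[OF R(1) w1 lists(1) vB(2) wB(2) vB(1) wB(1) d e d0 e0 K])
  then show "(LINT z|lborel. vB z * (d 1 (fst z) * e 0 (snd z))) = - (LINT z|lborel. wB z * (d 0 (fst z) * e 0 (snd z)))"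
   unfolding lin_partials_test_prod by (simp add: test_prod_def)
  have B: "(LINT z|lborel. vB z * lin_partials (1, 0) (0, 1) d' e [(1,0)] 0 0 z) =
    (-1) ^ length [(1,0)::real \<times> real] * (LINT z|lborel. wB z * test_prod d' e 0 0 0 z)"
   by (rule weak_test_prod[OF R(1) w1 lists(1) vB(2) wB(2) vB(1) wB(1) d' e d'0 e0 K])
  have C: "(LINT z|lborel. vB z * lin_partials (1, 0) (0, 1) d e [(1,0),(1,0)] 0 0 z) =
    (-1) ^ length [(1,0)::real \<times> real, (1,0)] * (LINT z|lborel. aB z * test_prod d e 0 0 0 z)"
   by (rule weak_test_prod[OF R(1) w2 lists(2) vB(2) aB(2) vB(1) aB(1) d e d0 e0 K])
  show "(LINT z|lborel. wB z * (d 1 (fst z) * e 0 (snd z))) = - (LINT z|lborel. aB z * (d 0 (fst z) * e 0 (snd z)))"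
   using B C unfolding lin_partials_test_prod by (simp add: test_prod_def d'_def numeral_2_eq_2)
 qed
 have lip: "EX E. (AE t in lborel. t \<in> {0<..<T} --> t \<in> E) & (\<forall>s\<in>E. \<forall>t\<in>E.
   \<bar>(LINT x|lborel. vB (t, x) * bump 1 \<gamma> \<delta> x) - (LINT x|lborel. vB (s, x) * bump 1 \<gamma> \<delta> x)\<bar> <= M * \<bar>t - s\<bar> &
   \<bar>(LINT x|lborel. wB (t, x) * bump 1 \<gamma> \<delta> x) - (LINT x|lborel. wB (s, x) * bump 1 \<gamma> \<delta> x)\<bar> <= M * \<bar>t - s\<bar>)"
  if \<gamma>\<delta>: "0 < \<gamma>" "\<delta> < 1" for \<gamma> \<delta>
 proof -
  obtain e where e: "smooth_seq e" "e 0 = bump 1 \<gamma> \<delta>" using bump_smooth_seq[of 1 \<gamma> \<delta>] by auto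
  have bc: "cont (bump 1 \<gamma> \<delta>)" by (rule bump_continuous) simp
  have b0: "bump 1 \<gamma> \<delta> x = 0" if "x ~: {\<gamma>..\<delta>}" for x using that by (intro bump_outside) auto
  have e0: "e 0 x = 0" if "x ~: {\<gamma>..\<delta>}" for x using b0[OF that] e by simp
  obtain E1 where E1: "AE t in lborel. t \<in> {0<..<T} --> t \<in> E1"
   "!!s t. s \<in> E1 ==> t \<in> E1 ==> \<bar>(LINT x|lborel. vB (t, x) * bump 1 \<gamma> \<delta> x) - (LINT x|lborel. vB (s, x) * bump 1 \<gamma> \<delta> x)\<bar> <= M * \<bar>t - s\<bar>"
  proof (rule moment_lipschitz[OF T vB(1) wB(1) bc b0, where M=M and \<gamma>=\<gamma> and \<delta>=\<delta>], goal_cases)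
   case (4 d \<alpha> \<beta>)
   show ?case using weak1[OF 4(5) e(1) 4(6) e0 4(2) 4(4) \<gamma>\<delta>] e(2) by simp
  qed (use loc_int[OF _ _ _ \<gamma>\<delta>] mb[OF _ \<gamma>\<delta>] in blast)+
  obtain E2 where E2: "AE t in lborel. t \<in> {0<..<T} --> t \<in> E2"
   "!!s t. s \<in> E2 ==> t \<in> E2 ==> \<bar>(LINT x|lborel. wB (t, x) * bump 1 \<gamma> \<delta> x) - (LINT x|lborel. wB (s, x) * bump 1 \<gamma> \<delta> x)\<bar> <= M * \<bar>t - s\<bar>"
  proof (rule moment_lipschitz[OF T wB(1) aB(1) bc b0, where M=M and \<gamma>=\<gamma> and \<delta>=\<delta>], goal_cases)
   case (4 d \<alpha> \<beta>)
   show ?case using weak2[OF 4(5) e(1) 4(6) e0 4(2) 4(4) \<gamma>\<delta>] e(2) by simp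
  qed (use loc_int[OF _ _ _ \<gamma>\<delta>] mb[OF _ \<gamma>\<delta>] in blast)+
  show ?thesis
  proof (intro exI[of _ "E1 \<inter> E2"] conjI ballI)
   show "AE t in lborel. t \<in> {0<..<T} --> t \<in> E1 \<inter> E2" using E1(1) E2(1) by eventually_elim simp
  qed (use E1(2) E2(2) in auto)
 qed
 \<comment> \<open>Each bump has its own exceptional set of times; rational end points leave
   countably many bumps and hence a common set of full measure.\<close>
 define Q where "Q = {(\<gamma> :: real, \<delta>). \<gamma> \<in> \<rat> & \<delta> \<in> \<rat> & 0 < \<gamma> & \<delta> < (1::real)}"
 have Qc: "countable Q"
  by (rule countable_subset[of _ "\<rat> \<times> \<rat>"]) (auto simp: Q_def intro: countable_rat)
 have "\<forall>q\<in>Q. EX E. (AE t in lborel. t \<in> {0<..<T} --> t \<in> E) & (\<forall>s\<in>E. \<forall>t\<in>E.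
   \<bar>(LINT x|lborel. vB (t, x) * bump 1 (fst q) (snd q) x) - (LINT x|lborel. vB (s, x) * bump 1 (fst q) (snd q) x)\<bar> <= M * \<bar>t - s\<bar> &
   \<bar>(LINT x|lborel. wB (t, x) * bump 1 (fst q) (snd q) x) - (LINT x|lborel. wB (s, x) * bump 1 (fst q) (snd q) x)\<bar> <= M * \<bar>t - s\<bar>)"
  using lip by (auto simp: Q_def)
 from bchoice[OF this] obtain E where E: "!!q. q \<in> Q ==> AE t in lborel. t \<in> {0<..<T} --> t \<in> E q"
  "!!q s t. q \<in> Q ==> s \<in> E q ==> t \<in> E q ==>
   \<bar>(LINT x|lborel. vB (t, x) * bump 1 (fst q) (snd q) x) - (LINT x|lborel. vB (s, x) * bump 1 (fst q) (snd q) x)\<bar> <= M * \<bar>t - s\<bar> &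
   \<bar>(LINT x|lborel. wB (t, x) * bump 1 (fst q) (snd q) x) - (LINT x|lborel. wB (s, x) * bump 1 (fst q) (snd q) x)\<bar> <= M * \<bar>t - s\<bar>"
  by blast
 define N where "N = {t \<in> N0. \<forall>q\<in>Q. t \<in> E q}"
 have NN0: "t \<in> N0" if "t \<in> N" for t using that by (simp add: N_def)
 have Nsub: "N \<subseteq> {0<..<T}" by (auto simp: N_def N0_def)
 have N: "AE t in lborel. t \<in> {0<..<T} --> t \<in> N"
 proof -
  have "AE t in lborel. \<forall>q\<in>Q. t \<in> {0<..<T} --> t \<in> E q"
   using E(1) by (subst AE_ball_countable[OF Qc]) auto
  then show ?thesis using N0 by eventually_elim (auto simp: N_def)
 qed
 have dense: "{0..T} \<subseteq> closure N" by (rule AE_imp_dense[OF T N])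
 have mom: "(LINT x|lborel. (Z t x - Z s x) * bump 1 \<gamma> \<delta> x) =
   (LINT x|lborel. Z t x * bump 1 \<gamma> \<delta> x) - (LINT x|lborel. Z s x * bump 1 \<gamma> \<delta> x)"
  if "continuous_on {0..1} (Z t)" "continuous_on {0..1} (Z s)" "0 < \<gamma>" "\<delta> < 1" for Z :: "real => real => real" and t s \<gamma> \<delta>
  unfolding left_diff_distrib using that
  by (intro Bochner_Integration.integral_diff integrable_bump_mult) (auto intro: continuous_on_subset)
 have momV: "(LINT x|lborel. V0 t x * bump 1 \<gamma> \<delta> x) = (LINT x|lborel. vB (t, x) * bump 1 \<gamma> \<delta> x)"
  and momW: "(LINT x|lborel. W0 t x * bump 1 \<gamma> \<delta> x) = (LINT x|lborel. wB (t, x) * bump 1 \<gamma> \<delta> x)"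
  if t: "t \<in> N" and \<gamma>\<delta>: "0 < \<gamma>" "\<delta> < 1" for t \<gamma> \<delta>
 proof -
  have t0: "t \<in> N0" using NN0[OF t] .
  have "AE x in lborel. x \<in> \<Omega> --> v t x = V0 t x" "AE x in lborel. x \<in> \<Omega> --> v t x = vB (t, x)"
   using V0(2)[OF t0] t0 by (auto simp: AE_lebesgue_on N0_def)
  then have "AE x in lborel. x \<in> \<Omega> --> vB (t, x) = V0 t x" by eventually_elim simp
  from slice_LINT_cong[OF slice_borel[OF vB(1)] cV[OF t0] this bump_borel bumpsupp[OF \<gamma>\<delta>]]
  show "(LINT x|lborel. V0 t x * bump 1 \<gamma> \<delta> x) = (LINT x|lborel. vB (t, x) * bump 1 \<gamma> \<delta> x)" by simp
  have "AE x in lborel. x \<in> \<Omega> --> vt t x = W0 t x" "AE x in lborel. x \<in> \<Omega> --> vt t x = wB (t, x)"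
   using V0(3)[OF t0] t0 by (auto simp: AE_lebesgue_on N0_def)
  then have "AE x in lborel. x \<in> \<Omega> --> wB (t, x) = W0 t x" by eventually_elim simp
  from slice_LINT_cong[OF slice_borel[OF wB(1)] cW[OF t0] this bump_borel bumpsupp[OF \<gamma>\<delta>]]
  show "(LINT x|lborel. W0 t x * bump 1 \<gamma> \<delta> x) = (LINT x|lborel. wB (t, x) * bump 1 \<gamma> \<delta> x)" by simp
 qed
 have M: "M > 0" by (simp add: M_def add_pos_nonneg)
 have small: "\<exists>\<eta>>0. \<forall>t\<in>N. \<forall>s\<in>N. \<bar>t - s\<bar> < \<eta> --> \<bar>LINT x|lborel. (Z t x - Z s x) * bump 1 \<gamma> \<delta> x\<bar> <= \<epsilon>"
  if Z: "Z = V0 \<or> Z = W0" and \<gamma>\<delta>: "\<gamma> \<in> \<rat>" "\<delta> \<in> \<rat>" "0 < \<gamma>" "\<gamma> < \<delta>" "\<delta> < 1" and \<epsilon>: "\<epsilon> > 0" for Z \<gamma> \<delta> \<epsilon>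
 proof (intro exI[of _ "\<epsilon> / M"] conjI ballI impI)
  show "\<epsilon> / M > 0" using \<epsilon> M by simp
  fix t s assume ts: "t \<in> N" "s \<in> N" "\<bar>t - s\<bar> < \<epsilon> / M"
  have q: "(\<gamma>, \<delta>) \<in> Q" using \<gamma>\<delta> by (simp add: Q_def)
  have tE: "t \<in> E (\<gamma>, \<delta>)" "s \<in> E (\<gamma>, \<delta>)" using ts q by (auto simp: N_def)
  have "M * \<bar>t - s\<bar> <= \<epsilon>" using ts(3) M by (simp add: field_simps)
  then show "\<bar>LINT x|lborel. (Z t x - Z s x) * bump 1 \<gamma> \<delta> x\<bar> <= \<epsilon>"
   using Z E(2)[OF q tE(2,1)] momV[OF ts(1) \<gamma>\<delta>(3,5)] momV[OF ts(2) \<gamma>\<delta>(3,5)] momW[OF ts(1) \<gamma>\<delta>(3,5)] momW[OF ts(2) \<gamma>\<delta>(3,5)]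
    mom[of Z t s \<gamma> \<delta>] cV[OF NN0[OF ts(1)]] cV[OF NN0[OF ts(2)]] cW[OF NN0[OF ts(1)]] cW[OF NN0[OF ts(2)]] \<gamma>\<delta>
   by auto
 qed
 obtain V where V: "cont (%(t, x). V t x)" "!!t x. t \<in> N \<inter> {0..T} ==> x \<in> {0..1} ==> V t x = V0 t x"
  using continuous_extension_of_slices[OF T dense C(1) hV[OF NN0] small[of V0]] by blast
 obtain W where W: "cont (%(t, x). W t x)" "!!t x. t \<in> N \<inter> {0..T} ==> x \<in> {0..1} ==> W t x = W0 t x"
  using continuous_extension_of_slices[OF T dense C(1) hW[OF NN0] small[of W0]] by blast
 have NT: "t \<in> N \<inter> {0..T}" if "t \<in> N" for t using that Nsub by auto
 have Vuc: "\<exists>\<eta>>0. \<forall>t\<in>N. \<forall>s\<in>N. \<bar>t - s\<bar> < \<eta> --> (\<forall>x\<in>{0..1}. \<bar>V0 t x - V0 s x\<bar> <= \<epsilon>)" if \<epsilon>: "\<epsilon> > 0" for \<epsilon>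
 proof -
  have "uniformly_continuous_on ({0..T} \<times> {0..1}) (%(t, x). V t x)"
   by (intro compact_uniformly_continuous continuous_on_subset[OF V(1)] compact_Times) auto
  then obtain \<eta> where \<eta>: "\<eta> > 0" "!!z z'. z \<in> {0..T} \<times> {0..1} ==> z' \<in> {0..T} \<times> {0..1} ==> dist z' z < \<eta> ==>
    dist ((%(t, x). V t x) z') ((%(t, x). V t x) z) < \<epsilon>"
   using \<epsilon> unfolding uniformly_continuous_on_def by blast
  have "\<bar>V0 t x - V0 s x\<bar> <= \<epsilon>" if "t \<in> N" "s \<in> N" "\<bar>t - s\<bar> < \<eta>" "x \<in> {0..1}" for t s x
  proof -
   have "dist (t, x) (s, x) < \<eta>" using that(3) by (simp add: dist_Pair_Pair dist_real_def)
   then have "dist (V t x) (V s x) < \<epsilon>" using \<eta>(2)[of "(s, x)" "(t, x)"] that NT[OF that(1)] NT[OF that(2)] by auto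
   then show ?thesis using V(2)[OF NT[OF that(1)] that(4)] V(2)[OF NT[OF that(2)] that(4)] by (simp add: dist_real_def)
  qed
  then show ?thesis using \<eta>(1) by blast
 qed
 \<comment> \<open>Integration by parts in space moves the derivative onto the bump, after which the
   uniform continuity of the slices of \<open>v\<close> in time applies.\<close>
 have smallX: "\<exists>\<eta>>0. \<forall>t\<in>N. \<forall>s\<in>N. \<bar>t - s\<bar> < \<eta> --> \<bar>LINT x|lborel. (X0 t x - X0 s x) * bump 1 \<gamma> \<delta> x\<bar> <= \<epsilon>"
  if \<gamma>\<delta>: "\<gamma> \<in> \<rat>" "\<delta> \<in> \<rat>" "0 < \<gamma>" "\<gamma> < \<delta>" "\<delta> < 1" and \<epsilon>: "\<epsilon> > 0" for \<gamma> \<delta> \<epsilon>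
 proof -
  obtain e where e: "smooth_seq e" "e 0 = bump 1 \<gamma> \<delta>" using bump_smooth_seq[of 1 \<gamma> \<delta>] by auto
  have e0: "e 0 y = 0" if "y ~: \<Omega>" for y using bumpsupp[OF \<gamma>\<delta>(3,5) that] e by simp
  have e01: "e 0 y = 0" if "y ~: {0..1}" for y using that by (intro e0) auto
  obtain B where B: "B > 0" "!!x. \<bar>e 1 x\<bar> <= B" using smooth_seq_bounded[OF e(1) e01] by blast
  obtain \<eta> where \<eta>: "\<eta> > 0" "!!t s x. t \<in> N ==> s \<in> N ==> \<bar>t - s\<bar> < \<eta> ==> x \<in> {0..1} ==> \<bar>V0 t x - V0 s x\<bar> <= \<epsilon> / B"
   using Vuc[of "\<epsilon> / B"] \<epsilon> B by auto
  have ec: "continuous_on A (e j)" for A j by (rule smooth_seq_continuous[OF e(1)])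
  have ez: "e j y = 0" if "y ~: {0..1}" for j y using smooth_seq_support[OF e(1) _ that] e01 by blast
  have "\<bar>LINT x|lborel. (X0 t x - X0 s x) * bump 1 \<gamma> \<delta> x\<bar> <= \<epsilon>" if ts: "t \<in> N" "s \<in> N" "\<bar>t - s\<bar> < \<eta>" for t s
  proof -
   have cVd: "continuous_on {0..1} (%x. V0 t x - V0 s x)" "continuous_on {0..1} (%x. X0 t x - X0 s x)"
    by (intro continuous_intros cV cX NN0 ts)+
   have "(LINT x|lborel. (V0 t x - V0 s x) * e 1 x) = - (LINT x|lborel. (X0 t x - X0 s x) * e 0 x)"
    by (rule ac_parts_test[OF ac_deriv_diff_fun[OF V0(1) V0(1)] e(1) e0 cVd(2)]) (use NN0 ts in auto)
   then have "\<bar>LINT x|lborel. (X0 t x - X0 s x) * bump 1 \<gamma> \<delta> x\<bar> = \<bar>LINT x|lborel. (V0 t x - V0 s x) * e 1 x\<bar>"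
    by (simp add: e(2))
   also have "(LINT x|lborel. (V0 t x - V0 s x) * e 1 x) = (LINT x|lborel. indicator {0..1} x * ((V0 t x - V0 s x) * e 1 x))"
   proof (rule LINT_cong[OF refl])
    fix x show "(V0 t x - V0 s x) * e 1 x = indicator {0..1} x * ((V0 t x - V0 s x) * e 1 x)"
     using ez[of x 1] by (cases "x \<in> {0..1}") auto
   qed
   also have "\<bar>...\<bar> <= (LINT x|lborel. \<bar>indicator {0..1} x * ((V0 t x - V0 s x) * e 1 x)\<bar>)"
    by (rule integral_abs_bound)
   also have "... <= (LINT x|lborel. \<epsilon> * indicator {0..1::real} x)"
   proof (rule integral_mono)
    show "lint (%x. \<bar>indicator {0..1} x * ((V0 t x - V0 s x) * e 1 x)\<bar>)"
     by (intro integrable_abs integrable_indicator_continuous continuous_intros cVd ec)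
    fix x :: real
    show "\<bar>indicator {0..1} x * ((V0 t x - V0 s x) * e 1 x)\<bar> <= \<epsilon> * indicator {0..1} x"
    proof (cases "x \<in> {0..1}")
     case True
     have "\<bar>V0 t x - V0 s x\<bar> * \<bar>e 1 x\<bar> <= (\<epsilon> / B) * B"
      using \<eta>(2)[OF ts True] B \<epsilon> by (intro mult_mono) auto
     then show ?thesis using True B by (simp add: abs_mult)
    qed simp
   qed simp
   finally show ?thesis by simp
  qed
  then show ?thesis using \<eta>(1) by blast
 qed
 obtain X where X: "cont (%(t, x). X t x)" "!!t x. t \<in> N \<inter> {0..T} ==> x \<in> {0..1} ==> X t x = X0 t x"
  using continuous_extension_of_slices[OF T dense C(1) hX[OF NN0] smallX] by blast
 have eqV: "AE x in lebesgue_on \<Omega>. q x = K t x"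
  if "t \<in> N" "AE x in lebesgue_on \<Omega>. q x = L t x" "!!t x. t \<in> N \<inter> {0..T} ==> x \<in> {0..1} ==> K t x = L t x" for t q and K L :: "real => real => real"
 proof -
  have "AE x in lborel. x \<in> \<Omega> --> q x = L t x" using that(2) by (simp add: AE_lebesgue_on)
  then have "AE x in lborel. x \<in> \<Omega> --> q x = K t x"
   by eventually_elim (use that(3)[OF NT[OF that(1)]] in auto)
  then show ?thesis by (simp add: AE_lebesgue_on)
 qed
 \<comment> \<open>Equality on almost every slice gives equality almost everywhere on the rectangle
   once the set in question is Borel, hence the detour through \<open>qB\<close>.\<close>
 have joint: "AE z in lebesgue_on ?R. q (fst z) (snd z) = K (fst z) (snd z)"
  if K: "cont (%(t, x). K t x)" and qB: "qB \<in> BM" "AE z in lebesgue_on ?R. (%(t,x). q t x) z = qB z"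
   and sl: "!!t. t \<in> N ==> AE x in lborel. x \<in> \<Omega> --> q t x = qB (t, x)"
   and eq: "!!t. t \<in> N ==> AE x in lebesgue_on \<Omega>. q t x = K t x" for q K :: "real => real => real" and qB
 proof -
  have Km: "(%(t, x). K t x) \<in> BM" by (rule borel_measurable_continuous_onI[OF K])
  have "AE z in lborel. z \<in> ?R --> qB z = (%(t, x). K t x) z"
  proof (rule AE_of_slices)
   have "{z. qB z = (%(t, x). K t x) z} \<in> sets borel" using borel_measurable_eq[OF qB(1) Km] by simp
   then have "(- ?R) \<union> {z. qB z = (%(t, x). K t x) z} \<in> sets borel"
    using R(2) by (intro sets.Un borel_comp) auto
   moreover have "{z. z \<in> ?R --> qB z = (%(t, x). K t x) z} = (- ?R) \<union> {z. qB z = (%(t, x). K t x) z}" by auto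
   ultimately show "{z. z \<in> ?R --> qB z = (%(t, x). K t x) z} \<in> sets borel" by simp
   show "AE t in lborel. AE x in lborel. (t, x) \<in> ?R --> qB (t, x) = (%(t, x). K t x) (t, x)"
    using N
   proof eventually_elim
    case (elim t)
    show ?case
    proof (cases "t \<in> {0<..<T}")
     case True
     then have t: "t \<in> N" using elim by simp
     have "AE x in lborel. x \<in> \<Omega> --> q t x = K t x" using eq[OF t] by (simp add: AE_lebesgue_on)
     then show ?thesis using sl[OF t] by eventually_elim auto
    qed (auto intro!: AE_I2)
   qed
  qed
  then have "AE z in lebesgue_on ?R. qB z = (%(t, x). K t x) z" by (simp add: AE_lebesgue_on[OF R(2)])
  then show ?thesis using qB(2) by eventually_elim (auto simp: case_prod_unfold)
 qed
 have slN: "AE x in lborel. x \<in> \<Omega> --> v t x = vB (t, x)" "AE x in lborel. x \<in> \<Omega> --> vt t x = wB (t, x)" if "t \<in> N" for t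
  using NN0[OF that] by (auto simp: N0_def)
 have vV: "AE x in lebesgue_on \<Omega>. v t x = V t x" "AE x in lebesgue_on \<Omega>. vt t x = W t x" if "t \<in> N" for t
  by (rule eqV[where q="v t" and L=V0, OF that V0(2)[OF NN0[OF that]]], erule (1) V(2),
   rule eqV[where q="vt t" and L=W0, OF that V0(3)[OF NN0[OF that]]], erule (1) W(2))
 show ?thesis
 proof (rule that[OF V(1) W(1) X(1) N Nsub vV])
  show "AE z in lebesgue_on ?R. v (fst z) (snd z) = V (fst z) (snd z)"
   by (rule joint[OF V(1) vB slN(1) vV(1)])
  show "AE z in lebesgue_on ?R. vt (fst z) (snd z) = W (fst z) (snd z)"
   by (rule joint[OF W(1) wB slN(2) vV(2)])
  fix t assume t: "t \<in> N"
  have w: "has_weak_deriv \<Omega> [1] (v t) (X0 t)"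
   by (rule has_weak_deriv_cong_AE[OF _ _ has_weak_deriv_of_ac[OF V0(1)[OF NN0[OF t]] zero_less_one]])
    (use V0(2)[OF NN0[OF t]] in \<open>auto elim!: eventually_mono\<close>)
  show "AE x in lebesgue_on \<Omega>. weak_deriv \<Omega> 1 (v t) x = X t x"
   by (rule eqV[where L=X0, OF t _ X(2)]) (use weak_deriv_AE_eq[of 0 1 1 "v t" "X0 t"] w in auto)
  fix x :: real assume x: "x \<in> {0..1}"
  have "(V0 t has_real_derivative X0 t x) (at x within {0..1})"
   by (rule ac_deriv_DERIV[OF zero_less_one V0(1)[OF NN0[OF t]] cX[OF NN0[OF t]] x])
  then have "(V0 t has_real_derivative X t x) (at x within {0..1})"
   using X(2)[OF NT[OF t] x] by simp
  then show "(V t has_real_derivative X t x) (at x within {0..1})"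
   by (rule has_field_derivative_transform_within[OF _ zero_less_one x]) (use V(2)[OF NT[OF t]] in auto)
 qed
qed

section \<open>From the weak equation to the characteristics\<close>

lemma LINT_pair_compact_support:
 fixes f :: "real \<times> real => real"
 assumes "cont f" "compact K" "!!z. z ~: K ==> f z = 0"
 shows "(LINT z|lborel. f z) = (LINT t|lborel. LINT x|lborel. f (t, x))"
proof -
 have I: "integrable (lborel \<Otimes>\<^sub>M lborel) f"
  using integrable_compact_support[OF assms] by (simp add: lborel_prod)
 show ?thesis using lborel_pair.integral_fst'[OF I] by (simp add: lborel_prod)
qed

lemma continuous_powr_mult:
 fixes c :: real
 assumes "c > 0"
 shows "continuous_on A (%y::real. \<bar>y\<bar> powr c * y)"
 by (intro continuous_on_mult continuous_on_powr' continuous_intros) (use assms in auto)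

lemma continuous_test_prod:
 fixes f :: "real \<times> real => real"
 assumes d: "smooth_seq d" and e: "smooth_seq e" and d0: "!!t. t ~: {\<alpha>..\<beta>} ==> d 0 t = 0" and e0: "!!y. y ~: {\<gamma>..\<delta>} ==> e 0 y = 0"
  and f: "cont f"
 shows "lint (%z. f z * test_prod d e \<sigma> i j z)"
  "(LINT z|lborel. f z * test_prod d e \<sigma> i j z) = (LINT t|lborel. LINT x|lborel. f (t, x) * test_prod d e \<sigma> i j (t, x))"
proof -
 have c: "cont (%z. f z * test_prod d e \<sigma> i j z)"
  by (intro continuous_on_mult f test_prod_continuous[OF d e])
 have z: "f z * test_prod d e \<sigma> i j z = 0" if "z ~: sheared_box \<sigma> \<alpha> \<beta> \<gamma> \<delta>" for z
  using test_prod_support[OF d e d0 e0 that] by simp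
 show "lint (%z. f z * test_prod d e \<sigma> i j z)"
  by (rule integrable_compact_support[OF c compact_sheared_box z])
 show "(LINT z|lborel. f z * test_prod d e \<sigma> i j z) = (LINT t|lborel. LINT x|lborel. f (t, x) * test_prod d e \<sigma> i j (t, x))"
  by (rule LINT_pair_compact_support[OF c compact_sheared_box z])
qed

text \<open>Integration by parts in space on almost every time slice; by the assumption on the
  supports the factor \<open>e (x + \<sigma> * t)\<close> vanishes outside \<open>(0, 1)\<close>, so
  no boundary terms arise.\<close>

lemma space_parts_test_prod:
 fixes V X :: "real => real => real"
 assumes V: "cont (%(t, x). V t x)" and X: "cont (%(t, x). X t x)"
  and VX: "AE t in lborel. t \<in> {0<..<T} --> (\<forall>x\<in>{0..1}. (V t has_real_derivative X t x) (at x within {0..1}))"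
  and d: "smooth_seq d" and e: "smooth_seq e" and d0: "!!t. t ~: {\<alpha>..\<beta>} ==> d 0 t = 0" and e0: "!!y. y ~: {\<gamma>..\<delta>} ==> e 0 y = 0"
  and ab: "0 < \<alpha>" "\<beta> < T"
  and inside: "!!t y. t \<in> {\<alpha>..\<beta>} ==> y \<in> {\<gamma>..\<delta>} ==> y - \<sigma> * t \<in> {0<..<1}"
 shows "(LINT z|lborel. V (fst z) (snd z) * test_prod d e \<sigma> 0 1 z) = - (LINT z|lborel. X (fst z) (snd z) * test_prod d e \<sigma> 0 0 z)"
proof -
 have fub: "(LINT z|lborel. h (fst z) (snd z) * test_prod d e \<sigma> 0 j z) =
   (LINT t|lborel. d 0 t * (LINT x|lborel. h t x * e j (x + \<sigma> * t)))"
  if h: "cont (%(t, x). h t x)" for h :: "real => real => real" and j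
 proof -
  have hc: "cont (%z. h (fst z) (snd z))"
   by (intro continuous_on_pair[OF h] continuous_intros)
  have "(LINT z|lborel. h (fst z) (snd z) * test_prod d e \<sigma> 0 j z) =
    (LINT t|lborel. LINT x|lborel. h (fst (t, x)) (snd (t, x)) * test_prod d e \<sigma> 0 j (t, x))"
   by (rule continuous_test_prod(2)[OF d e _ _ hc, where \<alpha>=\<alpha> and \<beta>=\<beta> and \<gamma>=\<gamma> and \<delta>=\<delta>]) (use d0 e0 in auto)
  also have "... = (LINT t|lborel. LINT x|lborel. h t x * (d 0 t * e j (x + \<sigma> * t)))"
   by (simp add: test_prod_def)
  also have "... = (LINT t|lborel. d 0 t * (LINT x|lborel. h t x * e j (x + \<sigma> * t)))"
  proof (rule LINT_cong[OF refl])
   fix t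
   have "(LINT x|lborel. h t x * (d 0 t * e j (x + \<sigma> * t))) = (LINT x|lborel. d 0 t * (h t x * e j (x + \<sigma> * t)))"
    by (simp add: mult_ac)
   then show "(LINT x|lborel. h t x * (d 0 t * e j (x + \<sigma> * t))) = d 0 t * (LINT x|lborel. h t x * e j (x + \<sigma> * t))"
    by simp
  qed
  finally show ?thesis .
 qed
 have slice: "d 0 t * (LINT x|lborel. V t x * e 1 (x + \<sigma> * t)) = - (d 0 t * (LINT x|lborel. X t x * e 0 (x + \<sigma> * t)))"
  if D: "\<forall>x\<in>{0..1}. (V t has_real_derivative X t x) (at x within {0..1})" and t: "t \<in> {\<alpha>..\<beta>}" for t
 proof -
  define e' where "e' k x = e k (x + \<sigma> * t)" for k x
  have e': "smooth_seq e'"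
   unfolding smooth_seq_def e'_def
  proof (intro allI)
   fix k x
   show "((%x. e k (x + \<sigma> * t)) has_real_derivative e (Suc k) (x + \<sigma> * t)) (at x)"
    using smooth_seqD[OF e, of k "x + \<sigma> * t"] by (simp add: DERIV_shift)
  qed
  have e'0: "e' 0 x = 0" if "x ~: \<Omega>" for x
   unfolding e'_def using inside[OF t, of "x + \<sigma> * t"] that by (intro e0) auto
  have cX: "continuous_on A (X t)" for A by (intro continuous_on_pair[OF X] continuous_intros)
  have ac: "ac_deriv 0 1 (V t) (%x. indicator {0..1} x * X t x)"
   by (rule ac_deriv_C1) (use D cX in auto)
  have "(LINT x|lborel. V t x * e' 1 x) = - (LINT x|lborel. (indicator {0..1} x * X t x) * e' 0 x)"
  proof (rule ac_parts_test[OF ac e' e'0])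
   show "continuous_on {0..1} (%x. indicator {0..1} x * X t x)"
    by (rule continuous_on_eq[OF cX]) simp
  qed
  also have "(LINT x|lborel. (indicator {0..1} x * X t x) * e' 0 x) = (LINT x|lborel. X t x * e' 0 x)"
  proof (rule LINT_cong[OF refl])
   fix x show "(indicator {0..1} x * X t x) * e' 0 x = X t x * e' 0 x"
    using e'0[of x] by (cases "x \<in> {0..1}") auto
  qed
  finally show ?thesis by (simp add: e'_def)
 qed
 have mV: "(%t. d 0 t * (LINT x|lborel. h t x * e j (x + \<sigma> * t))) \<in> borel_measurable lborel"
  if h: "cont (%(t, x). h t x)" for h :: "real => real => real" and j
 proof -
  have c: "cont (%(t, x). h t x * e j (x + \<sigma> * t))"
   unfolding case_prod_unfold
   by (intro continuous_intros continuous_on_pair[OF h] continuous_on_compose2[OF smooth_seq_continuous[OF e, of UNIV]]) auto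
  then have [measurable]: "(%(t, x). h t x * e j (x + \<sigma> * t)) \<in> borel_measurable (lborel \<Otimes>\<^sub>M lborel)"
   by (intro borel_measurable_pair borel_measurable_continuous_onI)
  have [measurable]: "d 0 \<in> BM" by (rule smooth_seq_borel[OF d])
  show ?thesis by measurable
 qed
 have "(LINT t|lborel. d 0 t * (LINT x|lborel. V t x * e 1 (x + \<sigma> * t))) =
   (LINT t|lborel. - (d 0 t * (LINT x|lborel. X t x * e 0 (x + \<sigma> * t))))"
 proof (rule integral_cong_AE)
  show "AE t in lborel. d 0 t * (LINT x|lborel. V t x * e 1 (x + \<sigma> * t)) = - (d 0 t * (LINT x|lborel. X t x * e 0 (x + \<sigma> * t)))"
   using VX
  proof eventually_elim
   case (elim t)
   show ?case
   proof (cases "t \<in> {\<alpha>..\<beta>}")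
    case True
    then show ?thesis using elim ab by (intro slice) auto
   qed (simp add: d0)
  qed
 qed (use mV[OF V, of 1] mV[OF X, of 0] in auto)
 then show ?thesis unfolding fub[OF V] fub[OF X] by simp
qed

text \<open>The case \<open>\<sigma> = 0\<close> integrates \<open>W\<close> in time. For
  \<open>\<sigma> = 1\<close> and \<open>\<sigma> = -1\<close> the derivative of
  \<open>W + \<sigma> * X\<close> along \<open>x = \<xi> - \<sigma> * t\<close> is formally
  \<open>u_tt - u_xx\<close>, because \<open>\<sigma>^2 = 1\<close> and the mixed derivatives
  cancel; the proof carries this out on the test function.\<close>

lemma solution_lines:
 fixes v vt vtt vxx V W X G :: "real => real => real"
 assumes T: "T > 0"
  and w1: "has_weak_deriv ({0<..<T} \<times> \<Omega>) [(1,0)] (%(t,x). v t x) (%(t,x). vt t x)"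
  and w2: "has_weak_deriv ({0<..<T} \<times> \<Omega>) [(1,0),(1,0)] (%(t,x). v t x) (%(t,x). vtt t x)"
  and w3: "has_weak_deriv ({0<..<T} \<times> \<Omega>) [(0,1),(0,1)] (%(t,x). v t x) (%(t,x). vxx t x)"
  and V: "cont (%(t, x). V t x)" and W: "cont (%(t, x). W t x)"
  and X: "cont (%(t, x). X t x)" and G: "cont (%(t, x). G t x)"
  and vV: "AE z in lebesgue_on ({0<..<T} \<times> \<Omega>). v (fst z) (snd z) = V (fst z) (snd z)"
  and vW: "AE z in lebesgue_on ({0<..<T} \<times> \<Omega>). vt (fst z) (snd z) = W (fst z) (snd z)"
  and VX: "AE t in lborel. t \<in> {0<..<T} --> (\<forall>x\<in>{0..1}. (V t has_real_derivative X t x) (at x within {0..1}))"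
  and pde: "AE z in lebesgue_on ({0<..<T} \<times> \<Omega>). vtt (fst z) (snd z) - vxx (fst z) (snd z) = G (fst z) (snd z)"
  and st: "0 <= s" "s <= t" "t <= T"
 shows "\<xi> \<in> {0..1} ==> V t \<xi> - V s \<xi> = prim (%u. W (s + u) \<xi>) (t - s)"
  "\<sigma> = 1 \<or> \<sigma> = -1 ==> \<xi> - \<sigma> * s \<in> {0..1} ==> \<xi> - \<sigma> * t \<in> {0..1} ==>
   (W t (\<xi> - \<sigma> * t) + \<sigma> * X t (\<xi> - \<sigma> * t)) - (W s (\<xi> - \<sigma> * s) + \<sigma> * X s (\<xi> - \<sigma> * s)) =
   prim (%u. G (s + u) (\<xi> - \<sigma> * (s + u))) (t - s)"
proof -
 let ?R = "{0<..<T} \<times> \<Omega>"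
 have R: "open ?R" "?R \<in> sets borel" by (auto intro!: open_Times borel_open)
 let ?V = "%z. V (fst z) (snd z)" and ?W = "%z. W (fst z) (snd z)" and ?X = "%z. X (fst z) (snd z)" and ?G = "%z. G (fst z) (snd z)"
 have c: "continuous_on A ?V" "continuous_on A ?W" "continuous_on A ?X" "continuous_on A ?G" for A
  by (intro continuous_on_pair[OF V] continuous_on_pair[OF W] continuous_on_pair[OF X] continuous_on_pair[OF G] continuous_intros)+
 have m: "?V \<in> BM" "?W \<in> BM" "?X \<in> BM" "?G \<in> BM"
  using c[of UNIV] by (auto intro: borel_measurable_continuous_onI)
 have lists: "[(1,0)] \<in> lists (Basis :: (real \<times> real) set)" "[(1,0),(1,0)] \<in> lists (Basis :: (real \<times> real) set)"
   "[(0,1),(0,1)] \<in> lists (Basis :: (real \<times> real) set)"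
  by (auto simp: Basis_prod_def)
 have vV': "AE z in lebesgue_on ?R. (%(t,x). v t x) z = ?V z" and vW': "AE z in lebesgue_on ?R. (%(t,x). vt t x) z = ?W z"
  using vV vW by (simp_all add: case_prod_unfold)
 have locs: "locally_integrable ?R (%(t,x). vtt t x)" "locally_integrable ?R (%(t,x). vxx t x)"
  using w2 w3 unfolding has_weak_deriv_def by auto
 obtain aB where aB: "aB \<in> BM" "AE z in lebesgue_on ?R. (%(t,x). vtt t x) z = aB z"
  by (rule borel_representative[OF R(2) locally_integrable_measurable[OF R(1) locs(1)]]) blast
 obtain xB where xB: "xB \<in> BM" "AE z in lebesgue_on ?R. (%(t,x). vxx t x) z = xB z"
  by (rule borel_representative[OF R(2) locally_integrable_measurable[OF R(1) locs(2)]]) blast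
 have AG: "AE z in lborel. z \<in> ?R --> aB z - xB z = ?G z"
 proof -
  have "AE z in lebesgue_on ?R. aB z - xB z = ?G z"
   using pde aB(2) xB(2) by eventually_elim (auto simp: case_prod_unfold)
  then show ?thesis by (simp add: AE_lebesgue_on[OF R(2)])
 qed
 have box: "sheared_box \<sigma> \<alpha> \<beta> \<gamma> \<delta> \<subseteq> ?R" if "0 < \<alpha>" "\<beta> < T"
  "!!t y. t \<in> {\<alpha>..\<beta>} ==> y \<in> {\<gamma>..\<delta>} ==> y - \<sigma> * t \<in> {0<..<1}" for \<sigma> \<alpha> \<beta> \<gamma> \<delta>
 proof
  fix z assume "z \<in> sheared_box \<sigma> \<alpha> \<beta> \<gamma> \<delta>"
  then have "fst z \<in> {\<alpha>..\<beta>}" "snd z + \<sigma> * fst z \<in> {\<gamma>..\<delta>}" by (auto simp: sheared_box_def)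
  then show "z \<in> ?R" using that(3)[of "fst z" "snd z + \<sigma> * fst z"] that(1,2) by (cases z) auto
 qed
 have W1: "(LINT z|lborel. ?V z * test_prod d e \<sigma> 1 0 z) + \<sigma> * (LINT z|lborel. ?V z * test_prod d e \<sigma> 0 1 z) =
   - (LINT z|lborel. ?W z * test_prod d e \<sigma> 0 0 z)"
  if d: "smooth_seq d" and e: "smooth_seq e" and d0: "!!t. t ~: {\<alpha>..\<beta>} ==> d 0 t = 0" and e0: "!!y. y ~: {\<gamma>..\<delta>} ==> e 0 y = 0"
   and K: "sheared_box \<sigma> \<alpha> \<beta> \<gamma> \<delta> \<subseteq> ?R" for d e \<alpha> \<beta> \<gamma> \<delta> \<sigma>
 proof -
  have i: "lint (%z. ?V z * test_prod d e \<sigma> i j z)" for i j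
   by (rule continuous_test_prod(1)[OF d e d0 e0 c(1)])
  have "(LINT z|lborel. ?V z * lin_partials (1, 0) (\<sigma>, 1) d e [(1,0)] 0 0 z) =
    (-1) ^ length [(1,0)::real \<times> real] * (LINT z|lborel. ?W z * test_prod d e \<sigma> 0 0 z)"
   by (rule weak_test_prod[OF R(1) w1 lists(1) vV' vW' m(1,2) d e d0 e0 K])
  moreover have "(LINT z|lborel. ?V z * lin_partials (1, 0) (\<sigma>, 1) d e [(1,0)] 0 0 z) =
    (LINT z|lborel. ?V z * test_prod d e \<sigma> 1 0 z + \<sigma> * (?V z * test_prod d e \<sigma> 0 1 z))"
   unfolding lin_partials_test_prod by (simp add: algebra_simps)
  moreover have "... = (LINT z|lborel. ?V z * test_prod d e \<sigma> 1 0 z) + \<sigma> * (LINT z|lborel. ?V z * test_prod d e \<sigma> 0 1 z)"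
   using i[of 1 0] i[of 0 1] by simp
  ultimately show ?thesis by simp
 qed
 show "V t \<xi> - V s \<xi> = prim (%u. W (s + u) \<xi>) (t - s)" if \<xi>: "\<xi> \<in> {0..1}"
 proof -
  have "V t (\<xi> - 0 * t) - V s (\<xi> - 0 * s) = prim (%u. W (s + u) (\<xi> - 0 * (s + u))) (t - s)"
  proof (rule line_identity[OF V W, where T=T], goal_cases)
   case (1 d e \<alpha> \<beta> \<gamma> \<delta>)
   show ?case
    using W1[OF 1(1-4) box[OF 1(5,7,9)]] by (simp add: test_prod_def)
  qed (use T st \<xi> in auto)
  then show ?thesis by simp
 qed
 assume \<sigma>: "\<sigma> = 1 \<or> \<sigma> = -1" and ends: "\<xi> - \<sigma> * s \<in> {0..1}" "\<xi> - \<sigma> * t \<in> {0..1}"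
 have cA: "cont (%(t, x). W t x + \<sigma> * X t x)"
  using c[of UNIV] unfolding case_prod_unfold by (intro continuous_intros)
 show "(W t (\<xi> - \<sigma> * t) + \<sigma> * X t (\<xi> - \<sigma> * t)) - (W s (\<xi> - \<sigma> * s) + \<sigma> * X s (\<xi> - \<sigma> * s)) =
   prim (%u. G (s + u) (\<xi> - \<sigma> * (s + u))) (t - s)"
 proof (rule line_identity[where f="%t x. W t x + \<sigma> * X t x" and g=G and T=T, OF cA G], goal_cases)
  case (1 d e \<alpha> \<beta> \<gamma> \<delta>)
  note d = 1(1) and e = 1(2) and d0 = 1(3) and e0 = 1(4)
  have K: "sheared_box \<sigma> \<alpha> \<beta> \<gamma> \<delta> \<subseteq> ?R" by (rule box[OF 1(5,7,9)])
  let ?I = "%f i j. LINT z|lborel. f z * test_prod d e \<sigma> i j z"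
  have ic: "lint (%z. f z * test_prod d e \<sigma> i j z)" if "cont f" for f i j
   by (rule continuous_test_prod(1)[OF d e d0 e0 that])
  define d' where "d' k = d (Suc k)" for k
  have d': "smooth_seq d'" using d by (simp add: smooth_seq_def d'_def)
  have d'0: "d' 0 t = 0" if "t ~: {\<alpha>..\<beta>}" for t
   unfolding d'_def using smooth_seq_support[OF d _ that] d0 by blast
  have tp: "test_prod d' e \<sigma> i j = test_prod d e \<sigma> (Suc i) j" for i j
   by (simp add: fun_eq_iff test_prod_def d'_def)
  \<comment> \<open>Here \<open>a\<close> tests \<open>vt\<close> against the time derivative of
    \<open>d\<close>, \<open>b\<close> moves one space derivative from the test function onto
    \<open>V\<close>, and \<open>cc\<close>, \<open>dd\<close> are the second-order identities. In
    \<open>cc\<close> the factor \<open>\<sigma>^2 = 1\<close> makes the last term the one that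
    \<open>dd\<close> evaluates.\<close>
  have a: "?I ?V 2 0 + \<sigma> * ?I ?V 1 1 = - ?I ?W 1 0"
   using W1[OF d' e d'0 e0 K] by (simp add: tp numeral_2_eq_2)
  have b: "?I ?V 1 1 = - ?I ?X 1 0"
   using space_parts_test_prod[OF V X VX d' e d'0 e0 1(5,7,9)] by (simp add: tp)
  have cc: "?I ?V 2 0 + 2 * \<sigma> * ?I ?V 1 1 + ?I ?V 0 2 = ?I aB 0 0"
  proof -
   have "(LINT z|lborel. ?V z * lin_partials (1, 0) (\<sigma>, 1) d e [(1,0),(1,0)] 0 0 z) =
     (-1) ^ length [(1,0)::real \<times> real, (1,0)] * ?I aB 0 0"
    by (rule weak_test_prod[OF R(1) w2 lists(2) vV' aB(2) m(1) aB(1) d e d0 e0 K])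
   moreover have "(LINT z|lborel. ?V z * lin_partials (1, 0) (\<sigma>, 1) d e [(1,0),(1,0)] 0 0 z) =
     (LINT z|lborel. ?V z * test_prod d e \<sigma> 2 0 z + 2 * \<sigma> * (?V z * test_prod d e \<sigma> 1 1 z) + ?V z * test_prod d e \<sigma> 0 2 z)"
    unfolding lin_partials_test_prod using \<sigma> by (intro LINT_cong refl) (auto simp: algebra_simps numeral_2_eq_2)
   moreover have "... = ?I ?V 2 0 + 2 * \<sigma> * ?I ?V 1 1 + ?I ?V 0 2"
    using ic[OF c(1), of 2 0] ic[OF c(1), of 1 1] ic[OF c(1), of 0 2] by simp
   ultimately show ?thesis by simp
  qed
  have dd: "?I ?V 0 2 = ?I xB 0 0"
  proof -
   have "(LINT z|lborel. ?V z * lin_partials (1, 0) (\<sigma>, 1) d e [(0,1),(0,1)] 0 0 z) =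
     (-1) ^ length [(0,1)::real \<times> real, (0,1)] * ?I xB 0 0"
    by (rule weak_test_prod[OF R(1) w3 lists(3) vV' xB(2) m(1) xB(1) d e d0 e0 K])
   then show ?thesis unfolding lin_partials_test_prod by (simp add: numeral_2_eq_2)
  qed
  have ee: "?I aB 0 0 - ?I xB 0 0 = ?I ?G 0 0"
  proof -
   have ia: "lint (%z. aB z * test_prod d e \<sigma> 0 0 z)"
    by (rule integrable_test_prod[OF d e d0 e0 locally_integrable_lborel[OF R(1) locs(1) aB(2,1) compact_sheared_box K]])
   have ix: "lint (%z. xB z * test_prod d e \<sigma> 0 0 z)"
    by (rule integrable_test_prod[OF d e d0 e0 locally_integrable_lborel[OF R(1) locs(2) xB(2,1) compact_sheared_box K]])
   have "?I aB 0 0 - ?I xB 0 0 = (LINT z|lborel. aB z * test_prod d e \<sigma> 0 0 z - xB z * test_prod d e \<sigma> 0 0 z)"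
    using ia ix by simp
   also have "... = ?I ?G 0 0"
   proof (rule integral_cong_AE)
    show "AE z in lborel. aB z * test_prod d e \<sigma> 0 0 z - xB z * test_prod d e \<sigma> 0 0 z = ?G z * test_prod d e \<sigma> 0 0 z"
     using AG
    proof eventually_elim
     case (elim z)
     have "test_prod d e \<sigma> 0 0 z = 0" if "z ~: ?R"
      using test_prod_support[OF d e d0 e0] K that by blast
     then show ?case using elim by (cases "z \<in> ?R") (auto simp: left_diff_distrib[symmetric])
    qed
   qed (use ia ix ic[OF c(4)] in \<open>auto intro: borel_measurable_integrable\<close>)
   finally show ?thesis .
  qed
  have "(LINT z|lborel. (?W z + \<sigma> * ?X z) * test_prod d e \<sigma> 1 0 z) = ?I ?W 1 0 + \<sigma> * ?I ?X 1 0"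
  proof -
   have "(LINT z|lborel. (?W z + \<sigma> * ?X z) * test_prod d e \<sigma> 1 0 z) =
     (LINT z|lborel. ?W z * test_prod d e \<sigma> 1 0 z + \<sigma> * (?X z * test_prod d e \<sigma> 1 0 z))"
    by (simp add: algebra_simps)
   then show ?thesis using ic[OF c(2), of 1 0] ic[OF c(3), of 1 0] by simp
  qed
  also have "... = - ?I ?G 0 0"
   using a b cc dd ee by (simp add: algebra_simps)
  finally show ?case by (simp add: test_prod_def)
 qed (use T st ends in auto)
qed

text \<open>The representative continuous in L^2 agrees with \<open>V\<close> at times accumulating
  at 0. There the squared distance of \<open>Y t\<close> from \<open>Y 0\<close> equals
  \<open>q t\<close>, a continuous function of time, so \<open>q 0 = 0\<close>.\<close>

lemma initial_value_eq:
 assumes T: "T > 0" and N: "AE t in lborel. t \<in> {0<..<T} --> t \<in> N"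
  and V: "cont (%(t, x). V t x)" and vV: "!!t. t \<in> N ==> AE x in lebesgue_on \<Omega>. v t x = V t x"
  and init: "has_initial_value T v u" and u: "AE x in lebesgue_on \<Omega>. u x = U x" and U: "continuous_on {0..1} U"
  and x: "x \<in> {0..1}"
 shows "V 0 x = U x"
proof -
 obtain Y where Y: "((%s. L2_norm \<Omega> (%x. Y s x - Y 0 x)) \<longlongrightarrow> 0) (at 0 within {0..T})"
  "AE t in lebesgue_on {0<..<T}. AE x in lebesgue_on \<Omega>. v t x = Y t x" "AE x in lebesgue_on \<Omega>. Y 0 x = u x"
  using init T unfolding has_initial_value_def by (meson atLeastAtMost_iff less_eq_real_def order_refl)
 define N' where "N' = {t \<in> {0<..<T}. t \<in> N & (AE x in lebesgue_on \<Omega>. v t x = Y t x)}"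
 have "AE t in lborel. t \<in> {0<..<T} --> t \<in> N'"
 proof -
  have "AE t in lborel. t \<in> {0<..<T} --> (AE x in lebesgue_on \<Omega>. v t x = Y t x)"
   using Y(2) by (subst (asm) AE_lebesgue_on) auto
  then show ?thesis using N by eventually_elim (auto simp: N'_def)
 qed
 then have "{0..T} \<subseteq> closure N'" by (rule AE_imp_dense[OF T])
 then have "0 \<in> closure N'" using T by auto
 moreover have "0 ~: N'" by (simp add: N'_def)
 ultimately have "0 islimpt N'" by (simp add: closure_def)
 then have nt: "at 0 within N' ~= bot" by (simp add: trivial_limit_within)
 define q where "q t = integral {0..1} (%x. (V t x - U x)^2)" for t
 have cVU: "continuous_on {0..1} (%x. (V t x - U x)^2)" for t
  by (intro continuous_intros continuous_on_pair[OF V] U)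
 have qc: "cont q"
 proof -
  have "continuous_on (UNIV \<times> cbox 0 1) (%(t, x). (V t x - U x)^2)"
   unfolding case_prod_unfold
   by (intro continuous_intros continuous_on_pair[OF V] continuous_on_compose2[OF U]) auto
  from integral_continuous_on_param[OF this] show ?thesis unfolding q_def[abs_def] by simp
 qed
 have q0: "(q \<longlongrightarrow> q 0) (at 0 within N')"
  using qc by (metis UNIV_I continuous_on_def subset_UNIV tendsto_within_subset)
 have "((%s. (L2_norm \<Omega> (%x. Y s x - Y 0 x))^2) \<longlongrightarrow> 0^2) (at 0 within N')"
  by (intro tendsto_power tendsto_within_subset[OF Y(1)]) (auto simp: N'_def)
 moreover have "\<forall>\<^sub>F t in at 0 within N'. (L2_norm \<Omega> (%x. Y t x - Y 0 x))^2 = q t"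
  unfolding eventually_at_filter
 proof (intro always_eventually allI impI)
  fix t assume "t \<in> N'"
  then have t: "t \<in> N" "AE x in lebesgue_on \<Omega>. v t x = Y t x" by (auto simp: N'_def)
  have "AE x in lebesgue_on \<Omega>. Y t x - Y 0 x = V t x - U x"
   using t(2) vV[OF t(1)] Y(3) u by eventually_elim simp
  then have "AE x in lborel. x \<in> \<Omega> --> Y t x - Y 0 x = V t x - U x" by (simp add: AE_lebesgue_on)
  then have "AE x in lebesgue_on \<Omega>. Y t x - Y 0 x = indicator {0..1} x * (V t x - U x)"
   by (subst AE_lebesgue_on) (auto elim!: eventually_mono)
  moreover have "(%x. indicator {0..1} x * (V t x - U x)) \<in> BM"
   by (rule borel_indicator_mult_continuous) (auto intro!: continuous_on_diff continuous_on_pair[OF V] continuous_on_const continuous_on_id U)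
  ultimately have "(L2_norm \<Omega> (%x. Y t x - Y 0 x))^2 = (LINT x|lborel. indicator {0..1} x * (indicator {0..1} x * (V t x - U x))^2)"
   by (intro L2_norm_sq)
  also have "... = (LINT x|lborel. indicator {0..1} x * (V t x - U x)^2)"
   by (rule LINT_cong[OF refl]) (auto simp: indicator_def)
  also have "... = q t"
   unfolding q_def using borel_integrable_atLeastAtMost'[OF cVU]
   by (simp add: set_borel_integral_eq_integral(2)[symmetric] set_lebesgue_integral_def)
  finally show "(L2_norm \<Omega> (%x. Y t x - Y 0 x))^2 = q t" .
 qed
 ultimately have "(q \<longlongrightarrow> 0) (at 0 within N')"
  using tendsto_cong by force
 then have "q 0 = 0" using tendsto_unique[OF nt q0] by blast
 then have "(V 0 x - U x)^2 = 0"
  using integral_eq_0_iff[OF cVU zero_less_one, of 0] x unfolding q_def by auto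
 then show ?thesis by simp
qed

section \<open>Uniqueness\<close>

text \<open>At the origin the difference quotient is \<open>\<bar>h\<bar> powr c\<close>, which
  tends to zero as \<open>c > 0\<close>. Away from it the function is a power up to sign.\<close>

lemma DERIV_abs_powr_mult:
 fixes c y :: real
 assumes c: "c > 0"
 shows "((%y. \<bar>y\<bar> powr c * y) has_real_derivative (c + 1) * \<bar>y\<bar> powr c) (at y)"
proof -
 consider "y > 0" | "y < 0" | "y = 0" by linarith
 then show ?thesis
 proof cases
  case 1
  have "((%y. y powr (c + 1)) has_real_derivative (c + 1) * y powr (c + 1 - 1)) (at y)"
   by (rule has_real_derivative_powr[OF 1])
  then have *: "((%y. y powr (c + 1)) has_real_derivative (c + 1) * \<bar>y\<bar> powr c) (at y)" using 1 by simp
  show ?thesis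
   by (rule has_field_derivative_transform_within_open[OF *, of "{0<..}"]) (use 1 in \<open>auto simp: powr_add\<close>)
 next
  case 2
  have "((%y. - ((- y) powr (c + 1))) has_real_derivative - ((c + 1) * (- y) powr (c + 1 - 1) * (-1))) (at y)"
   by (intro DERIV_minus DERIV_chain2[where g=uminus, OF has_real_derivative_powr]) (use 2 in \<open>auto intro!: derivative_eq_intros\<close>)
  then have *: "((%y. - ((- y) powr (c + 1))) has_real_derivative (c + 1) * \<bar>y\<bar> powr c) (at y)" using 2 by simp
  show ?thesis
   by (rule has_field_derivative_transform_within_open[OF *, of "{..<0}"]) (use 2 in \<open>auto simp: powr_add\<close>)
 next
  case 3
  have "((%h. \<bar>h\<bar> powr c) \<longlongrightarrow> \<bar>0\<bar> powr c) (at (0::real))"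
   by (intro tendsto_powr2 tendsto_intros) (use c in auto)
  then have "((%h. \<bar>h\<bar> powr c) \<longlongrightarrow> 0) (at (0::real))" using c by simp
  then have "((%h. (\<bar>0 + h\<bar> powr c * (0 + h) - \<bar>0\<bar> powr c * 0) / h) \<longlongrightarrow> 0) (at (0::real))"
   by (rule Lim_transform_eventually) (use c in \<open>auto simp: eventually_at_filter\<close>)
  then show ?thesis using 3 c by (simp add: DERIV_def)
 qed
qed

definition locally_lipschitz :: "(real => real) => bool" where
 "locally_lipschitz f \<longleftrightarrow> (ALL R. EX L>=0. ALL x y. \<bar>x\<bar> <= R --> \<bar>y\<bar> <= R --> \<bar>f x - f y\<bar> <= L * \<bar>x - y\<bar>)"

lemma locally_lipschitz_abs_powr_mult:
 assumes c: "c > 0"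
 shows "locally_lipschitz (%y. \<bar>y\<bar> powr c * y)"
 unfolding locally_lipschitz_def
proof (intro allI exI[of _ "(c + 1) * \<bar>R\<bar> powr c" for R] conjI impI)
 fix R x y :: real assume xy: "\<bar>x\<bar> <= R" "\<bar>y\<bar> <= R"
 have "norm (\<bar>x\<bar> powr c * x - \<bar>y\<bar> powr c * y) <= ((c + 1) * \<bar>R\<bar> powr c) * norm (x - y)"
 proof (rule field_differentiable_bound[where S="{-R..R}" and f'="%y. (c + 1) * \<bar>y\<bar> powr c"])
  show "((%y. \<bar>y\<bar> powr c * y) has_real_derivative (c + 1) * \<bar>z\<bar> powr c) (at z within {- R..R})" for z
   by (rule has_field_derivative_at_within[OF DERIV_abs_powr_mult[OF c]])
  fix z assume "z \<in> {-R..R}"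
  then have "\<bar>z\<bar> powr c <= \<bar>R\<bar> powr c" using c by (intro powr_mono2) auto
  then show "norm ((c + 1) * \<bar>z\<bar> powr c) <= (c + 1) * \<bar>R\<bar> powr c"
   using c by (simp add: abs_mult)
 qed (use xy in auto)
 then show "\<bar>\<bar>x\<bar> powr c * x - \<bar>y\<bar> powr c * y\<bar> <= ((c + 1) * \<bar>R\<bar> powr c) * \<bar>x - y\<bar>" by simp
qed (use c in auto)

lemma locally_lipschitz_diff_id:
 assumes "locally_lipschitz f"
 shows "locally_lipschitz (%y. f y - y)"
 unfolding locally_lipschitz_def
proof
 fix R
 obtain L where L: "L >= 0" "!!x y. \<bar>x\<bar> <= R ==> \<bar>y\<bar> <= R ==> \<bar>f x - f y\<bar> <= L * \<bar>x - y\<bar>"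
  using assms unfolding locally_lipschitz_def by blast
 have "\<bar>(f x - x) - (f y - y)\<bar> <= (L + 1) * \<bar>x - y\<bar>" if "\<bar>x\<bar> <= R" "\<bar>y\<bar> <= R" for x y
  using L(2)[OF that] unfolding distrib_right mult_1 by linarith
 then show "EX L>=0. ALL x y. \<bar>x\<bar> <= R --> \<bar>y\<bar> <= R --> \<bar>f x - x - (f y - y)\<bar> <= L * \<bar>x - y\<bar>"
  using L(1) by (intro exI[of _ "L + 1"]) auto
qed

text \<open>The problem in integrated form, free of derivatives, so that two solutions can be
  subtracted pointwise. \<open>V\<close>, \<open>W\<close>, \<open>X\<close> stand for the solution,
  its velocity and its slope; \<open>W + X\<close> is followed along lines of constant
  \<open>x + t\<close>, and \<open>W - X\<close> along lines of constant
  \<open>x - t\<close>.\<close>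

definition mild_system where
 "mild_system lam lam0 lam1 tlam0 tlam1 f \<phi>0 \<phi>1 H0 H1 T V W X \<longleftrightarrow>
   cont (%(t, x). V t x) & cont (%(t, x). W t x) & cont (%(t, x). X t x) &
   (\<forall>s t \<xi>. 0 <= s --> s <= t --> t <= T --> \<xi> \<in> {0..1} --> V t \<xi> - V s \<xi> = prim (%u. W (s + u) \<xi>) (t - s)) &
   (\<forall>s t \<xi> \<sigma>. 0 <= s --> s <= t --> t <= T --> (\<sigma> = 1 \<or> \<sigma> = -1) --> \<xi> - \<sigma> * s \<in> {0..1} --> \<xi> - \<sigma> * t \<in> {0..1} -->
    (W t (\<xi> - \<sigma> * t) + \<sigma> * X t (\<xi> - \<sigma> * t)) - (W s (\<xi> - \<sigma> * s) + \<sigma> * X s (\<xi> - \<sigma> * s)) =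
    prim (%u. f (V (s + u) (\<xi> - \<sigma> * (s + u))) - lam * W (s + u) (\<xi> - \<sigma> * (s + u))) (t - s)) &
   (\<forall>t\<in>{0..T}. X t 0 = - \<phi>0 (V t 0) + lam0 * W t 0 + H1 t * V t 1 + tlam1 * W t (1::real)) &
   (\<forall>t\<in>{0..T}. - X t 1 = - \<phi>1 (V t 1) + lam1 * W t 1 + H0 t * V t 0 + tlam0 * W t (0::real))"
 for lam lam0 lam1 tlam0 tlam1 T :: real and f \<phi>0 \<phi>1 H0 H1 :: "real => real" and V W X :: "real => real => real"

lemma mild_systemD:
 assumes "mild_system lam lam0 lam1 tlam0 tlam1 f \<phi>0 \<phi>1 H0 H1 T V W X"
 shows "cont (%(t, x). V t x)" "cont (%(t, x). W t x)" "cont (%(t, x). X t x)"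
  "0 <= s ==> s <= t ==> t <= T ==> \<xi> \<in> {0..1} ==> V t \<xi> - V s \<xi> = prim (%u. W (s + u) \<xi>) (t - s)"
  "0 <= s ==> s <= t ==> t <= T ==> \<sigma> = 1 \<or> \<sigma> = -1 ==> \<xi> - \<sigma> * s \<in> {0..1} ==> \<xi> - \<sigma> * t \<in> {0..1} ==>
    (W t (\<xi> - \<sigma> * t) + \<sigma> * X t (\<xi> - \<sigma> * t)) - (W s (\<xi> - \<sigma> * s) + \<sigma> * X s (\<xi> - \<sigma> * s)) =
    prim (%u. f (V (s + u) (\<xi> - \<sigma> * (s + u))) - lam * W (s + u) (\<xi> - \<sigma> * (s + u))) (t - s)"
  "t \<in> {0..T} ==> X t 0 = - \<phi>0 (V t 0) + lam0 * W t 0 + H1 t * V t 1 + tlam1 * W t 1"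
  "t \<in> {0..T} ==> - X t 1 = - \<phi>1 (V t 1) + lam1 * W t 1 + H0 t * V t 0 + tlam0 * W t 0"
proof -
 note a = assms[unfolded mild_system_def]
 note a1 = a[THEN conjunct2] note a2 = a1[THEN conjunct2] note a3 = a2[THEN conjunct2]
 note a4 = a3[THEN conjunct2] note a5 = a4[THEN conjunct2]
 show "cont (%(t, x). V t x)" "cont (%(t, x). W t x)" "cont (%(t, x). X t x)"
  by (rule a[THEN conjunct1], rule a1[THEN conjunct1], rule a2[THEN conjunct1])
 show "0 <= s ==> s <= t ==> t <= T ==> \<xi> \<in> {0..1} ==> V t \<xi> - V s \<xi> = prim (%u. W (s + u) \<xi>) (t - s)"
  using a3[THEN conjunct1] by blast
 show "0 <= s ==> s <= t ==> t <= T ==> \<sigma> = 1 \<or> \<sigma> = -1 ==> \<xi> - \<sigma> * s \<in> {0..1} ==> \<xi> - \<sigma> * t \<in> {0..1} ==>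
    (W t (\<xi> - \<sigma> * t) + \<sigma> * X t (\<xi> - \<sigma> * t)) - (W s (\<xi> - \<sigma> * s) + \<sigma> * X s (\<xi> - \<sigma> * s)) =
    prim (%u. f (V (s + u) (\<xi> - \<sigma> * (s + u))) - lam * W (s + u) (\<xi> - \<sigma> * (s + u))) (t - s)"
  using a4[THEN conjunct1] by blast
 show "t \<in> {0..T} ==> X t 0 = - \<phi>0 (V t 0) + lam0 * W t 0 + H1 t * V t 1 + tlam1 * W t 1"
  using a5[THEN conjunct1] by blast
 show "t \<in> {0..T} ==> - X t 1 = - \<phi>1 (V t 1) + lam1 * W t 1 + H0 t * V t 0 + tlam0 * W t 0"
  using a5[THEN conjunct2] by blast
qed

text \<open>The gain in the weighted norm: integrating growth of rate \<open>\<mu>\<close> in time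
  produces a factor \<open>1 / \<mu>\<close>.\<close>

lemma prim_exp_bound:
 assumes g: "cont g" and st: "s <= t" and \<mu>: "\<mu> > 0" and K: "K >= 0"
  and le: "!!u. u \<in> {0..t - s} ==> \<bar>g u\<bar> <= K * exp (\<mu> * (s + u))"
 shows "\<bar>prim g (t - s)\<bar> <= K * exp (\<mu> * t) / \<mu>"
proof -
 have "prim g (t - s) = (LINT u|lborel. indicator {0..t - s} u * g u)"
  by (rule prim_LINT[OF g]) (use st in simp)
 then have "\<bar>prim g (t - s)\<bar> <= (LINT u|lborel. \<bar>indicator {0..t - s} u * g u\<bar>)" by simp
 also have "... <= (LINT u|lborel. indicator {0..t - s} u * (K * exp (\<mu> * (s + u))))"
 proof (rule integral_mono)
  show "lint (%u. \<bar>indicator {0..t - s} u * g u\<bar>)"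
   by (intro integrable_abs integrable_indicator_continuous continuous_on_subset[OF g]) simp
  show "lint (%u. indicator {0..t - s} u * (K * exp (\<mu> * (s + u))))"
   by (intro integrable_indicator_continuous continuous_intros)
  show "\<bar>indicator {0..t - s} u * g u\<bar> <= indicator {0..t - s} u * (K * exp (\<mu> * (s + u)))" for u
   using le[of u] by (auto simp: indicator_def)
 qed
 also have "... = K * exp (\<mu> * (s + (t - s))) / \<mu> - K * exp (\<mu> * (s + 0)) / \<mu>"
 proof -
  have "(LINT u|lborel. (K * exp (\<mu> * (s + u))) * indicator {0..t - s} u) = K * exp (\<mu> * (s + (t - s))) / \<mu> - K * exp (\<mu> * (s + 0)) / \<mu>"
   by (rule integral_FTC_Icc_real) (use st \<mu> in \<open>auto intro!: derivative_eq_intros\<close>)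
  then show ?thesis by (simp add: mult.commute)
 qed
 also have "... <= K * exp (\<mu> * t) / \<mu>" using K \<mu> by simp
 finally show ?thesis .
qed

text \<open>The condition on \<open>tlam0 + tlam1\<close> makes the boundary conditions uniquely solvable for the traces of the velocity.\<close>

lemma boundary_det_pos:
 fixes lam0 lam1 tlam0 tlam1 :: real
 assumes "lam0 > 0" "lam1 > 0" "\<bar>tlam0 + tlam1\<bar> < 2 * sqrt (lam0 * lam1)"
 shows "(1 + lam0) * (1 + lam1) - tlam0 * tlam1 > 0"
proof -
 have "(tlam0 + tlam1)^2 < (2 * sqrt (lam0 * lam1))^2"
  using assms(3) by (metis abs_ge_zero power2_abs power_strict_mono zero_less_numeral)
 then have "(tlam0 + tlam1)^2 < 4 * (lam0 * lam1)" using assms(1,2) by (simp add: power_mult_distrib)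
 moreover have "4 * (tlam0 * tlam1) <= (tlam0 + tlam1)^2"
  using zero_le_power2[of "tlam0 - tlam1"] by (simp add: power2_eq_square algebra_simps)
 ultimately have "tlam0 * tlam1 < lam0 * lam1" by linarith
 then show ?thesis using assms(1,2) by (simp add: algebra_simps)
qed

text \<open>Cramer's rule for the traces of the velocity.\<close>

lemma boundary_solve:
 fixes p q r0 r1 :: real
 assumes "(1 + lam0) * p + tlam1 * q = r0" "tlam0 * p + (1 + lam1) * q = r1"
  and D: "D = (1 + lam0) * (1 + lam1) - tlam0 * tlam1" "D > 0"
 shows "p = ((1 + lam1) * r0 - tlam1 * r1) / D" "q = ((1 + lam0) * r1 - tlam0 * r0) / D"
proof -
 have "D * p = (1 + lam1) * r0 - tlam1 * r1" "D * q = (1 + lam0) * r1 - tlam0 * r0"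
  unfolding assms(1,2)[symmetric] D(1) by (simp_all add: algebra_simps)
 then show "p = ((1 + lam1) * r0 - tlam1 * r1) / D" "q = ((1 + lam0) * r1 - tlam0 * r0) / D"
  using D(2) by (simp_all add: field_simps)
qed

text \<open>The difference of two solutions is maximised with the weight
  \<open>exp (- \<mu> * t)\<close>. Every integral along a line gains \<open>1 / \<mu>\<close>, and
  with \<open>\<mu> = 2 * K\<close> the weighted maximum \<open>B\<close> satisfies
  \<open>B <= B / 2\<close>. By \<open>T <= 1\<close> the line that enters a boundary point reaches
  time 0 without a further reflection.\<close>

lemma mild_unique:
 assumes T: "0 < T" "T <= 1" and lip: "locally_lipschitz f" "locally_lipschitz \<phi>0" "locally_lipschitz \<phi>1"
  and fc: "cont f"
  and H: "continuous_on {0..T} H0" "continuous_on {0..T} H1"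
  and D: "(1 + lam0) * (1 + lam1) - tlam0 * tlam1 > 0"
  and s1: "mild_system lam lam0 lam1 tlam0 tlam1 f \<phi>0 \<phi>1 H0 H1 T V W X"
  and s2: "mild_system lam lam0 lam1 tlam0 tlam1 f \<phi>0 \<phi>1 H0 H1 T V' W' X'"
  and init: "!!x. x \<in> {0..1} ==> V 0 x = V' 0 x" "!!x. x \<in> {0..1} ==> W 0 x = W' 0 x" "!!x. x \<in> {0..1} ==> X 0 x = X' 0 x"
  and tx: "t \<in> {0..T}" "x \<in> {0..1}"
 shows "V t x = V' t x"
proof -
 have cont: "cont (%(t, x). V t x)" "cont (%(t, x). W t x)" "cont (%(t, x). X t x)"
   "cont (%(t, x). V' t x)" "cont (%(t, x). W' t x)" "cont (%(t, x). X' t x)"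
  by (rule mild_systemD[OF s1] mild_systemD[OF s2])+
 note cp = continuous_on_pair[OF cont(1)] continuous_on_pair[OF cont(2)] continuous_on_pair[OF cont(3)]
  continuous_on_pair[OF cont(4)] continuous_on_pair[OF cont(5)] continuous_on_pair[OF cont(6)]
 let ?Q = "{0..T} \<times> {0..1::real}"
 have Qne: "?Q ~= {}" and Qc: "compact ?Q" using T by (auto intro!: compact_Times)
 define z w \<xi> where "z t x = V t x - V' t x" and "w t x = W t x - W' t x" and "\<xi> t x = X t x - X' t x" for t x
 obtain R where R: "!!t x. t \<in> {0..T} ==> x \<in> {0..1} ==> \<bar>V t x\<bar> <= R & \<bar>V' t x\<bar> <= R"
 proof -
  have "bounded ((%z. V (fst z) (snd z)) ` ?Q)" "bounded ((%z. V' (fst z) (snd z)) ` ?Q)"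
   by (intro compact_imp_bounded compact_continuous_image Qc cp continuous_intros)+
  then obtain a b where "\<forall>y\<in>(%z. V (fst z) (snd z)) ` ?Q. norm y <= a" "\<forall>y\<in>(%z. V' (fst z) (snd z)) ` ?Q. norm y <= b"
   unfolding bounded_iff by blast
  then show ?thesis by (intro that[of "max a b"]) (force simp: le_max_iff_disj)
 qed
 obtain L1 where L1: "L1 >= 0" "!!x y. \<bar>x\<bar> <= R ==> \<bar>y\<bar> <= R ==> \<bar>f x - f y\<bar> <= L1 * \<bar>x - y\<bar>"
  using lip(1) unfolding locally_lipschitz_def by blast
 obtain L2 where L2: "L2 >= 0" "!!x y. \<bar>x\<bar> <= R ==> \<bar>y\<bar> <= R ==> \<bar>\<phi>0 x - \<phi>0 y\<bar> <= L2 * \<bar>x - y\<bar>"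
  using lip(2) unfolding locally_lipschitz_def by blast
 obtain L3 where L3: "L3 >= 0" "!!x y. \<bar>x\<bar> <= R ==> \<bar>y\<bar> <= R ==> \<bar>\<phi>1 x - \<phi>1 y\<bar> <= L3 * \<bar>x - y\<bar>"
  using lip(3) unfolding locally_lipschitz_def by blast
 obtain h0 where h0: "h0 > 0" "!!t. t \<in> {0..T} ==> \<bar>H0 t\<bar> <= h0" using continuous_on_Icc_bounded[OF H(1)] by blast
 obtain h1 where h1: "h1 > 0" "!!t. t \<in> {0..T} ==> \<bar>H1 t\<bar> <= h1" using continuous_on_Icc_bounded[OF H(2)] by blast
 define Dt where "Dt = (1 + lam0) * (1 + lam1) - tlam0 * tlam1"
 have Dt: "Dt > 0" using D by (simp add: Dt_def)
 \<comment> \<open>Constants in units of \<open>B * exp (\<mu> * t) / \<mu>\<close>: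
   \<open>K1\<close> for the source, \<open>K2\<close> for the right-hand sides of the boundary
   system, \<open>K3\<close> for its solution, \<open>K4\<close> for the reflected invariants, and
   \<open>K\<close> for the whole of \<open>m\<close>.\<close>
 define K1 where "K1 = L1 + \<bar>lam\<bar>"
 define K2 where "K2 = K1 + L2 + L3 + h0 + h1"
 define K3 where "K3 = (\<bar>1 + lam0\<bar> + \<bar>1 + lam1\<bar> + \<bar>tlam0\<bar> + \<bar>tlam1\<bar>) * K2 / Dt"
 define K4 where "K4 = 2 * K3 + K1"
 define K where "K = 1 + 4 * (K4 + K1)"
 have Kpos: "K1 >= 0" "K2 >= 0" "K3 >= 0" "K4 >= 0" "K > 0"
 proof -
  show "K1 >= 0" using L1 by (simp add: K1_def)
  then show "K2 >= 0" using L2 L3 h0 h1 by (simp add: K2_def)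
  then show "K3 >= 0" unfolding K3_def using Dt by (intro divide_nonneg_pos mult_nonneg_nonneg) auto
  then show "K4 >= 0" using \<open>K1 >= 0\<close> by (simp add: K4_def)
  then show "K > 0" using \<open>K1 >= 0\<close> by (simp add: K_def)
 qed
 define \<mu> where "\<mu> = 2 * K"
 have \<mu>: "\<mu> > 0" using Kpos by (simp add: \<mu>_def)
 define m where "m t x = \<bar>z t x\<bar> + \<bar>w t x\<bar> + \<bar>\<xi> t x\<bar>" for t x
 have cm: "continuous_on ?Q (%q. exp (- \<mu> * fst q) * m (fst q) (snd q))"
  unfolding m_def z_def w_def \<xi>_def by (intro continuous_intros cp)
 obtain q0 where q0: "q0 \<in> ?Q" "!!q. q \<in> ?Q ==> exp (- \<mu> * fst q) * m (fst q) (snd q) <= exp (- \<mu> * fst q0) * m (fst q0) (snd q0)"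
  using continuous_attains_sup[OF Qc Qne cm] by blast
 define B where "B = exp (- \<mu> * fst q0) * m (fst q0) (snd q0)"
 have B0: "B >= 0" by (simp add: B_def m_def)
 have ee: "exp (- \<mu> * t) * exp (\<mu> * t) = 1" for t
  by (simp add: exp_minus)
 have mB: "m t x <= B * exp (\<mu> * t)" if "t \<in> {0..T}" "x \<in> {0..1}" for t x
 proof -
  have "exp (- \<mu> * t) * m t x <= B" using q0(2)[of "(t, x)"] that by (simp add: B_def)
  then have "(exp (- \<mu> * t) * m t x) * exp (\<mu> * t) <= B * exp (\<mu> * t)" by (intro mult_right_mono) auto
  also have "(exp (- \<mu> * t) * m t x) * exp (\<mu> * t) = (exp (- \<mu> * t) * exp (\<mu> * t)) * m t x"
   by (simp only: mult_ac)
  finally show ?thesis unfolding ee by simp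
 qed
 have comp: "\<bar>z t x\<bar> <= m t x" "\<bar>w t x\<bar> <= m t x" for t x by (auto simp: m_def)
 have zb: "\<bar>z t x\<bar> <= B * exp (\<mu> * t) / \<mu>" if t: "t \<in> {0..T}" and x: "x \<in> {0..1}" for t x
 proof -
  have "V t x - V 0 x = prim (%u. W (0 + u) x) (t - 0)" "V' t x - V' 0 x = prim (%u. W' (0 + u) x) (t - 0)"
   using mild_systemD(4)[OF s1, of 0 t x] mild_systemD(4)[OF s2, of 0 t x] t x by auto
  then have "z t x = prim (%u. W u x) t - prim (%u. W' u x) t"
   using init(1)[OF x] by (simp add: z_def)
  also have "... = prim (%u. w u x) (t - 0)"
   unfolding w_def using prim_diff[of "%u. W u x" "%u. W' u x"] by (simp add: cp continuous_on_id continuous_on_const)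
  also have "\<bar>...\<bar> <= B * exp (\<mu> * t) / \<mu>"
  proof (rule prim_exp_bound)
   show "cont (%u. w u x)" unfolding w_def by (intro continuous_intros cp)
   fix u assume "u \<in> {0..t - 0}"
   then show "\<bar>w u x\<bar> <= B * exp (\<mu> * (0 + u))" using mB[of u x] comp[of u x] t x by auto
  qed (use t \<mu> B0 in auto)
  finally show ?thesis .
 qed
 have line: "\<bar>(w t (c - \<sigma> * t) + \<sigma> * \<xi> t (c - \<sigma> * t)) - (w s (c - \<sigma> * s) + \<sigma> * \<xi> s (c - \<sigma> * s))\<bar> <= K1 * B * exp (\<mu> * t) / \<mu>"
  if st: "0 <= s" "s <= t" "t <= T" and \<sigma>: "\<sigma> = 1 \<or> \<sigma> = -1" and ends: "c - \<sigma> * s \<in> {0..1}" "c - \<sigma> * t \<in> {0..1}" for s t c \<sigma>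
 proof -
  define g where "g u = f (V (s + u) (c - \<sigma> * (s + u))) - lam * W (s + u) (c - \<sigma> * (s + u))" for u
  define g' where "g' u = f (V' (s + u) (c - \<sigma> * (s + u))) - lam * W' (s + u) (c - \<sigma> * (s + u))" for u
  have gc: "cont g" "cont g'"
   unfolding g_def g'_def by (intro continuous_intros cp continuous_on_compose2[OF fc]; simp)+
  have "(W t (c - \<sigma> * t) + \<sigma> * X t (c - \<sigma> * t)) - (W s (c - \<sigma> * s) + \<sigma> * X s (c - \<sigma> * s)) = prim g (t - s)"
   "(W' t (c - \<sigma> * t) + \<sigma> * X' t (c - \<sigma> * t)) - (W' s (c - \<sigma> * s) + \<sigma> * X' s (c - \<sigma> * s)) = prim g' (t - s)"
   unfolding g_def g'_def by (rule mild_systemD(5)[OF s1 st \<sigma> ends], rule mild_systemD(5)[OF s2 st \<sigma> ends])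
  then have "(w t (c - \<sigma> * t) + \<sigma> * \<xi> t (c - \<sigma> * t)) - (w s (c - \<sigma> * s) + \<sigma> * \<xi> s (c - \<sigma> * s)) = prim g (t - s) - prim g' (t - s)"
   by (simp add: w_def \<xi>_def algebra_simps)
  also have "... = prim (%u. g u - g' u) (t - s)" by (rule prim_diff[OF gc, symmetric])
  also have "\<bar>...\<bar> <= (K1 * B) * exp (\<mu> * t) / \<mu>"
  proof (rule prim_exp_bound)
   show "cont (%u. g u - g' u)" by (intro continuous_intros gc)
   fix u assume u: "u \<in> {0..t - s}"
   have tin: "s + u \<in> {0..T}" using u st by auto
   have xin: "c - \<sigma> * (s + u) \<in> {0..1}" using u ends \<sigma> by auto
   let ?y = "c - \<sigma> * (s + u)"
   have "\<bar>g u - g' u\<bar> <= \<bar>f (V (s + u) ?y) - f (V' (s + u) ?y)\<bar> + \<bar>lam * w (s + u) ?y\<bar>"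
    unfolding g_def g'_def w_def by (simp add: right_diff_distrib)
   also have "... <= L1 * m (s + u) ?y + \<bar>lam\<bar> * m (s + u) ?y"
   proof (intro add_mono)
    have "\<bar>f (V (s + u) ?y) - f (V' (s + u) ?y)\<bar> <= L1 * \<bar>z (s + u) ?y\<bar>"
     unfolding z_def using R[OF tin xin] by (intro L1) auto
    also have "... <= L1 * m (s + u) ?y" using comp L1 by (intro mult_left_mono) auto
    finally show "\<bar>f (V (s + u) ?y) - f (V' (s + u) ?y)\<bar> <= L1 * m (s + u) ?y" .
    show "\<bar>lam * w (s + u) ?y\<bar> <= \<bar>lam\<bar> * m (s + u) ?y"
     unfolding abs_mult using comp by (intro mult_left_mono) auto
   qed
   also have "... = K1 * m (s + u) ?y" by (simp add: K1_def distrib_right)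
   also have "... <= K1 * (B * exp (\<mu> * (s + u)))" using mB[OF tin xin] Kpos by (intro mult_left_mono) auto
   finally show "\<bar>g u - g' u\<bar> <= K1 * B * exp (\<mu> * (s + u))" by simp
  qed (use st \<mu> B0 Kpos in auto)
  finally show ?thesis .
 qed
 have i0: "z 0 x = 0" "w 0 x = 0" "\<xi> 0 x = 0" if "x \<in> {0..1}" for x using init that by (auto simp: z_def w_def \<xi>_def)
 define E where "E t = B * exp (\<mu> * t) / \<mu>" for t
 have E0: "E t >= 0" for t using B0 \<mu> by (simp add: E_def)
 have Emono: "E s <= E t" if "s <= t" for s t
  unfolding E_def using that B0 \<mu> by (intro divide_right_mono mult_left_mono) auto
 have line': "\<bar>(w t (c - \<sigma> * t) + \<sigma> * \<xi> t (c - \<sigma> * t)) - (w s (c - \<sigma> * s) + \<sigma> * \<xi> s (c - \<sigma> * s))\<bar> <= K1 * E t"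
  if "0 <= s" "s <= t" "t <= T" "\<sigma> = 1 \<or> \<sigma> = -1" "c - \<sigma> * s \<in> {0..1}" "c - \<sigma> * t \<in> {0..1}" for s t c \<sigma>
  using line[OF that] by (simp add: E_def)
 \<comment> \<open>The outgoing invariant at an end is twice the velocity minus the incoming one.
   The incoming one is traced back to time 0, and the velocity is obtained from the boundary
   system.\<close>
 have bdry: "\<bar>2 * w \<tau> 0 - (w \<tau> 0 + \<xi> \<tau> 0)\<bar> <= K4 * E \<tau>" "\<bar>2 * w \<tau> 1 - (w \<tau> 1 - \<xi> \<tau> 1)\<bar> <= K4 * E \<tau>" if \<tau>: "\<tau> \<in> {0..T}" for \<tau>
 proof -
  define a0 b1 where "a0 = w \<tau> 0 + \<xi> \<tau> 0" and "b1 = w \<tau> 1 - \<xi> \<tau> 1"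
  have a0: "\<bar>a0\<bar> <= K1 * E \<tau>"
   using line'[of 0 \<tau> 1 \<tau>] \<tau> T i0[of \<tau>] by (auto simp: a0_def)
  have b1: "\<bar>b1\<bar> <= K1 * E \<tau>"
   using line'[of 0 \<tau> "-1" "1 - \<tau>"] \<tau> T i0[of "1 - \<tau>"] by (auto simp: b1_def)
  define r0 where "r0 = a0 + (\<phi>0 (V \<tau> 0) - \<phi>0 (V' \<tau> 0)) - H1 \<tau> * z \<tau> 1"
  define r1 where "r1 = b1 + (\<phi>1 (V \<tau> 1) - \<phi>1 (V' \<tau> 1)) - H0 \<tau> * z \<tau> 0"
  have zz: "\<bar>z \<tau> 0\<bar> <= E \<tau>" "\<bar>z \<tau> 1\<bar> <= E \<tau>" using zb[OF \<tau>] by (auto simp: E_def)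
  have r0b: "\<bar>r0\<bar> <= K2 * E \<tau>"
  proof -
   have "\<bar>\<phi>0 (V \<tau> 0) - \<phi>0 (V' \<tau> 0)\<bar> <= L2 * \<bar>z \<tau> 0\<bar>" unfolding z_def using R[OF \<tau>, of 0] by (intro L2) auto
   also have "... <= L2 * E \<tau>" using L2 zz by (intro mult_left_mono) auto
   finally have 1: "\<bar>\<phi>0 (V \<tau> 0) - \<phi>0 (V' \<tau> 0)\<bar> <= L2 * E \<tau>" .
   have 2: "\<bar>H1 \<tau> * z \<tau> 1\<bar> <= h1 * E \<tau>" unfolding abs_mult using h1 \<tau> zz by (intro mult_mono) auto
   have "\<bar>r0\<bar> <= K1 * E \<tau> + L2 * E \<tau> + h1 * E \<tau>" unfolding r0_def using a0 1 2 by linarith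
   also have "... <= K2 * E \<tau>" unfolding distrib_right[symmetric] using L3 h0 E0 by (intro mult_right_mono) (auto simp: K2_def)
   finally show ?thesis .
  qed
  have r1b: "\<bar>r1\<bar> <= K2 * E \<tau>"
  proof -
   have "\<bar>\<phi>1 (V \<tau> 1) - \<phi>1 (V' \<tau> 1)\<bar> <= L3 * \<bar>z \<tau> 1\<bar>" unfolding z_def using R[OF \<tau>, of 1] by (intro L3) auto
   also have "... <= L3 * E \<tau>" using L3 zz by (intro mult_left_mono) auto
   finally have 1: "\<bar>\<phi>1 (V \<tau> 1) - \<phi>1 (V' \<tau> 1)\<bar> <= L3 * E \<tau>" .
   have 2: "\<bar>H0 \<tau> * z \<tau> 0\<bar> <= h0 * E \<tau>" unfolding abs_mult using h0 \<tau> zz by (intro mult_mono) auto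
   have "\<bar>r1\<bar> <= K1 * E \<tau> + L3 * E \<tau> + h0 * E \<tau>" unfolding r1_def using b1 1 2 by linarith
   also have "... <= K2 * E \<tau>" unfolding distrib_right[symmetric] using L2 h1 E0 by (intro mult_right_mono) (auto simp: K2_def)
   finally show ?thesis .
  qed
  have X0: "X \<tau> 0 = - \<phi>0 (V \<tau> 0) + lam0 * W \<tau> 0 + H1 \<tau> * V \<tau> 1 + tlam1 * W \<tau> 1"
   "X' \<tau> 0 = - \<phi>0 (V' \<tau> 0) + lam0 * W' \<tau> 0 + H1 \<tau> * V' \<tau> 1 + tlam1 * W' \<tau> 1"
   "- X \<tau> 1 = - \<phi>1 (V \<tau> 1) + lam1 * W \<tau> 1 + H0 \<tau> * V \<tau> 0 + tlam0 * W \<tau> 0"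
   "- X' \<tau> 1 = - \<phi>1 (V' \<tau> 1) + lam1 * W' \<tau> 1 + H0 \<tau> * V' \<tau> 0 + tlam0 * W' \<tau> 0"
   by (rule mild_systemD(6,7)[OF s1 \<tau>] mild_systemD(6,7)[OF s2 \<tau>])+
  have e1: "(1 + lam0) * w \<tau> 0 + tlam1 * w \<tau> 1 = r0"
   unfolding r0_def a0_def w_def \<xi>_def z_def using X0(1,2) by (simp add: algebra_simps)
  have e2: "tlam0 * w \<tau> 0 + (1 + lam1) * w \<tau> 1 = r1"
   unfolding r1_def b1_def w_def \<xi>_def z_def using X0(3,4) by (simp add: algebra_simps)
  have lin: "\<bar>a * x - b * y\<bar> / Dt <= K3 * E \<tau>"
   if "\<bar>a\<bar> + \<bar>b\<bar> <= \<bar>1 + lam0\<bar> + \<bar>1 + lam1\<bar> + \<bar>tlam0\<bar> + \<bar>tlam1\<bar>" "\<bar>x\<bar> <= K2 * E \<tau>" "\<bar>y\<bar> <= K2 * E \<tau>" for a b x y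
  proof -
   have "\<bar>a * x - b * y\<bar> <= \<bar>a\<bar> * \<bar>x\<bar> + \<bar>b\<bar> * \<bar>y\<bar>" by (metis abs_mult abs_triangle_ineq4)
   also have "... <= \<bar>a\<bar> * (K2 * E \<tau>) + \<bar>b\<bar> * (K2 * E \<tau>)" using that by (intro add_mono mult_left_mono) auto
   also have "... = (\<bar>a\<bar> + \<bar>b\<bar>) * (K2 * E \<tau>)" by (simp add: distrib_right)
   also have "... <= (\<bar>1 + lam0\<bar> + \<bar>1 + lam1\<bar> + \<bar>tlam0\<bar> + \<bar>tlam1\<bar>) * (K2 * E \<tau>)"
    using that(1) Kpos E0 by (intro mult_right_mono) auto
   finally have "\<bar>a * x - b * y\<bar> / Dt <= (\<bar>1 + lam0\<bar> + \<bar>1 + lam1\<bar> + \<bar>tlam0\<bar> + \<bar>tlam1\<bar>) * (K2 * E \<tau>) / Dt"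
    using Dt by (intro divide_right_mono) auto
   then show ?thesis by (simp add: K3_def mult.assoc)
  qed
  have "\<bar>w \<tau> 0\<bar> <= K3 * E \<tau>" "\<bar>w \<tau> 1\<bar> <= K3 * E \<tau>"
   using boundary_solve[OF e1 e2 Dt_def Dt] lin[of "1 + lam1" tlam1 r0 r1] lin[of "1 + lam0" tlam0 r1 r0] r0b r1b Dt
   by (auto simp: abs_divide)
  then have "\<bar>2 * w \<tau> 0 - a0\<bar> <= 2 * (K3 * E \<tau>) + K1 * E \<tau>" "\<bar>2 * w \<tau> 1 - b1\<bar> <= 2 * (K3 * E \<tau>) + K1 * E \<tau>"
   using a0 b1 by linarith+
  then show "\<bar>2 * w \<tau> 0 - (w \<tau> 0 + \<xi> \<tau> 0)\<bar> <= K4 * E \<tau>" "\<bar>2 * w \<tau> 1 - (w \<tau> 1 - \<xi> \<tau> 1)\<bar> <= K4 * E \<tau>"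
   by (simp_all add: a0_def b1_def K4_def distrib_right)
 qed
 have ab: "\<bar>w t x + \<xi> t x\<bar> <= (K4 + K1) * E t" "\<bar>w t x - \<xi> t x\<bar> <= (K4 + K1) * E t" if t: "t \<in> {0..T}" and x: "x \<in> {0..1}" for t x
 proof -
  have K4E: "K4 * E t >= 0" using Kpos E0 by simp
  show "\<bar>w t x + \<xi> t x\<bar> <= (K4 + K1) * E t"
  proof (cases "x + t <= 1")
   case True
   then show ?thesis using line'[of 0 t 1 "x + t"] t x T i0[of "x + t"] K4E by (auto simp: distrib_right)
  next
   case False
   \<comment> \<open>The time at which the line through \<open>(t, x)\<close> leaves the end
     \<open>x = 1\<close>.\<close>
   define \<tau> where "\<tau> = x + t - 1"
   have \<tau>: "\<tau> \<in> {0..T}" "\<tau> <= t" using False t x by (auto simp: \<tau>_def)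
   have "\<bar>(w t x + \<xi> t x) - (w \<tau> 1 + \<xi> \<tau> 1)\<bar> <= K1 * E t"
    using line'[of \<tau> t 1 "x + t"] \<tau> t x by (auto simp: \<tau>_def)
   moreover have "\<bar>w \<tau> 1 + \<xi> \<tau> 1\<bar> <= K4 * E t"
    using bdry(2)[OF \<tau>(1)] mult_left_mono[OF Emono[OF \<tau>(2)] Kpos(4)] by auto
   ultimately show ?thesis unfolding distrib_right by linarith
  qed
  show "\<bar>w t x - \<xi> t x\<bar> <= (K4 + K1) * E t"
  proof (cases "t <= x")
   case True
   then show ?thesis using line'[of 0 t "-1" "x - t"] t x T i0[of "x - t"] K4E by (auto simp: distrib_right)
  next
   case False
   define \<tau> where "\<tau> = t - x"
   have \<tau>: "\<tau> \<in> {0..T}" "\<tau> <= t" using False t x by (auto simp: \<tau>_def)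
   have "\<bar>(w t x - \<xi> t x) - (w \<tau> 0 - \<xi> \<tau> 0)\<bar> <= K1 * E t"
    using line'[of \<tau> t "-1" "x - t"] \<tau> t x by (auto simp: \<tau>_def)
   moreover have "\<bar>w \<tau> 0 - \<xi> \<tau> 0\<bar> <= K4 * E t"
    using bdry(1)[OF \<tau>(1)] mult_left_mono[OF Emono[OF \<tau>(2)] Kpos(4)] by auto
   ultimately show ?thesis unfolding distrib_right by linarith
  qed
 qed
 have mK: "m t x <= K * E t" if "t \<in> {0..T}" "x \<in> {0..1}" for t x
 proof -
  have "\<bar>w t x\<bar> <= (K4 + K1) * E t" "\<bar>\<xi> t x\<bar> <= (K4 + K1) * E t" using ab[OF that] by linarith+
  moreover have "\<bar>z t x\<bar> <= E t" using zb[OF that] by (simp add: E_def)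
  moreover have "(K4 + K1) * E t >= 0" using Kpos E0 by simp
  ultimately have "m t x <= E t + 4 * ((K4 + K1) * E t)" unfolding m_def by linarith
  then show ?thesis by (simp add: K_def algebra_simps)
 qed
 have "B <= exp (- \<mu> * fst q0) * (K * E (fst q0))"
  unfolding B_def using mK[of "fst q0" "snd q0"] q0(1) by (intro mult_left_mono) auto
 also have "... = (exp (- \<mu> * fst q0) * exp (\<mu> * fst q0)) * (B / 2)"
  using Kpos by (simp add: E_def \<mu>_def)
 also have "... = B / 2" unfolding ee by simp
 finally have "B = 0" using B0 by simp
 then show ?thesis using mB[OF tx] comp(1)[of t x] by (simp add: z_def)
qed

text \<open>Equation and boundary conditions are given only almost everywhere; continuity of
  \<open>V\<close>, \<open>W\<close>, \<open>X\<close> extends the boundary conditions to all times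
  of the closed interval, and \<open>solution_lines\<close> integrates the equation up to its end
  points.\<close>

lemma solution_regular:
 assumes T: "T > 0" and p: "p > 2" "\<alpha> > 2" "\<beta> > 2"
  and H: "continuous_on {0..T} H0" "continuous_on {0..T} H1"
  and h: "AE t in lebesgue_on {0<..<T}. h0 t = H0 t" "AE t in lebesgue_on {0<..<T}. h1 t = H1 t"
  and u0: "AE x in lebesgue_on \<Omega>. u0 x = U0 x" "!!x. x \<in> {0..1} ==> (U0 has_real_derivative U0' x) (at x within {0..1})"
  and u1: "AE x in lebesgue_on \<Omega>. u1 x = U1 x" "continuous_on {0..1} U1"
  and sol: "is_solution p \<alpha> \<beta> lam lam0 lam1 tlam0 tlam1 h0 h1 u0 u1 T v"
 obtains V W X where
  "mild_system lam lam0 lam1 tlam0 tlam1 (%y. \<bar>y\<bar> powr (p - 2) * y - y) (%y. \<bar>y\<bar> powr (\<alpha> - 2) * y) (%y. \<bar>y\<bar> powr (\<beta> - 2) * y) H0 H1 T V W X"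
  "!!x. x \<in> {0..1} ==> V 0 x = U0 x" "!!x. x \<in> {0..1} ==> W 0 x = U1 x" "!!x. x \<in> {0..1} ==> X 0 x = U0' x"
  "AE z in lebesgue_on ({0<..<T} \<times> \<Omega>). v (fst z) (snd z) = V (fst z) (snd z)"
proof -
 let ?R = "{0<..<T} \<times> \<Omega>"
 let ?f = "%y. \<bar>y\<bar> powr (p - 2) * y - y" and ?\<phi>0 = "%y. \<bar>y\<bar> powr (\<alpha> - 2) * y" and ?\<phi>1 = "%y. \<bar>y\<bar> powr (\<beta> - 2) * y"
 obtain vt vtt vxx where
  w1: "has_weak_deriv ?R [(1,0)] (%(t,x). v t x) (%(t,x). vt t x)" and
  w2: "has_weak_deriv ?R [(1,0),(1,0)] (%(t,x). v t x) (%(t,x). vtt t x)" and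
  w3: "has_weak_deriv ?R [(0,1),(0,1)] (%(t,x). v t x) (%(t,x). vxx t x)" and
  b1: "v \<in> Linf_Bochner {0<..<T} (Sobolev 2 \<Omega>) (Sobolev_norm 2 \<Omega>)" and
  b2: "vt \<in> Linf_Bochner {0<..<T} (Sobolev 1 \<Omega>) (Sobolev_norm 1 \<Omega>)" and
  b3: "vtt \<in> Linf_Bochner {0<..<T} (L2 \<Omega>) (L2_norm \<Omega>)" and
  pde: "AE (t,x) in lebesgue_on ?R. vtt t x - vxx t x + v t x + lam * vt t x = \<bar>v t x\<bar> powr (p - 2) * v t x" and
  bc0: "AE t in lebesgue_on {0<..<T}.
      cont_value \<Omega> (weak_deriv \<Omega> 1 (v t)) 0 =
       - (\<bar>cont_value \<Omega> (v t) 0\<bar> powr (\<alpha> - 2) * cont_value \<Omega> (v t) 0)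
       + lam0 * cont_value \<Omega> (vt t) 0
       + h1 t * cont_value \<Omega> (v t) 1 + tlam1 * cont_value \<Omega> (vt t) 1" and
  bc1: "AE t in lebesgue_on {0<..<T}.
      - cont_value \<Omega> (weak_deriv \<Omega> 1 (v t)) 1 =
       - (\<bar>cont_value \<Omega> (v t) 1\<bar> powr (\<beta> - 2) * cont_value \<Omega> (v t) 1)
       + lam1 * cont_value \<Omega> (vt t) 1
       + h0 t * cont_value \<Omega> (v t) 0 + tlam0 * cont_value \<Omega> (vt t) 0" and
  i0: "has_initial_value T v u0" and i1: "has_initial_value T vt u1"
  using sol unfolding is_solution_def by (elim exE conjE)
 obtain V W X N where
  V: "cont (%(t, x). V t x)" and W: "cont (%(t, x). W t x)" and X: "cont (%(t, x). X t x)"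
  and N: "AE t in lborel. t \<in> {0<..<T} --> t \<in> N" "N \<subseteq> {0<..<T}"
  and vV: "!!t. t \<in> N ==> AE x in lebesgue_on \<Omega>. v t x = V t x"
  and vW: "!!t. t \<in> N ==> AE x in lebesgue_on \<Omega>. vt t x = W t x"
  and VX: "!!t x. t \<in> N ==> x \<in> {0..1} ==> (V t has_real_derivative X t x) (at x within {0..1})"
  and vX: "!!t. t \<in> N ==> AE x in lebesgue_on \<Omega>. weak_deriv \<Omega> 1 (v t) x = X t x"
  and jV: "AE z in lebesgue_on ?R. v (fst z) (snd z) = V (fst z) (snd z)"
  and jW: "AE z in lebesgue_on ?R. vt (fst z) (snd z) = W (fst z) (snd z)"
  by (rule solution_slices[OF T w1 w2 b1 b2 b3]) (assumption | blast)+
 note cp = continuous_on_pair[OF V] continuous_on_pair[OF W] continuous_on_pair[OF X]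
 have fc: "cont ?f" by (intro continuous_on_diff continuous_powr_mult continuous_on_id) (use p in simp)
 have \<phi>c: "cont ?\<phi>0" "cont ?\<phi>1" by (rule continuous_powr_mult; use p in simp)+
 define G where "G t x = ?f (V t x) - lam * W t x" for t x
 have G: "cont (%(t, x). G t x)"
  unfolding G_def case_prod_unfold
  by (intro continuous_on_diff continuous_on_mult continuous_on_const cp continuous_on_fst continuous_on_snd continuous_on_id
    continuous_on_compose2[OF fc]) auto
 have VXA: "AE t in lborel. t \<in> {0<..<T} --> (\<forall>x\<in>{0..1}. (V t has_real_derivative X t x) (at x within {0..1}))"
  using N(1) by eventually_elim (use VX in blast)
 have pdeG: "AE z in lebesgue_on ?R. vtt (fst z) (snd z) - vxx (fst z) (snd z) = G (fst z) (snd z)"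
  using pde jV jW
 proof eventually_elim
  case (elim z)
  then show ?case by (simp add: G_def case_prod_unfold)
 qed
 note lines = solution_lines[OF T w1 w2 w3 V W X G jV jW VXA pdeG]
 have cV: "continuous_on {0..1} (V t)" "continuous_on {0..1} (W t)" "continuous_on {0..1} (X t)" for t
  by (intro cp continuous_intros)+
 have N': "AE t in lborel. t \<in> {0<..<T} -->
   X t 0 = - ?\<phi>0 (V t 0) + lam0 * W t 0 + H1 t * V t 1 + tlam1 * W t 1 &
   - X t 1 = - ?\<phi>1 (V t 1) + lam1 * W t 1 + H0 t * V t 0 + tlam0 * W t 0"
 proof -
  have A: "AE t in lebesgue_on {0<..<T}. t \<in> N"
   using N(1) by (simp add: AE_lebesgue_on)
  have "AE t in lebesgue_on {0<..<T}.
    X t 0 = - ?\<phi>0 (V t 0) + lam0 * W t 0 + H1 t * V t 1 + tlam1 * W t 1 &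
    - X t 1 = - ?\<phi>1 (V t 1) + lam1 * W t 1 + H0 t * V t 0 + tlam0 * W t 0"
   using A bc0 bc1 h
  proof eventually_elim
   case (elim t)
   have "cont_value \<Omega> (v t) x = V t x" "cont_value \<Omega> (vt t) x = W t x" "cont_value \<Omega> (weak_deriv \<Omega> 1 (v t)) x = X t x"
    if "x \<in> {0..1}" for x
    by (rule cont_value_eq[OF zero_less_one cV(1) vV[OF elim(1)] that], rule cont_value_eq[OF zero_less_one cV(2) vW[OF elim(1)] that],
      rule cont_value_eq[OF zero_less_one cV(3) vX[OF elim(1)] that])
   from this[of 0] this[of 1] elim(2-5) show ?case by simp
  qed
  then show ?thesis by (simp only: AE_lebesgue_on_Ioo)
 qed
 have bc: "X t 0 = - ?\<phi>0 (V t 0) + lam0 * W t 0 + H1 t * V t 1 + tlam1 * W t 1"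
  "- X t 1 = - ?\<phi>1 (V t 1) + lam1 * W t 1 + H0 t * V t 0 + tlam0 * W t 0" if t: "t \<in> {0..T}" for t
 proof -
  show "X t 0 = - ?\<phi>0 (V t 0) + lam0 * W t 0 + H1 t * V t 1 + tlam1 * W t 1"
  proof (rule continuous_AE_eq[OF T _ _ _ t, of "%t. X t 0" "%t. - ?\<phi>0 (V t 0) + lam0 * W t 0 + H1 t * V t 1 + tlam1 * W t 1"])
   show "continuous_on {0..T} (%t. - ?\<phi>0 (V t 0) + lam0 * W t 0 + H1 t * V t 1 + tlam1 * W t 1)"
    by (intro continuous_on_add continuous_on_minus continuous_on_mult continuous_on_const H cp continuous_on_id
      continuous_on_compose2[OF \<phi>c(1)]) auto
   show "AE s in lborel. s \<in> {0<..<T} --> X s 0 = - ?\<phi>0 (V s 0) + lam0 * W s 0 + H1 s * V s 1 + tlam1 * W s 1"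
    using N' by eventually_elim blast
  qed (intro cp continuous_intros)
  show "- X t 1 = - ?\<phi>1 (V t 1) + lam1 * W t 1 + H0 t * V t 0 + tlam0 * W t 0"
  proof (rule continuous_AE_eq[OF T _ _ _ t, of "%t. - X t 1" "%t. - ?\<phi>1 (V t 1) + lam1 * W t 1 + H0 t * V t 0 + tlam0 * W t 0"])
   show "continuous_on {0..T} (%t. - ?\<phi>1 (V t 1) + lam1 * W t 1 + H0 t * V t 0 + tlam0 * W t 0)"
    by (intro continuous_on_add continuous_on_minus continuous_on_mult continuous_on_const H cp continuous_on_id
      continuous_on_compose2[OF \<phi>c(2)]) auto
   show "AE s in lborel. s \<in> {0<..<T} --> - X s 1 = - ?\<phi>1 (V s 1) + lam1 * W s 1 + H0 s * V s 0 + tlam0 * W s 0"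
    using N' by eventually_elim blast
  qed (intro cp continuous_intros)
 qed
 have U0c: "continuous_on {0..1} U0"
  using u0(2) by (intro DERIV_continuous_on) auto
 have V0: "V 0 x = U0 x" if "x \<in> {0..1}" for x
  by (rule initial_value_eq[OF T N(1) V vV i0 u0(1) U0c that])
 have W0: "W 0 x = U1 x" if "x \<in> {0..1}" for x
  by (rule initial_value_eq[OF T N(1) W vW i1 u1(1,2) that])
 \<comment> \<open>\<open>X\<close> has no initial condition of its own. The relation between
   \<open>V\<close> and \<open>X\<close> in space is carried to time 0 by continuity in time, and
   there \<open>V\<close> is known.\<close>
 have Vprim: "V t y = V t 0 + prim (X t) y" if y: "y \<in> {0..1}" and t: "t \<in> {0..T}" for t y
 proof (rule continuous_AE_eq[OF T _ _ _ t, of "%t. V t y" "%t. V t 0 + prim (X t) y"])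
  show "continuous_on {0..T} (%t. V t 0 + prim (X t) y)"
   by (intro continuous_on_add cp continuous_intros continuous_on_subset[OF prim_continuous_on[OF X]]) auto
  show "AE s in lborel. s \<in> {0<..<T} --> V s y = V s 0 + prim (X s) y"
   using VXA
  proof eventually_elim
   case (elim s)
   show ?case
   proof
    assume "s \<in> {0<..<T}"
    then have D: "\<forall>x\<in>{0..1}. (V s has_real_derivative X s x) (at x within {0..1})" using elim by blast
    have cX: "continuous_on A (X s)" for A by (intro cp continuous_intros)
    have "(LINT u|lborel. indicator {0..y} u *\<^sub>R X s u) = V s y - V s 0"
    proof (rule integral_FTC_Icc)
     show "0 <= y" using y by simp
     fix u assume "0 <= u" "u <= y"
     then have "(V s has_real_derivative X s u) (at u within {0..y})"
      using D y by (auto intro: has_field_derivative_subset[of _ _ _ "{0..1}" "{0..y}"])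
     then show "(V s has_vector_derivative X s u) (at u within {0..y})"
      by (simp add: has_real_derivative_iff_has_vector_derivative)
    qed (rule cX)
    then show "V s y = V s 0 + prim (X s) y"
     using prim_LINT[OF cX, of y] y by simp
   qed
  qed
 qed (intro cp continuous_intros)
 have X0: "X 0 x = U0' x" if x: "x \<in> {0..1}" for x
 proof -
  have cX: "cont (X 0)" by (intro cp continuous_intros)
  have "((%y. V 0 0 + prim (X 0) y) has_real_derivative X 0 x) (at x within {0..1})"
   using has_field_derivative_at_within[OF DERIV_prim[OF cX]] by (auto intro!: derivative_eq_intros)
  then have "(U0 has_real_derivative X 0 x) (at x within {0..1})"
  proof (rule has_field_derivative_transform_within[OF _ zero_less_one x])
   fix y :: real assume y: "y \<in> {0..1}"
   show "V 0 0 + prim (X 0) y = U0 y" using Vprim[OF y, of 0] V0[OF y] T by simp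
  qed
  then show ?thesis
   using u0(2)[OF x] x vector_derivative_unique_within_closed_interval[of 0 1 x U0 "X 0 x" "U0' x"]
   by (simp add: has_real_derivative_iff_has_vector_derivative)
 qed
 have "mild_system lam lam0 lam1 tlam0 tlam1 ?f ?\<phi>0 ?\<phi>1 H0 H1 T V W X"
  unfolding mild_system_def
 proof (intro conjI allI impI ballI V W X)
  fix s t \<xi> assume "0 <= s" "s <= t" "t <= T" "\<xi> \<in> {0..1::real}"
  then show "V t \<xi> - V s \<xi> = prim (%u. W (s + u) \<xi>) (t - s)" by (rule lines(1))
 next
  fix s t \<xi> \<sigma> :: real assume "0 <= s" "s <= t" "t <= T" "\<sigma> = 1 \<or> \<sigma> = -1" "\<xi> - \<sigma> * s \<in> {0..1}" "\<xi> - \<sigma> * t \<in> {0..1}"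
  then show "(W t (\<xi> - \<sigma> * t) + \<sigma> * X t (\<xi> - \<sigma> * t)) - (W s (\<xi> - \<sigma> * s) + \<sigma> * X s (\<xi> - \<sigma> * s)) =
    prim (%u. ?f (V (s + u) (\<xi> - \<sigma> * (s + u))) - lam * W (s + u) (\<xi> - \<sigma> * (s + u))) (t - s)"
   unfolding G_def[symmetric] by (rule lines(2))
 qed (rule bc, assumption)+
 then show ?thesis by (rule that) (use V0 W0 X0 jV in auto)
qed

lemma solution_unique:
 assumes T: "T > 0" "T <= 1" and p: "p > 2" "\<alpha> > 2" "\<beta> > 2"
  and lam: "lam0 > 0" "lam1 > 0" "\<bar>tlam0 + tlam1\<bar> < 2 * sqrt (lam0 * lam1)"
  and H: "continuous_on {0..T} H0" "continuous_on {0..T} H1"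
  and h: "AE t in lebesgue_on {0<..<T}. h0 t = H0 t" "AE t in lebesgue_on {0<..<T}. h1 t = H1 t"
  and u0: "AE x in lebesgue_on \<Omega>. u0 x = U0 x" "!!x. x \<in> {0..1} ==> (U0 has_real_derivative U0' x) (at x within {0..1})"
  and u1: "AE x in lebesgue_on \<Omega>. u1 x = U1 x" "continuous_on {0..1} U1"
  and u: "is_solution p \<alpha> \<beta> lam lam0 lam1 tlam0 tlam1 h0 h1 u0 u1 T u"
  and v: "is_solution p \<alpha> \<beta> lam lam0 lam1 tlam0 tlam1 h0 h1 u0 u1 T v"
 shows "AE (t,x) in lebesgue_on ({0<..<T} \<times> \<Omega>). v t x = u t x"
proof -
 let ?f = "%y. \<bar>y\<bar> powr (p - 2) * y - y" and ?\<phi>0 = "%y. \<bar>y\<bar> powr (\<alpha> - 2) * y" and ?\<phi>1 = "%y. \<bar>y\<bar> powr (\<beta> - 2) * y"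
 have ex: "EX V W X. mild_system lam lam0 lam1 tlam0 tlam1 ?f ?\<phi>0 ?\<phi>1 H0 H1 T V W X &
   (\<forall>x\<in>{0..1}. V 0 x = U0 x & W 0 x = U1 x & X 0 x = U0' x) &
   (AE z in lebesgue_on ({0<..<T} \<times> \<Omega>). w (fst z) (snd z) = V (fst z) (snd z))"
  if sol: "is_solution p \<alpha> \<beta> lam lam0 lam1 tlam0 tlam1 h0 h1 u0 u1 T w" for w
 proof (rule solution_regular[OF T(1) p H h u0(1) u0(2) u1 sol])
  fix V W X
  assume "mild_system lam lam0 lam1 tlam0 tlam1 ?f ?\<phi>0 ?\<phi>1 H0 H1 T V W X"
   "!!x. x \<in> {0..1} ==> V 0 x = U0 x" "!!x. x \<in> {0..1} ==> W 0 x = U1 x" "!!x. x \<in> {0..1} ==> X 0 x = U0' x"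
   "AE z in lebesgue_on ({0<..<T} \<times> \<Omega>). w (fst z) (snd z) = V (fst z) (snd z)"
  then show ?thesis by (intro exI[of _ V] exI[of _ W] exI[of _ X] conjI ballI) simp_all
 qed
 obtain V W X where s1: "mild_system lam lam0 lam1 tlam0 tlam1 ?f ?\<phi>0 ?\<phi>1 H0 H1 T V W X"
  and i1: "\<forall>x\<in>{0..1}. V 0 x = U0 x & W 0 x = U1 x & X 0 x = U0' x"
  and e1: "AE z in lebesgue_on ({0<..<T} \<times> \<Omega>). u (fst z) (snd z) = V (fst z) (snd z)"
  using ex[OF u] by (elim exE conjE)
 obtain V' W' X' where s2: "mild_system lam lam0 lam1 tlam0 tlam1 ?f ?\<phi>0 ?\<phi>1 H0 H1 T V' W' X'"
  and i2: "\<forall>x\<in>{0..1}. V' 0 x = U0 x & W' 0 x = U1 x & X' 0 x = U0' x"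
  and e2: "AE z in lebesgue_on ({0<..<T} \<times> \<Omega>). v (fst z) (snd z) = V' (fst z) (snd z)"
  using ex[OF v] by (elim exE conjE)
 have eq: "V t x = V' t x" if "t \<in> {0..T}" "x \<in> {0..1}" for t x
 proof (rule mild_unique[OF T _ _ _ _ H boundary_det_pos[OF lam] s1 s2 _ _ _ that])
  show "locally_lipschitz ?f" "locally_lipschitz ?\<phi>0" "locally_lipschitz ?\<phi>1"
   using p by (auto intro!: locally_lipschitz_diff_id locally_lipschitz_abs_powr_mult)
  show "cont ?f"
   by (intro continuous_on_diff continuous_powr_mult continuous_on_id) (use p in simp)
 qed (use i1 i2 in auto)
 have R: "{0<..<T} \<times> \<Omega> \<in> sets borel" by (auto intro!: open_Times borel_open)
 have "AE z in lebesgue_on ({0<..<T} \<times> \<Omega>). z \<in> {0<..<T} \<times> \<Omega>"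
  by (simp add: AE_lebesgue_on[OF R])
 then show ?thesis
  using e1 e2
 proof eventually_elim
  case (elim z)
  then show ?case using eq[of "fst z" "snd z"] by (auto simp: case_prod_unfold)
 qed
qed

section \<open>The fixed point equation\<close>

lemma prim_bound_nonneg:
 assumes g: "cont g" and y: "0 <= y" and le: "!!s. s \<in> {0..y} ==> \<bar>g s\<bar> <= M"
 shows "\<bar>prim g y\<bar> <= M * y"
proof -
 have "norm (integral {0..1} (%\<theta>. g (y * \<theta>))) <= M * (1 - 0)"
 proof (rule integral_bound)
  show "continuous_on {0..1} (%\<theta>. g (y * \<theta>))"
   by (intro continuous_on_compose2[OF g] continuous_intros) auto
  fix \<theta> :: real assume "\<theta> \<in> {0..1}"
  then show "norm (g (y * \<theta>)) <= M"
   using le[of "y * \<theta>"] y by (simp add: mult_left_le)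
 qed simp
 then have "y * \<bar>integral {0..1} (%\<theta>. g (y * \<theta>))\<bar> <= y * M"
  using y by (intro mult_left_mono) auto
 then show ?thesis using y by (simp add: prim_def abs_mult mult.commute)
qed

lemma prim_continuous:
 assumes g: "cont g"
 shows "cont (prim g)"
 using DERIV_isCont[OF DERIV_prim[OF g]] by (simp add: continuous_at_imp_continuous_on)

lemma prim_cong:
 assumes "0 <= y" "!!s. s \<in> {0..y} ==> g s = h s"
 shows "prim g y = prim h y"
proof -
 have "integral {0..1} (%\<theta>. g (y * \<theta>)) = integral {0..1} (%\<theta>. h (y * \<theta>))"
  by (rule integral_cong) (use assms in \<open>auto simp: mult_left_le\<close>)
 then show ?thesis by (simp add: prim_def)
qed

lemma prim_split:
 assumes g: "cont g"
 shows "prim g (a + y) = prim g a + prim (%u. g (a + u)) y"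
proof -
 obtain G where G: "!!x. (G has_real_derivative g x) (at x)" using continuous_antiderivative[OF g] by blast
 have "((%u. G (a + u)) has_real_derivative g (a + u)) (at u)" for u
  by (rule DERIV_cong[OF DERIV_chain2[where g="%u. a + u" and Db=1, OF G]]) (auto intro!: derivative_eq_intros)
 from prim_eq_antiderivative[OF this, of y] prim_eq_antiderivative[OF G]
 show ?thesis by simp
qed

text \<open>Applied to differences of continued data: they vanish up to the corner, so only the part
  of length at most \<open>L\<close> beyond it contributes.\<close>

lemma prim_tail_right:
 assumes g: "cont g" and z: "!!s. s <= 1 ==> g s = 0" and M: "!!s. \<bar>g s\<bar> <= M" and y: "y <= 1 + L" "L >= 0"
 shows "\<bar>prim g y\<bar> <= M * L"
proof -
 have M0: "M >= 0" using M[of 0] by linarith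
 have small: "prim g x = 0" if "x <= 1" for x
 proof -
  have zz: "g (x * \<theta>) = 0" if "\<theta> \<in> {0..1}" for \<theta>
  proof (rule z)
   show "x * \<theta> <= 1"
    using \<open>x <= 1\<close> that mult_mono[of x 1 \<theta> 1] by (cases "x >= 0") (auto intro: order_trans[OF mult_nonpos_nonneg])
  qed
  have "integral {0..1} (%\<theta>. g (x * \<theta>)) = integral {0..1} (%\<theta>::real. 0)" by (rule integral_cong[OF zz])
  then show ?thesis by (simp add: prim_def)
 qed
 show ?thesis
 proof (cases "y <= 1")
  case True
  then show ?thesis using small M0 y by simp
 next
  case False
  have "prim g (1 + (y - 1)) = prim g 1 + prim (%u. g (1 + u)) (y - 1)" by (rule prim_split[OF g])
  then have "\<bar>prim g y\<bar> = \<bar>prim (%u. g (1 + u)) (y - 1)\<bar>" using small[of 1] by simp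
  also have "... <= M * \<bar>y - 1\<bar>"
   by (rule prim_bound) (auto intro!: continuous_on_compose2[OF g] continuous_intros M)
  also have "... <= M * L" using False y M0 by (intro mult_left_mono) auto
  finally show ?thesis .
 qed
qed

lemma prim_tail_left:
 assumes g: "cont g" and z: "!!s. s >= 0 ==> g s = 0" and M: "!!s. \<bar>g s\<bar> <= M" and y: "- L <= y" "L >= 0"
 shows "\<bar>prim g y\<bar> <= M * L"
proof -
 have M0: "M >= 0" using M[of 0] by linarith
 show ?thesis
 proof (cases "y >= 0")
  case True
  have "\<bar>prim g y\<bar> <= 0 * y" by (rule prim_bound_nonneg[OF g True]) (use z in auto)
  then show ?thesis using M0 y by simp
 next
  case False
  have "\<bar>prim g y\<bar> <= M * \<bar>y\<bar>" by (rule prim_bound[OF g M])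
  also have "... <= M * L" using False y M0 by (intro mult_left_mono) auto
  finally show ?thesis .
 qed
qed

lemma DERIV_prim_param:
 fixes h hz :: "real => real => real"
 assumes h: "cont (%(z, r). h z r)" and hz: "cont (%(z, r). hz z r)"
  and D: "!!z r. ((%z. h z r) has_real_derivative hz z r) (at z)"
 shows "((%z. prim (h z) \<tau>) has_real_derivative prim (hz z) \<tau>) (at z)"
proof -
 have "((%z. integral (cbox 0 1) (%\<theta>. h z (\<tau> * \<theta>))) has_real_derivative integral (cbox 0 1) (%\<theta>. hz z (\<tau> * \<theta>))) (at z within UNIV)"
 proof (rule leibniz_rule_field_derivative)
  show "(%\<theta>. h z (\<tau> * \<theta>)) integrable_on cbox 0 1" for z
   by (intro integrable_continuous continuous_on_pair[OF h] continuous_intros)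
  show "continuous_on (UNIV \<times> cbox 0 1) (%(z, \<theta>). hz z (\<tau> * \<theta>))"
   unfolding case_prod_unfold by (intro continuous_on_pair[OF hz] continuous_intros)
 qed (use D in auto)
 then have "((%z. \<tau> * integral (cbox 0 1) (%\<theta>. h z (\<tau> * \<theta>))) has_real_derivative \<tau> * integral (cbox 0 1) (%\<theta>. hz z (\<tau> * \<theta>))) (at z)"
  by (intro DERIV_cmult)
 then show ?thesis by (simp add: prim_def)
qed

text \<open>In the second formula time enters through the limit of integration and through the
  integrand. The two are separated as arguments of a function of two variables and joined again by
  the chain rule on the diagonal.\<close>

lemma DERIV_prim_line:
 fixes k ky :: "real => real => real"
 assumes k: "cont (%(r, y). k r y)" and ky: "cont (%(r, y). ky r y)"
  and D: "!!r y. (k r has_real_derivative ky r y) (at y)"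
 shows "((%x. prim (%r. k r (x + \<sigma> * (t - r))) t) has_real_derivative prim (%r. ky r (x + \<sigma> * (t - r))) t) (at x)"
  "((%t. prim (%r. k r (x + \<sigma> * (t - r))) t) has_real_derivative k t x + \<sigma> * prim (%r. ky r (x + \<sigma> * (t - r))) t) (at t)"
proof -
 show "((%x. prim (%r. k r (x + \<sigma> * (t - r))) t) has_real_derivative prim (%r. ky r (x + \<sigma> * (t - r))) t) (at x)"
 proof (rule DERIV_prim_param)
  show "cont (%(x, r). k r (x + \<sigma> * (t - r)))" "cont (%(x, r). ky r (x + \<sigma> * (t - r)))"
   unfolding case_prod_unfold by (intro continuous_on_pair[OF k] continuous_on_pair[OF ky] continuous_intros)+
  show "((%x. k r (x + \<sigma> * (t - r))) has_real_derivative ky r (x + \<sigma> * (t - r))) (at x)" for x r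
   using D[of r "x + \<sigma> * (t - r)"] by (simp add: DERIV_shift)
 qed
 define H where "H \<tau> t = prim (%r. k r (x + \<sigma> * (t - r))) \<tau>" for \<tau> t
 define H' where "H' \<tau> t = \<sigma> * prim (%r. ky r (x + \<sigma> * (t - r))) \<tau>" for \<tau> t
 have c: "cont (%r. k r (x + \<sigma> * (t - r)))" for t
  by (intro continuous_on_pair[OF k] continuous_intros)
 have 1: "((%\<tau>. H \<tau> t) has_derivative (*) (k t x)) (at t within UNIV)"
  using DERIV_prim[OF c, of t t] unfolding H_def has_field_derivative_def by simp
 have 2: "((%t. H \<tau> t) has_derivative blinfun_apply (blinfun_mult_right (H' \<tau> t))) (at t within UNIV)" for \<tau> t
 proof -
  have "((%t. prim (%r. k r (x + \<sigma> * (t - r))) \<tau>) has_real_derivative prim (%r. \<sigma> * ky r (x + \<sigma> * (t - r))) \<tau>) (at t)"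
  proof (rule DERIV_prim_param)
   show "cont (%(t, r). k r (x + \<sigma> * (t - r)))" "cont (%(t, r). \<sigma> * ky r (x + \<sigma> * (t - r)))"
    unfolding case_prod_unfold by (intro continuous_on_pair[OF k] continuous_on_pair[OF ky] continuous_intros)+
   show "((%t. k r (x + \<sigma> * (t - r))) has_real_derivative \<sigma> * ky r (x + \<sigma> * (t - r))) (at t)" for t r
    by (rule DERIV_cong[OF DERIV_chain2[where g="%t. x + \<sigma> * (t - r)" and Db=\<sigma>, OF D]]) (auto intro!: derivative_eq_intros)
  qed
  moreover have "prim (%r. \<sigma> * ky r (x + \<sigma> * (t - r))) \<tau> = H' \<tau> t"
   unfolding H'_def prim_def by simp
  ultimately show ?thesis unfolding H_def has_field_derivative_def by simp
 qed
 have 3: "continuous (at (t, t) within UNIV \<times> UNIV) (%(\<tau>, t). blinfun_mult_right (H' \<tau> t))"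
 proof -
  have "cont (%z. prim (%r. ky r (x + \<sigma> * (snd z - r))) (fst z))"
   by (rule prim_continuous_on) (auto simp: case_prod_unfold intro!: continuous_on_pair[OF ky] continuous_intros)
  then have "cont (%z. blinfun_mult_right (H' (fst z) (snd z)))"
   unfolding H'_def by (intro bounded_linear.continuous_on[OF bounded_linear_blinfun_mult_right] continuous_intros)
  then show ?thesis by (simp add: continuous_on_eq_continuous_at case_prod_unfold)
 qed
 have "((%(\<tau>, t). H \<tau> t) has_derivative (%(a, b). k t x * a + blinfun_apply (blinfun_mult_right (H' t t)) b)) (at (t, t) within UNIV \<times> UNIV)"
  by (rule has_derivative_partialsI[OF 1 2 3]) auto
 then have *: "((%(\<tau>, t). H \<tau> t) has_derivative (%(a, b). k t x * a + H' t t * b)) (at (t, t))"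
  by simp
 have "((%t. (t, t)) has_derivative (%h. (h, h))) (at t)"
  by (auto intro!: derivative_eq_intros)
 from has_derivative_compose[OF this *]
 have "((%t. H t t) has_derivative (%h. k t x * h + H' t t * h)) (at t)"
  by simp
 moreover have "(%h. k t x * h + H' t t * h) = (*) (k t x + H' t t)" by (auto simp: distrib_right)
 ultimately have "((%t. H t t) has_derivative (*) (k t x + H' t t)) (at t)" by simp
 then show "((%t. prim (%r. k r (x + \<sigma> * (t - r))) t) has_real_derivative k t x + \<sigma> * prim (%r. ky r (x + \<sigma> * (t - r))) t) (at t)"
  unfolding H_def H'_def has_field_derivative_def .
qed

text \<open>Abstracts the undamped problem \<open>v_tt - v_xx = F t v\<close> with
  \<open>v_x = N0 + lam0 * v_t + tlam1 * v_t(1)\<close> at 0 and the corresponding condition at 1.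
  \<open>A0\<close> and \<open>B0\<close> play the part of the initial values of
  \<open>v_t + v_x\<close> and \<open>v_t - v_x\<close>, continued to the whole line, and
  \<open>u00\<close> that of \<open>v\<close> at the corner \<open>x = 0\<close>.\<close>

locale wave_data =
 fixes F DF :: "real => real => real" and N0 N1 :: "real => real => real => real" and A0 B0 :: "real => real"
  and lam0 lam1 tlam0 tlam1 u00 :: real
 assumes F_cont: "cont (%(t, y). F t y)" and DF_cont: "cont (%(t, y). DF t y)"
  and F_deriv: "!!t y. (F t has_real_derivative DF t y) (at y)"
  and F_lip: "!!R. EX L>=0. \<forall>t\<in>{0..1}. ALL x y. \<bar>x\<bar> <= R --> \<bar>y\<bar> <= R --> \<bar>F t x - F t y\<bar> <= L * \<bar>x - y\<bar>"
  and N0_cont: "cont (%(t, y, z). N0 t y z)" and N1_cont: "cont (%(t, y, z). N1 t y z)"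
  and N0_lip: "!!R. EX L>=0. \<forall>t\<in>{0..1}. ALL y z y' z'. \<bar>y\<bar> <= R --> \<bar>z\<bar> <= R --> \<bar>y'\<bar> <= R --> \<bar>z'\<bar> <= R -->
    \<bar>N0 t y z - N0 t y' z'\<bar> <= L * (\<bar>y - y'\<bar> + \<bar>z - z'\<bar>)"
  and N1_lip: "!!R. EX L>=0. \<forall>t\<in>{0..1}. ALL y z y' z'. \<bar>y\<bar> <= R --> \<bar>z\<bar> <= R --> \<bar>y'\<bar> <= R --> \<bar>z'\<bar> <= R -->
    \<bar>N1 t y z - N1 t y' z'\<bar> <= L * (\<bar>y - y'\<bar> + \<bar>z - z'\<bar>)"
  and A0_cont: "cont A0" and B0_cont: "cont B0"
  and det_pos: "(1 + lam0) * (1 + lam1) - tlam0 * tlam1 > 0"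
begin

definition det :: real where "det = (1 + lam0) * (1 + lam1) - tlam0 * tlam1"

text \<open>
 \<open>inhom \<sigma> w t x\<close> is the source \<open>F\<close> integrated along the characteristic of slope \<open>\<sigma>\<close> ending in \<open>(t,x)\<close>.
 \<open>inc0\<close>, \<open>inc1\<close> are the incoming Riemann invariants at \<open>x = 0\<close> and \<open>x = 1\<close>; with them the boundary
 conditions form a linear system for the traces of the velocity, solved by \<open>vel0\<close>, \<open>vel1\<close>.
\<close>

definition inhom :: "real => (real => real => real) => real => real => real" where
 "inhom \<sigma> w t x = prim (%r. F r (w r (x + \<sigma> * (t - r)))) t"

definition inc0 where "inc0 w t = A0 t + inhom 1 w t 0"
definition inc1 where "inc1 w t = B0 (1 - t) + inhom (-1) w t 1"
definition res0 where "res0 w t = inc0 w t - N0 t (w t 0) (w t 1)"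
definition res1 where "res1 w t = inc1 w t - N1 t (w t 0) (w t 1)"
definition vel0 where "vel0 w t = ((1 + lam1) * res0 w t - tlam1 * res1 w t) / det"
definition vel1 where "vel1 w t = ((1 + lam0) * res1 w t - tlam0 * res0 w t) / det"

text \<open>The initial Riemann invariants continued beyond \<open>[0,1]\<close> so that the boundary conditions hold for \<open>0 <= t <= T\<close>.\<close>

definition outA where "outA w t = 2 * vel1 w t - inc1 w t - inhom 1 w t 1"
definition outB where "outB w t = 2 * vel0 w t - inc0 w t - inhom (-1) w t 0"
text \<open>Subtracting \<open>outA w 0\<close> makes the continuation continuous for every
  \<open>w\<close>, also for those that do not match the data at the corner. For the fixed point the
  compatibility conditions give \<open>outA w 0 = A0 1\<close>, and beyond the corner the value is
  \<open>outA\<close> itself.\<close>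

definition extA where "extA T w y = A0 (clamp_to 0 1 y) + (outA w (clamp_to 0 T (y - 1)) - outA w 0)"
definition extB where "extB T w y = B0 (clamp_to 0 1 y) + (outB w (clamp_to 0 T (- y)) - outB w 0)"

text \<open>The difference of the two signs is the integral of the source over the backward triangle
  of \<open>(t, x)\<close>; splitting it into primitives from 0 keeps each half an integral along
  one characteristic.\<close>

definition duhamel :: "real => (real => real => real) => real => real => real" where
 "duhamel \<sigma> w t x = prim (%r. prim (%y. F r (w r y)) (x + \<sigma> * (t - r))) t"

text \<open>The invariants serve as data: their half sum is the velocity and their half difference
  the slope. Primitives taken from 0 fix the value \<open>u00\<close> at the corner.\<close>

definition dalembert :: "real => (real => real => real) => real => real => real" where
 "dalembert T w t x = u00 + (prim (extA T w) (x + t) - prim (extB T w) (x - t)) / 2 + (duhamel 1 w t x - duhamel (-1) w t x) / 2"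

context
 fixes w :: "real => real => real"
 assumes w: "cont (%(t, x). w t x)"
begin

lemma source_cont: "cont (%(r, y). F r (w r y))"
 unfolding case_prod_unfold by (intro continuous_on_pair[OF F_cont] continuous_on_pair[OF w] continuous_intros)

lemma inhom_cont: "cont (%(t, x). inhom \<sigma> w t x)"
 unfolding inhom_def case_prod_unfold
 by (rule prim_continuous_on) (auto simp: case_prod_unfold intro!: continuous_on_pair[OF source_cont] continuous_intros)

lemma prim_source_cont: "cont (%(r, y). prim (%y. F r (w r y)) y)"
 unfolding case_prod_unfold
 by (rule prim_continuous_on) (auto simp: case_prod_unfold intro!: continuous_on_pair[OF source_cont] continuous_intros)

lemma duhamel_cont: "cont (%(t, x). duhamel \<sigma> w t x)"
 unfolding duhamel_def case_prod_unfold
 by (rule prim_continuous_on) (auto simp: case_prod_unfold intro!: continuous_on_pair[OF prim_source_cont] continuous_intros)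

lemma triple_cont:
 assumes "cont (%(t, y, z). N t y z)" "continuous_on A f" "continuous_on A g" "continuous_on A h"
 shows "continuous_on A (%x. N (f x) (g x) (h x))"
proof -
 have "continuous_on A (%x. (%(t, y, z). N t y z) (f x, g x, h x))"
  by (rule continuous_on_compose2[OF assms(1)]) (auto intro!: continuous_intros assms)
 then show ?thesis by simp
qed

lemma res_cont: "cont (inc0 w)" "cont (inc1 w)" "cont (res0 w)" "cont (res1 w)"
 unfolding inc0_def[abs_def] inc1_def[abs_def] res0_def[abs_def] res1_def[abs_def]
 by (intro continuous_intros triple_cont[OF N0_cont] triple_cont[OF N1_cont] A0_cont continuous_on_compose2[OF B0_cont]
   continuous_on_pair[OF inhom_cont] continuous_on_pair[OF w]; simp)+

lemma out_cont: "cont (vel0 w)" "cont (vel1 w)" "cont (outA w)" "cont (outB w)"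
proof -
 have d: "det ~= 0" using det_pos by (simp add: det_def)
 show v: "cont (vel0 w)" "cont (vel1 w)"
  unfolding vel0_def[abs_def] vel1_def[abs_def] by (intro continuous_intros res_cont; use d in simp)+
 show "cont (outA w)" "cont (outB w)"
  unfolding outA_def[abs_def] outB_def[abs_def] by (intro continuous_intros v res_cont continuous_on_pair[OF inhom_cont])+
qed

lemma ext_cont: "cont (extA T w)" "cont (extB T w)"
 unfolding extA_def[abs_def] extB_def[abs_def]
 by (intro continuous_intros continuous_on_compose2[OF A0_cont] continuous_on_compose2[OF B0_cont]
   continuous_on_compose2[OF out_cont(3)] continuous_on_compose2[OF out_cont(4)]; simp)+

lemma dalembert_cont: "cont (%(t, x). dalembert T w t x)"
proof -
 have "cont (prim (extA T w))" "cont (prim (extB T w))"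
  by (rule prim_continuous[OF ext_cont(1)], rule prim_continuous[OF ext_cont(2)])
 then have "cont (%z. prim (extA T w) (snd z + fst z))" "cont (%z. prim (extB T w) (snd z - fst z))"
  by (auto intro!: continuous_on_compose2[of UNIV "prim (extA T w)"] continuous_on_compose2[of UNIV "prim (extB T w)"] continuous_intros)
 moreover have "cont (%z. duhamel 1 w (fst z) (snd z))" "cont (%z. duhamel (-1) w (fst z) (snd z))"
  using duhamel_cont[of 1] duhamel_cont[of "-1"] by (simp_all add: case_prod_unfold)
 ultimately show ?thesis
  unfolding dalembert_def case_prod_unfold by (intro continuous_on_add continuous_on_diff continuous_on_divide continuous_on_const) auto
qed

end

end

section \<open>Lipschitz estimates for d'Alembert's operator, and its fixed point\<close>

lemma abs_diff_prim_le:
 assumes "cont g" "cont h" "0 <= y" "y <= T" "K >= 0"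
  and "!!s. s \<in> {0..y} ==> \<bar>g s - h s\<bar> <= K"
 shows "\<bar>prim g y - prim h y\<bar> <= K * T"
proof -
 have "\<bar>prim g y - prim h y\<bar> <= K * y"
  unfolding prim_diff[OF assms(1,2), symmetric]
  by (rule prim_bound_nonneg) (use assms in \<open>auto intro!: continuous_intros\<close>)
 also have "... <= K * T" using assms by (intro mult_left_mono) auto
 finally show ?thesis .
qed

lemma abs_combination_le:
 fixes a b x y :: real
 assumes "\<bar>x\<bar> <= e" "\<bar>y\<bar> <= e" "D > 0"
 shows "\<bar>(a * x - b * y) / D\<bar> <= (\<bar>a\<bar> + \<bar>b\<bar>) / D * e"
proof -
 have "\<bar>a * x\<bar> <= \<bar>a\<bar> * e" "\<bar>b * y\<bar> <= \<bar>b\<bar> * e"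
  using assms by (auto simp: abs_mult intro: mult_left_mono)
 then have "\<bar>a * x - b * y\<bar> <= (\<bar>a\<bar> + \<bar>b\<bar>) * e" by (auto simp: algebra_simps)
 then show ?thesis using assms(3) by (simp add: field_simps)
qed

lemma add_halves_bound:
 fixes a b c d p q r u :: real
 assumes "\<bar>a\<bar> <= p" "\<bar>b\<bar> <= q" "\<bar>c\<bar> <= r" "\<bar>d\<bar> <= r"
 shows "\<bar>u + (a - b) / 2 + (c - d) / 2\<bar> <= \<bar>u\<bar> + p + q + r"
proof -
 have "\<bar>a - b\<bar> <= p + q" "\<bar>c - d\<bar> <= r + r" "p >= 0" "q >= 0" "r >= 0" using assms by linarith+
 then have "\<bar>(a - b) / 2\<bar> <= p + q" "\<bar>(c - d) / 2\<bar> <= r" by auto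
 then show ?thesis by linarith
qed

context wave_data begin

lemma det_gt_0: "det > 0" using det_pos by (simp add: det_def)

text \<open>\<open>q\<close> bounds the absolute row sums of the inverse boundary matrix. The
  residuals change by at most \<open>2 * K\<close>, the velocities by at most
  \<open>2 * q * K\<close>, and the outgoing invariants by twice that plus two terms
  \<open>K\<close>.\<close>

lemma out_diff:
 assumes K: "K >= 0" and t: "t \<in> {0..1}"
  and inh: "!!\<sigma> x. \<bar>inhom \<sigma> w t x - inhom \<sigma> w' t x\<bar> <= K"
  and n: "\<bar>N0 t (w t 0) (w t 1) - N0 t (w' t 0) (w' t 1)\<bar> <= K" "\<bar>N1 t (w t 0) (w t 1) - N1 t (w' t 0) (w' t 1)\<bar> <= K"
 defines "q \<equiv> (2 + \<bar>lam0\<bar> + \<bar>lam1\<bar> + \<bar>tlam0\<bar> + \<bar>tlam1\<bar>) / det"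
 shows "\<bar>outA w t - outA w' t\<bar> <= (4 * q + 2) * K" "\<bar>outB w t - outB w' t\<bar> <= (4 * q + 2) * K"
proof -
 have i: "\<bar>inc0 w t - inc0 w' t\<bar> <= K" "\<bar>inc1 w t - inc1 w' t\<bar> <= K" using inh by (auto simp: inc0_def inc1_def)
 have r: "\<bar>res0 w t - res0 w' t\<bar> <= 2 * K" "\<bar>res1 w t - res1 w' t\<bar> <= 2 * K"
  using i n unfolding res0_def res1_def by linarith+
 have "vel0 w t - vel0 w' t = ((1 + lam1) * (res0 w t - res0 w' t) - tlam1 * (res1 w t - res1 w' t)) / det"
  "vel1 w t - vel1 w' t = ((1 + lam0) * (res1 w t - res1 w' t) - tlam0 * (res0 w t - res0 w' t)) / det"
  unfolding vel0_def vel1_def by (simp_all add: diff_divide_distrib[symmetric]) (simp_all add: algebra_simps)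
 moreover have "(\<bar>1 + lam1\<bar> + \<bar>tlam1\<bar>) / det * (2 * K) <= q * (2 * K)" "(\<bar>1 + lam0\<bar> + \<bar>tlam0\<bar>) / det * (2 * K) <= q * (2 * K)"
  using K det_gt_0 unfolding q_def by (intro mult_right_mono divide_right_mono; simp)+
 ultimately have v: "\<bar>vel0 w t - vel0 w' t\<bar> <= q * (2 * K)" "\<bar>vel1 w t - vel1 w' t\<bar> <= q * (2 * K)"
  using abs_combination_le[OF r det_gt_0, of "1 + lam1" tlam1] abs_combination_le[OF r(2) r(1) det_gt_0, of "1 + lam0" tlam0]
  by linarith+
 have "(4 * q + 2) * K = 2 * (q * (2 * K)) + K + K" by (simp add: algebra_simps)
 then show "\<bar>outA w t - outA w' t\<bar> <= (4 * q + 2) * K" "\<bar>outB w t - outB w' t\<bar> <= (4 * q + 2) * K"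
  using v i inh[of 1 1] inh[of "-1" 0] unfolding outA_def outB_def by linarith+
qed

text \<open>Each term gains a factor \<open>T\<close>. The continued data differ only beyond the
  corner and are integrated at most \<open>2 * T\<close> past it; the Duhamel terms extend over a
  time of at most \<open>T\<close>, with inner intervals of length at most 3 since
  \<open>T <= 1\<close>.\<close>

lemma dalembert_diff:
 assumes w: "cont (%(t, x). w t x)" and w': "cont (%(t, x). w' t x)"
  and T: "0 < T" "T <= 1" and K: "K >= 0"
  and F: "!!r y. r \<in> {0..1} ==> \<bar>F r (w r y) - F r (w' r y)\<bar> <= K"
  and n: "!!t. t \<in> {0..1} ==> \<bar>N0 t (w t 0) (w t 1) - N0 t (w' t 0) (w' t 1)\<bar> <= K"
   "!!t. t \<in> {0..1} ==> \<bar>N1 t (w t 0) (w t 1) - N1 t (w' t 0) (w' t 1)\<bar> <= K"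
  and t: "t \<in> {0..T}" and x: "x \<in> {-T..1 + T}"
 defines "q \<equiv> (2 + \<bar>lam0\<bar> + \<bar>lam1\<bar> + \<bar>tlam0\<bar> + \<bar>tlam1\<bar>) / det"
 shows "\<bar>dalembert T w t x - dalembert T w' t x\<bar> <= (16 * q + 11) * T * K"
proof -
 define E where "E = (4 * q + 2) * K"
 have inh: "\<bar>inhom \<sigma> w s y - inhom \<sigma> w' s y\<bar> <= K" if "s \<in> {0..1}" for \<sigma> s y
 proof -
  have "\<bar>inhom \<sigma> w s y - inhom \<sigma> w' s y\<bar> <= K * 1"
   unfolding inhom_def
   by (rule abs_diff_prim_le)
    (use K F that in \<open>auto intro!: continuous_on_pair[OF source_cont[OF w]] continuous_on_pair[OF source_cont[OF w']] continuous_intros\<close>)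
  then show ?thesis by simp
 qed
 have out: "\<bar>outA w s - outA w' s\<bar> <= E" "\<bar>outB w s - outB w' s\<bar> <= E" if "s \<in> {0..1}" for s
  using out_diff[OF K that inh[OF that] n[OF that]] unfolding E_def q_def by auto
 have c: "clamp_to 0 T y \<in> {0..1}" for y using clamp_to_in[of 0 T y] T by auto
 have exA: "\<bar>prim (extA T w) y - prim (extA T w') y\<bar> <= 2 * E * (2 * T)" if "y <= 1 + 2 * T" for y
  unfolding prim_diff[OF ext_cont(1)[OF w] ext_cont(1)[OF w'], symmetric]
 proof (rule prim_tail_right)
  show "cont (%s. extA T w s - extA T w' s)" by (intro continuous_intros ext_cont w w')
  show "extA T w s - extA T w' s = 0" if "s <= 1" for s
   using that T by (simp add: extA_def clamp_to_def)
  show "\<bar>extA T w s - extA T w' s\<bar> <= 2 * E" for s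
   using out(1)[OF c[of "s - 1"]] out(1)[of 0] unfolding extA_def by simp
 qed (use that T in auto)
 have exB: "\<bar>prim (extB T w) y - prim (extB T w') y\<bar> <= 2 * E * (2 * T)" if "- (2 * T) <= y" for y
  unfolding prim_diff[OF ext_cont(2)[OF w] ext_cont(2)[OF w'], symmetric]
 proof (rule prim_tail_left)
  show "cont (%s. extB T w s - extB T w' s)" by (intro continuous_intros ext_cont w w')
  show "extB T w s - extB T w' s = 0" if "s >= 0" for s
   using that T by (simp add: extB_def clamp_to_def)
  show "\<bar>extB T w s - extB T w' s\<bar> <= 2 * E" for s
   using out(2)[OF c[of "- s"]] out(2)[of 0] unfolding extB_def by simp
 qed (use that T in auto)
 have du: "\<bar>duhamel \<sigma> w t x - duhamel \<sigma> w' t x\<bar> <= (3 * K) * T" if "\<sigma> \<in> {1, -1}" for \<sigma>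
  unfolding duhamel_def
 proof (rule abs_diff_prim_le)
  show "cont (%r. prim (%y. F r (w r y)) (x + \<sigma> * (t - r)))" "cont (%r. prim (%y. F r (w' r y)) (x + \<sigma> * (t - r)))"
   by (intro continuous_on_pair[OF prim_source_cont[OF w]] continuous_on_pair[OF prim_source_cont[OF w']] continuous_intros)+
  fix r assume r: "r \<in> {0..t}"
  have "\<bar>x + \<sigma> * (t - r)\<bar> <= 3" using that r t x T by auto
  then have "K * \<bar>x + \<sigma> * (t - r)\<bar> <= 3 * K" using K by (simp add: mult.commute mult_left_mono)
  moreover have "\<bar>prim (%y. F r (w r y) - F r (w' r y)) (x + \<sigma> * (t - r))\<bar> <= K * \<bar>x + \<sigma> * (t - r)\<bar>"
   by (rule prim_bound) (use F[of r] r t T in \<open>auto intro!: continuous_on_pair[OF source_cont[OF w]] continuous_on_pair[OF source_cont[OF w']] continuous_intros\<close>)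
  ultimately show "\<bar>prim (%y. F r (w r y)) (x + \<sigma> * (t - r)) - prim (%y. F r (w' r y)) (x + \<sigma> * (t - r))\<bar> <= 3 * K"
   by (subst prim_diff[symmetric]) (auto intro!: continuous_on_pair[OF source_cont[OF w]] continuous_on_pair[OF source_cont[OF w']] continuous_intros)
 qed (use t K in auto)
 have KT: "K * T >= 0" using K T by simp
 have "dalembert T w t x - dalembert T w' t x = ((prim (extA T w) (x + t) - prim (extA T w') (x + t)) - (prim (extB T w) (x - t) - prim (extB T w') (x - t))
   + (duhamel 1 w t x - duhamel 1 w' t x) - (duhamel (-1) w t x - duhamel (-1) w' t x)) / 2"
  by (simp add: dalembert_def field_simps)
 then have "\<bar>dalembert T w t x - dalembert T w' t x\<bar> <= 2 * E * (2 * T) + (3 * K) * T"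
  using exA[of "x + t"] exB[of "x - t"] du[of 1] du[of "-1"] t x by (simp add: abs_le_iff)
 also have "... = (16 * q + 11) * T * K" by (simp add: E_def algebra_simps)
 finally show ?thesis .
qed

lemma dalembert_lipschitz:
 "EX C>=0. ALL T w w' d t x. 0 < T --> T <= 1 --> cont (%(t, x). w t x) --> cont (%(t, x). w' t x) -->
   (ALL t x. \<bar>w t x\<bar> <= R & \<bar>w' t x\<bar> <= R & \<bar>w t x - w' t x\<bar> <= d) --> t \<in> {0..T} --> x \<in> {-T..1 + T} -->
   \<bar>dalembert T w t x - dalembert T w' t x\<bar> <= C * T * d"
proof -
 obtain L where L: "L >= 0" "!!t x y. t \<in> {0..1} ==> \<bar>x\<bar> <= R ==> \<bar>y\<bar> <= R ==> \<bar>F t x - F t y\<bar> <= L * \<bar>x - y\<bar>"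
  using F_lip[of R] by auto
 obtain L0 where L0: "L0 >= 0" "!!t y z y' z'. t \<in> {0..1} ==> \<bar>y\<bar> <= R ==> \<bar>z\<bar> <= R ==> \<bar>y'\<bar> <= R ==> \<bar>z'\<bar> <= R ==>
    \<bar>N0 t y z - N0 t y' z'\<bar> <= L0 * (\<bar>y - y'\<bar> + \<bar>z - z'\<bar>)"
  using N0_lip[of R] by auto
 obtain L1 where L1: "L1 >= 0" "!!t y z y' z'. t \<in> {0..1} ==> \<bar>y\<bar> <= R ==> \<bar>z\<bar> <= R ==> \<bar>y'\<bar> <= R ==> \<bar>z'\<bar> <= R ==>
    \<bar>N1 t y z - N1 t y' z'\<bar> <= L1 * (\<bar>y - y'\<bar> + \<bar>z - z'\<bar>)"
  using N1_lip[of R] by auto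
 define q where "q = (2 + \<bar>lam0\<bar> + \<bar>lam1\<bar> + \<bar>tlam0\<bar> + \<bar>tlam1\<bar>) / det"
 have q: "q >= 0" using det_gt_0 by (simp add: q_def)
 define M where "M = L + 2 * L0 + 2 * L1"
 show ?thesis
 proof (intro exI[of _ "(16 * q + 11) * M"] conjI allI impI)
  show "0 <= (16 * q + 11) * M" using q L L0 L1 by (simp add: M_def)
  fix T d t x :: real and w w' :: "real => real => real"
  assume T: "0 < T" "T <= 1" and w: "cont (%(t, x). w t x)" "cont (%(t, x). w' t x)"
   and b: "ALL t x. \<bar>w t x\<bar> <= R & \<bar>w' t x\<bar> <= R & \<bar>w t x - w' t x\<bar> <= d" and tx: "t \<in> {0..T}" "x \<in> {-T..1 + T}"
  have d: "d >= 0" using b[rule_format, of 0 0] by linarith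
  have LM: "L * d <= M * d" "L0 * (d + d) <= M * d" "L1 * (d + d) <= M * d"
   using d L(1) L0(1) L1(1) by (auto simp: M_def algebra_simps)
  have "\<bar>dalembert T w t x - dalembert T w' t x\<bar> <= (16 * q + 11) * T * (M * d)"
   unfolding q_def
  proof (rule dalembert_diff[OF w T _ _ _ _ tx])
   show "0 <= M * d" using d L L0 L1 by (simp add: M_def)
   fix r :: real assume r: "r \<in> {0..1}"
   show "\<bar>F r (w r y) - F r (w' r y)\<bar> <= M * d" for y
    using L(2)[OF r, of "w r y" "w' r y"] mult_left_mono[OF _ L(1), of "\<bar>w r y - w' r y\<bar>" d] b LM by force
   have "\<bar>w r 0 - w' r 0\<bar> + \<bar>w r 1 - w' r 1\<bar> <= d + d" by (intro add_mono) (use b in auto)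
   from mult_left_mono[OF this L0(1)] mult_left_mono[OF this L1(1)]
    L0(2)[OF r, of "w r 0" "w r 1" "w' r 0" "w' r 1"] L1(2)[OF r, of "w r 0" "w r 1" "w' r 0" "w' r 1"] LM
   show "\<bar>N0 r (w r 0) (w r 1) - N0 r (w' r 0) (w' r 1)\<bar> <= M * d" "\<bar>N1 r (w r 0) (w r 1) - N1 r (w' r 0) (w' r 1)\<bar> <= M * d"
    using b by (metis order_trans)+
  qed
  then show "\<bar>dalembert T w t x - dalembert T w' t x\<bar> <= (16 * q + 11) * M * T * d" by (simp add: mult_ac)
 qed
qed

text \<open>The image of zero is bounded uniformly in \<open>T\<close>, so that the radius of the
  ball, and with it the Lipschitz constant, can be fixed before \<open>T\<close> is chosen.\<close>

lemma dalembert_zero_bound: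
 "EX C>=0. ALL T t x. 0 < T --> T <= 1 --> t \<in> {0..T} --> x \<in> {-T..1 + T} --> \<bar>dalembert T (%_ _. 0) t x\<bar> <= C"
proof -
 let ?w = "%_ _. 0 :: real"
 have w: "cont (%(t, x). ?w t x)" by (simp add: case_prod_unfold)
 obtain M where M: "!!s. s \<in> {0..1} ==> \<bar>F s 0\<bar> <= M"
  using continuous_on_Icc_bounded[of 0 1 "%s. F s 0"] continuous_on_pair[OF F_cont, of "{0..1}" "%s. s" "%_. 0"] by auto
 obtain MA where MA: "!!s. s \<in> {0..1} ==> \<bar>A0 s\<bar> <= MA"
  using continuous_on_Icc_bounded[OF continuous_on_subset[OF A0_cont subset_UNIV], of 0 1] by blast
 obtain MB where MB: "!!s. s \<in> {0..1} ==> \<bar>B0 s\<bar> <= MB"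
  using continuous_on_Icc_bounded[OF continuous_on_subset[OF B0_cont subset_UNIV], of 0 1] by blast
 obtain OA where OA: "!!s. s \<in> {0..1} ==> \<bar>outA ?w s\<bar> <= OA"
  using continuous_on_Icc_bounded[OF continuous_on_subset[OF out_cont(3)[OF w] subset_UNIV], of 0 1] by blast
 obtain OB where OB: "!!s. s \<in> {0..1} ==> \<bar>outB ?w s\<bar> <= OB"
  using continuous_on_Icc_bounded[OF continuous_on_subset[OF out_cont(4)[OF w] subset_UNIV], of 0 1] by blast
 have nn: "M >= 0" "MA >= 0" "MB >= 0" "OA >= 0" "OB >= 0" using M[of 0] MA[of 0] MB[of 0] OA[of 0] OB[of 0] by auto
 show ?thesis
 proof (intro exI[of _ "\<bar>u00\<bar> + (MA + 2 * OA) * 3 + (MB + 2 * OB) * 3 + (M * 3) * 1"] conjI allI impI)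
  fix T t x :: real assume T: "0 < T" "T <= 1" and t: "t \<in> {0..T}" and x: "x \<in> {-T..1 + T}"
  have c: "clamp_to 0 T y \<in> {0..1}" "clamp_to 0 1 y \<in> {0..1}" for y using clamp_to_in[of 0 T y] clamp_to_in[of 0 1 y] T by auto
  have ext: "\<bar>extA T ?w y\<bar> <= MA + 2 * OA" "\<bar>extB T ?w y\<bar> <= MB + 2 * OB" for y
   using MA[OF c(2)[of y]] OA[OF c(1)[of "y - 1"]] OA[of 0] MB[OF c(2)[of y]] OB[OF c(1)[of "- y"]] OB[of 0]
   unfolding extA_def extB_def by simp_all
  have xt: "\<bar>x + t\<bar> <= 3" "\<bar>x - t\<bar> <= 3" using t x T by auto
  have 1: "\<bar>prim (extA T ?w) (x + t)\<bar> <= (MA + 2 * OA) * 3" "\<bar>prim (extB T ?w) (x - t)\<bar> <= (MB + 2 * OB) * 3"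
   using prim_bound[OF ext_cont(1)[OF w] ext(1), where y="x + t"] prim_bound[OF ext_cont(2)[OF w] ext(2), where y="x - t"]
    mult_left_mono[OF xt(1), of "MA + 2 * OA"] mult_left_mono[OF xt(2), of "MB + 2 * OB"] nn by linarith+
  have du: "\<bar>duhamel \<sigma> ?w t x\<bar> <= (M * 3) * 1" if "\<sigma> \<in> {1, -1}" for \<sigma>
  proof -
   have "\<bar>duhamel \<sigma> ?w t x\<bar> <= (M * 3) * t"
    unfolding duhamel_def
   proof (rule prim_bound_nonneg)
    show "cont (%r. prim (%y. F r 0) (x + \<sigma> * (t - r)))"
     by (intro continuous_on_pair[OF prim_source_cont[OF w]] continuous_intros)
    fix r assume r: "r \<in> {0..t}"
    have "\<bar>prim (%y. F r 0) (x + \<sigma> * (t - r))\<bar> <= M * \<bar>x + \<sigma> * (t - r)\<bar>"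
     by (rule prim_bound) (use M[of r] r t T in auto)
    also have "... <= M * 3" using that r t x T nn by (intro mult_left_mono) auto
    finally show "\<bar>prim (%y. F r 0) (x + \<sigma> * (t - r))\<bar> <= M * 3" .
   qed (use t in auto)
   also have "... <= (M * 3) * 1" using t T nn by (intro mult_left_mono) auto
   finally show ?thesis .
  qed
  have "\<bar>duhamel 1 ?w t x\<bar> <= (M * 3) * 1" "\<bar>duhamel (-1) ?w t x\<bar> <= (M * 3) * 1" by (rule du; simp)+
  then show "\<bar>dalembert T ?w t x\<bar> <= \<bar>u00\<bar> + (MA + 2 * OA) * 3 + (MB + 2 * OB) * 3 + (M * 3) * 1"
   unfolding dalembert_def by (rule add_halves_bound[OF 1])
 qed (use nn in auto)
qed

text \<open>Banach's theorem in a ball of bounded continuous functions on the plane.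
  \<open>R = 2 * C0\<close> is fixed first because \<open>C\<close> depends on it;
  \<open>T <= 1 / (2 * C + 1)\<close> then makes \<open>C * T <= 1 / 2\<close>, which gives the
  contraction and, by \<open>C0 + R / 2 = R\<close>, the self-map.\<close>

lemma exists_fixpoint:
 "\<exists>T0>0. T0 <= 1 & (ALL T. 0 < T & T <= T0 -->
   (EX w. cont (%(t, x). w t x) & (\<forall>t\<in>{0..T}. \<forall>x\<in>{-T..1 + T}. w t x = dalembert T w t x)))"
proof -
 obtain C0 where C0: "C0 >= 0" "!!T t x. 0 < T ==> T <= 1 ==> t \<in> {0..T} ==> x \<in> {-T..1 + T} ==> \<bar>dalembert T (%_ _. 0) t x\<bar> <= C0"
  using dalembert_zero_bound by auto
 define R where "R = 2 * C0"
 obtain C where C: "C >= 0" "!!T w w' d t x. 0 < T ==> T <= 1 ==> cont (%(t, x). w t x) ==> cont (%(t, x). w' t x) ==>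
   (ALL t x. \<bar>w t x\<bar> <= R & \<bar>w' t x\<bar> <= R & \<bar>w t x - w' t x\<bar> <= d) ==> t \<in> {0..T} ==> x \<in> {-T..1 + T} ==>
   \<bar>dalembert T w t x - dalembert T w' t x\<bar> <= C * T * d"
  using dalembert_lipschitz[of R] by metis
 show ?thesis
 proof (intro exI[of _ "1 / (2 * C + 1)"] conjI allI impI)
  show "1 / (2 * C + 1) > 0" "1 / (2 * C + 1) <= 1" using C(1) by auto
  fix T assume TT: "0 < T & T <= 1 / (2 * C + 1)"
  then have T: "0 < T" "T <= 1" using C(1) \<open>1 / (2 * C + 1) <= 1\<close> by linarith+
  have "(2 * C + 1) * T <= 1" using TT C(1) by (simp add: pos_le_divide_eq mult.commute)
  then have CT: "C * T <= 1 / 2" using T by (simp add: algebra_simps)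
  \<comment> \<open>Clamping makes the operator act on functions on the whole plane without changing
    it on the strip where the equation is required.\<close>
  define ct cx where "ct = clamp_to 0 T" and "cx = clamp_to (-T) (1 + T)"
  have cl: "ct t \<in> {0..T}" "cx x \<in> {-T..1 + T}" for t x using T by (auto simp: ct_def cx_def clamp_to_def)
  have lip: "\<bar>dalembert T w (ct t) (cx x) - dalembert T w' (ct t) (cx x)\<bar> <= 1 / 2 * d"
   if "cont (%(t, x). w t x)" "cont (%(t, x). w' t x)"
    "ALL t x. \<bar>w t x\<bar> <= R & \<bar>w' t x\<bar> <= R & \<bar>w t x - w' t x\<bar> <= d" for w w' d t x
  proof -
   have "d >= 0" using that(3)[rule_format, of 0 0] by linarith
   then show ?thesis using C(2)[OF T that cl, of t x] mult_right_mono[OF CT, of d] by linarith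
  qed
  define op where "op w z = dalembert T (%t x. apply_bcontfun w (t, x)) (ct (fst z)) (cx (snd z))" for w :: "(real \<times> real) \<Rightarrow>\<^sub>C real" and z
  have wc: "cont (%(t, x). apply_bcontfun w (t, x))" for w :: "(real \<times> real) \<Rightarrow>\<^sub>C real" by (simp add: case_prod_unfold)
  have opb: "\<bar>op w z\<bar> <= R" if "norm w <= R" for w z
  proof -
   have b: "\<bar>apply_bcontfun w y\<bar> <= R" for y using norm_bounded[of w y] that by simp
   then have R: "R >= 0" using b[of 0] by linarith
   have "\<bar>op w z - dalembert T (%_ _. 0) (ct (fst z)) (cx (snd z))\<bar> <= 1 / 2 * R"
    unfolding op_def by (rule lip[OF wc]) (use b R in \<open>auto simp: case_prod_unfold\<close>)
   then show ?thesis using C0(2)[OF T cl, of "fst z" "snd z"] unfolding R_def by linarith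
  qed
  have opc: "cont (op w)" for w
   unfolding op_def ct_def cx_def
   by (rule continuous_on_pair[OF dalembert_cont[OF wc]]) (intro continuous_intros)+
  \<comment> \<open>The bound on the image is established for \<open>w\<close> in the ball, so
    \<open>\<Phi>\<close> is specified only there.\<close>
  have "\<exists>\<Phi>. apply_bcontfun \<Phi> = op w" if "norm w <= R" for w
   using bcontfun_normI[OF opc, of w R] opb[OF that] by (metis bcontfunE real_norm_def)
  then obtain \<Phi> where \<Phi>: "!!w. norm w <= R ==> apply_bcontfun (\<Phi> w) = op w" by metis
  have "\<exists>!w\<in>cball 0 R. \<Phi> w = w"
  proof (rule Banach_fix[where c="1/2"])
   show "complete (cball (0 :: (real \<times> real) \<Rightarrow>\<^sub>C real) R)" by (simp add: complete_eq_closed)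
   show "cball (0 :: (real \<times> real) \<Rightarrow>\<^sub>C real) R ~= {}" using C0(1) by (simp add: R_def)
   show "\<Phi> ` cball 0 R \<subseteq> cball 0 R"
    using \<Phi> opb by (auto intro!: norm_bound)
   fix v w :: "(real \<times> real) \<Rightarrow>\<^sub>C real" assume "v \<in> cball 0 R" "w \<in> cball 0 R"
   then have vw: "norm v <= R" "norm w <= R" by auto
   show "dist (\<Phi> v) (\<Phi> w) <= 1 / 2 * dist v w"
   proof (rule dist_bound)
    fix z
    have "\<bar>op v z - op w z\<bar> <= 1 / 2 * dist v w"
     unfolding op_def
    proof (rule lip[OF wc wc], intro allI conjI)
     fix t x
     show "\<bar>apply_bcontfun v (t, x)\<bar> <= R" "\<bar>apply_bcontfun w (t, x)\<bar> <= R"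
      using norm_bounded[of v "(t, x)"] norm_bounded[of w "(t, x)"] vw by auto
     show "\<bar>apply_bcontfun v (t, x) - apply_bcontfun w (t, x)\<bar> <= dist v w"
      using dist_bounded[of v "(t, x)" w] by (simp add: dist_real_def)
    qed
    then show "dist (apply_bcontfun (\<Phi> v) z) (apply_bcontfun (\<Phi> w) z) <= 1 / 2 * dist v w"
     using \<Phi> vw by (simp add: dist_real_def)
   qed
  qed auto
  then obtain w where w: "norm w <= R" "\<Phi> w = w" by auto
  show "EX w. cont (%(t, x). w t x) & (\<forall>t\<in>{0..T}. \<forall>x\<in>{-T..1 + T}. w t x = dalembert T w t x)"
  proof (intro exI conjI ballI)
   show "cont (%(t, x). apply_bcontfun w (t, x))" by (rule wc)
   fix t x assume "t \<in> {0..T}" "x \<in> {-T..1 + T}"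
   then have "ct t = t" "cx x = x" by (auto simp: ct_def cx_def clamp_to_id)
   then show "apply_bcontfun w (t, x) = dalembert T (%t x. apply_bcontfun w (t, x)) t x"
    using \<Phi>[OF w(1)] w(2) by (metis op_def fst_conv snd_conv)
  qed
 qed
qed

end

section \<open>Regularity of the fixed point\<close>

lemma ac_deriv_cong_deriv:
 assumes F: "ac_deriv a b F f" and g: "g \<in> BM" "!!x. x \<in> {a..b} ==> f x = g x"
 shows "ac_deriv a b F g"
 unfolding ac_deriv_def
proof (intro conjI ballI)
 have "(%x. indicator {a..b} x * (f x)^2) = (%x. indicator {a..b} x * (g x)^2)"
  using g(2) by (auto simp: indicator_def fun_eq_iff)
 then show "lint (%x. indicator {a..b} x * (g x)^2)" using ac_derivD(2)[OF F] by simp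
 fix x assume x: "x \<in> {a..b}"
 then have "(%s. indicator {a..x} s * f s) = (%s. indicator {a..x} s * g s)"
  using g(2) by (auto simp: indicator_def fun_eq_iff)
 then have *: "prim_from a f x = prim_from a g x" by (simp add: prim_from_def)
 show "F x = F a + prim_from a g x" using ac_derivD(3)[OF F x] unfolding * .
qed (rule g(1))

lemma ac_deriv_DERIV_all:
 assumes "!!x. (F has_real_derivative f x) (at x)" and f: "cont f"
 shows "ac_deriv a b F f"
 by (rule ac_deriv_cong_deriv[OF ac_deriv_C1[where f=f]])
  (use assms in \<open>auto intro: has_field_derivative_at_within continuous_on_subset[OF f] borel_measurable_continuous_onI\<close>)

abbreviation abs_cont :: "real => real => (real => real) => bool" where
 "abs_cont a b F \<equiv> EX g. ac_deriv a b F g"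

lemma abs_cont_intros:
 "abs_cont a b F ==> abs_cont a b G ==> abs_cont a b (%x. F x + G x)"
 "abs_cont a b F ==> abs_cont a b G ==> abs_cont a b (%x. F x - G x)"
 "abs_cont a b F ==> abs_cont a b (%x. c * F x)"
 "abs_cont a b F ==> abs_cont a b (%x. F x / c)"
 "abs_cont a b (%x. c)"
 using ac_deriv_add ac_deriv_diff_fun ac_deriv_cmult ac_deriv_cmult[where c="inverse c"] ac_deriv_const
 by (fastforce simp: divide_inverse mult.commute)+

lemma abs_cont_cong: "abs_cont a b F ==> (!!x. x \<in> {a..b} ==> F x = G x) ==> abs_cont a b G"
 using ac_deriv_cong by blast

lemma abs_cont_affine:
 assumes "abs_cont a b F" "\<sigma> = 1 \<or> \<sigma> = -1" "!!x. x \<in> {a'..b'} ==> c + \<sigma> * x \<in> {a..b}"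
 shows "abs_cont a' b' (%x. F (c + \<sigma> * x))"
 using assms ac_deriv_affine by blast

text \<open>Derivatives extended by zero are square integrable on the whole line, where translations
  act without boundary effects.\<close>

lemma ac_extend:
 assumes "ac_deriv c d F f"
 shows "ac_deriv c d F (%x. indicator {c..d} x * f x)" "lint (%x. (indicator {c..d} x * f x)^2)"
proof -
 have [measurable]: "f \<in> BM" by (rule ac_derivD(1)[OF assms])
 show "ac_deriv c d F (%x. indicator {c..d} x * f x)" by (rule ac_deriv_cong_deriv[OF assms]) auto
 show "lint (%x. (indicator {c..d} x * f x)^2)"
  using ac_derivD(2)[OF assms] by (rule Bochner_Integration.integrable_cong[THEN iffD1, rotated -1]) (auto simp: indicator_def)
qed

text \<open>Adds a fixed point \<open>w\<close> on the strip and the regularity of the data.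
  \<open>N0_ac\<close> and \<open>N1_ac\<close> ask only for absolute continuity in time along
  continuously differentiable functions, since the coefficients of the boundary conditions are
  merely in H^1.\<close>

locale wave_ivp = wave_data +
 fixes T :: real and U0 U0' W1 a0 b0 :: "real => real" and w :: "real => real => real"
 assumes T: "0 < T" "T <= 1"
  and A0_eq: "!!x. x \<in> {0..1} ==> A0 x = W1 x + U0' x" and B0_eq: "!!x. x \<in> {0..1} ==> B0 x = W1 x - U0' x"
  and U0_deriv: "!!x. x \<in> {0..1} ==> (U0 has_real_derivative U0' x) (at x within {0..1})" and u00: "u00 = U0 0"
  and A0_ac: "ac_deriv 0 1 A0 a0" and B0_ac: "ac_deriv 0 1 B0 b0"
  and N0_ac: "!!f g f' g'. (!!t. (f has_real_derivative f' t) (at t)) ==> (!!t. (g has_real_derivative g' t) (at t)) ==>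
    cont f' ==> cont g' ==> abs_cont 0 T (%t. N0 t (f t) (g t))"
  and N1_ac: "!!f g f' g'. (!!t. (f has_real_derivative f' t) (at t)) ==> (!!t. (g has_real_derivative g' t) (at t)) ==>
    cont f' ==> cont g' ==> abs_cont 0 T (%t. N1 t (f t) (g t))"
  and compat0: "N0 0 (U0 0) (U0 1) = U0' 0 - lam0 * W1 0 - tlam1 * W1 1"
  and compat1: "N1 0 (U0 0) (U0 1) = - U0' 1 - lam1 * W1 1 - tlam0 * W1 0"
  and w_cont: "cont (%(t, x). w t x)"
  and w_fix: "!!t x. t \<in> {0..T} ==> x \<in> {-T..1 + T} ==> w t x = dalembert T w t x"
begin

text \<open>\<open>w\<close> is known to be continuous, and to solve the equation on the strip only;
  its image under the operator is differentiable everywhere and takes its place.\<close>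

definition v :: "real => real => real" where "v = dalembert T w"
definition a where "a t x = extA T w (x + t) + inhom 1 w t x"
definition b where "b t x = extB T w (x - t) + inhom (-1) w t x"
definition vt where "vt t x = (a t x + b t x) / 2"
definition vx where "vx t x = (a t x - b t x) / 2"

lemma ab_cont: "cont (%(t, x). a t x)" "cont (%(t, x). b t x)"
 unfolding a_def b_def case_prod_unfold
 by (intro continuous_intros continuous_on_pair[OF inhom_cont[OF w_cont]]
   continuous_on_compose2[OF ext_cont(1)[OF w_cont]] continuous_on_compose2[OF ext_cont(2)[OF w_cont]]; simp)+

lemma v_cont: "cont (%(t, x). v t x)" "cont (%(t, x). vt t x)" "cont (%(t, x). vx t x)"
proof -
 show "cont (%(t, x). v t x)" unfolding v_def by (rule dalembert_cont[OF w_cont])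
 show "cont (%(t, x). vt t x)" "cont (%(t, x). vx t x)"
  using ab_cont unfolding vt_def vx_def case_prod_unfold by (auto intro!: continuous_intros)
qed

text \<open>The time derivative of each Duhamel term contains the primitive of the source at
  \<open>(t, x)\<close>, which cancels between the two signs.\<close>

lemma DERIV_v: "((%t. v t x) has_real_derivative vt t x) (at t)" "(v t has_real_derivative vx t x) (at x)"
proof -
 define k where "k = (%r. prim (%y. F r (w r y)))"
 have d: "((%x. duhamel \<sigma> w t x) has_real_derivative inhom \<sigma> w t x) (at x)"
  "((%t. duhamel \<sigma> w t x) has_real_derivative k t x + \<sigma> * inhom \<sigma> w t x) (at t)" for \<sigma> t x
  unfolding duhamel_def inhom_def k_def
  by (rule DERIV_prim_line[OF prim_source_cont[OF w_cont] source_cont[OF w_cont]],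
    rule DERIV_prim[OF continuous_on_pair[OF source_cont[OF w_cont]]], (intro continuous_intros)+)+
 have eA: "((%t. prim (extA T w) (x + t)) has_real_derivative extA T w (x + t)) (at t)"
  "((%x. prim (extA T w) (x + t)) has_real_derivative extA T w (x + t)) (at x)" for t x
  by (rule DERIV_cong[OF DERIV_chain2[OF DERIV_prim[OF ext_cont(1)[OF w_cont]], where Db=1]]; auto intro!: derivative_eq_intros)+
 have eB: "((%t. prim (extB T w) (x - t)) has_real_derivative - extB T w (x - t)) (at t)"
  "((%x. prim (extB T w) (x - t)) has_real_derivative extB T w (x - t)) (at x)" for t x
   by (rule DERIV_cong[OF DERIV_chain2[OF DERIV_prim[OF ext_cont(2)[OF w_cont]], where Db="-1"]]; auto intro!: derivative_eq_intros)
    (rule DERIV_cong[OF DERIV_chain2[OF DERIV_prim[OF ext_cont(2)[OF w_cont]], where Db=1]]; auto intro!: derivative_eq_intros)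
 have "((%t. u00 + (prim (extA T w) (x + t) - prim (extB T w) (x - t)) / 2 + (duhamel 1 w t x - duhamel (-1) w t x) / 2) has_real_derivative
   0 + (extA T w (x + t) - - extB T w (x - t)) / 2 + ((k t x + 1 * inhom 1 w t x) - (k t x + (-1) * inhom (-1) w t x)) / 2) (at t)"
  by (intro DERIV_add DERIV_diff DERIV_cdivide DERIV_const eA eB d)
 then show "((%t. v t x) has_real_derivative vt t x) (at t)"
  by (simp add: v_def dalembert_def[abs_def] vt_def a_def b_def add_divide_distrib diff_divide_distrib add_ac)
 have "((%x. u00 + (prim (extA T w) (x + t) - prim (extB T w) (x - t)) / 2 + (duhamel 1 w t x - duhamel (-1) w t x) / 2) has_real_derivative
   0 + (extA T w (x + t) - extB T w (x - t)) / 2 + (inhom 1 w t x - inhom (-1) w t x) / 2) (at x)"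
  by (intro DERIV_add DERIV_diff DERIV_cdivide DERIV_const eA eB d)
 moreover have "0 + (extA T w (x + t) - extB T w (x - t)) / 2 + (inhom 1 w t x - inhom (-1) w t x) / 2 = vx t x"
  by (simp add: vx_def a_def b_def add_divide_distrib diff_divide_distrib)
 ultimately show "(v t has_real_derivative vx t x) (at x)"
  by (simp add: v_def dalembert_def[abs_def])
qed

lemma w_eq_v: "t \<in> {0..T} ==> x \<in> {-T..1 + T} ==> w t x = v t x"
 by (simp add: v_def w_fix)

text \<open>The bootstrap: backward characteristics from \<open>[0, 1]\<close> stay in the strip
  where \<open>w\<close> and \<open>v\<close> coincide, so the source may be taken along the
  continuously differentiable \<open>v\<close>.\<close>

lemma inhom_eq:
 assumes "t \<in> {0..T}" "x \<in> {0..1}" "\<sigma> \<in> {1, -1}"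
 shows "inhom \<sigma> w t x = inhom \<sigma> v t x"
 unfolding inhom_def
proof (rule prim_cong)
 fix r assume "r \<in> {0..t}"
 then have "r \<in> {0..T}" "x + \<sigma> * (t - r) \<in> {-T..1 + T}" using assms by auto
 then show "F r (w r (x + \<sigma> * (t - r))) = F r (v r (x + \<sigma> * (t - r)))" by (simp add: w_eq_v)
qed (use assms in auto)

definition S where "S \<sigma> t x = prim (%r. DF r (v r (x + \<sigma> * (t - r))) * vx r (x + \<sigma> * (t - r))) t"

lemma Fv_cont: "cont (%(t, x). F t (v t x))" "cont (%(t, x). DF t (v t x) * vx t x)"
 unfolding case_prod_unfold
 by (intro continuous_on_mult continuous_on_pair[OF F_cont] continuous_on_pair[OF DF_cont] continuous_on_pair[OF v_cont(1)]
   continuous_on_pair[OF v_cont(3)] continuous_intros)+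

lemma S_cont: "cont (%(t, x). S \<sigma> t x)"
 unfolding S_def case_prod_unfold
 by (rule prim_continuous_on, unfold case_prod_unfold, rule continuous_on_pair[OF Fv_cont(2)]) (intro continuous_intros)+

lemma DERIV_inhom_v:
 "((%x. inhom \<sigma> v t x) has_real_derivative S \<sigma> t x) (at x)"
 "((%t. inhom \<sigma> v t x) has_real_derivative F t (v t x) + \<sigma> * S \<sigma> t x) (at t)"
proof -
 have "((%y. F r (v r y)) has_real_derivative DF r (v r y) * vx r y) (at y)" for r y
  by (rule DERIV_chain2[OF F_deriv DERIV_v(2)])
 from DERIV_prim_line[OF Fv_cont this]
 show "((%x. inhom \<sigma> v t x) has_real_derivative S \<sigma> t x) (at x)"
  "((%t. inhom \<sigma> v t x) has_real_derivative F t (v t x) + \<sigma> * S \<sigma> t x) (at t)"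
  unfolding inhom_def S_def by blast+
qed

lemma inhom_ac:
 "ac_deriv c d (%x. inhom \<sigma> v t x) (%x. S \<sigma> t x)"
 "ac_deriv c d (%t. inhom \<sigma> v t x) (%t. F t (v t x) + \<sigma> * S \<sigma> t x)"
 by (rule ac_deriv_DERIV_all, rule DERIV_inhom_v,
   intro continuous_intros continuous_on_pair[OF S_cont] continuous_on_pair[OF Fv_cont(1)])+

lemma v_0: "x \<in> {0..1} ==> v 0 x = U0 x" "x \<in> {0..1} ==> vx 0 x = U0' x" "x \<in> {0..1} ==> vt 0 x = W1 x"
proof -
 have i: "inhom \<sigma> w 0 x = 0" for \<sigma> x by (simp add: inhom_def prim_0)
 have e: "extA T w x = A0 x" "extB T w x = B0 x" if "x \<in> {0..1}" for x
  using that T by (auto simp: extA_def extB_def clamp_to_def)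
 show vx: "vx 0 x = U0' x" and "vt 0 x = W1 x" if "x \<in> {0..1}" for x
  using that by (simp_all add: vx_def vt_def a_def b_def i e A0_eq B0_eq)
 show "v 0 x = U0 x" if x: "x \<in> {0..1}"
 proof -
  have "((%x. v 0 x - U0 x) has_real_derivative 0) (at y within {0..1})" if "y \<in> {0..1}" for y
   using DERIV_diff[OF has_field_derivative_at_within[OF DERIV_v(2)] U0_deriv[OF that], of 0] vx[OF that] by simp
  then obtain c where c: "!!y. y \<in> {0..1} ==> v 0 y - U0 y = c"
   using has_field_derivative_zero_constant[of "{0..1}" "%x. v 0 x - U0 x"] by (auto simp: convex_closed_interval)
  have "v 0 0 = u00" by (simp add: v_def dalembert_def duhamel_def prim_0)
  then show ?thesis using c[OF x] c[of 0] u00 by simp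
 qed
qed

lemma vel_eqs:
 "(1 + lam0) * vel0 w t + tlam1 * vel1 w t = res0 w t" "tlam0 * vel0 w t + (1 + lam1) * vel1 w t = res1 w t"
proof -
 have d: "det ~= 0" using det_gt_0 by simp
 have "det * vel0 w t = (1 + lam1) * res0 w t - tlam1 * res1 w t" "det * vel1 w t = (1 + lam0) * res1 w t - tlam0 * res0 w t"
  using d by (simp_all add: vel0_def vel1_def)
 then have "det * ((1 + lam0) * vel0 w t + tlam1 * vel1 w t) = det * res0 w t"
  "det * (tlam0 * vel0 w t + (1 + lam1) * vel1 w t) = det * res1 w t"
  unfolding det_def by algebra+
 then show "(1 + lam0) * vel0 w t + tlam1 * vel1 w t = res0 w t" "tlam0 * vel0 w t + (1 + lam1) * vel1 w t = res1 w t"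
  using d by simp_all
qed

text \<open>The compatibility conditions make the continued Riemann invariants continuous at the corners.\<close>

lemma out_0: "outA w 0 = A0 1" "outB w 0 = B0 0"
proof -
 have i: "inhom \<sigma> w 0 x = 0" for \<sigma> x by (simp add: inhom_def prim_0)
 have w0: "w 0 0 = U0 0" "w 0 1 = U0 1" using T by (simp_all add: w_eq_v v_0)
 have "(1 + lam0) * W1 0 + tlam1 * W1 1 = res0 w 0" "tlam0 * W1 0 + (1 + lam1) * W1 1 = res1 w 0"
  using compat0 compat1 by (simp_all add: res0_def res1_def inc0_def inc1_def i w0 A0_eq B0_eq algebra_simps)
 from boundary_solve[OF this det_def det_gt_0]
 have "vel0 w 0 = W1 0" "vel1 w 0 = W1 1" by (simp_all add: vel0_def vel1_def)
 then show "outA w 0 = A0 1" "outB w 0 = B0 0"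
  by (simp_all add: outA_def outB_def inc0_def inc1_def i A0_eq B0_eq)
qed

text \<open>At \<open>x = 0\<close> the invariants are \<open>inc0\<close> and
  \<open>2 * vel0 - inc0\<close>, whose half sum is \<open>vel0\<close>; the linear system solved by
  \<open>vel0\<close> and \<open>vel1\<close> is then the boundary condition. \<open>out_0\<close>
  enters because the continuation contains only the increment
  \<open>outB w t - outB w 0\<close>.\<close>

lemma boundary:
 assumes t: "t \<in> {0..T}"
 shows "vx t 0 = N0 t (v t 0) (v t 1) + lam0 * vt t 0 + tlam1 * vt t 1"
  "- vx t 1 = N1 t (v t 0) (v t 1) + lam1 * vt t 1 + tlam0 * vt t 0"
proof -
 have a0: "a t 0 = inc0 w t" using t T by (simp add: a_def extA_def inc0_def clamp_to_def)
 have b0: "b t 0 = 2 * vel0 w t - inc0 w t"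
  using t T out_0 by (simp add: b_def extB_def outB_def clamp_to_def)
 have b1: "b t 1 = inc1 w t" using t T by (simp add: b_def extB_def inc1_def clamp_to_def)
 have a1: "a t 1 = 2 * vel1 w t - inc1 w t"
  using t T out_0 by (simp add: a_def extA_def outA_def clamp_to_def)
 have w: "w t 0 = v t 0" "w t 1 = v t 1" using t T by (simp_all add: w_eq_v)
 show "vx t 0 = N0 t (v t 0) (v t 1) + lam0 * vt t 0 + tlam1 * vt t 1"
  "- vx t 1 = N1 t (v t 0) (v t 1) + lam1 * vt t 1 + tlam0 * vt t 0"
  using vel_eqs[of t] unfolding res0_def res1_def w vt_def vx_def a0 b0 a1 b1
  by (simp_all add: field_simps)
qed

text \<open>Every ingredient is at least absolutely continuous in time: the initial invariants along
  the boundary, the inhomogeneities by the bootstrap, and the boundary terms by \<open>N0_ac\<close>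
  and \<open>N1_ac\<close>.\<close>

lemma out_ac: "abs_cont 0 T (outA w)" "abs_cont 0 T (outB w)"
proof -
 have A: "abs_cont 0 T A0" using ac_deriv_subset[OF A0_ac] T by auto
 have B: "abs_cont 0 T (%t. B0 (1 + (-1) * t))" using B0_ac T by (intro abs_cont_affine[of 0 1]) auto
 have J: "abs_cont 0 T (%t. inhom \<sigma> v t x)" for \<sigma> x using inhom_ac(2) by blast
 have N: "abs_cont 0 T (%t. N0 t (v t 0) (v t 1))" "abs_cont 0 T (%t. N1 t (v t 0) (v t 1))"
  by (rule N0_ac N1_ac, rule DERIV_v, rule DERIV_v; intro continuous_on_pair[OF v_cont(2)] continuous_intros)+
 have i: "abs_cont 0 T (%t. A0 t + inhom 1 v t 0)" "abs_cont 0 T (%t. B0 (1 + (-1) * t) + inhom (-1) v t 1)"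
  by (intro abs_cont_intros A B J)+
 have in0: "abs_cont 0 T (inc0 w)" and in1: "abs_cont 0 T (inc1 w)"
  by (rule abs_cont_cong[OF i(1)], simp add: inc0_def inhom_eq) (rule abs_cont_cong[OF i(2)], simp add: inc1_def inhom_eq)
 have "abs_cont 0 T (%t. inc0 w t - N0 t (v t 0) (v t 1))" "abs_cont 0 T (%t. inc1 w t - N1 t (v t 0) (v t 1))"
  by (intro abs_cont_intros in0 in1 N)+
 from abs_cont_cong[OF this(1), of "res0 w"] abs_cont_cong[OF this(2), of "res1 w"]
 have r: "abs_cont 0 T (res0 w)" "abs_cont 0 T (res1 w)" using T by (simp_all add: res0_def res1_def w_eq_v)
 have vel: "abs_cont 0 T (vel0 w)" "abs_cont 0 T (vel1 w)"
  unfolding vel0_def[abs_def] vel1_def[abs_def] by (intro abs_cont_intros r)+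
 have "abs_cont 0 T (%t. 2 * vel1 w t - inc1 w t - inhom 1 v t 1)" "abs_cont 0 T (%t. 2 * vel0 w t - inc0 w t - inhom (-1) v t 0)"
  by (intro abs_cont_intros vel in0 in1 J)+
 from abs_cont_cong[OF this(1)] abs_cont_cong[OF this(2)]
 show "abs_cont 0 T (outA w)" "abs_cont 0 T (outB w)" by (auto simp: outA_def outB_def inhom_eq)
qed

lemma ext_ac: "abs_cont 0 (1 + T) (extA T w)" "abs_cont (- T) 1 (extB T w)"
proof -
 have "ac_deriv 0 1 (extA T w) a0"
  by (rule ac_deriv_cong[OF A0_ac]) (use T in \<open>simp add: extA_def clamp_to_def\<close>)
 moreover have "abs_cont 1 (1 + T) (%y. outA w (-1 + 1 * y))" using out_ac(1) by (rule abs_cont_affine) auto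
 then have "abs_cont 1 (1 + T) (extA T w)"
  by (rule abs_cont_cong) (use T out_0 in \<open>auto simp: extA_def clamp_to_def\<close>)
 ultimately show "abs_cont 0 (1 + T) (extA T w)" using ac_deriv_glue[of 0 1 "extA T w" a0 "1 + T"] T by force
 have "ac_deriv 0 1 (extB T w) b0"
  by (rule ac_deriv_cong[OF B0_ac]) (use T in \<open>simp add: extB_def clamp_to_def\<close>)
 moreover have "abs_cont (- T) 0 (%y. outB w (0 + (-1) * y))" using out_ac(2) by (rule abs_cont_affine) auto
 then have "abs_cont (- T) 0 (extB T w)"
  by (rule abs_cont_cong) (use T out_0 in \<open>auto simp: extB_def clamp_to_def\<close>)
 ultimately show "abs_cont (- T) 1 (extB T w)" using ac_deriv_glue[of "-T" 0 "extB T w" _ 1 b0] T by force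
qed

text \<open>The second derivatives are translates of two fixed square integrable functions plus
  continuous terms, a form that yields their continuity in time with values in L^2. Between the time
  derivative of \<open>vt\<close> and the space derivative of \<open>vx\<close> the translates
  cancel and \<open>F\<close> remains, so the wave equation holds at every point of the
  rectangle.\<close>

lemma regularity:
 obtains A' B' :: "real => real" where
  "A' \<in> BM" "B' \<in> BM" "lint (%x. (A' x)^2)" "lint (%x. (B' x)^2)"
  "!!x. x \<in> {0..1} ==> ac_deriv 0 T (%t. vt t x) (%t. (A' (x + t) - B' (x - t)) / 2 + (F t (v t x) + (S 1 t x - S (-1) t x) / 2))"
  "!!t. t \<in> {0..T} ==> ac_deriv 0 1 (vx t) (%x. (A' (x + t) - B' (x - t)) / 2 + (S 1 t x - S (-1) t x) / 2)"
  "!!t. t \<in> {0..T} ==> ac_deriv 0 1 (vt t) (%x. (A' (x + t) + B' (x - t)) / 2 + (S 1 t x + S (-1) t x) / 2)"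
proof -
 obtain A' where A: "ac_deriv 0 (1 + T) (extA T w) A'" "lint (%x. (A' x)^2)"
  using ext_ac(1) ac_extend by blast
 obtain B' where B: "ac_deriv (- T) 1 (extB T w) B'" "lint (%x. (B' x)^2)"
  using ext_ac(2) ac_extend by blast
 show ?thesis
 proof (rule that[of A' B'])
  show "A' \<in> BM" "B' \<in> BM" using A B ac_derivD(1) by blast+
  fix x :: real assume x: "x \<in> {0..1}"
  have "ac_deriv 0 T (%t. extA T w (x + 1 * t)) (%t. 1 * A' (x + 1 * t))" "ac_deriv 0 T (%t. extB T w (x + (-1) * t)) (%t. (-1) * B' (x + (-1) * t))"
   by (rule ac_deriv_affine[OF A(1)] ac_deriv_affine[OF B(1)]; use x in auto)+
  then have "ac_deriv 0 T (%t. extA T w (x + t)) (%t. A' (x + t))" "ac_deriv 0 T (%t. extB T w (x - t)) (%t. (-1) * B' (x - t))" by simp_all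
  from ac_deriv_cmult[OF ac_deriv_add[OF ac_deriv_add[OF this(1) inhom_ac(2)[of _ _ 1 x]] ac_deriv_add[OF this(2) inhom_ac(2)[of _ _ "-1" x]]], of "1/2"]
  have *: "ac_deriv 0 T (%t. 1 / 2 * (extA T w (x + t) + inhom 1 v t x + (extB T w (x - t) + inhom (-1) v t x)))
   (%t. 1 / 2 * (A' (x + t) + (F t (v t x) + 1 * S 1 t x) + ((-1) * B' (x - t) + (F t (v t x) + (-1) * S (-1) t x))))" .
  have "(%t. 1 / 2 * (A' (x + t) + (F t (v t x) + 1 * S 1 t x) + ((-1) * B' (x - t) + (F t (v t x) + (-1) * S (-1) t x)))) =
   (%t. (A' (x + t) - B' (x - t)) / 2 + (F t (v t x) + (S 1 t x - S (-1) t x) / 2))" by (auto simp: field_simps)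
  with * show "ac_deriv 0 T (%t. vt t x) (%t. (A' (x + t) - B' (x - t)) / 2 + (F t (v t x) + (S 1 t x - S (-1) t x) / 2))"
   using x by (auto elim!: ac_deriv_cong simp: vt_def a_def b_def inhom_eq)
 next
  fix t :: real assume t: "t \<in> {0..T}"
  have "ac_deriv 0 1 (%x. extA T w (t + 1 * x)) (%x. 1 * A' (t + 1 * x))" "ac_deriv 0 1 (%x. extB T w (- t + 1 * x)) (%x. 1 * B' (- t + 1 * x))"
   by (rule ac_deriv_affine[OF A(1)] ac_deriv_affine[OF B(1)]; use t in auto)+
  then have 1: "ac_deriv 0 1 (%x. extA T w (x + t)) (%x. A' (x + t))" "ac_deriv 0 1 (%x. extB T w (x - t)) (%x. B' (x - t))" by (simp_all add: add.commute)
  note 2 = ac_deriv_add[OF 1(1) inhom_ac(1)[of _ _ 1 t]] ac_deriv_add[OF 1(2) inhom_ac(1)[of _ _ "-1" t]]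
  have "ac_deriv 0 1 (%x. 1 / 2 * (extA T w (x + t) + inhom 1 v t x + (extB T w (x - t) + inhom (-1) v t x)))
   (%x. (A' (x + t) + B' (x - t)) / 2 + (S 1 t x + S (-1) t x) / 2)"
   by (rule ac_deriv_cmult[OF ac_deriv_add[OF 2], of "1/2", THEN back_subst[of "ac_deriv _ _ _"]]) (auto simp: field_simps)
  then show "ac_deriv 0 1 (vt t) (%x. (A' (x + t) + B' (x - t)) / 2 + (S 1 t x + S (-1) t x) / 2)"
   using t by (auto elim!: ac_deriv_cong simp: vt_def a_def b_def inhom_eq)
  have "ac_deriv 0 1 (%x. 1 / 2 * (extA T w (x + t) + inhom 1 v t x - (extB T w (x - t) + inhom (-1) v t x)))
   (%x. (A' (x + t) - B' (x - t)) / 2 + (S 1 t x - S (-1) t x) / 2)"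
   by (rule ac_deriv_cmult[OF ac_deriv_diff_fun[OF 2], of "1/2", THEN back_subst[of "ac_deriv _ _ _"]]) (auto simp: field_simps)
  then show "ac_deriv 0 1 (vx t) (%x. (A' (x + t) - B' (x - t)) / 2 + (S 1 t x - S (-1) t x) / 2)"
   using t by (auto elim!: ac_deriv_cong simp: vx_def a_def b_def inhom_eq)
 qed (use A B in auto)
qed

end

section \<open>Verification of the weak formulation\<close>

lemma integrable_real_affine:
 fixes A :: "real => real"
 assumes "lint A"
 shows "lint (%x. A (x + h))" "(LINT x|lborel. A (x + h)) = (LINT x|lborel. A x)"
 using lborel_integrable_real_affine[OF assms, of 1 h] lborel_integral_real_affine[of 1 A h] by (simp_all add: add.commute)

definition translation_continuous :: "(real => real) => bool" where
 "translation_continuous A \<longleftrightarrow> (ALL h. h \<longlonglongrightarrow> 0 --> (%n. LINT x|lborel. (A (x + h n) - A x)^2) \<longlonglongrightarrow> 0)"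

lemma integrable_square_diff:
 fixes f g :: "'a => real"
 assumes [measurable]: "f \<in> borel_measurable M" "g \<in> borel_measurable M"
  and "integrable M (%x. (f x)^2)" "integrable M (%x. (g x)^2)"
 shows "integrable M (%x. (f x - g x)^2)"
proof (rule Bochner_Integration.integrable_bound)
 show "integrable M (%x. 2 * (f x)^2 + 2 * (g x)^2)" using assms by auto
 have "(f x - g x)^2 <= 2 * (f x)^2 + 2 * (g x)^2" for x
  using zero_le_power2[of "f x + g x"] by (simp add: power2_eq_square algebra_simps)
 then show "AE x in M. norm ((f x - g x)^2) <= norm (2 * (f x)^2 + 2 * (g x)^2)" by (simp add: abs_of_nonneg)
qed simp

text \<open>The usual argument with three differences; translation invariance of the integral makes
  the outer two equal.\<close>

lemma translation_continuous_limit: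
 assumes A[measurable]: "A \<in> BM" and Ai: "lint (%x. (A x)^2)"
  and \<phi>[measurable]: "!!k. \<phi> k \<in> BM" and \<phi>i: "!!k. lint (%x. (\<phi> k x)^2)"
  and tc: "!!k. translation_continuous (\<phi> k)"
  and lim: "(%k::nat. LINT x|lborel. (A x - \<phi> k x)^2) \<longlonglongrightarrow> 0"
 shows "translation_continuous A"
 unfolding translation_continuous_def
proof (intro allI impI, rule LIMSEQ_I)
 fix h and \<epsilon> :: real assume h: "h \<longlonglongrightarrow> (0::real)" and \<epsilon>: "0 < \<epsilon>"
 obtain k where k: "(LINT x|lborel. (A x - \<phi> k x)^2) < \<epsilon> / 12"
  using LIMSEQ_D[OF lim, of "\<epsilon> / 12"] \<epsilon> by (auto simp: abs_less_iff)
 have "(%n. LINT x|lborel. (\<phi> k (x + h n) - \<phi> k x)^2) \<longlonglongrightarrow> 0" using tc h by (auto simp: translation_continuous_def)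
 then obtain n0 where n0: "!!n. n >= n0 ==> (LINT x|lborel. (\<phi> k (x + h n) - \<phi> k x)^2) < \<epsilon> / 12"
  using LIMSEQ_D[of _ 0 "\<epsilon> / 12"] \<epsilon> by (force simp: abs_less_iff)
 have d: "lint (%x. (A x - \<phi> k x)^2)" by (rule integrable_square_diff) (use Ai \<phi>i in auto)
 have "(LINT x|lborel. (A (x + h n) - A x)^2) < \<epsilon>" if "n >= n0" for n
 proof -
  have p: "lint (%x. (\<phi> k (x + h n) - \<phi> k x)^2)" "lint (%x. (A (x + h n) - A x)^2)"
   by (rule integrable_square_diff; use Ai \<phi>i integrable_real_affine(1)[OF Ai] integrable_real_affine(1)[OF \<phi>i] in simp)+
  have "(LINT x|lborel. (A (x + h n) - A x)^2) <=
    (LINT x|lborel. 3 * (A (x + h n) - \<phi> k (x + h n))^2 + 3 * (\<phi> k (x + h n) - \<phi> k x)^2 + 3 * (A x - \<phi> k x)^2)"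
  proof (rule integral_mono)
   fix x
   have "(a + b - c)^2 <= 3 * a^2 + 3 * b^2 + 3 * c^2" for a b c :: real
    using zero_le_power2[of "a - b"] zero_le_power2[of "a + c"] zero_le_power2[of "b + c"]
    by (simp add: power2_eq_square algebra_simps)
   from this[of "A (x + h n) - \<phi> k (x + h n)" "\<phi> k (x + h n) - \<phi> k x" "A x - \<phi> k x"]
   show "(A (x + h n) - A x)^2 <= 3 * (A (x + h n) - \<phi> k (x + h n))^2 + 3 * (\<phi> k (x + h n) - \<phi> k x)^2 + 3 * (A x - \<phi> k x)^2"
    by simp
  qed (use p d integrable_real_affine(1)[OF d] in auto)
  also have "... = 3 * (LINT x|lborel. (A x - \<phi> k x)^2) + 3 * (LINT x|lborel. (\<phi> k (x + h n) - \<phi> k x)^2) + 3 * (LINT x|lborel. (A x - \<phi> k x)^2)"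
   using p d integrable_real_affine[OF d, of "h n"] by simp
  also have "... < \<epsilon>" using k n0[OF that] \<epsilon> by simp
  finally show ?thesis .
 qed
 then show "EX no. ALL n>=no. norm ((LINT x|lborel. (A (x + h n) - A x)^2) - 0) < \<epsilon>"
  by (auto simp: abs_of_nonneg integral_nonneg_AE)
qed

lemma sq_le_indicator:
 fixes y :: real
 assumes "\<bar>y\<bar> <= C" "x ~: {-M..M} ==> y = 0"
 shows "y^2 <= indicator {-M..M} x * C^2"
 using assms abs_le_square_iff[of y C] by (cases "x \<in> {-M..M}") (auto simp: indicator_def)

text \<open>Dominated convergence; a bound \<open>K\<close> for the shifts enlarges the support
  uniformly.\<close>

lemma translation_continuous_of_continuous:
 assumes c: "cont A" and b: "!!x. \<bar>A x\<bar> <= C" and z: "!!x. x ~: {-M..M} ==> A x = 0"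
 shows "translation_continuous A"
 unfolding translation_continuous_def
proof (intro allI impI)
 fix h assume h: "h \<longlonglongrightarrow> (0::real)"
 have [measurable]: "A \<in> BM" by (rule borel_measurable_continuous_onI[OF c])
 obtain K where K: "!!n. \<bar>h n\<bar> <= K" using h by (metis convergentI convergent_imp_Bseq BseqE real_norm_def)
 have "(%n. LINT x|lborel. (A (x + h n) - A x)^2) \<longlonglongrightarrow> (LINT x|lborel. (A (x + 0) - A x)^2)"
 proof (rule integral_dominated_convergence[where w="%x. indicator {-(M + K)..M + K} x * (2 * C)^2"])
  show "AE x in lborel. (%n. (A (x + h n) - A x)^2) \<longlonglongrightarrow> (A (x + 0) - A x)^2"
   by (intro AE_I2 tendsto_intros continuous_on_tendsto_compose[OF c]) (use h in \<open>auto intro!: tendsto_eq_intros\<close>)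
  show "AE x in lborel. norm ((A (x + h n) - A x)^2) <= indicator {-(M + K)..M + K} x * (2 * C)^2" for n
  proof (intro AE_I2)
   fix x
   have "(A (x + h n) - A x)^2 <= indicator {-(M + K)..M + K} x * (2 * C)^2"
   proof (rule sq_le_indicator)
    show "\<bar>A (x + h n) - A x\<bar> <= 2 * C" using b[of x] b[of "x + h n"] by linarith
    assume "x ~: {-(M + K)..M + K}"
    then have "x ~: {-M..M}" "x + h n ~: {-M..M}" using K[of n] by auto
    then show "A (x + h n) - A x = 0" using z by simp
   qed
   then show "norm ((A (x + h n) - A x)^2) <= indicator {-(M + K)..M + K} x * (2 * C)^2" by simp
  qed
 qed auto
 then show "(%n. LINT x|lborel. (A (x + h n) - A x)^2) \<longlonglongrightarrow> 0" by simp
qed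

text \<open>Two approximations: \<open>A\<close> is truncated in argument and value, which makes it
  bounded with bounded support, and each truncation is approximated by the equally truncated
  continuous functions \<open>g k\<close>, which converge to \<open>A\<close> almost everywhere.
  Dominated convergence serves for both.\<close>

lemma translation_continuous_L2:
 assumes A[measurable]: "A \<in> BM" and Ai: "lint (%x. (A x)^2)"
 shows "translation_continuous A"
proof -
 have "A measurable_on UNIV" using A by (intro lebesgue_measurable_imp_measurable_on_real) (auto intro: measurable_completion)
 then obtain N g where N: "negligible N" and g: "!!n. cont (g n)" and gA: "!!x. x ~: N ==> (%n. g n x) \<longlonglongrightarrow> A x"
  unfolding measurable_on_def by (auto simp: continuous_on_eq_continuous_at)
 have AE: "AE x in lborel. (%n. g n x) \<longlonglongrightarrow> A x"
  using N gA by (metis (mono_tags, lifting) AE_completion_iff AE_iff_null_sets UNIV_I negligible_iff_null_sets completion.complete2 eventually_mono AE_not_in)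
 define cut where "cut n x = clamp_to 0 1 (real n + 1 - \<bar>x\<bar>)" for n x
 define cl where "cl n y = clamp_to (- real n) (real n) y" for n y
 have cut: "0 <= cut n x" "cut n x <= 1" "\<bar>x\<bar> <= real n ==> cut n x = 1" "x ~: {-(real n + 1)..real n + 1} ==> cut n x = 0" for n x
  by (auto simp: cut_def clamp_to_def)
 have cl: "\<bar>cl n y\<bar> <= real n" "\<bar>cl n y\<bar> <= \<bar>y\<bar>" "\<bar>y\<bar> <= real n ==> cl n y = y" for n y
  by (auto simp: cl_def clamp_to_def)
 have b: "\<bar>cut n x * cl n y\<bar> <= real n" "\<bar>cut n x * cl n y\<bar> <= \<bar>y\<bar>" for n x y
  using cut(1,2)[of n x] cl(1,2)[of n y] mult_mono[of "cut n x" 1 "\<bar>cl n y\<bar>" "\<bar>cl n y\<bar>"] by (auto simp: abs_mult)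
 have cutc: "cont (cut n)" and clc: "cont (cl n)" for n
  unfolding cut_def cl_def by (intro continuous_intros)+
 have [measurable]: "cut n \<in> BM" "cl n \<in> BM" "g n \<in> BM" for n
  using cutc clc g by (auto intro: borel_measurable_continuous_onI)
 have ind: "lint (%x. indicator {-(real n + 1)..real n + 1} x * c)" for n and c :: real by simp
 have sqi: "lint (%x. (cut n x * cl n (f x))^2)" if [measurable]: "f \<in> BM" for n f
 proof (rule Bochner_Integration.integrable_bound[OF ind[of n "(real n)^2"]])
  have "(cut n x * cl n (f x))^2 <= indicator {-(real n + 1)..real n + 1} x * (real n)^2" for x
   by (rule sq_le_indicator[OF b(1)]) (use cut(4) in simp)
  then show "AE x in lborel. norm ((cut n x * cl n (f x))^2) <= norm (indicator {-(real n + 1)..real n + 1} x * (real n)^2)" by simp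
 qed measurable
 have tc: "translation_continuous (%x. cut n x * cl n (A x))" for n
 proof (rule translation_continuous_limit[where \<phi>="%k x. cut n x * cl n (g k x)"])
  show "translation_continuous (%x. cut n x * cl n (g k x))" for k
  proof (rule translation_continuous_of_continuous[OF _ b(1)])
   show "cont (%x. cut n x * cl n (g k x))"
    by (intro continuous_on_mult cutc continuous_on_compose2[OF clc g]) simp
   show "cut n x * cl n (g k x) = 0" if "x ~: {-(real n + 1)..real n + 1}" for x using cut(4)[OF that] by simp
  qed
  have "(%k. LINT x|lborel. (cut n x * cl n (A x) - cut n x * cl n (g k x))^2) \<longlonglongrightarrow> (LINT (x::real)|lborel. 0)"
  proof (rule integral_dominated_convergence[where w="%x. indicator {-(real n + 1)..real n + 1} x * (2 * real n)^2"])
   show "AE x in lborel. (%k. (cut n x * cl n (A x) - cut n x * cl n (g k x))^2) \<longlonglongrightarrow> 0"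
    using AE
   proof eventually_elim
    case (elim x)
    have "(%k. cl n (g k x)) \<longlonglongrightarrow> cl n (A x)" by (rule continuous_on_tendsto_compose[OF clc elim]) auto
    then show ?case by (auto intro!: tendsto_eq_intros)
   qed
   show "AE x in lborel. norm ((cut n x * cl n (A x) - cut n x * cl n (g k x))^2) <= indicator {-(real n + 1)..real n + 1} x * (2 * real n)^2" for k
   proof (intro AE_I2)
    fix x
    have "\<bar>cut n x * cl n (A x) - cut n x * cl n (g k x)\<bar> <= 2 * real n" using b(1)[of n x "A x"] b(1)[of n x "g k x"] by linarith
    then have "(cut n x * cl n (A x) - cut n x * cl n (g k x))^2 <= indicator {-(real n + 1)..real n + 1} x * (2 * real n)^2"
     by (rule sq_le_indicator) (use cut(4) in simp)
    then show "norm ((cut n x * cl n (A x) - cut n x * cl n (g k x))^2) <= indicator {-(real n + 1)..real n + 1} x * (2 * real n)^2" by simp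
   qed
  qed (use ind in auto)
  then show "(%k. LINT x|lborel. (cut n x * cl n (A x) - cut n x * cl n (g k x))^2) \<longlonglongrightarrow> 0" by simp
 qed (use sqi in auto)
 have "(%n. LINT x|lborel. (A x - cut n x * cl n (A x))^2) \<longlonglongrightarrow> (LINT (x::real)|lborel. 0)"
 proof (rule integral_dominated_convergence[where w="%x. (2 * A x)^2"])
  show "AE x in lborel. (%n. (A x - cut n x * cl n (A x))^2) \<longlonglongrightarrow> 0"
  proof (intro AE_I2 tendsto_eventually eventually_sequentiallyI)
   fix x n assume "nat \<lceil>max \<bar>x\<bar> \<bar>A x\<bar>\<rceil> <= n"
   then have "\<bar>x\<bar> <= real n" "\<bar>A x\<bar> <= real n" by linarith+
   then show "(A x - cut n x * cl n (A x))^2 = 0" using cut(3) cl(3) by simp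
  qed
  show "AE x in lborel. norm ((A x - cut n x * cl n (A x))^2) <= (2 * A x)^2" for n
  proof (intro AE_I2)
   fix x
   have "\<bar>A x - cut n x * cl n (A x)\<bar> <= \<bar>2 * A x\<bar>" using b(2)[of n x "A x"] by linarith
   then show "norm ((A x - cut n x * cl n (A x))^2) <= (2 * A x)^2" unfolding abs_le_square_iff by simp
  qed
 qed (use Ai in \<open>auto simp: power_mult_distrib\<close>)
 then have lim: "(%n. LINT x|lborel. (A x - cut n x * cl n (A x))^2) \<longlonglongrightarrow> 0" by simp
 show ?thesis
  by (rule translation_continuous_limit[OF A Ai _ sqi[OF A] tc lim]) measurable
qed

section \<open>Curves in L^2(0,1) that are continuous in time\<close>

abbreviation Isq :: "(real => real) => real" where
 "Isq f \<equiv> (LINT x|lborel. indicator {0..1} x * (f x)^2)"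

text \<open>Collects what the Bochner spaces and the initial values call for: joint measurability
  for Fubini, and boundedness and continuity in time with respect to L^2(0,1), here at every time
  and not only at almost every one.\<close>

definition L2_curve :: "(real => real => real) => bool" where
 "L2_curve g \<longleftrightarrow> (%z. g (fst z) (snd z)) \<in> BM &
   (ALL t. lint (%x. indicator {0..1} x * (g t x)^2)) &
   (ALL T. EX C. \<forall>t\<in>{0..T}. Isq (g t) <= C) &
   (ALL s t. s \<longlonglongrightarrow> t --> (%n. Isq (%x. g (s n) x - g t x)) \<longlonglongrightarrow> 0)"

lemma L2_curve_borel: "L2_curve g ==> g t \<in> BM"
 using slice_borel[of "%z. g (fst z) (snd z)" t] by (simp add: L2_curve_def)

lemma Isq_nonneg: "Isq f >= 0" by (rule LINT_indicator_square_nonneg)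

lemma Isq_le_combination:
 assumes [measurable]: "f \<in> BM" "g \<in> BM" "h \<in> BM"
  and i: "lint (%x. indicator {0..1} x * (f x)^2)" "lint (%x. indicator {0..1} x * (g x)^2)"
  and h: "!!x. h x = a * f x + b * g x"
 shows "lint (%x. indicator {0..1} x * (h x)^2)" "Isq h <= 2 * a^2 * Isq f + 2 * b^2 * Isq g"
proof -
 have le: "indicator {0..1} x * (h x)^2 <= 2 * a^2 * (indicator {0..1} x * (f x)^2) + 2 * b^2 * (indicator {0..1} x * (g x)^2)" for x
  using zero_le_power2[of "a * f x - b * g x"] unfolding h by (auto simp: indicator_def power2_eq_square algebra_simps)
 have r: "lint (%x. 2 * a^2 * (indicator {0..1} x * (f x)^2) + 2 * b^2 * (indicator {0..1} x * (g x)^2))" using i by auto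
 show hi: "lint (%x. indicator {0..1} x * (h x)^2)"
  by (rule Bochner_Integration.integrable_bound[OF r]) (use le in \<open>auto simp: abs_of_nonneg\<close>)
 have "Isq h <= (LINT x|lborel. 2 * a^2 * (indicator {0..1} x * (f x)^2) + 2 * b^2 * (indicator {0..1} x * (g x)^2))"
  by (rule integral_mono[OF hi r le])
 then show "Isq h <= 2 * a^2 * Isq f + 2 * b^2 * Isq g" using i by simp
qed

lemma L2_curve_combination:
 assumes f: "L2_curve f" and g: "L2_curve g" and a: "cont a" and b: "cont b"
 shows "L2_curve (%t x. a t * f t x + b t * g t x)"
 unfolding L2_curve_def
proof (intro conjI allI impI)
 note m[measurable] = L2_curve_borel[OF f] L2_curve_borel[OF g]
 have i: "lint (%x. indicator {0..1} x * (f t x)^2)" "lint (%x. indicator {0..1} x * (g t x)^2)" for t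
  using f g by (auto simp: L2_curve_def)
 have [measurable]: "(%z. f (fst z) (snd z)) \<in> BM" "(%z. g (fst z) (snd z)) \<in> BM"
  "(%z::real\<times>real. a (fst z)) \<in> BM" "(%z::real\<times>real. b (fst z)) \<in> BM"
  using f g by (auto simp: L2_curve_def intro!: borel_measurable_continuous_onI continuous_on_compose2[OF a] continuous_on_compose2[OF b] continuous_intros)
 show "(%z. a (fst z) * f (fst z) (snd z) + b (fst z) * g (fst z) (snd z)) \<in> BM" by measurable
 show "lint (%x. indicator {0..1} x * (a t * f t x + b t * g t x)^2)" for t
  by (rule Isq_le_combination(1)[OF m(1)[of t] m(2)[of t] _ i refl]) simp
 show "EX C. \<forall>t\<in>{0..T}. Isq (%x. a t * f t x + b t * g t x) <= C" for T
 proof -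
  obtain C D where C: "!!t. t \<in> {0..T} ==> Isq (f t) <= C" and D: "!!t. t \<in> {0..T} ==> Isq (g t) <= D"
   using f g unfolding L2_curve_def by meson
  obtain p where p: "!!t. t \<in> {0..T} ==> \<bar>(a t)^2\<bar> <= p"
   using continuous_on_Icc_bounded[of 0 T "%t. (a t)^2"] continuous_on_subset[OF a subset_UNIV] by (metis continuous_on_power)
  obtain q where q: "!!t. t \<in> {0..T} ==> \<bar>(b t)^2\<bar> <= q"
   using continuous_on_Icc_bounded[of 0 T "%t. (b t)^2"] continuous_on_subset[OF b subset_UNIV] by (metis continuous_on_power)
  have "Isq (%x. a t * f t x + b t * g t x) <= 2 * p * C + 2 * q * D" if t: "t \<in> {0..T}" for t
  proof -
   have "Isq (%x. a t * f t x + b t * g t x) <= 2 * (a t)^2 * Isq (f t) + 2 * (b t)^2 * Isq (g t)"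
    by (rule Isq_le_combination(2)[OF m(1)[of t] m(2)[of t] _ i refl]) simp
   also have "... <= 2 * p * C + 2 * q * D"
    using order_trans[OF abs_ge_zero p[OF t]] order_trans[OF abs_ge_zero q[OF t]]
     p[OF t] q[OF t] C[OF t] D[OF t] Isq_nonneg[of "f t"] Isq_nonneg[of "g t"] by (intro add_mono mult_mono) auto
   finally show ?thesis .
  qed
  then show ?thesis by blast
 qed
 fix s :: "nat => real" and t assume s: "s \<longlonglongrightarrow> t"
 have fg: "(%n. Isq (%x. f (s n) x - f t x)) \<longlonglongrightarrow> 0" "(%n. Isq (%x. g (s n) x - g t x)) \<longlonglongrightarrow> 0"
  using f g s by (auto simp: L2_curve_def)
 have as: "(%n. a (s n)) \<longlonglongrightarrow> a t" "(%n. b (s n)) \<longlonglongrightarrow> b t"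
  using continuous_on_tendsto_compose[OF a s] continuous_on_tendsto_compose[OF b s] by auto
 \<comment> \<open>Bound from the splitting \<open>a s * f s - a t * f t = a s * (f s - f t) + (a s
   - a t) * f t\<close> and its analogue for \<open>b\<close> and \<open>g\<close>.\<close>
 define R where "R n = 2 * 1^2 * (2 * (a (s n))^2 * Isq (%x. f (s n) x - f t x) + 2 * (a (s n) - a t)^2 * Isq (f t)) +
   2 * 1^2 * (2 * (b (s n))^2 * Isq (%x. g (s n) x - g t x) + 2 * (b (s n) - b t)^2 * Isq (g t))" for n
 have "R \<longlonglongrightarrow> 2 * 1^2 * (2 * (a t)^2 * 0 + 2 * (a t - a t)^2 * Isq (f t)) + 2 * 1^2 * (2 * (b t)^2 * 0 + 2 * (b t - b t)^2 * Isq (g t))"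
  unfolding R_def by (intro tendsto_intros fg as)
 then have R0: "R \<longlonglongrightarrow> 0" by simp
 show "(%n. Isq (%x. (a (s n) * f (s n) x + b (s n) * g (s n) x) - (a t * f t x + b t * g t x))) \<longlonglongrightarrow> 0"
 proof (rule tendsto_sandwich[OF _ _ tendsto_const R0])
  show "\<forall>\<^sub>F n in sequentially. Isq (%x. (a (s n) * f (s n) x + b (s n) * g (s n) x) - (a t * f t x + b t * g t x)) <= R n"
  proof (intro always_eventually allI)
   fix n
   define u where "u x = a (s n) * (f (s n) x - f t x) + (a (s n) - a t) * f t x" for x
   define v where "v x = b (s n) * (g (s n) x - g t x) + (b (s n) - b t) * g t x" for x
   have [measurable]: "u \<in> BM" "v \<in> BM" unfolding u_def v_def by measurable
   have df: "lint (%x. indicator {0..1} x * (f (s n) x - f t x)^2)" "lint (%x. indicator {0..1} x * (g (s n) x - g t x)^2)"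
    by (rule Isq_le_combination(1)[OF m(1)[of "s n"] m(1)[of t] _ i(1) i(1), of _ 1 "-1"] Isq_le_combination(1)[OF m(2)[of "s n"] m(2)[of t] _ i(2) i(2), of _ 1 "-1"]; simp)+
   have u: "lint (%x. indicator {0..1} x * (u x)^2)" "Isq u <= 2 * (a (s n))^2 * Isq (%x. f (s n) x - f t x) + 2 * (a (s n) - a t)^2 * Isq (f t)"
    by (rule Isq_le_combination[OF _ m(1)[of t] _ df(1) i(1) u_def]; simp)+
   have v: "lint (%x. indicator {0..1} x * (v x)^2)" "Isq v <= 2 * (b (s n))^2 * Isq (%x. g (s n) x - g t x) + 2 * (b (s n) - b t)^2 * Isq (g t)"
    by (rule Isq_le_combination[OF _ m(2)[of t] _ df(2) i(2) v_def]; simp)+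
   have "Isq (%x. (a (s n) * f (s n) x + b (s n) * g (s n) x) - (a t * f t x + b t * g t x)) <= 2 * 1^2 * Isq u + 2 * 1^2 * Isq v"
    by (rule Isq_le_combination(2)[OF _ _ _ u(1) v(1)]) (simp_all add: u_def v_def algebra_simps)
   also have "... <= R n" unfolding R_def using u v by simp
   finally show "Isq (%x. (a (s n) * f (s n) x + b (s n) * g (s n) x) - (a t * f t x + b t * g t x)) <= R n" .
  qed
 qed (simp add: Isq_nonneg)
qed

lemma L2_curve_continuous:
 assumes g: "cont (%(t, x). g t x)"
 shows "L2_curve g"
 unfolding L2_curve_def
proof (intro conjI allI impI)
 have gc: "cont (%z. g (fst z) (snd z))" using g by (simp add: case_prod_unfold)
 show "(%z. g (fst z) (snd z)) \<in> BM" by (rule borel_measurable_continuous_onI[OF gc])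
 have ct: "cont (g t)" for t by (intro continuous_on_pair[OF g] continuous_intros)
 then have [measurable]: "g t \<in> BM" for t by (rule borel_measurable_continuous_onI)
 show "lint (%x. indicator {0..1} x * (g t x)^2)" for t
  by (rule integrable_indicator_continuous) (intro continuous_intros continuous_on_subset[OF ct] subset_UNIV)
 have bd: "EX C. \<forall>t\<in>{c..d}. \<forall>x\<in>{0..1}. \<bar>g t x\<bar> <= C" for c d
 proof -
  have "compact ((%z. g (fst z) (snd z)) ` ({c..d} \<times> {0..1}))"
   by (intro compact_continuous_image continuous_on_subset[OF gc] compact_Times) auto
  then obtain C where "\<forall>y\<in>(%z. g (fst z) (snd z)) ` ({c..d} \<times> {0..1}). norm y <= C"
   using compact_imp_bounded bounded_iff by metis
  then show ?thesis by (intro exI[of _ C]) force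
 qed
 show "EX C. \<forall>t\<in>{0..T}. Isq (g t) <= C" for T
 proof -
  obtain C where C: "!!t x. t \<in> {0..T} ==> x \<in> {0..1} ==> \<bar>g t x\<bar> <= C" using bd[of 0 T] by blast
  have "Isq (g t) <= (LINT x|lborel. indicator {0..1::real} x * C^2)" if t: "t \<in> {0..T}" for t
  proof (rule integral_mono)
   show "lint (%x. indicator {0..1} x * (g t x)^2)"
    by (rule integrable_indicator_continuous) (intro continuous_intros continuous_on_subset[OF ct] subset_UNIV)
   show "indicator {0..1} x * (g t x)^2 <= indicator {0..1::real} x * C^2" for x
    using C[OF t, of x] abs_le_square_iff[of "g t x" C] by (auto simp: indicator_def)
  qed simp
  then show ?thesis by blast
 qed
 fix s :: "nat => real" and t assume s: "s \<longlonglongrightarrow> t"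
 obtain K where K: "!!n. \<bar>s n\<bar> <= K" using s by (metis convergentI convergent_imp_Bseq BseqE real_norm_def)
 have tK: "\<bar>t\<bar> <= K" using LIMSEQ_le_const2[OF tendsto_rabs[OF s]] K by auto
 obtain C where C: "!!t x. t \<in> {-K..K} ==> x \<in> {0..1} ==> \<bar>g t x\<bar> <= C" using bd[of "-K" K] by blast
 have "(%n. Isq (%x. g (s n) x - g t x)) \<longlonglongrightarrow> (LINT x|lborel. indicator {0..1} x * (g t x - g t x)^2)"
 proof (rule integral_dominated_convergence[where w="%x. indicator {0..1} x * (2 * C)^2"])
  have "(%n. g (s n) x) \<longlonglongrightarrow> g t x" for x
   by (rule continuous_on_tendsto_compose[OF continuous_on_pair[OF g, of UNIV "%t. t" "%_. x"] s]) auto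
  then show "AE x in lborel. (%n. indicator {0..1} x * (g (s n) x - g t x)^2) \<longlonglongrightarrow> indicator {0..1} x * (g t x - g t x)^2"
   by (intro AE_I2 tendsto_intros)
  show "AE x in lborel. norm (indicator {0..1} x * (g (s n) x - g t x)^2) <= indicator {0..1} x * (2 * C)^2" for n
  proof (intro AE_I2)
   fix x :: real
   have "\<bar>g (s n) x - g t x\<bar> <= \<bar>2 * C\<bar>" if "x \<in> {0..1}"
    using C[of "s n" x] C[of t x] K[of n] tK that by (auto simp: abs_le_iff)
   then show "norm (indicator {0..1} x * (g (s n) x - g t x)^2) <= indicator {0..1} x * (2 * C)^2"
    using abs_le_square_iff[of "g (s n) x - g t x" "2 * C"] by (auto simp: indicator_def)
  qed
 qed auto
 then show "(%n. Isq (%x. g (s n) x - g t x)) \<longlonglongrightarrow> 0" by simp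
qed

text \<open>Substitution reduces the difference at two times to a shift by
  \<open>c * (s - t)\<close>; it is exact on the whole line, to which the integral over
  \<open>[0, 1]\<close> is enlarged first.\<close>

lemma L2_curve_translation:
 assumes A[measurable]: "A \<in> BM" and Ai: "lint (%x. (A x)^2)"
 shows "L2_curve (%t x. A (x + c * t))"
 unfolding L2_curve_def
proof (intro conjI allI impI)
 have "(%z::real \<times> real. snd z + c * fst z) \<in> BM"
  by (intro borel_measurable_continuous_onI continuous_intros)
 from measurable_compose[OF this A]
 show "(%z. A (snd z + c * fst z)) \<in> BM" .
 have le: "Isq f <= (LINT x|lborel. (f x)^2)" "lint (%x. indicator {0..1} x * (f x)^2)"
  if "lint (%x. (f x)^2)" for f
 proof -
  show i: "lint (%x. indicator {0..1} x * (f x)^2)"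
   using integrable_mult_indicator[OF _ that, of "{0..1}"] by simp
  show "Isq f <= (LINT x|lborel. (f x)^2)" by (rule integral_mono[OF i that]) (auto simp: indicator_def)
 qed
 show "lint (%x. indicator {0..1} x * (A (x + c * t))^2)" for t
  by (rule le(2)) (rule integrable_real_affine(1)[OF Ai])
 show "EX C. \<forall>t\<in>{0..T}. Isq (%x. A (x + c * t)) <= C" for T
  using le(1)[OF integrable_real_affine(1)[OF Ai]] integrable_real_affine(2)[OF Ai] by (intro exI[of _ "LINT x|lborel. (A x)^2"]) simp
 fix s :: "nat => real" and t assume s: "s \<longlonglongrightarrow> t"
 have "(%n. c * (s n - t)) \<longlonglongrightarrow> 0" using s by (auto intro!: tendsto_eq_intros)
 then have lim: "(%n. LINT x|lborel. (A (x + c * (s n - t)) - A x)^2) \<longlonglongrightarrow> 0"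
  using translation_continuous_L2[OF A Ai] unfolding translation_continuous_def by (auto dest: spec[of _ "%n. c * (s n - t)"])
 have le': "Isq (%x. A (x + c * s n) - A (x + c * t)) <= (LINT x|lborel. (A (x + c * (s n - t)) - A x)^2)" for n
 proof -
  have "lint (%x. (A (x + c * (s n - t)) - A x)^2)" "lint (%x. (A (x + c * s n) - A (x + c * t))^2)"
   by (rule integrable_square_diff; use Ai integrable_real_affine(1)[OF Ai] in simp)+
  then show ?thesis
   using le(1)[of "%x. A (x + c * s n) - A (x + c * t)"] integrable_real_affine(2)[of "%x. (A (x + c * (s n - t)) - A x)^2" "c * t"]
   by (simp add: algebra_simps)
 qed
 show "(%n. Isq (%x. A (x + c * s n) - A (x + c * t))) \<longlonglongrightarrow> 0"
  by (rule tendsto_sandwich[OF _ _ tendsto_const lim]) (use le' Isq_nonneg in auto)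
qed

section \<open>Weak derivatives on the rectangle from slices\<close>

lemma ac_deriv_parts_zero:
 assumes F: "ac_deriv a b F g" and ab: "a <= b" and \<psi>: "!!x. (\<psi> has_real_derivative \<phi> x) (at x)" "cont \<phi>" "\<psi> a = 0" "\<psi> b = 0"
 shows "(LINT x|lborel. indicator {a..b} x * (F x * \<phi> x)) = - (LINT x|lborel. indicator {a..b} x * (g x * \<psi> x))"
proof -
 have G: "ac_deriv a b \<psi> \<phi>" by (rule ac_deriv_DERIV_all[OF \<psi>(1,2)])
 have 0: "(LINT s|lborel. indicator {a..b} s * (g s * \<psi> s + F s * \<phi> s)) = 0"
  using ac_deriv_parts_aux[OF F G, of b] ab \<psi>(3,4) by simp
 have "(%x. indicator {a..b} x * (indicator {a..b} x * (g x * \<psi> x + F x * \<phi> x))) = (%x. indicator {a..b} x * (g x * \<psi> x + F x * \<phi> x))"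
  by (auto simp: indicator_def)
 with ac_deriv_integrable[OF ac_deriv_mult[OF F G]]
 have i1: "lint (%x. indicator {a..b} x * (g x * \<psi> x + F x * \<phi> x))" by simp
 have i2: "lint (%x. indicator {a..b} x * (F x * \<phi> x))"
  by (intro integrable_indicator_continuous continuous_on_mult ac_deriv_continuous[OF F] continuous_on_subset[OF \<psi>(2)]) auto
 have "(LINT x|lborel. indicator {a..b} x * (g x * \<psi> x)) =
   (LINT x|lborel. indicator {a..b} x * (g x * \<psi> x + F x * \<phi> x) - indicator {a..b} x * (F x * \<phi> x))"
  by (rule LINT_cong[OF refl]) (simp add: algebra_simps)
 also have "... = 0 - (LINT x|lborel. indicator {a..b} x * (F x * \<phi> x))"
  unfolding 0[symmetric] by (rule Bochner_Integration.integral_diff[OF i1 i2])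
 finally show ?thesis by simp
qed

text \<open>Separates measure theory from calculus: \<open>parts\<close> is a single integration by
  parts on the closed rectangle, for which integrability of both sides is supplied.\<close>

lemma has_weak_deriv_on_box:
 fixes f g :: "real \<times> real => real"
 assumes f: "f \<in> BM" "lint (%z. indicator ({0..T} \<times> {0..1}) z * f z)"
  and g: "g \<in> BM" "lint (%z. indicator ({0..T} \<times> {0..1}) z * g z)"
  and b: "b \<in> Basis"
  and parts: "!!D K. smooth_partials D ==> K \<subseteq> {0<..<T} \<times> \<Omega> ==> (!!z. z ~: K ==> D [] z = 0) ==> (!!z. z ~: K ==> D [b] z = 0) ==>
    lint (%z. indicator ({0..T} \<times> {0..1}) z * f z * D [b] z) ==> lint (%z. indicator ({0..T} \<times> {0..1}) z * g z * D [] z) ==>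
    (LINT z|lborel. indicator ({0..T} \<times> {0..1}) z * f z * D [b] z) = - (LINT z|lborel. indicator ({0..T} \<times> {0..1}) z * g z * D [] z)"
 shows "has_weak_deriv ({0<..<T} \<times> \<Omega>) [b] f g"
 unfolding has_weak_deriv_def
proof (intro conjI allI impI)
 let ?S = "{0<..<T} \<times> \<Omega>" and ?R = "{0..T} \<times> {0..1::real}"
 have S: "?S \<in> sets borel" by (intro borel_open open_Times) auto
 have SR: "?S \<subseteq> ?R" by auto
 have li: "locally_integrable ?S h" if "h \<in> BM" "lint (%z. indicator ?R z * h z)" for h
  unfolding locally_integrable_def
 proof (intro allI impI)
  fix K :: "(real \<times> real) set" assume K: "compact K & K \<subseteq> ?S"
  then have "K \<in> sets borel" by (simp add: borel_compact)
  with that K SR show "h absolutely_integrable_on K"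
   by (subst absolutely_integrable_on_borel) (auto intro!: integrable_indicator_subset[OF that(2)])
 qed
 show "locally_integrable ?S f" "locally_integrable ?S g" using li f g by auto
 fix D :: "(real \<times> real) list => real \<times> real => real"
 assume "smooth_partials D & (EX K. compact K & K \<subseteq> ?S & (ALL z. z ~: K --> D [] z = 0))"
 then obtain K where D: "smooth_partials D" and K: "compact K" "K \<subseteq> ?S" "!!z. z ~: K ==> D [] z = 0" by blast
 have D1: "D [b] z = 0" if "z ~: K" for z by (rule smooth_partials_deriv_support[OF D K(1,3) that b])
 have c: "continuous_on A (D [])" "continuous_on A (D [b])" for A using b by (auto intro!: smooth_partials_continuous[OF D])
 have int: "lint (%z. indicator ?R z * h z * d z)" if h: "lint (%z. indicator ?R z * h z)"
  and d: "cont d" "!!z. z ~: K ==> d z = 0" for h d :: "real \<times> real => real"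
 proof -
  have "bounded (d ` K)" by (intro compact_imp_bounded compact_continuous_image continuous_on_subset[OF d(1)] K(1)) auto
  then obtain C where "!!z. z \<in> K ==> \<bar>d z\<bar> <= C" by (auto simp: bounded_iff)
  then have C: "\<bar>d z\<bar> <= max C 0" for z using d(2)[of z] by (cases "z \<in> K") fastforce+
  show ?thesis by (rule integrable_mult_bounded[OF h _ C]) (use d(1) in \<open>auto intro: borel_measurable_continuous_onI\<close>)
 qed
 have eq: "(LINT z|lebesgue_on ?S. h z * d z) = (LINT z|lborel. indicator ?R z * h z * d z)"
  if [measurable]: "h \<in> BM" and d: "cont d" "!!z. z ~: K ==> d z = 0" for h d :: "real \<times> real => real"
 proof -
  have [measurable]: "d \<in> BM" by (rule borel_measurable_continuous_onI[OF d(1)])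
  have "(LINT z|lebesgue_on ?S. h z * d z) = (LINT z|lborel. indicator ?S z * (h z * d z))"
   by (rule LINT_lebesgue_on[OF S]) measurable
  also have "... = (LINT z|lborel. indicator ?R z * h z * d z)"
  proof (rule LINT_cong[OF refl])
   fix z show "indicator ?S z * (h z * d z) = indicator ?R z * h z * d z"
    using d(2)[of z] K(2) SR by (cases "z \<in> K") (auto simp: indicator_def)
  qed
  finally show ?thesis .
 qed
 show "(LINT z|lebesgue_on ?S. f z * D [b] z) = (- 1) ^ length [b] * (LINT z|lebesgue_on ?S. g z * D [] z)"
  using parts[OF D K(2,3) D1 int[OF f(2) c(2) D1] int[OF g(2) c(1) K(3)]] eq[OF f(1) c(2) D1] eq[OF g(1) c(1) K(3)] by simp
qed

lemma smooth_partials_DERIV: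
 fixes D :: "(real \<times> real) list => real \<times> real => real"
 assumes D: "smooth_partials D"
 shows "((%t. D [] (t, x)) has_real_derivative D [(1, 0)] (t, x)) (at t)"
  "((%x. D [] (t, x)) has_real_derivative D [(0, 1)] (t, x)) (at x)"
  "cont (%t. D [(1, 0)] (t, x))" "cont (%x. D [(0, 1)] (t, x))"
proof -
 have B: "(Basis :: (real \<times> real) set) = {(1, 0), (0, 1)}" by (auto simp: Basis_prod_def)
 have d: "(D [] has_derivative (%h. fst h * D [(1, 0)] z + snd h * D [(0, 1)] z)) (at z)" for z
 proof -
  have "(D [] has_derivative (%h. \<Sum>b\<in>Basis. (h \<bullet> b) * D [b] z)) (at z)"
   using D unfolding smooth_partials_def by fastforce
  then show ?thesis by (simp add: B inner_prod_def)
 qed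
 have "((%t. D [] (t, x)) has_derivative (%h. fst (h, 0::real) * D [(1, 0)] (t, x) + snd (h, 0::real) * D [(0, 1)] (t, x))) (at t)"
  by (rule has_derivative_compose[OF _ d, of "%t. (t, x)"]) (auto intro!: derivative_eq_intros)
 then show "((%t. D [] (t, x)) has_real_derivative D [(1, 0)] (t, x)) (at t)"
  by (simp add: has_field_derivative_def mult.commute[of _ "D [(1, 0)] (t, x)"])
 have "((%x. D [] (t, x)) has_derivative (%h. fst (0::real, h) * D [(1, 0)] (t, x) + snd (0::real, h) * D [(0, 1)] (t, x))) (at x)"
  by (rule has_derivative_compose[OF _ d, of "%x. (t, x)"]) (auto intro!: derivative_eq_intros)
 then show "((%x. D [] (t, x)) has_real_derivative D [(0, 1)] (t, x)) (at x)"
  by (simp add: has_field_derivative_def mult.commute[of _ "D [(0, 1)] (t, x)"])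
 have "cont (D [(1, 0)])" "cont (D [(0, 1)])"
  by (rule smooth_partials_continuous[OF D]; simp add: B)+
 then show "cont (%t. D [(1, 0)] (t, x))" "cont (%x. D [(0, 1)] (t, x))"
  by (auto intro!: continuous_on_compose2[of UNIV "D [(1, 0)]"] continuous_on_compose2[of UNIV "D [(0, 1)]"] continuous_intros)
qed

text \<open>Fubini with the direction of differentiation as inner integral. Slices that miss the
  open rectangle contribute zero, so absolute continuity is asked only on the others.\<close>

lemma has_weak_deriv_slices:
 fixes f g :: "real \<times> real => real"
 assumes T: "T > 0"
  and f: "f \<in> BM" "lint (%z. indicator ({0..T} \<times> {0..1}) z * f z)"
  and g: "g \<in> BM" "lint (%z. indicator ({0..T} \<times> {0..1}) z * g z)"
 shows "(!!x. x \<in> \<Omega> ==> ac_deriv 0 T (%t. f (t, x)) (%t. g (t, x))) ==> has_weak_deriv ({0<..<T} \<times> \<Omega>) [(1, 0)] f g"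
  "(!!t. t \<in> {0<..<T} ==> ac_deriv 0 1 (%x. f (t, x)) (%x. g (t, x))) ==> has_weak_deriv ({0<..<T} \<times> \<Omega>) [(0, 1)] f g"
proof -
 let ?R = "{0..T} \<times> {0..1::real}"
 have ind: "indicator ?R (t, x) = indicator {0..T} t * (indicator {0..1} x :: real)" for t x by (simp add: indicator_times)
 have snd: "(LINT z|lborel. h z) = (LINT x|lborel. LINT t|lborel. h (t, x))" and fst: "(LINT z|lborel. h z) = (LINT t|lborel. LINT x|lborel. h (t, x))"
  if "lint h" for h :: "real \<times> real => real"
  using lborel_pair.integral_snd[of "%t x. h (t, x)"] lborel_pair.integral_fst'[of h] that by (simp_all add: lborel_prod)
 show "has_weak_deriv ({0<..<T} \<times> \<Omega>) [(1, 0)] f g" if ac: "!!x. x \<in> \<Omega> ==> ac_deriv 0 T (%t. f (t, x)) (%t. g (t, x))"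
 proof (rule has_weak_deriv_on_box[OF f g])
  fix D :: "(real \<times> real) list => real \<times> real => real" and K
  assume D: "smooth_partials D" and K: "K \<subseteq> {0<..<T} \<times> \<Omega>" "!!z. z ~: K ==> D [] z = 0" "!!z. z ~: K ==> D [(1, 0)] z = 0"
   and i: "lint (%z. indicator ?R z * f z * D [(1, 0)] z)" "lint (%z. indicator ?R z * g z * D [] z)"
  have "(LINT t|lborel. indicator ?R (t, x) * f (t, x) * D [(1, 0)] (t, x)) = - (LINT t|lborel. indicator ?R (t, x) * g (t, x) * D [] (t, x))" for x
  proof (cases "x \<in> \<Omega>")
   case True
   have "(0, x) ~: K" "(T, x) ~: K" using K(1) by auto
   then have "(LINT t|lborel. indicator {0..T} t * (f (t, x) * D [(1, 0)] (t, x))) = - (LINT t|lborel. indicator {0..T} t * (g (t, x) * D [] (t, x)))"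
    by (intro ac_deriv_parts_zero[OF ac[OF True] _ smooth_partials_DERIV(1,3)[OF D]] K(2)) (use T in auto)
   then show ?thesis using True by (simp add: ind mult.assoc)
  next
   case False
   then have "(t, x) ~: K" for t using K(1) by auto
   then show ?thesis by (simp add: K(2,3))
  qed
  then show "(LINT z|lborel. indicator ?R z * f z * D [(1, 0)] z) = - (LINT z|lborel. indicator ?R z * g z * D [] z)"
   unfolding snd[OF i(1)] snd[OF i(2)] by simp
 qed (simp add: Basis_prod_def)
 show "has_weak_deriv ({0<..<T} \<times> \<Omega>) [(0, 1)] f g" if ac: "!!t. t \<in> {0<..<T} ==> ac_deriv 0 1 (%x. f (t, x)) (%x. g (t, x))"
 proof (rule has_weak_deriv_on_box[OF f g])
  fix D :: "(real \<times> real) list => real \<times> real => real" and K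
  assume D: "smooth_partials D" and K: "K \<subseteq> {0<..<T} \<times> \<Omega>" "!!z. z ~: K ==> D [] z = 0" "!!z. z ~: K ==> D [(0, 1)] z = 0"
   and i: "lint (%z. indicator ?R z * f z * D [(0, 1)] z)" "lint (%z. indicator ?R z * g z * D [] z)"
  have "(LINT x|lborel. indicator ?R (t, x) * f (t, x) * D [(0, 1)] (t, x)) = - (LINT x|lborel. indicator ?R (t, x) * g (t, x) * D [] (t, x))" for t
  proof (cases "t \<in> {0<..<T}")
   case True
   have "(t, 0) ~: K" "(t, 1) ~: K" using K(1) by auto
   then have "(LINT x|lborel. indicator {0..1} x * (f (t, x) * D [(0, 1)] (t, x))) = - (LINT x|lborel. indicator {0..1} x * (g (t, x) * D [] (t, x)))"
    by (intro ac_deriv_parts_zero[OF ac[OF True] _ smooth_partials_DERIV(2,4)[OF D]] K(2)) auto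
   then show ?thesis using True by (simp add: ind mult.assoc)
  next
   case False
   then have "(t, x) ~: K" for x using K(1) by auto
   then show ?thesis by (simp add: K(2,3))
  qed
  then show "(LINT z|lborel. indicator ?R z * f z * D [(0, 1)] z) = - (LINT z|lborel. indicator ?R z * g z * D [] z)"
   unfolding fst[OF i(1)] fst[OF i(2)] by simp
 qed (simp add: Basis_prod_def)
qed

text \<open>Tonelli with \<open>\<bar>y\<bar> <= 1 + y^2\<close>, which bounds the integral over
  each slice by one plus the squared norm.\<close>

lemma L2_curve_integrable:
 assumes g: "L2_curve g"
 shows "(%(t, x). g t x) \<in> BM" "lint (%z. indicator ({0..T} \<times> {0..1}) z * (%(t, x). g t x) z)"
proof -
 let ?f = "%z. indicator ({0..T} \<times> {0..1}) z * (%(t, x). g t x) z"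
 show gm[measurable]: "(%(t, x). g t x) \<in> BM" using g by (simp add: L2_curve_def case_prod_unfold)
 have R: "{0..T} \<times> {0..1::real} \<in> sets borel" by (intro borel_closed closed_Times) auto
 have "?f \<in> BM" using R by (intro borel_measurable_times borel_measurable_indicator gm)
 then have fm[measurable]: "?f \<in> borel_measurable (lborel \<Otimes>\<^sub>M lborel)" by (rule borel_measurable_pair)
 obtain C where C: "!!t. t \<in> {0..T} ==> Isq (g t) <= C" using g unfolding L2_curve_def by meson
 have sq: "lint (%x. indicator {0..1} x * (g t x)^2)" for t using g by (auto simp: L2_curve_def)
 have gi: "lint (%x. indicator {0..1} x * g t x)" for t
  by (rule integrable_of_square_integrable[OF L2_curve_borel[OF g] sq])
 have f: "?f (t, x) = indicator {0..T} t * (indicator {0..1} x * g t x)" for t x by (simp add: indicator_times mult.assoc)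
 have "integrable (lborel \<Otimes>\<^sub>M lborel) ?f"
 proof (rule lborel_pair.Fubini_integrable[OF fm])
  show "AE t in lborel. lint (%x. ?f (t, x))" unfolding f using gi by simp
  show "lint (%t. LINT x|lborel. norm (?f (t, x)))"
  proof (rule Bochner_Integration.integrable_bound[where f="%t. indicator {0..T} t * (1 + C)"])
   show "(%t. LINT x|lborel. norm (?f (t, x))) \<in> borel_measurable lborel" by measurable
   show "AE t in lborel. norm (LINT x|lborel. norm (?f (t, x))) <= norm (indicator {0..T} t * (1 + C))"
   proof (intro AE_I2)
    fix t :: real
    show "norm (LINT x|lborel. norm (?f (t, x))) <= norm (indicator {0..T} t * (1 + C))"
    proof (cases "t \<in> {0..T}")
     case True
     have "(LINT x|lborel. norm (?f (t, x))) <= (LINT x|lborel. indicator {0..1} x + indicator {0..1} x * (g t x)^2)"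
     proof (rule integral_mono)
      show "lint (%x. norm (?f (t, x)))" unfolding f using gi[of t] by simp
      have "\<bar>y\<bar> <= 1 + y^2" for y :: real
       using zero_le_power2[of "\<bar>y\<bar> - 1"] by (auto simp: power2_eq_square algebra_simps abs_if)
      then show "norm (?f (t, x)) <= indicator {0..1} x + indicator {0..1} x * (g t x)^2" for x
       using True unfolding f by (auto simp: indicator_def)
     qed (use sq in auto)
     also have "... = 1 + Isq (g t)" using sq by simp
     also have "... <= 1 + C" using C[OF True] by simp
     finally show ?thesis using True by (simp add: abs_of_nonneg integral_nonneg_AE)
    next
     case False
     then show ?thesis unfolding f by simp
    qed
   qed
  qed auto
 qed
 then show "lint ?f" by (simp add: lborel_prod)
qed

text \<open>A curve continuous with respect to \<open>N\<close> is strongly measurable: it is the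
  limit of its values on the grid of mesh \<open>1 / Suc n\<close>, where rounding down keeps the
  grid point in \<open>[0, T]\<close>.\<close>

lemma Linf_BochnerI:
 assumes T: "T > 0" and X: "!!t. t \<in> {0..T} ==> u t \<in> X" and C: "!!t. t \<in> {0..T} ==> N (u t) <= C"
  and lim: "!!s t. (!!n. s n \<in> {0..T}) ==> t \<in> {0..T} ==> s \<longlonglongrightarrow> t ==> (%n. N (%x. u (s n) x - u t x)) \<longlonglongrightarrow> 0"
 shows "u \<in> Linf_Bochner {0<..<T} X N"
 unfolding Linf_Bochner_def mem_Collect_eq
proof (intro conjI exI)
 have ae: "AE t in lebesgue_on {0<..<T}. P t" if "!!t. t \<in> {0..T} ==> P t" for P
  using that by (subst AE_lebesgue_on_Ioo) auto
 show "AE t in lebesgue_on {0<..<T}. u t \<in> X" "AE t in lebesgue_on {0<..<T}. N (u t) <= C" using ae X C by auto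
 define r where "r n t = real_of_int \<lfloor>real (Suc n) * t\<rfloor> / real (Suc n)" for n and t :: real
 have le: "r n t <= t" "t - 1 / real (Suc n) <= r n t" for n t
 proof -
  have "real_of_int \<lfloor>real (Suc n) * t\<rfloor> <= real (Suc n) * t" "real (Suc n) * t - 1 <= real_of_int \<lfloor>real (Suc n) * t\<rfloor>" by linarith+
  from divide_right_mono[OF this(1), of "real (Suc n)"] divide_right_mono[OF this(2), of "real (Suc n)"]
  show "r n t <= t" "t - 1 / real (Suc n) <= r n t" unfolding r_def by (simp_all add: diff_divide_distrib)
 qed
 have r: "r n t \<in> {0..T}" if "t \<in> {0..T}" for n t
  using that le(1)[of n t] by (auto simp: r_def)
 show "ALL n. simple_function (lebesgue_on {0<..<T}) ((%n t. u (r n t)) n) & (\<forall>t\<in>{0<..<T}. (%n t. u (r n t)) n t \<in> X)"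
 proof (intro allI conjI ballI)
  fix n
  show "u (r n t) \<in> X" if "t \<in> {0<..<T}" for t using X[OF r[of t]] that by simp
  have "simple_function (lebesgue_on {0<..<T}) (r n)"
  proof (rule simple_function_borel_measurable)
   have [measurable]: "r n \<in> BM" unfolding r_def by measurable
   show "r n \<in> borel_measurable (lebesgue_on {0<..<T})" by (intro measurable_restrict_space1 measurable_completion) measurable
   have "r n ` {0<..<T} \<subseteq> (%k. real_of_int k / real (Suc n)) ` {0..\<lfloor>real (Suc n) * T\<rfloor>}"
    by (auto simp: r_def intro!: imageI floor_mono mult_left_mono)
   then show "finite (r n ` space (lebesgue_on {0<..<T}))" by (simp add: space_restrict_space finite_subset)
  qed
  then show "simple_function (lebesgue_on {0<..<T}) (%t. u (r n t))" by (rule simple_function_compose1)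
 qed
 show "AE t in lebesgue_on {0<..<T}. (%n. N (%x. (%n t. u (r n t)) n t x - u t x)) \<longlonglongrightarrow> 0"
 proof (rule ae)
  fix t assume t: "t \<in> {0..T}"
  have "(%n. r n t) \<longlonglongrightarrow> t"
  proof (rule tendsto_sandwich[OF _ _ _ tendsto_const])
   show "(%n. t - 1 / real (Suc n)) \<longlonglongrightarrow> t"
    using tendsto_diff[OF tendsto_const LIMSEQ_inverse_real_of_nat, of t] by (simp add: inverse_eq_divide)
  qed (use le in auto)
  then show "(%n. N (%x. (%n t. u (r n t)) n t x - u t x)) \<longlonglongrightarrow> 0" by (intro lim r t)
 qed
qed

lemma tendsto_zero_of_square:
 fixes f :: "nat => real"
 assumes "(%n. (f n)^2) \<longlonglongrightarrow> 0"
 shows "f \<longlonglongrightarrow> 0"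
proof -
 have "(%n. sqrt ((f n)^2)) \<longlonglongrightarrow> sqrt 0" by (intro tendsto_intros assms)
 then show ?thesis by (simp add: tendsto_rabs_zero_iff)
qed

lemma le_of_square_le:
 fixes y :: real
 assumes "y^2 <= K"
 shows "y <= sqrt K"
 using assms real_le_rsqrt by blast

text \<open>The second derivatives enter as \<open>L2_curve\<close>, which supplies the Bochner
  spaces, and through absolute continuity on slices, which supplies the weak derivatives. The mixed
  derivative \<open>utx\<close> serves to place \<open>ut t\<close> in H^1.\<close>

lemma classical_is_solution:
 fixes u ut ux utt uxx utx :: "real => real => real"
 assumes T: "T > 0"
  and c: "cont (%(t, x). u t x)" "cont (%(t, x). ut t x)" "cont (%(t, x). ux t x)"
  and D: "!!t x. ((%t. u t x) has_real_derivative ut t x) (at t)" "!!t x. (u t has_real_derivative ux t x) (at x)"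
  and L: "L2_curve utt" "L2_curve uxx" "L2_curve utx"
  and tt: "!!x. x \<in> {0..1} ==> ac_deriv 0 T (%t. ut t x) (%t. utt t x)"
  and xx: "!!t. t \<in> {0..T} ==> ac_deriv 0 1 (ux t) (uxx t)" and tx: "!!t. t \<in> {0..T} ==> ac_deriv 0 1 (ut t) (utx t)"
  and pde: "!!t x. t \<in> {0..T} ==> x \<in> {0..1} ==> utt t x - uxx t x + u t x + lam * ut t x = \<bar>u t x\<bar> powr (p - 2) * u t x"
  and bc0: "!!t. t \<in> {0..T} ==> ux t 0 = - (\<bar>u t 0\<bar> powr (\<alpha> - 2) * u t 0) + lam0 * ut t 0 + H1 t * u t 1 + tlam1 * ut t 1"
  and bc1: "!!t. t \<in> {0..T} ==> - ux t 1 = - (\<bar>u t 1\<bar> powr (\<beta> - 2) * u t 1) + lam1 * ut t 1 + H0 t * u t 0 + tlam0 * ut t 0"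
  and h: "AE t in lebesgue_on {0<..<T}. h0 t = H0 t" "AE t in lebesgue_on {0<..<T}. h1 t = H1 t"
  and init: "AE x in lebesgue_on \<Omega>. u 0 x = u0 x" "AE x in lebesgue_on \<Omega>. ut 0 x = u1 x"
 shows "is_solution p \<alpha> \<beta> lam lam0 lam1 tlam0 tlam1 h0 h1 u0 u1 T u"
proof -
 have cx: "cont (u t)" "cont (ut t)" "cont (ux t)" for t
  by (intro continuous_on_pair[OF c(1)] continuous_on_pair[OF c(2)] continuous_on_pair[OF c(3)] continuous_intros)+
 have ct: "cont (%t. ut t x)" for x by (intro continuous_on_pair[OF c(2)] continuous_intros)
 note Lc = L2_curve_continuous[OF c(1)] L2_curve_continuous[OF c(2)] L2_curve_continuous[OF c(3)]
 have x_ac: "ac_deriv 0 1 (u t) (ux t)" for t by (rule ac_deriv_DERIV_all[OF D(2) cx(3)])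
 have t_ac: "ac_deriv 0 T (%t. u t x) (%t. ut t x)" for x by (rule ac_deriv_DERIV_all[OF D(1) ct])
 have cv: "cont_value \<Omega> (u t) x = u t x" "cont_value \<Omega> (ut t) x = ut t x" "cont_value \<Omega> (weak_deriv \<Omega> 1 (u t)) x = ux t x" if "x \<in> {0..1}" for t x
 proof -
  have "has_weak_deriv \<Omega> (replicate 1 1) (u t) (ux t)" using has_weak_deriv_of_ac[OF x_ac] by simp
  from weak_deriv_AE_eq[OF this]
  show "cont_value \<Omega> (weak_deriv \<Omega> 1 (u t)) x = ux t x"
   by (intro cont_value_eq[OF _ continuous_on_subset[OF cx(3)]] that) auto
  show "cont_value \<Omega> (u t) x = u t x" "cont_value \<Omega> (ut t) x = ut t x"
   by (intro cont_value_eq[OF _ continuous_on_subset[OF cx(1)]] cont_value_eq[OF _ continuous_on_subset[OF cx(2)]] that; simp)+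
 qed
 let ?S = "{0<..<T} \<times> \<Omega>"
 have w1: "has_weak_deriv ?S [(1, 0)] (%(t, x). u t x) (%(t, x). ut t x)"
  by (rule has_weak_deriv_slices(1)[OF T L2_curve_integrable[OF Lc(1)] L2_curve_integrable[OF Lc(2)]]) (use t_ac in simp)
 have w2: "has_weak_deriv ?S [(1, 0)] (%(t, x). ut t x) (%(t, x). utt t x)"
  by (rule has_weak_deriv_slices(1)[OF T L2_curve_integrable[OF Lc(2)] L2_curve_integrable[OF L(1)]]) (use tt in simp)
 have w3: "has_weak_deriv ?S [(0, 1)] (%(t, x). u t x) (%(t, x). ux t x)"
  by (rule has_weak_deriv_slices(2)[OF T L2_curve_integrable[OF Lc(1)] L2_curve_integrable[OF Lc(3)]]) (use x_ac in simp)
 have w4: "has_weak_deriv ?S [(0, 1)] (%(t, x). ux t x) (%(t, x). uxx t x)"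
  by (rule has_weak_deriv_slices(2)[OF T L2_curve_integrable[OF Lc(3)] L2_curve_integrable[OF L(2)]]) (use xx in simp)
 have B: "(1, 0) \<in> (Basis :: (real \<times> real) set)" "(0, 1) \<in> (Basis :: (real \<times> real) set)" by (auto simp: Basis_prod_def)
 note m = L2_curve_borel[OF L(1)] L2_curve_borel[OF Lc(1)] L2_curve_borel[OF Lc(2)]
 have m'[measurable]: "u t \<in> BM" "ut t \<in> BM" "utt t \<in> BM" for t
  using m by auto
 have lim: "(%n. Isq (%x. g (s n) x - g t x)) \<longlonglongrightarrow> 0" if "L2_curve g" "s \<longlonglongrightarrow> t" for g s t
  using that by (auto simp: L2_curve_def)
 have n0: "(L2_norm \<Omega> (%x. g s x - g t x))^2 = Isq (%x. g s x - g t x)" "(L2_norm \<Omega> (g t))^2 = Isq (g t)" if "L2_curve g" for g s t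
  using L2_curve_borel[OF that] by (intro L2_norm_sq; simp)+
 have l0: "(%n. L2_norm \<Omega> (%x. g (s n) x - g t x)) \<longlonglongrightarrow> 0" if "L2_curve g" "s \<longlonglongrightarrow> t" for g s t
  by (rule tendsto_zero_of_square) (simp add: n0[OF that(1)] lim[OF that])
 have l1: "(%n. Sobolev_norm 1 \<Omega> (%x. ut (s n) x - ut t x)) \<longlonglongrightarrow> 0"
  if st: "!!n. s n \<in> {0..T}" "t \<in> {0..T}" "s \<longlonglongrightarrow> t" for s t
 proof (rule tendsto_zero_of_square)
  have "(Sobolev_norm 1 \<Omega> (%x. ut (s n) x - ut t x))^2 = Isq (%x. ut (s n) x - ut t x) + Isq (%x. utx (s n) x - utx t x)" for n
   by (rule Sobolev_norm_1_sq[OF zero_less_one ac_deriv_diff_fun[OF tx[OF st(1)] tx[OF st(2)]]]) simp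
  then show "(%n. (Sobolev_norm 1 \<Omega> (%x. ut (s n) x - ut t x))^2) \<longlonglongrightarrow> 0"
   using tendsto_add[OF lim[OF Lc(2) st(3)] lim[OF L(3) st(3)]] by simp
 qed
 have l2: "(%n. Sobolev_norm 2 \<Omega> (%x. u (s n) x - u t x)) \<longlonglongrightarrow> 0"
  if st: "!!n. s n \<in> {0..T}" "t \<in> {0..T}" "s \<longlonglongrightarrow> t" for s t
 proof (rule tendsto_zero_of_square)
  have "(Sobolev_norm 2 \<Omega> (%x. u (s n) x - u t x))^2 = Isq (%x. u (s n) x - u t x) + Isq (%x. ux (s n) x - ux t x) + Isq (%x. uxx (s n) x - uxx t x)" for n
   by (rule Sobolev_norm_2_sq[OF zero_less_one ac_deriv_diff_fun[OF x_ac x_ac] ac_deriv_diff_fun[OF xx[OF st(1)] xx[OF st(2)]]]) simp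
  then show "(%n. (Sobolev_norm 2 \<Omega> (%x. u (s n) x - u t x))^2) \<longlonglongrightarrow> 0"
   using tendsto_add[OF tendsto_add[OF lim[OF Lc(1) st(3)] lim[OF Lc(3) st(3)]] lim[OF L(2) st(3)]] by simp
 qed
 have bd: "EX C. \<forall>t\<in>{0..T}. Isq (g t) <= C" if "L2_curve g" for g using that by (auto simp: L2_curve_def)
 obtain C0 where C0: "!!t. t \<in> {0..T} ==> Isq (u t) <= C0" using bd[OF Lc(1)] by blast
 obtain C1 where C1: "!!t. t \<in> {0..T} ==> Isq (ux t) <= C1" using bd[OF Lc(3)] by blast
 obtain C2 where C2: "!!t. t \<in> {0..T} ==> Isq (uxx t) <= C2" using bd[OF L(2)] by blast
 obtain C3 where C3: "!!t. t \<in> {0..T} ==> Isq (ut t) <= C3" using bd[OF Lc(2)] by blast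
 obtain C4 where C4: "!!t. t \<in> {0..T} ==> Isq (utx t) <= C4" using bd[OF L(3)] by blast
 obtain C5 where C5: "!!t. t \<in> {0..T} ==> Isq (utt t) <= C5" using bd[OF L(1)] by blast
 note C = C0 C1 C2 C3 C4 C5
 have B2: "u \<in> Linf_Bochner {0<..<T} (Sobolev 2 \<Omega>) (Sobolev_norm 2 \<Omega>)"
 proof (rule Linf_BochnerI[OF T])
  fix t assume t: "t \<in> {0..T}"
  show "u t \<in> Sobolev 2 \<Omega>" by (rule Sobolev2I[OF zero_less_one x_ac xx[OF t]])
  have "(Sobolev_norm 2 \<Omega> (u t))^2 <= C0 + C1 + C2"
   using Sobolev_norm_2_sq[OF zero_less_one x_ac xx[OF t], of "u t"] C(1,2,3)[OF t] by simp
  then show "Sobolev_norm 2 \<Omega> (u t) <= sqrt (C0 + C1 + C2)" by (rule le_of_square_le)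
 qed (rule l2)
 have B1: "ut \<in> Linf_Bochner {0<..<T} (Sobolev 1 \<Omega>) (Sobolev_norm 1 \<Omega>)"
 proof (rule Linf_BochnerI[OF T])
  fix t assume t: "t \<in> {0..T}"
  show "ut t \<in> Sobolev 1 \<Omega>" by (rule Sobolev1I[OF zero_less_one tx[OF t]])
  have "(Sobolev_norm 1 \<Omega> (ut t))^2 <= C3 + C4"
   using Sobolev_norm_1_sq[OF zero_less_one tx[OF t], of "ut t"] C(4,5)[OF t] by simp
  then show "Sobolev_norm 1 \<Omega> (ut t) <= sqrt (C3 + C4)" by (rule le_of_square_le)
 qed (rule l1)
 have B0: "utt \<in> Linf_Bochner {0<..<T} (L2 \<Omega>) (L2_norm \<Omega>)"
 proof (rule Linf_BochnerI[OF T])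
  fix t assume t: "t \<in> {0..T}"
  show "utt t \<in> L2 \<Omega>" by (rule L2I[of "utt t"]) (use L(1) in \<open>auto simp: L2_curve_def\<close>)
  have "(L2_norm \<Omega> (utt t))^2 <= C5" using n0(2)[OF L(1)] C(6)[OF t] by simp
  then show "L2_norm \<Omega> (utt t) <= sqrt C5" by (rule le_of_square_le)
 qed (rule l0[OF L(1)])
 \<comment> \<open>The curve itself is the representative continuous in L^2.\<close>
 have iv: "has_initial_value T g w" if g: "L2_curve g" and w: "AE x in lebesgue_on \<Omega>. g 0 x = w x" for g w
  unfolding has_initial_value_def
 proof (intro exI[of _ g] conjI ballI)
  fix t
  show "g t \<in> L2 \<Omega>" by (rule L2I[of "g t"]) (use g L2_curve_borel[OF g] in \<open>auto simp: L2_curve_def\<close>)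
  show "((%s. L2_norm \<Omega> (%x. g s x - g t x)) \<longlongrightarrow> 0) (at t within {0..T})"
   unfolding tendsto_at_iff_sequentially comp_def using l0[OF g] by blast
 qed (use w in auto)
 have tr: "(%t. cont_value \<Omega> (u t) x) \<in> Sobolev 2 {0<..<T}" if "x \<in> {0..1}" for x
  unfolding cv(1)[OF that] by (rule Sobolev2I[OF T t_ac tt[OF that]])
 have S: "?S \<in> sets borel" by (intro borel_open open_Times) auto
 note ioo = AE_lebesgue_on_Ioo
 have hh: "AE t in lborel. t \<in> {0<..<T} --> h0 t = H0 t" "AE t in lborel. t \<in> {0<..<T} --> h1 t = H1 t"
  using h unfolding ioo by auto
 have a1: "AE (t, x) in lebesgue_on ?S. utt t x - uxx t x + u t x + lam * ut t x = \<bar>u t x\<bar> powr (p - 2) * u t x"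
  unfolding AE_lebesgue_on[OF S] by (intro AE_I2) (auto intro!: pde)
 have a2: "AE t in lebesgue_on {0<..<T}. ux t 0 = - (\<bar>u t 0\<bar> powr (\<alpha> - 2) * u t 0) + lam0 * ut t 0 + h1 t * u t 1 + tlam1 * ut t 1"
  unfolding ioo using hh(2) by eventually_elim (auto simp: bc0)
 have a3: "AE t in lebesgue_on {0<..<T}. - ux t 1 = - (\<bar>u t 1\<bar> powr (\<beta> - 2) * u t 1) + lam1 * ut t 1 + h0 t * u t 0 + tlam0 * ut t 0"
  unfolding ioo using hh(1) by eventually_elim (auto simp: bc1)
 have z: "(0::real) \<in> {0..1}" "(1::real) \<in> {0..1}" by auto
 show ?thesis
  unfolding is_solution_def
  by (rule exI[of _ ut], rule exI[of _ utt], rule exI[of _ uxx], unfold cv[OF z(1)] cv[OF z(2)],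
    intro conjI w1 has_weak_deriv_twice[OF w1 w2 B(1)] has_weak_deriv_twice[OF w3 w4 B(2)]
    B0 B1 B2 tr[OF z(1), unfolded cv[OF z(1)]] tr[OF z(2), unfolded cv[OF z(2)]] a1 a2 a3 iv Lc init)
qed

section \<open>Existence\<close>

lemma abs_exp_powr_mult: "\<bar>exp s * y\<bar> powr c * (exp s * y) = exp s * (exp (c * s) * (\<bar>y\<bar> powr c * y))" for s y c :: real
proof -
 have "exp s powr c = exp (c * s)" by (simp add: powr_def)
 then show ?thesis by (simp add: abs_mult powr_mult mult_ac)
qed

text \<open>The power nonlinearity after the substitution: \<open>exp (\<kappa> * t)\<close> times
  the nonlinearity at \<open>exp (- \<kappa> * t) * y\<close>, where homogeneity leaves the exponent
  \<open>- \<kappa> * c * t\<close>.\<close>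

definition damped_power :: "real => real => real => real => real" where
 "damped_power \<kappa> c t y = exp (- (\<kappa> * c * t)) * (\<bar>y\<bar> powr c * y)"

lemma damped_power_cont:
 assumes c: "c > 0" and "continuous_on A f" "continuous_on A g"
 shows "continuous_on A (%x. damped_power \<kappa> c (f x) (g x))"
 unfolding damped_power_def
 by (intro continuous_intros assms continuous_on_compose2[OF continuous_powr_mult[OF c, of UNIV]]) auto

lemma damped_power_lip:
 assumes c: "c > 0" and \<kappa>: "\<kappa> >= 0"
 obtains L where "L >= 0" "!!t x y. t \<in> {0..1} ==> \<bar>x\<bar> <= R ==> \<bar>y\<bar> <= R ==> \<bar>damped_power \<kappa> c t x - damped_power \<kappa> c t y\<bar> <= L * \<bar>x - y\<bar>"
proof -
 obtain L where L: "L >= 0" "!!x y. \<bar>x\<bar> <= R ==> \<bar>y\<bar> <= R ==> \<bar>\<bar>x\<bar> powr c * x - \<bar>y\<bar> powr c * y\<bar> <= L * \<bar>x - y\<bar>"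
  using locally_lipschitz_abs_powr_mult[OF c] unfolding locally_lipschitz_def by blast
 have "\<bar>damped_power \<kappa> c t x - damped_power \<kappa> c t y\<bar> <= L * \<bar>x - y\<bar>" if t: "t \<in> {0..1}" and xy: "\<bar>x\<bar> <= R" "\<bar>y\<bar> <= R" for t x y
 proof -
  have "\<bar>damped_power \<kappa> c t x - damped_power \<kappa> c t y\<bar> = exp (- (\<kappa> * c * t)) * \<bar>\<bar>x\<bar> powr c * x - \<bar>y\<bar> powr c * y\<bar>"
   by (simp add: damped_power_def abs_mult flip: right_diff_distrib)
  also have "... <= 1 * \<bar>\<bar>x\<bar> powr c * x - \<bar>y\<bar> powr c * y\<bar>"
   by (rule mult_right_mono) (use t c \<kappa> in auto)
  also have "... <= L * \<bar>x - y\<bar>" using L(2)[OF xy] by simp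
  finally show ?thesis .
 qed
 with L(1) show ?thesis by (rule that)
qed

text \<open>The part of a boundary condition without velocities, after the substitution. Since
  \<open>u_t = exp (- \<kappa> * t) * (v_t - \<kappa> * v)\<close>, the velocity coefficients
  \<open>l\<close> and \<open>m\<close> leave the additional terms \<open>- l * \<kappa> * y\<close>
  and \<open>- m * \<kappa> * z\<close>; \<open>y\<close> is the value at the end concerned and
  \<open>z\<close> that at the opposite end.\<close>

definition boundary_source :: "real => real => real => (real => real) => real => real => real => real => real" where
 "boundary_source \<kappa> c l H m t y z = - damped_power \<kappa> c t y - l * \<kappa> * y + (H t - m * \<kappa>) * z"

lemma boundary_source_cont:
 assumes "c > 0" "cont H" "continuous_on A f" "continuous_on A g" "continuous_on A h"
 shows "continuous_on A (%x. boundary_source \<kappa> c l H m (f x) (g x) (h x))"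
 unfolding boundary_source_def
 by (intro continuous_intros damped_power_cont continuous_on_compose2[OF assms(2)] assms) auto

lemma boundary_source_lip:
 assumes c: "c > 0" and \<kappa>: "\<kappa> >= 0" and H: "cont H"
 shows "EX L>=0. \<forall>t\<in>{0..1}. ALL y z y' z'. \<bar>y\<bar> <= R --> \<bar>z\<bar> <= R --> \<bar>y'\<bar> <= R --> \<bar>z'\<bar> <= R -->
  \<bar>boundary_source \<kappa> c l H m t y z - boundary_source \<kappa> c l H m t y' z'\<bar> <= L * (\<bar>y - y'\<bar> + \<bar>z - z'\<bar>)"
proof -
 obtain L where L: "L >= 0" "!!t x y. t \<in> {0..1} ==> \<bar>x\<bar> <= R ==> \<bar>y\<bar> <= R ==> \<bar>damped_power \<kappa> c t x - damped_power \<kappa> c t y\<bar> <= L * \<bar>x - y\<bar>"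
  using damped_power_lip[OF c \<kappa>] by blast
 have "continuous_on {0..1} (%t. H t - m * \<kappa>)" by (intro continuous_intros continuous_on_subset[OF H]) auto
 from continuous_on_Icc_bounded[OF this] obtain M where M: "!!t. t \<in> {0..1} ==> \<bar>H t - m * \<kappa>\<bar> <= M" by blast
 have M0: "M >= 0" using M[of 0] by simp
 have "\<bar>boundary_source \<kappa> c l H m t y z - boundary_source \<kappa> c l H m t y' z'\<bar> <= (L + \<bar>l * \<kappa>\<bar> + M) * (\<bar>y - y'\<bar> + \<bar>z - z'\<bar>)"
  if t: "t \<in> {0..1}" and y: "\<bar>y\<bar> <= R" "\<bar>y'\<bar> <= R" for t y z y' z'
 proof -
  have "boundary_source \<kappa> c l H m t y z - boundary_source \<kappa> c l H m t y' z' =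
    - (damped_power \<kappa> c t y - damped_power \<kappa> c t y') - l * \<kappa> * (y - y') + (H t - m * \<kappa>) * (z - z')"
   by (simp add: boundary_source_def algebra_simps)
  also have "\<bar>...\<bar> <= \<bar>damped_power \<kappa> c t y - damped_power \<kappa> c t y'\<bar> + \<bar>l * \<kappa> * (y - y')\<bar> + \<bar>(H t - m * \<kappa>) * (z - z')\<bar>" by linarith
  also have "... <= L * \<bar>y - y'\<bar> + \<bar>l * \<kappa>\<bar> * \<bar>y - y'\<bar> + M * \<bar>z - z'\<bar>"
   using L(2)[OF t y] mult_right_mono[OF M[OF t], of "\<bar>z - z'\<bar>"] by (simp add: abs_mult)
  also have "... <= (L + \<bar>l * \<kappa>\<bar> + M) * (\<bar>y - y'\<bar> + \<bar>z - z'\<bar>)"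
   using L(1) M0 by (simp add: algebra_simps)
  finally show ?thesis .
 qed
 then show ?thesis using L(1) M0 by (intro exI[of _ "L + \<bar>l * \<kappa>\<bar> + M"]) auto
qed

text \<open>The exponential and the power along \<open>f\<close> are continuously differentiable in
  time, the latter by \<open>c > 0\<close>; \<open>H\<close> limits the regularity to absolute
  continuity.\<close>

lemma boundary_source_ac:
 assumes c: "c > 0" and H: "abs_cont 0 T H"
  and f: "!!t. (f has_real_derivative f' t) (at t)" "cont f'" and g: "!!t. (g has_real_derivative g' t) (at t)" "cont g'"
 shows "abs_cont 0 T (%t. boundary_source \<kappa> c l H m t (f t) (g t))"
proof -
 have fc: "cont f" using DERIV_isCont[OF f(1)] by (simp add: continuous_at_imp_continuous_on)
 define E where "E t = exp (- (\<kappa> * c * t))" for t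
 have E: "(E has_real_derivative - (\<kappa> * c) * E t) (at t)" for t unfolding E_def by (auto intro!: derivative_eq_intros)
 have Ec: "cont (%t. - (\<kappa> * c) * E t)" unfolding E_def by (intro continuous_intros)
 have p: "((%t. \<bar>f t\<bar> powr c * f t) has_real_derivative (c + 1) * \<bar>f t\<bar> powr c * f' t) (at t)" for t
  by (rule DERIV_chain2[OF DERIV_abs_powr_mult[OF c] f(1)])
 have pc: "cont (%t. (c + 1) * \<bar>f t\<bar> powr c * f' t)"
  by (intro continuous_on_mult continuous_on_powr' continuous_intros fc f(2)) (use c in auto)
 have "abs_cont 0 T (%t. damped_power \<kappa> c t (f t))"
  using ac_deriv_mult[OF ac_deriv_DERIV_all[OF E Ec] ac_deriv_DERIV_all[OF p pc]]
  unfolding damped_power_def E_def[symmetric] by blast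
 moreover have fa: "abs_cont 0 T f" using ac_deriv_DERIV_all[OF f] by blast
 moreover obtain k where "ac_deriv 0 T (%t. H t - m * \<kappa>) k" using abs_cont_intros(2)[OF H abs_cont_intros(5)] by blast
 then have "abs_cont 0 T (%t. (H t - m * \<kappa>) * g t)" using ac_deriv_mult[OF _ ac_deriv_DERIV_all[OF g]] by blast
 ultimately have "abs_cont 0 T (%t. ((0 - damped_power \<kappa> c t (f t)) - (l * \<kappa>) * f t) + (H t - m * \<kappa>) * g t)"
  by (intro abs_cont_intros)
 then show ?thesis by (simp add: boundary_source_def)
qed

text \<open>In the coefficient \<open>\<kappa>^2 - 1\<close>, the \<open>-1\<close> comes from the
  zero-order term of the equation, while \<open>u_tt\<close> and the damping leave
  \<open>\<kappa>^2 - 2 * \<kappa>^2\<close> on the left-hand side. In the second boundary term the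
  arguments are exchanged, because \<open>N1\<close> receives the value at 0 first.\<close>

lemma wave_data_damped:
 assumes p: "p > 2" "\<alpha> > 2" "\<beta> > 2" and \<kappa>: "\<kappa> >= 0" and H: "cont H0" "cont H1"
  and A: "cont A0" "cont B0"
  and lam: "lam0 > 0" "lam1 > 0" "\<bar>tlam0 + tlam1\<bar> < 2 * sqrt (lam0 * lam1)"
 shows "wave_data (%t y. (\<kappa>^2 - 1) * y + damped_power \<kappa> (p - 2) t y) (%t y. (\<kappa>^2 - 1) + exp (- (\<kappa> * (p - 2) * t)) * ((p - 2 + 1) * \<bar>y\<bar> powr (p - 2)))
   (boundary_source \<kappa> (\<alpha> - 2) lam0 H1 tlam1) (%t y z. boundary_source \<kappa> (\<beta> - 2) lam1 H0 tlam0 t z y) A0 B0 lam0 lam1 tlam0 tlam1"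
proof
 have c: "p - 2 > 0" "\<alpha> - 2 > 0" "\<beta> - 2 > 0" using p by auto
 show "cont (%(t, y). (\<kappa>^2 - 1) * y + damped_power \<kappa> (p - 2) t y)"
  unfolding case_prod_unfold by (intro continuous_on_add continuous_on_mult continuous_on_const damped_power_cont[OF c(1)] continuous_on_fst continuous_on_snd continuous_on_id)
 show "cont (%(t, y). (\<kappa>^2 - 1) + exp (- (\<kappa> * (p - 2) * t)) * ((p - 2 + 1) * \<bar>y\<bar> powr (p - 2)))"
  unfolding case_prod_unfold by (intro continuous_intros continuous_on_powr') (use c in auto)
 show "((%y. (\<kappa>^2 - 1) * y + damped_power \<kappa> (p - 2) t y) has_real_derivative (\<kappa>^2 - 1) + exp (- (\<kappa> * (p - 2) * t)) * ((p - 2 + 1) * \<bar>y\<bar> powr (p - 2))) (at y)" for t y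
  unfolding damped_power_def
  by (rule DERIV_add[OF DERIV_cmult_Id DERIV_cmult[OF DERIV_abs_powr_mult[OF c(1)]]])
 show "EX L>=0. \<forall>t\<in>{0..1}. ALL x y. \<bar>x\<bar> <= R --> \<bar>y\<bar> <= R -->
   \<bar>((\<kappa>^2 - 1) * x + damped_power \<kappa> (p - 2) t x) - ((\<kappa>^2 - 1) * y + damped_power \<kappa> (p - 2) t y)\<bar> <= L * \<bar>x - y\<bar>" for R
 proof -
  obtain L where L: "L >= 0" "!!t x y. t \<in> {0..1} ==> \<bar>x\<bar> <= R ==> \<bar>y\<bar> <= R ==> \<bar>damped_power \<kappa> (p - 2) t x - damped_power \<kappa> (p - 2) t y\<bar> <= L * \<bar>x - y\<bar>"
   using damped_power_lip[OF c(1) \<kappa>] by blast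
  have "\<bar>((\<kappa>^2 - 1) * x + damped_power \<kappa> (p - 2) t x) - ((\<kappa>^2 - 1) * y + damped_power \<kappa> (p - 2) t y)\<bar> <= (\<bar>\<kappa>^2 - 1\<bar> + L) * \<bar>x - y\<bar>"
   if "t \<in> {0..1}" "\<bar>x\<bar> <= R" "\<bar>y\<bar> <= R" for t x y
  proof -
   have "\<bar>(\<kappa>^2 - 1) * (x - y)\<bar> = \<bar>\<kappa>^2 - 1\<bar> * \<bar>x - y\<bar>" by (rule abs_mult)
   then show ?thesis using L(2)[OF that] unfolding distrib_right right_diff_distrib by linarith
  qed
  then show ?thesis using L(1) by (intro exI[of _ "\<bar>\<kappa>^2 - 1\<bar> + L"]) auto
 qed
 show "cont (%(t, y, z). boundary_source \<kappa> (\<alpha> - 2) lam0 H1 tlam1 t y z)"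
  "cont (%(t, y, z). boundary_source \<kappa> (\<beta> - 2) lam1 H0 tlam0 t z y)"
  unfolding case_prod_unfold by (intro boundary_source_cont c H continuous_intros)+
 show "EX L>=0. \<forall>t\<in>{0..1}. ALL y z y' z'. \<bar>y\<bar> <= R --> \<bar>z\<bar> <= R --> \<bar>y'\<bar> <= R --> \<bar>z'\<bar> <= R -->
  \<bar>boundary_source \<kappa> (\<alpha> - 2) lam0 H1 tlam1 t y z - boundary_source \<kappa> (\<alpha> - 2) lam0 H1 tlam1 t y' z'\<bar> <= L * (\<bar>y - y'\<bar> + \<bar>z - z'\<bar>)" for R
  by (rule boundary_source_lip[OF c(2) \<kappa> H(2)])
 show "EX L>=0. \<forall>t\<in>{0..1}. ALL y z y' z'. \<bar>y\<bar> <= R --> \<bar>z\<bar> <= R --> \<bar>y'\<bar> <= R --> \<bar>z'\<bar> <= R -->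
  \<bar>boundary_source \<kappa> (\<beta> - 2) lam1 H0 tlam0 t z y - boundary_source \<kappa> (\<beta> - 2) lam1 H0 tlam0 t z' y'\<bar> <= L * (\<bar>y - y'\<bar> + \<bar>z - z'\<bar>)" for R
 proof -
  obtain L where L: "L >= 0" "!!t y z y' z'. t \<in> {0..1} ==> \<bar>y\<bar> <= R ==> \<bar>z\<bar> <= R ==> \<bar>y'\<bar> <= R ==> \<bar>z'\<bar> <= R ==>
    \<bar>boundary_source \<kappa> (\<beta> - 2) lam1 H0 tlam0 t y z - boundary_source \<kappa> (\<beta> - 2) lam1 H0 tlam0 t y' z'\<bar> <= L * (\<bar>y - y'\<bar> + \<bar>z - z'\<bar>)"
   using boundary_source_lip[OF c(3) \<kappa> H(1), of R lam1 tlam0] by blast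
  show ?thesis
  proof (intro exI[of _ L] conjI ballI allI impI L(1))
   fix t y z y' z' assume "t \<in> {0..1::real}" "\<bar>y\<bar> <= R" "\<bar>z\<bar> <= R" "\<bar>y'\<bar> <= R" "\<bar>z'\<bar> <= R"
   with L(2)[of t z y z' y']
   show "\<bar>boundary_source \<kappa> (\<beta> - 2) lam1 H0 tlam0 t z y - boundary_source \<kappa> (\<beta> - 2) lam1 H0 tlam0 t z' y'\<bar> <= L * (\<bar>y - y'\<bar> + \<bar>z - z'\<bar>)"
    by (simp add: add.commute)
  qed
 qed
qed (use A boundary_det_pos[OF lam] in auto)

text \<open>
 With \<open>\<kappa> = lam / 2\<close> the substitution \<open>u = exp (- \<kappa> t) v\<close> removes the damping term \<open>lam u\<^sub>t\<close>.
\<close>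

lemma (in wave_ivp) damped_solution:
 assumes F: "F = (%t y. (\<kappa>^2 - 1) * y + damped_power \<kappa> (p - 2) t y)"
  and N0: "N0 = boundary_source \<kappa> (\<alpha> - 2) lam0 H1 tlam1" and N1: "N1 = (%t y z. boundary_source \<kappa> (\<beta> - 2) lam1 H0 tlam0 t z y)"
  and h: "AE t in lebesgue_on {0<..<T}. h0 t = H0 t" "AE t in lebesgue_on {0<..<T}. h1 t = H1 t"
  and u0: "AE x in lebesgue_on \<Omega>. u0 x = U0 x" and u1: "AE x in lebesgue_on \<Omega>. u1 x = W1 x - \<kappa> * U0 x"
 shows "is_solution p \<alpha> \<beta> (2 * \<kappa>) lam0 lam1 tlam0 tlam1 h0 h1 u0 u1 T (%t x. exp (- (\<kappa> * t)) * v t x)"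
proof -
 obtain A' B' where AB: "A' \<in> BM" "B' \<in> BM" "lint (%x. (A' x)^2)" "lint (%x. (B' x)^2)"
  and tt: "!!x. x \<in> {0..1} ==> ac_deriv 0 T (%t. vt t x) (%t. (A' (x + t) - B' (x - t)) / 2 + (F t (v t x) + (S 1 t x - S (-1) t x) / 2))"
  and xx: "!!t. t \<in> {0..T} ==> ac_deriv 0 1 (vx t) (%x. (A' (x + t) - B' (x - t)) / 2 + (S 1 t x - S (-1) t x) / 2)"
  and tx: "!!t. t \<in> {0..T} ==> ac_deriv 0 1 (vt t) (%x. (A' (x + t) + B' (x - t)) / 2 + (S 1 t x + S (-1) t x) / 2)"
  using regularity by blast
 define e where "e t = exp (- (\<kappa> * t))" for t
 have e: "(e has_real_derivative - \<kappa> * e t) (at t)" for t unfolding e_def by (auto intro!: derivative_eq_intros)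
 have ec: "cont e" unfolding e_def by (intro continuous_intros)
 have e0: "e t ~= 0" "e 0 = 1" for t by (auto simp: e_def)
 have ecp: "cont (%z. e (fst z))" by (intro continuous_on_compose2[OF ec] continuous_intros) auto
 note vc = v_cont[unfolded case_prod_unfold] and Sc = S_cont[unfolded case_prod_unfold] and Fc = Fv_cont(1)[unfolded case_prod_unfold]
 define ut where "ut t x = e t * (vt t x - \<kappa> * v t x)" for t x
 define ux where "ux t x = e t * vx t x" for t x
 define utt where "utt t x = e t * ((A' (x + t) - B' (x - t)) / 2 + (F t (v t x) + (S 1 t x - S (-1) t x) / 2) - 2 * \<kappa> * vt t x + \<kappa>^2 * v t x)" for t x
 define uxx where "uxx t x = e t * ((A' (x + t) - B' (x - t)) / 2 + (S 1 t x - S (-1) t x) / 2)" for t x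
 define utx where "utx t x = e t * ((A' (x + t) + B' (x - t)) / 2 + (S 1 t x + S (-1) t x) / 2 - \<kappa> * vx t x)" for t x
 have c: "cont (%(t, x). e t * v t x)" "cont (%(t, x). ut t x)" "cont (%(t, x). ux t x)"
  unfolding ut_def ux_def case_prod_unfold by (intro continuous_intros vc ecp)+
 have D: "((%t. e t * v t x) has_real_derivative ut t x) (at t)" "((%x. e t * v t x) has_real_derivative ux t x) (at x)" for t x
  unfolding ux_def ut_def
  by (rule DERIV_cong[OF DERIV_mult[OF e DERIV_v(1)]], simp add: algebra_simps) (rule DERIV_cmult[OF DERIV_v(2)])
 have La: "L2_curve (%t x. A' (x + t))" and Lb: "L2_curve (%t x. B' (x - t))"
  using L2_curve_translation[OF AB(1,3), of 1] L2_curve_translation[OF AB(2,4), of "-1"] by simp_all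
 \<comment> \<open>Common pattern of the three second derivatives: the translates with coefficients
   \<open>1 / 2\<close> and \<open>k\<close>, plus a continuous remainder.\<close>
 have L: "L2_curve (%t x. e t * ((1 / 2) * A' (x + t) + k * B' (x - t)) + 1 * q t x)" if "cont (%(t, x). q t x)" for k q
  by (intro L2_curve_combination La Lb ec continuous_on_const L2_curve_continuous that)
 have Lu: "L2_curve utt" "L2_curve uxx" "L2_curve utx"
 proof -
  have q: "cont (%(t, x). e t * (F t (v t x) + (S 1 t x - S (-1) t x) / 2 - 2 * \<kappa> * vt t x + \<kappa>^2 * v t x))"
   "cont (%(t, x). e t * ((S 1 t x - S (-1) t x) / 2))"
   "cont (%(t, x). e t * ((S 1 t x + S (-1) t x) / 2 - \<kappa> * vx t x))"
   unfolding case_prod_unfold by (intro continuous_intros vc ecp Sc Fc; simp)+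
  show "L2_curve utt" "L2_curve uxx" "L2_curve utx"
   by (rule back_subst[of L2_curve, OF L[OF q(1), of "-1/2"]] back_subst[of L2_curve, OF L[OF q(2), of "-1/2"]] back_subst[of L2_curve, OF L[OF q(3), of "1/2"]];
    auto simp: fun_eq_iff utt_def uxx_def utx_def field_simps; fail)+
 qed
 have va: "ac_deriv 0 T (%t. v t x) (%t. vt t x)" for x
  by (rule ac_deriv_DERIV_all[OF DERIV_v(1)]) (intro continuous_on_pair[OF v_cont(2)] continuous_intros)
 have vxa: "ac_deriv 0 1 (v t) (vx t)" for t
  by (rule ac_deriv_DERIV_all[OF DERIV_v(2)]) (intro continuous_on_pair[OF v_cont(3)] continuous_intros)
 have ea: "ac_deriv 0 T e (%t. - \<kappa> * e t)" by (rule ac_deriv_DERIV_all[OF e]) (intro continuous_intros ec)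
 have utt: "ac_deriv 0 T (%t. ut t x) (%t. utt t x)" if x: "x \<in> {0..1}" for x
  unfolding ut_def
 proof (rule ac_deriv_cong_deriv[OF ac_deriv_mult[OF ea ac_deriv_diff_fun[OF tt[OF x] ac_deriv_cmult[OF va]]]])
  have "(%z. utt (fst z) (snd z)) \<in> BM" using Lu(1) by (simp add: L2_curve_def)
  from measurable_compose[OF _ this, of "%t. (t, x)"]
  show "(%t. utt t x) \<in> BM" by (auto intro!: borel_measurable_continuous_onI continuous_intros)
 qed (auto simp: utt_def power2_eq_square algebra_simps)
 have uxx: "ac_deriv 0 1 (ux t) (uxx t)" if "t \<in> {0..T}" for t
  using ac_deriv_cmult[OF xx[OF that], of "e t"] unfolding ux_def[abs_def] uxx_def[abs_def] .
 have utx: "ac_deriv 0 1 (ut t) (utx t)" if "t \<in> {0..T}" for t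
  using ac_deriv_cmult[OF ac_deriv_diff_fun[OF tx[OF that] ac_deriv_cmult[OF vxa]], of "e t"] unfolding ut_def[abs_def] utx_def[abs_def] .
 have pw: "\<bar>e t * y\<bar> powr c * (e t * y) = e t * damped_power \<kappa> c t y" for t y c
  unfolding e_def damped_power_def abs_exp_powr_mult by (simp add: mult_ac)
 show ?thesis
  unfolding e_def[symmetric]
 proof (rule classical_is_solution[OF T(1) c D Lu utt uxx utx _ _ _ h])
  fix t x assume "t \<in> {0..T}" "x \<in> {0..1::real}"
  show "utt t x - uxx t x + e t * v t x + 2 * \<kappa> * ut t x = \<bar>e t * v t x\<bar> powr (p - 2) * (e t * v t x)"
   unfolding pw utt_def uxx_def ut_def F by (simp add: power2_eq_square algebra_simps)
 next
  fix t assume t: "t \<in> {0..T}"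
  have n: "N0 t y z = - damped_power \<kappa> (\<alpha> - 2) t y - lam0 * \<kappa> * y + (H1 t - tlam1 * \<kappa>) * z"
   "N1 t y z = - damped_power \<kappa> (\<beta> - 2) t z - lam1 * \<kappa> * z + (H0 t - tlam0 * \<kappa>) * y" for y z
   by (simp_all add: N0 N1 boundary_source_def)
  show "ux t 0 = - (\<bar>e t * v t 0\<bar> powr (\<alpha> - 2) * (e t * v t 0)) + lam0 * ut t 0 + H1 t * (e t * v t 1) + tlam1 * ut t 1"
   unfolding pw ux_def ut_def boundary(1)[OF t] n by (simp add: algebra_simps)
  have "- ux t 1 = e t * (- vx t 1)" by (simp add: ux_def)
  then show "- ux t 1 = - (\<bar>e t * v t 1\<bar> powr (\<beta> - 2) * (e t * v t 1)) + lam1 * ut t 1 + H0 t * (e t * v t 0) + tlam0 * ut t 0"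
   unfolding pw ut_def boundary(2)[OF t] n by (simp add: algebra_simps)
 next
  have i: "e 0 * v 0 x = U0 x" "ut 0 x = W1 x - \<kappa> * U0 x" if "x \<in> \<Omega>" for x
   using that by (auto simp: ut_def e0 v_0)
  note ioo = AE_lebesgue_on_Ioo
  show "AE x in lebesgue_on \<Omega>. e 0 * v 0 x = u0 x" using u0 unfolding ioo by eventually_elim (use i in auto)
  show "AE x in lebesgue_on \<Omega>. ut 0 x = u1 x" using u1 unfolding ioo by eventually_elim (use i in auto)
 qed
qed

theorem theorem2p3:
  fixes T p \<alpha> \<beta> lam lam0 lam1 tlam0 tlam1 :: real
    and h0 h1 u0 u1 :: "real \<Rightarrow> real"
  assumes "T > 0" and "p > 2" and "\<alpha> > 2" and "\<beta> > 2"
    and "lam > 0" and "lam0 > 0" and "lam1 > 0"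
    and "\<bar>tlam0 + tlam1\<bar> < 2 * sqrt (lam0 * lam1)"
    and "h0 \<in> Sobolev 1 {0<..<T}" and "h1 \<in> Sobolev 1 {0<..<T}"
    and "u0 \<in> Sobolev 2 \<Omega>" and "u1 \<in> Sobolev 1 \<Omega>"
    and "cont_value \<Omega> (weak_deriv \<Omega> 1 u0) 0 =
           - (\<bar>cont_value \<Omega> u0 0\<bar> powr (\<alpha> - 2) * cont_value \<Omega> u0 0)
           + lam0 * cont_value \<Omega> u1 0
           + cont_value {0<..<T} h1 0 * cont_value \<Omega> u0 1 + tlam1 * cont_value \<Omega> u1 1"
    and "- cont_value \<Omega> (weak_deriv \<Omega> 1 u0) 1 =
           - (\<bar>cont_value \<Omega> u0 1\<bar> powr (\<beta> - 2) * cont_value \<Omega> u0 1)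
           + lam1 * cont_value \<Omega> u1 1
           + cont_value {0<..<T} h0 0 * cont_value \<Omega> u0 0 + tlam0 * cont_value \<Omega> u1 0"
  shows "\<exists>T0. 0 < T0 \<and> T0 \<le> T \<and>
    (\<forall>Ts. 0 < Ts \<and> Ts \<le> T0 \<longrightarrow>
      (\<exists>u. is_solution p \<alpha> \<beta> lam lam0 lam1 tlam0 tlam1 h0 h1 u0 u1 Ts u \<and>
         (\<forall>v. is_solution p \<alpha> \<beta> lam lam0 lam1 tlam0 tlam1 h0 h1 u0 u1 Ts v \<longrightarrow>
            (AE (t,x) in lebesgue_on ({0<..<Ts} \<times> \<Omega>). v t x = u t x))))"
proof -
 note T = assms(1) and p = assms(2-4) and lam = assms(6-8)
 obtain U0 U0' U0'' where U0: "ac_deriv 0 1 U0 U0'" "ac_deriv 0 1 U0' U0''" "AE x in lebesgue_on \<Omega>. u0 x = U0 x"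
  using Sobolev2_rep[OF zero_less_one assms(11)] by blast
 obtain U1 U1' where U1: "ac_deriv 0 1 U1 U1'" "AE x in lebesgue_on \<Omega>. u1 x = U1 x"
  using Sobolev1_rep[OF zero_less_one assms(12)] by blast
 obtain G0 G0' where G0: "ac_deriv 0 T G0 G0'" "AE t in lebesgue_on {0<..<T}. h0 t = G0 t"
  using Sobolev1_rep[OF T assms(9)] by blast
 obtain G1 G1' where G1: "ac_deriv 0 T G1 G1'" "AE t in lebesgue_on {0<..<T}. h1 t = G1 t"
  using Sobolev1_rep[OF T assms(10)] by blast
 note UC = ac_deriv_continuous[OF U0(1)] ac_deriv_continuous[OF U0(2)] ac_deriv_continuous[OF U1(1)]
 have U0_deriv: "(U0 has_real_derivative U0' x) (at x within {0..1})" if "x \<in> {0..1}" for x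
  by (rule ac_deriv_DERIV[OF zero_less_one U0(1) UC(2) that])
 have wd: "AE x in lebesgue_on \<Omega>. weak_deriv \<Omega> 1 u0 x = U0' x"
 proof -
  have "has_weak_deriv \<Omega> [1] u0 U0'"
   by (rule has_weak_deriv_cong_AE[OF open_greaterThanLessThan _ has_weak_deriv_of_ac[OF U0(1) zero_less_one]]) (use U0(3) in auto)
  then show ?thesis by (intro weak_deriv_AE_eq) simp
 qed
 have z: "(0::real) \<in> {0..1}" "(1::real) \<in> {0..1}" "0 \<in> {0..T}" using T by auto
 note cv = cont_value_eq[OF zero_less_one UC(1) U0(3)] cont_value_eq[OF zero_less_one UC(3) U1(2)] cont_value_eq[OF zero_less_one UC(2) wd]
  cont_value_eq[OF T ac_deriv_continuous[OF G0(1)] G0(2) z(3)] cont_value_eq[OF T ac_deriv_continuous[OF G1(1)] G1(2) z(3)]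
 note compat = assms(13,14)[unfolded cv(1)[OF z(1)] cv(1)[OF z(2)] cv(2)[OF z(1)] cv(2)[OF z(2)] cv(3)[OF z(1)] cv(3)[OF z(2)] cv(4,5)]
 define \<kappa> where "\<kappa> = lam / 2"
 have \<kappa>: "\<kappa> >= 0" "2 * \<kappa> = lam" using assms(5) by (auto simp: \<kappa>_def)
 \<comment> \<open>Constant continuation beyond \<open>[0, T]\<close>, because the abstract problem
   asks for coefficients continuous on the whole line.\<close>
 define H0 where "H0 t = G0 (clamp_to 0 T t)" for t
 define H1 where "H1 t = G1 (clamp_to 0 T t)" for t
 have Hc: "cont H0" "cont H1"
  unfolding H0_def H1_def using clamp_to_in[of 0 T] T
  by (auto intro!: continuous_on_compose2[OF ac_deriv_continuous[OF G0(1)]] continuous_on_compose2[OF ac_deriv_continuous[OF G1(1)]] continuous_intros)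
 have HG: "H0 t = G0 t" "H1 t = G1 t" if "t \<in> {0..T}" for t using that by (auto simp: H0_def H1_def clamp_to_id)
 \<comment> \<open>The initial velocity of \<open>v = exp (\<kappa> * t) * u\<close>, namely
   \<open>u1 + \<kappa> * u0\<close>.\<close>
 define W1 where "W1 x = U1 x + \<kappa> * U0 x" for x
 have W1c: "continuous_on {0..1} W1" unfolding W1_def by (intro continuous_intros UC)
 define A0 where "A0 x = W1 (clamp_to 0 1 x) + U0' (clamp_to 0 1 x)" for x
 define B0 where "B0 x = W1 (clamp_to 0 1 x) - U0' (clamp_to 0 1 x)" for x
 have Ac: "cont A0" "cont B0"
  unfolding A0_def B0_def using clamp_to_in[of 0 1]
  by (auto intro!: continuous_intros continuous_on_compose2[OF W1c] continuous_on_compose2[OF UC(2)])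
 have A0_eq: "A0 x = W1 x + U0' x" and B0_eq: "B0 x = W1 x - U0' x" if "x \<in> {0..1}" for x
  using that by (auto simp: A0_def B0_def clamp_to_id)
 have Wa: "ac_deriv 0 1 W1 (%x. U1' x + \<kappa> * U0' x)" unfolding W1_def[abs_def] by (rule ac_deriv_add[OF U1(1) ac_deriv_cmult[OF U0(1)]])
 have A0_ac: "ac_deriv 0 1 A0 (%x. (U1' x + \<kappa> * U0' x) + U0'' x)"
  by (rule ac_deriv_cong[OF ac_deriv_add[OF Wa U0(2)]]) (simp add: A0_eq)
 have B0_ac: "ac_deriv 0 1 B0 (%x. (U1' x + \<kappa> * U0' x) - U0'' x)"
  by (rule ac_deriv_cong[OF ac_deriv_diff_fun[OF Wa U0(2)]]) (simp add: B0_eq)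
 define F where "F = (%t y. (\<kappa>^2 - 1) * y + damped_power \<kappa> (p - 2) t y)"
 define DF where "DF = (%t y. (\<kappa>^2 - 1) + exp (- (\<kappa> * (p - 2) * t)) * ((p - 2 + 1) * \<bar>y\<bar> powr (p - 2)))"
 define N0 where "N0 = boundary_source \<kappa> (\<alpha> - 2) lam0 H1 tlam1"
 define N1 where "N1 = (%t y z. boundary_source \<kappa> (\<beta> - 2) lam1 H0 tlam0 t z y)"
 have wave_data: "wave_data F DF N0 N1 A0 B0 lam0 lam1 tlam0 tlam1"
  unfolding F_def DF_def N0_def N1_def by (rule wave_data_damped[OF p \<kappa>(1) Hc Ac lam])
 then interpret wave_data F DF N0 N1 A0 B0 lam0 lam1 tlam0 tlam1 "U0 0" .
 obtain T1 where T1: "0 < T1" "T1 <= 1" and fix_ex: "!!Ts. 0 < Ts ==> Ts <= T1 ==>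
   EX w. cont (%(t, x). w t x) & (\<forall>t\<in>{0..Ts}. \<forall>x\<in>{-Ts..1 + Ts}. w t x = dalembert Ts w t x)"
  using exists_fixpoint by auto
 have sol: "EX u. is_solution p \<alpha> \<beta> lam lam0 lam1 tlam0 tlam1 h0 h1 u0 u1 Ts u &
     (ALL v. is_solution p \<alpha> \<beta> lam lam0 lam1 tlam0 tlam1 h0 h1 u0 u1 Ts v -->
      (AE (t,x) in lebesgue_on ({0<..<Ts} \<times> \<Omega>). v t x = u t x))"
  if Ts: "0 < Ts" "Ts <= T1" "Ts <= T" for Ts
 proof -
  obtain w where w: "cont (%(t, x). w t x)" "!!t x. t \<in> {0..Ts} ==> x \<in> {-Ts..1 + Ts} ==> w t x = dalembert Ts w t x"
   using fix_ex[OF Ts(1,2)] by blast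
  note ioo = AE_lebesgue_on_Ioo
  have h: "AE t in lebesgue_on {0<..<Ts}. h0 t = H0 t" "AE t in lebesgue_on {0<..<Ts}. h1 t = H1 t"
   using G0(2) G1(2) unfolding ioo by (eventually_elim, use Ts(3) HG in auto)+
  have Ha: "abs_cont 0 Ts H0" "abs_cont 0 Ts H1"
   using ac_deriv_cong[OF ac_deriv_subset[OF G0(1) order_refl Ts(3)], of H0] ac_deriv_cong[OF ac_deriv_subset[OF G1(1) order_refl Ts(3)], of H1] HG Ts(3)
   by auto
  interpret wave_ivp F DF N0 N1 A0 B0 lam0 lam1 tlam0 tlam1 "U0 0" Ts U0 U0' W1 "%x. (U1' x + \<kappa> * U0' x) + U0'' x" "%x. (U1' x + \<kappa> * U0' x) - U0'' x" w
  proof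
   show "abs_cont 0 Ts (%t. N0 t (f t) (g t))" if "!!t. (f has_real_derivative f' t) (at t)" "!!t. (g has_real_derivative g' t) (at t)"
    "cont f'" "cont g'" for f g f' g'
    unfolding N0_def by (rule boundary_source_ac[OF _ Ha(2) that(1,3,2,4)]) (use p in simp)
   show "abs_cont 0 Ts (%t. N1 t (f t) (g t))" if "!!t. (f has_real_derivative f' t) (at t)" "!!t. (g has_real_derivative g' t) (at t)"
    "cont f'" "cont g'" for f g f' g'
    unfolding N1_def by (rule boundary_source_ac[OF _ Ha(1) that(2,4,1,3)]) (use p in simp)
   \<comment> \<open>At time 0 the exponentials are 1, and the terms with \<open>\<kappa>\<close>
     cancel against those in \<open>W1\<close>, so these are the given compatibility
     conditions.\<close>
   show "N0 0 (U0 0) (U0 1) = U0' 0 - lam0 * W1 0 - tlam1 * W1 1" "N1 0 (U0 0) (U0 1) = - U0' 1 - lam1 * W1 1 - tlam0 * W1 0"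
    using compat HG[OF z(3)] by (simp_all add: N0_def N1_def boundary_source_def damped_power_def W1_def algebra_simps)
  qed (use Ts T1 A0_eq B0_eq U0_deriv A0_ac B0_ac w in auto)
  have u1: "AE x in lebesgue_on \<Omega>. u1 x = W1 x - \<kappa> * U0 x" using U1(2) by (simp add: W1_def)
  from damped_solution[OF F_def N0_def N1_def h U0(3) u1]
  have s: "is_solution p \<alpha> \<beta> lam lam0 lam1 tlam0 tlam1 h0 h1 u0 u1 Ts (%t x. exp (- (\<kappa> * t)) * v t x)" unfolding \<kappa>(2) .
  show ?thesis
  proof (intro exI conjI allI impI)
   fix v' assume v': "is_solution p \<alpha> \<beta> lam lam0 lam1 tlam0 tlam1 h0 h1 u0 u1 Ts v'"
   show "AE (t,x) in lebesgue_on ({0<..<Ts} \<times> \<Omega>). v' t x = exp (- (\<kappa> * t)) * v t x"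
    by (rule solution_unique[OF Ts(1) _ p lam _ _ h U0(3) U0_deriv U1(2) UC(3) s v'])
     (use Ts T1 continuous_on_subset[OF Hc(1)] continuous_on_subset[OF Hc(2)] in auto)
  qed (rule s)
 qed
 \<comment> \<open>\<open>T1\<close> comes from the contraction and is at most 1, as
   \<open>solution_unique\<close> requires; \<open>T\<close> bounds the interval on which the
   coefficients are given.\<close>
 show ?thesis
  by (rule exI[of _ "min T1 T"]) (use T T1 sol in auto)
qed

end
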